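(* Let $k$ be a field, let $\Lambda$ be a finite dimensional Gorenstein $k$-algebra, let $M, L$ be two finitely generated left $\Lambda$-modules, and let $N$ be a finitely generated right $\Lambda$-module. If the Gorenstein dimension of $\Lambda$ is at most $d$, then there are vector space isomorphisms $$\widehat{\mathrm{Tor}}^{\Lambda}_n(N,M) \cong \widehat{\mathrm{Tor}}^{\Lambda}_{-(n-d+1)}\left(\Omega_{\Lambda}^d(M)^*, D(N)\right),$$ $$\widehat{\mathrm{Ext}}_{\Lambda}^n(M,L) \cong \widehat{\mathrm{Ext}}_{\Lambda}^{-(n-d+1)}\left(L, D(\Omega_{\Lambda}^d(M)^* )\right)$$ for all $n \in \mathbb{Z}$.
   Context: $D(-)=\mathrm{Hom}_k(-,k)$ is the $k$-dual (it interchanges left and right modules) and $(-)^*=\mathrm{Hom}_\Lambda(-,\Lambda)$ is the ring dual. A finite dimensional algebra $\Lambda$ is Gorenstein of Gorenstein dimension $d$ if its injective dimensions as a left and as a right module over itself are finite (they are then equal), with common value $d$. Over such an algebra, of Gorenstein dimension $g$, every finitely generated left module $M$ has a complete resolution: an acyclic complex $\mathbb{T}\colon \cdots\to T_1\to T_0\to T_{-1}\to\cdots$ of finitely generated projective modules such that $\mathbb{T}^*$ is acyclic and such that there are a projective resolution $\mathbb{P}$ of $M$ and a chain map $f\colon\mathbb{T}\to\mathbb{P}$ with $f_n$ bijective for all $n\ge g$. For $n\in\mathbb{Z}$, a left module $L$ and a right module $N$, the Tate (co)homology groups are $\widehat{\mathrm{Ext}}^n_\Lambda(M,L)=H^n(\mathrm{Hom}_\Lambda(\mathbb{T},L))$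 and $\widehat{\mathrm{Tor}}^\Lambda_n(N,M)=H_n(N\otimes_\Lambda\mathbb{T})$; they are independent of the choice of $\mathbb{T}$. $\Omega^n_\Lambda(M)$ denotes the $n$th syzygy of $M$: the image of the map $d_n$ in the minimal projective resolution $\cdots\to P_2\xrightarrow{d_2}P_1\xrightarrow{d_1}P_0\xrightarrow{d_0}M\to 0$. *)

theory Defs
  imports "HOL-Algebra.Module" "HOL-Algebra.AbelCoset" "HOL-Library.Extended_Nat"
begin

section \<open>Modules over a ring that need not be commutative\<close>

text \<open>
  The locale \<^locale>\<open>Module.module\<close> of the library requires a commutative ring of scalars.  The locale
  below has the same axioms over an arbitrary ring; it uses the library's module records, whose
  components \<open>mult\<close> and \<open>one\<close> are irrelevant for a module.  The library's \<^const>\<open>submodule\<close> does not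
  need commutativity and is used as it is.
\<close>

locale left_module = R?: ring R + M?: abelian_group M
  for R :: "('a, 'b) ring_scheme" (structure) and M :: "('a, 'm, 'c) module_scheme" (structure) +
  assumes smult_closed [simp, intro]:
      "\<lbrakk>a \<in> carrier R; x \<in> carrier M\<rbrakk> \<Longrightarrow> a \<odot>\<^bsub>M\<^esub> x \<in> carrier M"
    and smult_l_distr:
      "\<lbrakk>a \<in> carrier R; b \<in> carrier R; x \<in> carrier M\<rbrakk> \<Longrightarrow>
        (a \<oplus> b) \<odot>\<^bsub>M\<^esub> x = a \<odot>\<^bsub>M\<^esub> x \<oplus>\<^bsub>M\<^esub> b \<odot>\<^bsub>M\<^esub> x"
    and smult_r_distr:
      "\<lbrakk>a \<in> carrier R; x \<in> carrier M; y \<in> carrier M\<rbrakk> \<Longrightarrow>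
        a \<odot>\<^bsub>M\<^esub> (x \<oplus>\<^bsub>M\<^esub> y) = a \<odot>\<^bsub>M\<^esub> x \<oplus>\<^bsub>M\<^esub> a \<odot>\<^bsub>M\<^esub> y"
    and smult_assoc1:
      "\<lbrakk>a \<in> carrier R; b \<in> carrier R; x \<in> carrier M\<rbrakk> \<Longrightarrow>
        (a \<otimes> b) \<odot>\<^bsub>M\<^esub> x = a \<odot>\<^bsub>M\<^esub> (b \<odot>\<^bsub>M\<^esub> x)"
    and smult_one [simp]: "x \<in> carrier M \<Longrightarrow> \<one> \<odot>\<^bsub>M\<^esub> x = x"

text \<open>
  Right modules over \<open>R\<close> are left modules over the opposite ring: if \<open>N\<close> is such a module, then
  \<open>a \<odot>\<^bsub>N\<^esub> x\<close> stands for \<open>x a\<close>.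
\<close>

definition opp :: "('a, 'b) ring_scheme \<Rightarrow> ('a, 'b) ring_scheme"
  where "opp R = R\<lparr>mult := \<lambda>x y. y \<otimes>\<^bsub>R\<^esub> x\<rparr>"

abbreviation right_module :: "('a, 'b) ring_scheme \<Rightarrow> ('a, 'm, 'c) module_scheme \<Rightarrow> bool"
  where "right_module R N \<equiv> left_module (opp R) N"

definition mk_module ::
    "'m set \<Rightarrow> 'm \<Rightarrow> ('m \<Rightarrow> 'm \<Rightarrow> 'm) \<Rightarrow> ('a \<Rightarrow> 'm \<Rightarrow> 'm) \<Rightarrow> ('a, 'm) module"
  where "mk_module C z p s =
    \<lparr>carrier = C, monoid.mult = (\<lambda>_ _. z), one = z, ring.zero = z, ring.add = p, smult = s\<rparr>"

definition regular :: "('a, 'b) ring_scheme \<Rightarrow> ('a, 'a) module"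
  where "regular R = mk_module (carrier R) \<zero>\<^bsub>R\<^esub> (ring.add R) (monoid.mult R)"

definition is_hom ::
    "('a, 'b) ring_scheme \<Rightarrow> ('a, 'm) module \<Rightarrow> ('a, 'n) module \<Rightarrow> ('m \<Rightarrow> 'n) \<Rightarrow> bool"
  where "is_hom R M N f \<longleftrightarrow>
    f \<in> carrier M \<rightarrow> carrier N \<and>
    (\<forall>x\<in>carrier M. \<forall>y\<in>carrier M. f (x \<oplus>\<^bsub>M\<^esub> y) = f x \<oplus>\<^bsub>N\<^esub> f y) \<and>
    (\<forall>a\<in>carrier R. \<forall>x\<in>carrier M. f (a \<odot>\<^bsub>M\<^esub> x) = a \<odot>\<^bsub>N\<^esub> f x)"

text \<open>
  The elements of a set of homomorphisms are extensional (they are \<^const>\<open>undefined\<close> off the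
  carrier), so that two homomorphisms are equal iff they agree on the carrier.
\<close>

definition Hom_set ::
    "('a, 'b) ring_scheme \<Rightarrow> ('a, 'm) module \<Rightarrow> ('a, 'n) module \<Rightarrow> ('m \<Rightarrow> 'n) set"
  where "Hom_set R M N = {f \<in> extensional (carrier M). is_hom R M N f}"

definition mod_iso :: "('a, 'b) ring_scheme \<Rightarrow> ('a, 'm) module \<Rightarrow> ('a, 'n) module \<Rightarrow> bool"
  where "mod_iso R M N \<longleftrightarrow> (\<exists>f. is_hom R M N f \<and> bij_betw f (carrier M) (carrier N))"

definition gen_submodule :: "('a, 'b) ring_scheme \<Rightarrow> ('a, 'm) module \<Rightarrow> 'm set \<Rightarrow> 'm set"
  where "gen_submodule R M S = \<Inter>{H. submodule H R M \<and> S \<subseteq> H}"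

definition fin_gen :: "('a, 'b) ring_scheme \<Rightarrow> ('a, 'm) module \<Rightarrow> bool"
  where "fin_gen R M \<longleftrightarrow>
    (\<exists>S. finite S \<and> S \<subseteq> carrier M \<and> gen_submodule R M S = carrier M)"

definition quotient_module :: "('a, 'm) module \<Rightarrow> 'm set \<Rightarrow> ('a, 'm set) module"
  where "quotient_module M B =
    mk_module (a_rcosets\<^bsub>M\<^esub> B) B (\<lambda>X Y. X <+>\<^bsub>M\<^esub> Y) (\<lambda>a X. \<Union>x\<in>X. B +>\<^bsub>M\<^esub> (a \<odot>\<^bsub>M\<^esub> x))"

text \<open>The free left module on the set \<open>S\<close>: finitely supported functions from \<open>S\<close> to \<open>R\<close>.\<close>

definition free_module :: "('a, 'b) ring_scheme \<Rightarrow> 's set \<Rightarrow> ('a, 's \<Rightarrow> 'a) module"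
  where "free_module R S =
    mk_module
      {u. (\<forall>x\<in>S. u x \<in> carrier R) \<and> (\<forall>x. x \<notin> S \<longrightarrow> u x = \<zero>\<^bsub>R\<^esub>) \<and> finite {x. u x \<noteq> \<zero>\<^bsub>R\<^esub>}}
      (\<lambda>_. \<zero>\<^bsub>R\<^esub>) (\<lambda>u v x. u x \<oplus>\<^bsub>R\<^esub> v x) (\<lambda>a u x. a \<otimes>\<^bsub>R\<^esub> u x)"

definition free_gen :: "('a, 'b) ring_scheme \<Rightarrow> 's \<Rightarrow> 's \<Rightarrow> 'a"
  where "free_gen R s = (\<lambda>x. if x = s then \<one>\<^bsub>R\<^esub> else \<zero>\<^bsub>R\<^esub>)"


section \<open>Projective and injective modules, injective dimension\<close>

text \<open>
  A module is projective if it is (isomorphic to) a direct summand of a free module.  Restricting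
  the index set \<open>X\<close> of the free module to the type of the elements of \<open>P\<close> is no loss: a projective
  module \<open>P\<close> is a direct summand of the free module on its own carrier.
\<close>

definition projective :: "('a, 'b) ring_scheme \<Rightarrow> ('a, 'm) module \<Rightarrow> bool"
  where "projective R P \<longleftrightarrow> left_module R P \<and>
    (\<exists>(X :: 'm set) i p. is_hom R P (free_module R X) i \<and> is_hom R (free_module R X) P p \<and>
      (\<forall>x\<in>carrier P. p (i x) = x))"

text \<open>
  The quantifiers over modules in the next definition and in the definitions of the injective
  dimension and of syzygies range over modules whose elements lie in the type \<^typ>\<open>nat \<Rightarrow> 'a\<close>, with
  \<^typ>\<open>'a\<close> the type of the elements of the ring.  For a nonzero finite dimensional algebra over a
  field \<open>k\<close> this type contains copies of all finite dimensional vector spaces over \<open>k\<close> (as functions with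
  values in the multiples of \<open>1\<close>), hence an isomorphic copy of every finitely generated module;
  for the zero algebra all modules are zero.  In particular the ideals of the ring occur in
  the extension property below, so that by Baer's criterion it is the usual injectivity.
\<close>

definition injective :: "('a, 'b) ring_scheme \<Rightarrow> ('a, 'm) module \<Rightarrow> bool"
  where "injective R I \<longleftrightarrow> left_module R I \<and>
    (\<forall>(X :: ('a, nat \<Rightarrow> 'a) module) (Y :: ('a, nat \<Rightarrow> 'a) module) j h.
      left_module R X \<and> left_module R Y \<and> is_hom R X Y j \<and> inj_on j (carrier X) \<and>
      is_hom R X I h \<longrightarrow>
      (\<exists>h'. is_hom R Y I h' \<and> (\<forall>x\<in>carrier X. h' (j x) = h x)))"

text \<open>An injective resolution \<open>0 \<rightarrow> M \<rightarrow> I 0 \<rightarrow> I 1 \<rightarrow> \<dots> \<rightarrow> I n \<rightarrow> 0\<close>.\<close>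

definition injective_resolution ::
    "('a, 'b) ring_scheme \<Rightarrow> ('a, 'm) module \<Rightarrow> nat \<Rightarrow>
      (nat \<Rightarrow> ('a, 'i) module) \<Rightarrow> ('m \<Rightarrow> 'i) \<Rightarrow> (nat \<Rightarrow> 'i \<Rightarrow> 'i) \<Rightarrow> bool"
  where "injective_resolution R M n I e \<delta> \<longleftrightarrow>
    (\<forall>i. injective R (I i) \<and> is_hom R (I i) (I (Suc i)) (\<delta> i)) \<and>
    (\<forall>i>n. carrier (I i) = {\<zero>\<^bsub>I i\<^esub>}) \<and>
    is_hom R M (I 0) e \<and> inj_on e (carrier M) \<and>
    e ` carrier M = a_kernel (I 0) (I 1) (\<delta> 0) \<and>
    (\<forall>i. \<delta> i ` carrier (I i) = a_kernel (I (Suc i)) (I (Suc (Suc i))) (\<delta> (Suc i)))"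

text \<open>The infimum is \<open>\<infinity>\<close> if there is no finite injective resolution.\<close>

definition inj_dim :: "('a, 'b) ring_scheme \<Rightarrow> ('a, 'm) module \<Rightarrow> enat"
  where "inj_dim R M =
    Inf {enat n | n. \<exists>(I :: nat \<Rightarrow> ('a, nat \<Rightarrow> 'a) module) e \<delta>. injective_resolution R M n I e \<delta>}"

definition gorenstein_of_dim :: "('a, 'b) ring_scheme \<Rightarrow> nat \<Rightarrow> bool"
  where "gorenstein_of_dim A g \<longleftrightarrow>
    inj_dim A (regular A) = enat g \<and> inj_dim (opp A) (regular (opp A)) = enat g"


section \<open>Complexes and resolutions\<close>

text \<open>Complexes are indexed homologically: \<open>diff C n\<close> maps \<open>obj C n\<close> to \<open>obj C (n - 1)\<close>.\<close>

record ('a, 'm) complx =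
  obj :: "int \<Rightarrow> ('a, 'm) module"
  diff :: "int \<Rightarrow> 'm \<Rightarrow> 'm"

definition is_complex :: "('a, 'b) ring_scheme \<Rightarrow> ('a, 'm) complx \<Rightarrow> bool"
  where "is_complex R C \<longleftrightarrow>
    (\<forall>n. left_module R (obj C n) \<and> is_hom R (obj C n) (obj C (n - 1)) (diff C n) \<and>
      (\<forall>x\<in>carrier (obj C n). diff C (n - 1) (diff C n x) = \<zero>\<^bsub>obj C (n - 2)\<^esub>))"

definition cycles :: "('a, 'm) complx \<Rightarrow> int \<Rightarrow> 'm set"
  where "cycles C n = a_kernel (obj C n) (obj C (n - 1)) (diff C n)"

definition boundaries :: "('a, 'm) complx \<Rightarrow> int \<Rightarrow> 'm set"
  where "boundaries C n = diff C (n + 1) ` carrier (obj C (n + 1))"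

definition homology :: "('a, 'm) complx \<Rightarrow> int \<Rightarrow> ('a, 'm set) module"
  where "homology C n = quotient_module ((obj C n)\<lparr>carrier := cycles C n\<rparr>) (boundaries C n)"

definition acyclic :: "('a, 'm) complx \<Rightarrow> bool"
  where "acyclic C \<longleftrightarrow> (\<forall>n. cycles C n = boundaries C n)"

definition chain_map ::
    "('a, 'b) ring_scheme \<Rightarrow> ('a, 'm) complx \<Rightarrow> ('a, 'n) complx \<Rightarrow> (int \<Rightarrow> 'm \<Rightarrow> 'n) \<Rightarrow> bool"
  where "chain_map R C D f \<longleftrightarrow>
    (\<forall>n. is_hom R (obj C n) (obj D n) (f n) \<and>
      (\<forall>x\<in>carrier (obj C n). f (n - 1) (diff C n x) = diff D n (f n x)))"

text \<open>The augmentation \<open>e\<close> of a projective resolution is the map usually called \<open>d\<^sub>0\<close>.\<close>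

definition projective_resolution ::
    "('a, 'b) ring_scheme \<Rightarrow> ('a, 'm) module \<Rightarrow> ('a, 'p) complx \<Rightarrow> ('p \<Rightarrow> 'm) \<Rightarrow> bool"
  where "projective_resolution R M P e \<longleftrightarrow>
    is_complex R P \<and>
    (\<forall>n\<ge>0. projective R (obj P n)) \<and>
    (\<forall>n<0. carrier (obj P n) = {\<zero>\<^bsub>obj P n\<^esub>}) \<and>
    (\<forall>n\<ge>1. cycles P n = boundaries P n) \<and>
    is_hom R (obj P 0) M e \<and> e ` carrier (obj P 0) = carrier M \<and>
    a_kernel (obj P 0) M e = boundaries P 0"

definition superfluous :: "('a, 'b) ring_scheme \<Rightarrow> ('a, 'm) module \<Rightarrow> 'm set \<Rightarrow> bool"
  where "superfluous R M B \<longleftrightarrow>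
    (\<forall>H. submodule H R M \<and> B <+>\<^bsub>M\<^esub> H = carrier M \<longrightarrow> H = carrier M)"

text \<open>Minimality: every map of the resolution is a projective cover of its image.\<close>

definition minimal_projective_resolution ::
    "('a, 'b) ring_scheme \<Rightarrow> ('a, 'm) module \<Rightarrow> ('a, 'p) complx \<Rightarrow> ('p \<Rightarrow> 'm) \<Rightarrow> bool"
  where "minimal_projective_resolution R M P e \<longleftrightarrow>
    projective_resolution R M P e \<and>
    superfluous R (obj P 0) (a_kernel (obj P 0) M e) \<and>
    (\<forall>n\<ge>1. superfluous R (obj P n) (cycles P n))"

text \<open>
  Syzygies are determined up to isomorphism: \<open>W\<close> is an \<open>n\<close>th syzygy of \<open>M\<close> if it is isomorphic to
  the image of \<open>d\<^sub>n\<close> in a minimal projective resolution of \<open>M\<close>.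
\<close>

definition is_syzygy ::
    "('a, 'b) ring_scheme \<Rightarrow> nat \<Rightarrow> ('a, 'm) module \<Rightarrow> ('a, 'w) module \<Rightarrow> bool"
  where "is_syzygy R n M W \<longleftrightarrow> left_module R W \<and>
    (\<exists>(P :: ('a, nat \<Rightarrow> 'a) complx) e. minimal_projective_resolution R M P e \<and>
      (if n = 0 then mod_iso R W (M\<lparr>carrier := e ` carrier (obj P 0)\<rparr>)
       else mod_iso R W
         ((obj P (int n - 1))\<lparr>carrier := diff P (int n) ` carrier (obj P (int n))\<rparr>)))"


section \<open>Algebras, duals and tensor products\<close>

text \<open>
  An algebra over the field \<open>K\<close> is a module record over \<open>K\<close> whose ring components form a ring, not
  necessarily commutative.
\<close>

locale k_algebra = Module.module K A + K: field K + A: ring A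
  for K :: "('k, 'c) ring_scheme" and A :: "('k, 'a) module" +
  assumes smult_mult_left:
      "\<lbrakk>c \<in> carrier K; x \<in> carrier A; y \<in> carrier A\<rbrakk> \<Longrightarrow>
        (c \<odot>\<^bsub>A\<^esub> x) \<otimes>\<^bsub>A\<^esub> y = c \<odot>\<^bsub>A\<^esub> (x \<otimes>\<^bsub>A\<^esub> y)"
    and smult_mult_right:
      "\<lbrakk>c \<in> carrier K; x \<in> carrier A; y \<in> carrier A\<rbrakk> \<Longrightarrow>
        x \<otimes>\<^bsub>A\<^esub> (c \<odot>\<^bsub>A\<^esub> y) = c \<odot>\<^bsub>A\<^esub> (x \<otimes>\<^bsub>A\<^esub> y)"

text \<open>The field acts on a module over an algebra through the multiples \<open>c 1\<close> of the identity.\<close>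

definition k_smult :: "('k, 'a) module \<Rightarrow> ('a, 'm) module \<Rightarrow> 'k \<Rightarrow> 'm \<Rightarrow> 'm"
  where "k_smult A M c x = (c \<odot>\<^bsub>A\<^esub> \<one>\<^bsub>A\<^esub>) \<odot>\<^bsub>M\<^esub> x"

definition k_space :: "('k, 'a) module \<Rightarrow> ('a, 'm) module \<Rightarrow> ('k, 'm) module"
  where "k_space A M = mk_module (carrier M) \<zero>\<^bsub>M\<^esub> (ring.add M) (k_smult A M)"

definition Hom_space ::
    "('k, 'a) module \<Rightarrow> ('a, 'm) module \<Rightarrow> ('a, 'n) module \<Rightarrow> ('k, 'm \<Rightarrow> 'n) module"
  where "Hom_space A M N =
    mk_module (Hom_set A M N) (\<lambda>x\<in>carrier M. \<zero>\<^bsub>N\<^esub>)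
      (\<lambda>f g. \<lambda>x\<in>carrier M. f x \<oplus>\<^bsub>N\<^esub> g x) (\<lambda>c f. \<lambda>x\<in>carrier M. k_smult A N c (f x))"

text \<open>
  The dual \<open>D(M) = Hom\<^sub>k(M, k)\<close> of a left \<open>A\<close>-module \<open>M\<close>, with the right action \<open>(f a)(x) = f(a x)\<close>,
  i.e. as a left module over \<^term>\<open>opp A\<close>.  For a right \<open>A\<close>-module \<open>N\<close>, \<open>k_dual K (opp A) N\<close> is the
  left \<open>A\<close>-module \<open>D(N)\<close>.
\<close>

definition k_dual ::
    "('k, 'c) ring_scheme \<Rightarrow> ('k, 'a) module \<Rightarrow> ('a, 'm) module \<Rightarrow> ('a, 'm \<Rightarrow> 'k) module"
  where "k_dual K A M =
    mk_module (Hom_set K (k_space A M) (regular K)) (\<lambda>x\<in>carrier M. \<zero>\<^bsub>K\<^esub>)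
      (\<lambda>f g. \<lambda>x\<in>carrier M. f x \<oplus>\<^bsub>K\<^esub> g x) (\<lambda>a f. \<lambda>x\<in>carrier M. f (a \<odot>\<^bsub>M\<^esub> x))"

text \<open>
  The ring dual of a left \<open>R\<close>-module, with the right action \<open>(f a)(x) = f(x) a\<close>, i.e. as a left
  module over \<^term>\<open>opp R\<close>.
\<close>

definition ring_dual :: "('a, 'b) ring_scheme \<Rightarrow> ('a, 'm) module \<Rightarrow> ('a, 'm \<Rightarrow> 'a) module"
  where "ring_dual R M =
    mk_module (Hom_set R M (regular R)) (\<lambda>x\<in>carrier M. \<zero>\<^bsub>R\<^esub>)
      (\<lambda>f g. \<lambda>x\<in>carrier M. f x \<oplus>\<^bsub>R\<^esub> g x) (\<lambda>a f. \<lambda>x\<in>carrier M. f x \<otimes>\<^bsub>R\<^esub> a)"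

text \<open>
  The tensor product over the \<open>K\<close>-algebra \<open>A\<close> of a right module \<open>N\<close> and a left module \<open>M\<close>, as a
  vector space: the free vector space on pairs modulo biadditivity, \<open>A\<close>-balancedness and
  compatibility with the scalars from \<open>K\<close>.
\<close>

definition tensor_relations ::
    "('k, 'c) ring_scheme \<Rightarrow> ('k, 'a) module \<Rightarrow> ('a, 'n) module \<Rightarrow> ('a, 'm) module \<Rightarrow>
      ('n \<times> 'm \<Rightarrow> 'k) set"
  where "tensor_relations K A N M =
    (let F = free_module K (carrier N \<times> carrier M); \<delta> = free_gen K in
      gen_submodule K F
       ({\<delta> (y \<oplus>\<^bsub>N\<^esub> y', x) \<ominus>\<^bsub>F\<^esub> (\<delta> (y, x) \<oplus>\<^bsub>F\<^esub> \<delta> (y', x)) | y y' x.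
           y \<in> carrier N \<and> y' \<in> carrier N \<and> x \<in> carrier M} \<union>
        {\<delta> (y, x \<oplus>\<^bsub>M\<^esub> x') \<ominus>\<^bsub>F\<^esub> (\<delta> (y, x) \<oplus>\<^bsub>F\<^esub> \<delta> (y, x')) | y x x'.
           y \<in> carrier N \<and> x \<in> carrier M \<and> x' \<in> carrier M} \<union>
        {\<delta> (a \<odot>\<^bsub>N\<^esub> y, x) \<ominus>\<^bsub>F\<^esub> \<delta> (y, a \<odot>\<^bsub>M\<^esub> x) | a y x.
           a \<in> carrier A \<and> y \<in> carrier N \<and> x \<in> carrier M} \<union>
        {\<delta> (k_smult A N c y, x) \<ominus>\<^bsub>F\<^esub> (c \<odot>\<^bsub>F\<^esub> \<delta> (y, x)) | c y x.
           c \<in> carrier K \<and> y \<in> carrier N \<and> x \<in> carrier M}))"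

definition tensor ::
    "('k, 'c) ring_scheme \<Rightarrow> ('k, 'a) module \<Rightarrow> ('a, 'n) module \<Rightarrow> ('a, 'm) module \<Rightarrow>
      ('k, ('n \<times> 'm \<Rightarrow> 'k) set) module"
  where "tensor K A N M =
    quotient_module (free_module K (carrier N \<times> carrier M)) (tensor_relations K A N M)"

definition pure_tensor ::
    "('k, 'c) ring_scheme \<Rightarrow> ('k, 'a) module \<Rightarrow> ('a, 'n) module \<Rightarrow> ('a, 'm) module \<Rightarrow>
      'n \<Rightarrow> 'm \<Rightarrow> ('n \<times> 'm \<Rightarrow> 'k) set"
  where "pure_tensor K A N M y x =
    tensor_relations K A N M +>\<^bsub>free_module K (carrier N \<times> carrier M)\<^esub> free_gen K (y, x)"

text \<open>The map \<open>N \<otimes> g\<close> from \<open>N \<otimes> M\<close> to \<open>N \<otimes> M'\<close>.\<close>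

definition tensor_map ::
    "('k, 'c) ring_scheme \<Rightarrow> ('k, 'a) module \<Rightarrow> ('a, 'n) module \<Rightarrow> ('a, 'm) module \<Rightarrow>
      ('a, 'm') module \<Rightarrow> ('m \<Rightarrow> 'm') \<Rightarrow> ('n \<times> 'm \<Rightarrow> 'k) set \<Rightarrow> ('n \<times> 'm' \<Rightarrow> 'k) set"
  where "tensor_map K A N M M' g =
    (THE h. h \<in> Hom_set K (tensor K A N M) (tensor K A N M') \<and>
      (\<forall>y\<in>carrier N. \<forall>x\<in>carrier M.
        h (pure_tensor K A N M y x) = pure_tensor K A N M' y (g x)))"


section \<open>Complete resolutions and Tate (co)homology\<close>

text \<open>
  Contravariant functors turn a complex \<open>T\<close> into a complex whose component in (homological) degree
  \<open>n\<close> comes from the component of \<open>T\<close> in degree \<open>- n\<close>.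
\<close>

definition dual_complex :: "('a, 'b) ring_scheme \<Rightarrow> ('a, 't) complx \<Rightarrow> ('a, 't \<Rightarrow> 'a) complx"
  where "dual_complex R T =
    \<lparr>obj = (\<lambda>n. ring_dual R (obj T (- n))),
     diff = (\<lambda>n f. compose (carrier (obj T (- n + 1))) f (diff T (- n + 1)))\<rparr>"

definition Hom_complex ::
    "('k, 'a) module \<Rightarrow> ('a, 't) complx \<Rightarrow> ('a, 'l) module \<Rightarrow> ('k, 't \<Rightarrow> 'l) complx"
  where "Hom_complex A T L =
    \<lparr>obj = (\<lambda>n. Hom_space A (obj T (- n)) L),
     diff = (\<lambda>n f. compose (carrier (obj T (- n + 1))) f (diff T (- n + 1)))\<rparr>"

definition tensor_complex ::
    "('k, 'c) ring_scheme \<Rightarrow> ('k, 'a) module \<Rightarrow> ('a, 'n) module \<Rightarrow> ('a, 't) complx \<Rightarrow>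
      ('k, ('n \<times> 't \<Rightarrow> 'k) set) complx"
  where "tensor_complex K A N T =
    \<lparr>obj = (\<lambda>n. tensor K A N (obj T n)),
     diff = (\<lambda>n. tensor_map K A N (obj T n) (obj T (n - 1)) (diff T n))\<rparr>"

text \<open>
  The diagram \<open>T \<rightarrow> P \<rightarrow> M\<close> with maps \<open>f\<close> and \<open>e\<close> is a complete resolution of \<open>M\<close>, where \<open>g\<close> is
  the Gorenstein dimension of the algebra.
\<close>

definition complete_resolution ::
    "('a, 'b) ring_scheme \<Rightarrow> nat \<Rightarrow> ('a, 'm) module \<Rightarrow> ('a, 't) complx \<Rightarrow>
      ('a, 'p) complx \<Rightarrow> ('p \<Rightarrow> 'm) \<Rightarrow> (int \<Rightarrow> 't \<Rightarrow> 'p) \<Rightarrow> bool"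
  where "complete_resolution R g M T P e f \<longleftrightarrow>
    is_complex R T \<and> (\<forall>n. projective R (obj T n) \<and> fin_gen R (obj T n)) \<and>
    acyclic T \<and> acyclic (dual_complex R T) \<and>
    projective_resolution R M P e \<and> chain_map R T P f \<and>
    (\<forall>n\<ge>int g. bij_betw (f n) (carrier (obj T n)) (carrier (obj P n)))"

text \<open>
  Tate homology and cohomology of \<open>M\<close> are computed from the complex \<open>T\<close> of a complete resolution
  of \<open>M\<close>.  The sign in the second definition is the passage from homological to cohomological
  indexing.
\<close>

definition tate_Tor ::
    "('k, 'c) ring_scheme \<Rightarrow> ('k, 'a) module \<Rightarrow> ('a, 'n) module \<Rightarrow> ('a, 't) complx \<Rightarrow> int \<Rightarrow>
      ('k, ('n \<times> 't \<Rightarrow> 'k) set set) module"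
  where "tate_Tor K A N T n = homology (tensor_complex K A N T) n"

definition tate_Ext ::
    "('k, 'a) module \<Rightarrow> ('a, 't) complx \<Rightarrow> ('a, 'l) module \<Rightarrow> int \<Rightarrow>
      ('k, ('t \<Rightarrow> 'l) set) module"
  where "tate_Ext A T L n = homology (Hom_complex A T L) (- n)"

end

theory Submission
  imports Defs
begin

text \<open>
  Let \<open>T\<close> and \<open>U\<close> be complete resolutions of \<open>M\<close> and \<open>L\<close>.  The cohomology of \<open>Hom(T, L)\<close> in
  degree \<open>i\<close> consists of the homomorphisms to \<open>L\<close> from the image of \<open>T\<^sub>i \<rightarrow> T\<^sub>i\<^sub>-\<^sub>1\<close>, modulo those
  that factor through a projective module.  The rows and columns of the double complex
  \<open>Hom(T\<^sub>i, U\<^sub>j)\<close> are exact, so these stable homomorphisms do not change if both arguments are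
  replaced by the next or the previous syzygies.  Moving the first argument to the syzygy
  \<open>W = \<Omega>\<^sup>d(M)\<close> turns \<open>Ext\<^sup>n(M, L)\<close> into the homology of \<open>Hom(W, U)\<close> in degree \<open>d - 1 - n\<close>; that \<open>W\<close>
  comes from another resolution does not matter, because stable homomorphisms only depend on the
  stable equivalence class.  As \<open>U\<close> consists of finitely generated projective modules,
  \<open>Hom(W, U)\<close> is \<open>W\<^sup>* \<otimes> U\<close>, so that \<open>Ext\<^sup>n(M, L)\<close> is isomorphic to the homology of \<open>W\<^sup>* \<otimes> U\<close> in
  degree \<open>d - 1 - n\<close>.  Both isomorphisms of the theorem follow from this one, because
  \<open>D(N \<otimes> T) = Hom(T, D(N))\<close> makes \<open>Ext\<^sup>n(M, D(N))\<close> dual to \<open>Tor\<^sub>n(N, M)\<close>, and finite dimensional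
  spaces are isomorphic to their duals.
\<close>


section \<open>Modules and homomorphisms\<close>

text \<open>The complexes \<open>T\<close> and \<open>U\<close> agree with the projective
  resolutions of \<open>M\<close> and \<open>L\<close> only from degree \<open>g\<close> on, and
  those resolutions are neither minimal in general nor finitely generated below that degree. This
  dictates the route. Both arguments are moved up along the resolution of \<open>L\<close> as far as
  degree \<open>g\<close>, where its terms may be exchanged for those of \<open>U\<close>; only
  along \<open>U\<close> can one come down again. Let the arguments be the images of
  \<open>T_i \<rightarrow> T_(i-1)\<close> and of \<open>U_(j+1) \<rightarrow> U_j\<close>. The
  difference \<open>i - j\<close> never changes, and it is \<open>n + 1\<close> because
  \<open>L\<close> takes the place of \<open>j = -1\<close> when \<open>i = n\<close>. Hence
  \<open>i = d\<close> forces \<open>j = -(n - d + 1)\<close>. The bound \<open>g \<le> d\<close>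
  makes \<open>T\<close> and the resolution of \<open>M\<close> agree in degrees \<open>d\<close>
  and \<open>d + 1\<close>, so that at \<open>i = d\<close> the first argument is a syzygy of
  \<open>M\<close>. Finite dimensionality is visible on the cohomology side, where maps from
  finitely generated modules to finite dimensional ones are counted. Tate homology, a subquotient of
  tensor products given by generators and relations, inherits it through its dual.\<close>

lemma mk_module_simps [simp]:
  "carrier (mk_module C z p s) = C"
  "\<zero>\<^bsub>mk_module C z p s\<^esub> = z"
  "x \<oplus>\<^bsub>mk_module C z p s\<^esub> y = p x y"
  "a \<odot>\<^bsub>mk_module C z p s\<^esub> x = s a x"
  by (simp_all add: mk_module_def)

text \<open>Additive inverses are produced as multiples by \<open>-1\<close>, so none has to be
  exhibited. In exchange \<open>0 x = 0\<close>, usually a consequence of the axioms, becomes a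
  premise; for functions and cosets it is immediate.\<close>

lemma left_moduleI:
  fixes R (structure) and M (structure)
  assumes "ring R"
    and "\<And>x y. \<lbrakk>x \<in> carrier M; y \<in> carrier M\<rbrakk> \<Longrightarrow> x \<oplus>\<^bsub>M\<^esub> y \<in> carrier M"
    and "\<zero>\<^bsub>M\<^esub> \<in> carrier M"
    and "\<And>x y z. \<lbrakk>x \<in> carrier M; y \<in> carrier M; z \<in> carrier M\<rbrakk> \<Longrightarrow>
          (x \<oplus>\<^bsub>M\<^esub> y) \<oplus>\<^bsub>M\<^esub> z = x \<oplus>\<^bsub>M\<^esub> (y \<oplus>\<^bsub>M\<^esub> z)"
    and "\<And>x y. \<lbrakk>x \<in> carrier M; y \<in> carrier M\<rbrakk> \<Longrightarrow> x \<oplus>\<^bsub>M\<^esub> y = y \<oplus>\<^bsub>M\<^esub> x"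
    and "\<And>x. x \<in> carrier M \<Longrightarrow> \<zero>\<^bsub>M\<^esub> \<oplus>\<^bsub>M\<^esub> x = x"
    and "\<And>a x. \<lbrakk>a \<in> carrier R; x \<in> carrier M\<rbrakk> \<Longrightarrow> a \<odot>\<^bsub>M\<^esub> x \<in> carrier M"
    and "\<And>a b x. \<lbrakk>a \<in> carrier R; b \<in> carrier R; x \<in> carrier M\<rbrakk> \<Longrightarrow>
          (a \<oplus> b) \<odot>\<^bsub>M\<^esub> x = a \<odot>\<^bsub>M\<^esub> x \<oplus>\<^bsub>M\<^esub> b \<odot>\<^bsub>M\<^esub> x"
    and "\<And>a x y. \<lbrakk>a \<in> carrier R; x \<in> carrier M; y \<in> carrier M\<rbrakk> \<Longrightarrow>
          a \<odot>\<^bsub>M\<^esub> (x \<oplus>\<^bsub>M\<^esub> y) = a \<odot>\<^bsub>M\<^esub> x \<oplus>\<^bsub>M\<^esub> a \<odot>\<^bsub>M\<^esub> y"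
    and "\<And>a b x. \<lbrakk>a \<in> carrier R; b \<in> carrier R; x \<in> carrier M\<rbrakk> \<Longrightarrow>
          (a \<otimes> b) \<odot>\<^bsub>M\<^esub> x = a \<odot>\<^bsub>M\<^esub> (b \<odot>\<^bsub>M\<^esub> x)"
    and "\<And>x. x \<in> carrier M \<Longrightarrow> \<one> \<odot>\<^bsub>M\<^esub> x = x"
    and zero: "\<And>x. x \<in> carrier M \<Longrightarrow> \<zero> \<odot>\<^bsub>M\<^esub> x = \<zero>\<^bsub>M\<^esub>"
  shows "left_module R M"
proof -
  interpret R: ring R by fact
  have "\<exists>y\<in>carrier M. y \<oplus>\<^bsub>M\<^esub> x = \<zero>\<^bsub>M\<^esub>" if x: "x \<in> carrier M" for x
  proof (rule bexI[of _ "(\<ominus> \<one>) \<odot>\<^bsub>M\<^esub> x"])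
    have "(\<ominus> \<one>) \<odot>\<^bsub>M\<^esub> x \<oplus>\<^bsub>M\<^esub> x = (\<ominus> \<one> \<oplus> \<one>) \<odot>\<^bsub>M\<^esub> x"
      using assms(8)[of "\<ominus> \<one>" \<one> x] assms(11)[OF x] x by simp
    then show "(\<ominus> \<one>) \<odot>\<^bsub>M\<^esub> x \<oplus>\<^bsub>M\<^esub> x = \<zero>\<^bsub>M\<^esub>" by (simp add: R.l_neg zero x)
  qed (simp add: assms x)
  then have "abelian_group M"
    by (intro abelian_groupI) (use assms(2-6) in auto)
  then show ?thesis
    by (intro left_module.intro left_module_axioms.intro) (simp_all add: assms)
qed

context left_module
begin

lemma left_module: "left_module R M" ..

lemma abelian_group: "abelian_group M" ..

lemma smult_l_null [simp]: "x \<in> carrier M \<Longrightarrow> \<zero> \<odot>\<^bsub>M\<^esub> x = \<zero>\<^bsub>M\<^esub>"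
  by (metis M.add.l_cancel_one M.zero_closed R.add.l_cancel_one R.zero_closed smult_closed smult_l_distr)

lemma smult_r_null [simp]: "a \<in> carrier R \<Longrightarrow> a \<odot>\<^bsub>M\<^esub> \<zero>\<^bsub>M\<^esub> = \<zero>\<^bsub>M\<^esub>"
  by (metis M.add.l_cancel_one M.zero_closed smult_closed smult_r_distr)

lemma smult_r_minus: "\<lbrakk>a \<in> carrier R; x \<in> carrier M\<rbrakk> \<Longrightarrow> a \<odot>\<^bsub>M\<^esub> (\<ominus>\<^bsub>M\<^esub> x) = \<ominus>\<^bsub>M\<^esub> (a \<odot>\<^bsub>M\<^esub> x)"
  by (metis M.add.inv_closed M.minus_equality M.l_neg smult_closed smult_r_distr smult_r_null)

lemma smult_minus_one: "x \<in> carrier M \<Longrightarrow> (\<ominus> \<one>) \<odot>\<^bsub>M\<^esub> x = \<ominus>\<^bsub>M\<^esub> x"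
  by (metis M.minus_equality R.add.inv_closed R.l_neg R.one_closed smult_closed smult_l_distr smult_l_null smult_one)

lemma smult_diff: "\<lbrakk>a \<in> carrier R; x \<in> carrier M; y \<in> carrier M\<rbrakk> \<Longrightarrow>
    a \<odot>\<^bsub>M\<^esub> (x \<ominus>\<^bsub>M\<^esub> y) = a \<odot>\<^bsub>M\<^esub> x \<ominus>\<^bsub>M\<^esub> a \<odot>\<^bsub>M\<^esub> y"
  by (simp add: a_minus_def smult_r_distr smult_r_minus)

lemma diff_eq_zero_iff: "\<lbrakk>x \<in> carrier M; y \<in> carrier M\<rbrakk> \<Longrightarrow> x \<ominus>\<^bsub>M\<^esub> y = \<zero>\<^bsub>M\<^esub> \<longleftrightarrow> x = y"
  by (metis M.add.inv_closed M.minus_equality M.minus_minus M.r_neg a_minus_def)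

lemma diff_zero: "x \<in> carrier M \<Longrightarrow> x \<oplus>\<^bsub>M\<^esub> \<ominus>\<^bsub>M\<^esub> \<zero>\<^bsub>M\<^esub> = x"
  using M.add.inv_one by (simp add: a_inv_def)

lemma add_diff_add: "\<lbrakk>x \<in> carrier M; y \<in> carrier M; x' \<in> carrier M; y' \<in> carrier M\<rbrakk> \<Longrightarrow>
    (x \<oplus>\<^bsub>M\<^esub> y) \<ominus>\<^bsub>M\<^esub> (x' \<oplus>\<^bsub>M\<^esub> y') = (x \<ominus>\<^bsub>M\<^esub> x') \<oplus>\<^bsub>M\<^esub> (y \<ominus>\<^bsub>M\<^esub> y')"
  by (simp add: a_minus_def M.minus_add M.a_ac)

lemma diff_diff:
  assumes "v \<in> carrier M" "s \<in> carrier M" "t \<in> carrier M"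
  shows "(v \<ominus>\<^bsub>M\<^esub> s) \<ominus>\<^bsub>M\<^esub> (v \<ominus>\<^bsub>M\<^esub> t) = t \<ominus>\<^bsub>M\<^esub> s"
proof -
  have "(v \<ominus>\<^bsub>M\<^esub> s) \<ominus>\<^bsub>M\<^esub> (v \<ominus>\<^bsub>M\<^esub> t) = (v \<oplus>\<^bsub>M\<^esub> \<ominus>\<^bsub>M\<^esub> v) \<oplus>\<^bsub>M\<^esub> (t \<ominus>\<^bsub>M\<^esub> s)"
    using assms by (simp only: a_minus_def M.minus_add M.minus_minus M.a_ac M.add.inv_closed M.a_closed)
  then show ?thesis using assms by (simp add: M.r_neg)
qed

lemma diff_add_cancel: "\<lbrakk>x \<in> carrier M; y \<in> carrier M\<rbrakk> \<Longrightarrow> (x \<ominus>\<^bsub>M\<^esub> y) \<oplus>\<^bsub>M\<^esub> y = x"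
  by (simp add: a_minus_def M.a_assoc M.l_neg)

lemma submoduleI:
  assumes "H \<subseteq> carrier M" "\<zero>\<^bsub>M\<^esub> \<in> H" "\<And>x y. \<lbrakk>x \<in> H; y \<in> H\<rbrakk> \<Longrightarrow> x \<oplus>\<^bsub>M\<^esub> y \<in> H"
    and "\<And>a x. \<lbrakk>a \<in> carrier R; x \<in> H\<rbrakk> \<Longrightarrow> a \<odot>\<^bsub>M\<^esub> x \<in> H"
  shows "submodule H R M"
proof -
  have "\<ominus>\<^bsub>M\<^esub> x \<in> H" if "x \<in> H" for x
    using assms(4)[of "\<ominus> \<one>" x] that assms(1) by (auto simp: smult_minus_one)
  then show ?thesis
    unfolding submodule_def submodule_axioms_def
    using assms by (auto intro!: M.add.subgroupI simp flip: a_inv_def)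
qed

lemma submodule_subset: "submodule H R M \<Longrightarrow> H \<subseteq> carrier M"
  using subgroup.subset submodule_def by fastforce

lemma submodule_zero: "submodule H R M \<Longrightarrow> \<zero>\<^bsub>M\<^esub> \<in> H"
  using subgroup.one_closed submodule_def by fastforce

lemma submodule_add: "\<lbrakk>submodule H R M; x \<in> H; y \<in> H\<rbrakk> \<Longrightarrow> x \<oplus>\<^bsub>M\<^esub> y \<in> H"
  using subgroup.m_closed submodule_def by fastforce

lemma submodule_smult: "\<lbrakk>submodule H R M; a \<in> carrier R; x \<in> H\<rbrakk> \<Longrightarrow> a \<odot>\<^bsub>M\<^esub> x \<in> H"
  by (rule submodule.smult_closed)

lemma submodule_diff: "\<lbrakk>submodule H R M; x \<in> H; y \<in> H\<rbrakk> \<Longrightarrow> x \<ominus>\<^bsub>M\<^esub> y \<in> H"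
  using subgroup.m_inv_closed[of H "add_monoid M" y] submodule_add[of H x "\<ominus>\<^bsub>M\<^esub> y"]
  by (simp add: a_minus_def submodule_def a_inv_def)

lemma left_module_restrict:
  assumes H: "submodule H R M"
  shows "left_module R (M\<lparr>carrier := H\<rparr>)"
proof (rule left_moduleI)
qed (use H submodule_subset[OF H] in \<open>auto simp: R.ring_axioms submodule_zero submodule_add submodule_smult M.a_ac
      smult_l_distr smult_r_distr smult_assoc1 subset_iff\<close>)

lemma submodule_carrier: "submodule (carrier M) R M"
  by (rule submoduleI) auto

lemma submodule_zero_set: "submodule {\<zero>\<^bsub>M\<^esub>} R M"
  by (rule submoduleI) auto

end

lemma gen_submodule:
  assumes "left_module R M" "S \<subseteq> carrier M"
  shows "submodule (gen_submodule R M S) R M"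
proof -
  interpret left_module R M by fact
  show ?thesis
    unfolding gen_submodule_def using assms(2)
    by (intro submoduleI)
      (auto simp: submodule_zero submodule_add submodule_smult intro: submodule_carrier)
qed

lemma gen_submodule_incl: "S \<subseteq> gen_submodule R M S"
  by (auto simp: gen_submodule_def)

lemma gen_submodule_least: "\<lbrakk>submodule H R M; S \<subseteq> H\<rbrakk> \<Longrightarrow> gen_submodule R M S \<subseteq> H"
  by (auto simp: gen_submodule_def)

lemma is_homI:
  assumes "\<And>x. x \<in> carrier M \<Longrightarrow> f x \<in> carrier N"
    and "\<And>x y. \<lbrakk>x \<in> carrier M; y \<in> carrier M\<rbrakk> \<Longrightarrow> f (x \<oplus>\<^bsub>M\<^esub> y) = f x \<oplus>\<^bsub>N\<^esub> f y"
    and "\<And>a x. \<lbrakk>a \<in> carrier R; x \<in> carrier M\<rbrakk> \<Longrightarrow> f (a \<odot>\<^bsub>M\<^esub> x) = a \<odot>\<^bsub>N\<^esub> f x"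
  shows "is_hom R M N f"
  using assms by (auto simp: is_hom_def)

lemma is_hom_closed: "\<lbrakk>is_hom R M N f; x \<in> carrier M\<rbrakk> \<Longrightarrow> f x \<in> carrier N"
  and is_hom_add: "\<lbrakk>is_hom R M N f; x \<in> carrier M; y \<in> carrier M\<rbrakk> \<Longrightarrow> f (x \<oplus>\<^bsub>M\<^esub> y) = f x \<oplus>\<^bsub>N\<^esub> f y"
  and is_hom_smult: "\<lbrakk>is_hom R M N f; a \<in> carrier R; x \<in> carrier M\<rbrakk> \<Longrightarrow> f (a \<odot>\<^bsub>M\<^esub> x) = a \<odot>\<^bsub>N\<^esub> f x"
  by (auto simp: is_hom_def)

lemma is_hom_comp: "\<lbrakk>is_hom R M N f; is_hom R N P g\<rbrakk> \<Longrightarrow> is_hom R M P (\<lambda>x. g (f x))"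
  by (auto simp: is_hom_def Pi_iff)

lemma is_hom_id: "is_hom R M M (\<lambda>x. x)"
  by (auto simp: is_hom_def)

lemma is_hom_cong:
  assumes "left_module R M" "is_hom R M N f" "\<And>x. x \<in> carrier M \<Longrightarrow> f x = g x"
  shows "is_hom R M N g"
proof -
  interpret M: left_module R M by fact
  show ?thesis
    by (rule is_homI) (use assms(2) in \<open>simp_all flip: assms(3) add: is_hom_def Pi_iff\<close>)
qed

lemma is_hom_zero:
  assumes "left_module R M" "left_module R N" "is_hom R M N f"
  shows "f \<zero>\<^bsub>M\<^esub> = \<zero>\<^bsub>N\<^esub>"
proof -
  interpret M: left_module R M by fact
  interpret N: left_module R N by fact
  have "f (\<zero>\<^bsub>R\<^esub> \<odot>\<^bsub>M\<^esub> \<zero>\<^bsub>M\<^esub>) = \<zero>\<^bsub>R\<^esub> \<odot>\<^bsub>N\<^esub> f \<zero>\<^bsub>M\<^esub>"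
    using is_hom_smult[OF assms(3), of "\<zero>\<^bsub>R\<^esub>" "\<zero>\<^bsub>M\<^esub>"] by simp
  then show ?thesis
    using is_hom_closed[OF assms(3), of "\<zero>\<^bsub>M\<^esub>"] by simp
qed

lemma is_hom_uminus:
  assumes "left_module R M" "left_module R N" "is_hom R M N f" "x \<in> carrier M"
  shows "f (\<ominus>\<^bsub>M\<^esub> x) = \<ominus>\<^bsub>N\<^esub> f x"
proof -
  interpret M: left_module R M by fact
  interpret N: left_module R N by fact
  show ?thesis
    using is_hom_smult[OF assms(3), of "\<ominus>\<^bsub>R\<^esub> \<one>\<^bsub>R\<^esub>" x] is_hom_closed[OF assms(3,4)] assms(4)
    by (simp add: M.smult_minus_one N.smult_minus_one)
qed

lemma is_hom_diff:
  assumes "left_module R M" "left_module R N" "is_hom R M N f" "x \<in> carrier M" "y \<in> carrier M"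
  shows "f (x \<ominus>\<^bsub>M\<^esub> y) = f x \<ominus>\<^bsub>N\<^esub> f y"
proof -
  interpret M: left_module R M by fact
  show ?thesis
    using is_hom_uminus[OF assms(1-3,5)] is_hom_add[OF assms(3,4), of "\<ominus>\<^bsub>M\<^esub> y"] assms(5)
    by (simp add: a_minus_def)
qed

lemma is_hom_zero_map: "left_module R N \<Longrightarrow> is_hom R M N (\<lambda>_. \<zero>\<^bsub>N\<^esub>)"
proof -
  assume "left_module R N"
  then interpret N: left_module R N .
  show ?thesis by (rule is_homI) auto
qed

lemma is_hom_add_map:
  assumes "left_module R N" "is_hom R M N f" "is_hom R M N g"
  shows "is_hom R M N (\<lambda>x. f x \<oplus>\<^bsub>N\<^esub> g x)"
proof -
  interpret N: left_module R N by fact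
  show ?thesis
    using assms(2,3) by (intro is_homI) (auto simp: is_hom_def Pi_iff N.smult_r_distr N.M.a_ac)
qed

lemma is_hom_diff_map:
  assumes "left_module R N" "is_hom R M N f" "is_hom R M N g"
  shows "is_hom R M N (\<lambda>x. f x \<ominus>\<^bsub>N\<^esub> g x)"
proof -
  interpret N: left_module R N by fact
  show ?thesis
    using assms(2,3)
    by (intro is_homI) (auto simp: is_hom_def Pi_iff N.smult_diff N.add_diff_add)
qed

lemma is_hom_restrict_carrier:
  "\<lbrakk>is_hom R M N f; \<And>x. x \<in> carrier M \<Longrightarrow> f x \<in> H\<rbrakk> \<Longrightarrow> is_hom R M (N\<lparr>carrier := H\<rparr>) f"
  by (auto simp: is_hom_def)

lemma is_hom_incl: "H \<subseteq> carrier N \<Longrightarrow> is_hom R (N\<lparr>carrier := H\<rparr>) N (\<lambda>x. x)"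
  by (auto simp: is_hom_def)

lemma is_hom_sub: "\<lbrakk>is_hom R M N f; H \<subseteq> carrier M\<rbrakk> \<Longrightarrow> is_hom R (M\<lparr>carrier := H\<rparr>) N f"
  by (simp add: is_hom_def Pi_iff subset_iff)

lemma submodule_kernel:
  assumes "left_module R M" "left_module R N" "is_hom R M N f"
  shows "submodule {x \<in> carrier M. f x = \<zero>\<^bsub>N\<^esub>} R M"
proof -
  interpret M: left_module R M by fact
  interpret N: left_module R N by fact
  show ?thesis
    by (rule M.submoduleI) (auto simp: is_hom_zero[OF assms] is_hom_add[OF assms(3)] is_hom_smult[OF assms(3)])
qed

lemma submodule_image:
  assumes "left_module R M" "left_module R N" "is_hom R M N f" "submodule H R M"
  shows "submodule (f ` H) R N"
proof -
  interpret M: left_module R M by fact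
  interpret N: left_module R N by fact
  note H = M.submodule_subset[OF assms(4)]
  show ?thesis
  proof (rule N.submoduleI)
    show "f ` H \<subseteq> carrier N" using H is_hom_closed[OF assms(3)] by auto
    show "\<zero>\<^bsub>N\<^esub> \<in> f ` H"
      using M.submodule_zero[OF assms(4)] is_hom_zero[OF assms(1-3)] by force
    fix x a assume x: "x \<in> f ` H" and a: "a \<in> carrier R"
    then obtain u where u: "u \<in> H" "x = f u" "u \<in> carrier M" using H by auto
    show "a \<odot>\<^bsub>N\<^esub> x \<in> f ` H"
      using M.submodule_smult[OF assms(4) a u(1)] is_hom_smult[OF assms(3) a u(3)] u(2) by force
  next
    fix x y assume "x \<in> f ` H" "y \<in> f ` H"
    then obtain u v where u: "u \<in> H" "x = f u" "u \<in> carrier M" "v \<in> H" "y = f v" "v \<in> carrier M"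
      using H by auto
    show "x \<oplus>\<^bsub>N\<^esub> y \<in> f ` H"
      using M.submodule_add[OF assms(4) u(1,4)] is_hom_add[OF assms(3) u(3,6)] u(2,5) by force
  qed
qed

lemma a_kernel_eq: "a_kernel M N f = {x \<in> carrier M. f x = \<zero>\<^bsub>N\<^esub>}"
  by (simp add: a_kernel_def')

lemma mod_iso_trans: "\<lbrakk>mod_iso R M N; mod_iso R N P\<rbrakk> \<Longrightarrow> mod_iso R M P"
  unfolding mod_iso_def by (metis bij_betw_trans[unfolded comp_def] is_hom_comp)

lemma mod_iso_sym:
  assumes "left_module R M" "mod_iso R M N"
  shows "mod_iso R N M"
proof -
  interpret M: left_module R M by fact
  obtain f where f: "is_hom R M N f" "bij_betw f (carrier M) (carrier N)"
    using assms(2) by (auto simp: mod_iso_def)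
  let ?g = "inv_into (carrier M) f"
  have g: "?g y \<in> carrier M" "f (?g y) = y" if "y \<in> carrier N" for y
    using f(2) that by (auto simp: bij_betw_def f_inv_into_f inv_into_into)
  have inj: "x = y" if "f x = f y" "x \<in> carrier M" "y \<in> carrier M" for x y
    using f(2) that by (auto simp: bij_betw_def inj_on_def)
  \<comment> \<open>Closure of \<open>N\<close> under its operations is transported along the
    bijection, the module axioms being available for \<open>M\<close>.\<close>
  have N: "x \<oplus>\<^bsub>N\<^esub> y \<in> carrier N" "a \<odot>\<^bsub>N\<^esub> x \<in> carrier N"
    if "x \<in> carrier N" "y \<in> carrier N" "a \<in> carrier R" for x y a
    using g that is_hom_closed[OF f(1)] is_hom_add[OF f(1), of "?g x" "?g y"] is_hom_smult[OF f(1), of a "?g x"]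
    by (metis M.M.a_closed, metis M.smult_closed)
  have N': "x \<oplus>\<^bsub>N\<^esub> y \<in> carrier N" if "x \<in> carrier N" "y \<in> carrier N" for x y
    using N(1)[OF that M.R.zero_closed] .
  have N'': "a \<odot>\<^bsub>N\<^esub> x \<in> carrier N" if "x \<in> carrier N" "a \<in> carrier R" for x a
    using N(2)[OF that(1) that] .
  have "is_hom R N M ?g"
    by (intro is_homI inj) (simp_all add: g N' N'' is_hom_add[OF f(1)] is_hom_smult[OF f(1)])
  then show ?thesis
    using bij_betw_inv_into[OF f(2)] by (auto simp: mod_iso_def)
qed

section \<open>Quotient modules\<close>

context
  fixes R :: "('a, 'b) ring_scheme" and M :: "('a, 'm) module" and B :: "'m set"
  assumes M: "left_module R M" and B: "submodule B R M"
begin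

interpretation M: left_module R M by (rule M)

interpretation B: abelian_subgroup B M
  using B by (intro abelian_subgroupI3 additive_subgroup.intro M.abelian_group) (simp add: submodule_def)

lemma coset_eq_iff:
  assumes "x \<in> carrier M" "y \<in> carrier M"
  shows "B +>\<^bsub>M\<^esub> x = B +>\<^bsub>M\<^esub> y \<longleftrightarrow> x \<ominus>\<^bsub>M\<^esub> y \<in> B"
proof
  assume "B +>\<^bsub>M\<^esub> x = B +>\<^bsub>M\<^esub> y"
  then have "x \<in> B +>\<^bsub>M\<^esub> y"
    using assms(1) B.a_rcos_self by blast
  then show "x \<ominus>\<^bsub>M\<^esub> y \<in> B"
    using B.a_rcos_module_imp[OF assms(2)] by (simp add: a_minus_def)
next
  assume "x \<ominus>\<^bsub>M\<^esub> y \<in> B"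
  then have "x \<in> B +>\<^bsub>M\<^esub> y"
    by (intro B.a_rcos_module_rev assms) (simp add: a_minus_def)
  then show "B +>\<^bsub>M\<^esub> x = B +>\<^bsub>M\<^esub> y"
    using B.a_repr_independence'[OF _ assms(2)] by simp
qed

lemma coset_self: "x \<in> carrier M \<Longrightarrow> x \<in> B +>\<^bsub>M\<^esub> x"
  by (rule B.a_rcos_self)

lemma coset_member: "\<lbrakk>y \<in> B +>\<^bsub>M\<^esub> x; x \<in> carrier M\<rbrakk> \<Longrightarrow> y \<in> carrier M \<and> B +>\<^bsub>M\<^esub> y = B +>\<^bsub>M\<^esub> x"
  using B.a_elemrcos_carrier B.a_repr_independence' by metis

lemma carrier_quotient: "carrier (quotient_module M B) = (\<lambda>x. B +>\<^bsub>M\<^esub> x) ` carrier M"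
  by (auto simp: quotient_module_def A_RCOSETS_def')

lemma quotient_closed: "x \<in> carrier M \<Longrightarrow> B +>\<^bsub>M\<^esub> x \<in> carrier (quotient_module M B)"
  by (simp add: carrier_quotient)

lemma quotient_cases:
  assumes "X \<in> carrier (quotient_module M B)"
  obtains x where "x \<in> carrier M" "X = B +>\<^bsub>M\<^esub> x"
  using assms by (auto simp: carrier_quotient)

lemma coset_zero: "B +>\<^bsub>M\<^esub> \<zero>\<^bsub>M\<^esub> = B"
  by (rule B.a_rcos_const) (rule B.zero_closed)

lemma quotient_zero: "\<zero>\<^bsub>quotient_module M B\<^esub> = B +>\<^bsub>M\<^esub> \<zero>\<^bsub>M\<^esub>"
  by (simp add: coset_zero quotient_module_def)

lemma coset_eq_zero_iff: "x \<in> carrier M \<Longrightarrow> B +>\<^bsub>M\<^esub> x = \<zero>\<^bsub>quotient_module M B\<^esub> \<longleftrightarrow> x \<in> B"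
  by (simp add: quotient_zero coset_eq_iff a_minus_def M.diff_zero)

lemma quotient_add:
  "\<lbrakk>x \<in> carrier M; y \<in> carrier M\<rbrakk> \<Longrightarrow>
    (B +>\<^bsub>M\<^esub> x) \<oplus>\<^bsub>quotient_module M B\<^esub> (B +>\<^bsub>M\<^esub> y) = B +>\<^bsub>M\<^esub> (x \<oplus>\<^bsub>M\<^esub> y)"
  by (simp add: quotient_module_def B.a_rcos_sum)

lemma quotient_smult:
  assumes "a \<in> carrier R" "x \<in> carrier M"
  shows "a \<odot>\<^bsub>quotient_module M B\<^esub> (B +>\<^bsub>M\<^esub> x) = B +>\<^bsub>M\<^esub> (a \<odot>\<^bsub>M\<^esub> x)"
proof -
  \<comment> \<open>The scalar action on cosets is defined by a union; all its members are one and
    the same coset, since \<open>B\<close> absorbs the multiples of \<open>y - x\<close>.\<close>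
  have "B +>\<^bsub>M\<^esub> (a \<odot>\<^bsub>M\<^esub> y) = B +>\<^bsub>M\<^esub> (a \<odot>\<^bsub>M\<^esub> x)" if y: "y \<in> B +>\<^bsub>M\<^esub> x" for y
  proof -
    have yc: "y \<in> carrier M" and "B +>\<^bsub>M\<^esub> y = B +>\<^bsub>M\<^esub> x"
      using coset_member[OF y assms(2)] by auto
    then have "y \<ominus>\<^bsub>M\<^esub> x \<in> B" using coset_eq_iff assms(2) by blast
    then have "a \<odot>\<^bsub>M\<^esub> (y \<ominus>\<^bsub>M\<^esub> x) \<in> B" by (rule M.submodule_smult[OF B assms(1)])
    then show ?thesis
      using yc assms by (simp add: coset_eq_iff M.smult_diff)
  qed
  then show ?thesis
    unfolding quotient_module_def mk_module_simps
    by (intro UN_constant_eq[OF coset_self[OF assms(2)]] ballI)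
qed

lemma left_module_quotient: "left_module R (quotient_module M B)"
proof (rule left_moduleI)
qed (auto elim!: quotient_cases intro!: quotient_closed
      simp: M.R.ring_axioms quotient_zero quotient_add quotient_smult M.M.a_ac
      M.smult_l_distr M.smult_r_distr M.smult_assoc1)

lemma is_hom_coset: "is_hom R M (quotient_module M B) (\<lambda>x. B +>\<^bsub>M\<^esub> x)"
  by (rule is_homI) (simp_all add: quotient_closed quotient_add quotient_smult)

lemma quotient_lift:
  assumes "is_hom R M N f" "\<And>x. x \<in> B \<Longrightarrow> f x = \<zero>\<^bsub>N\<^esub>" "left_module R N"
  obtains f' where "is_hom R (quotient_module M B) N f'"
    "\<And>x. x \<in> carrier M \<Longrightarrow> f' (B +>\<^bsub>M\<^esub> x) = f x"
proof -
  interpret N: left_module R N by fact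
  define f' where "f' X = f (SOME x. x \<in> X)" for X
  have f': "f' (B +>\<^bsub>M\<^esub> x) = f x" if x: "x \<in> carrier M" for x
  proof -
    have "(SOME y. y \<in> B +>\<^bsub>M\<^esub> x) \<in> B +>\<^bsub>M\<^esub> x" (is "?y \<in> _")
      by (rule someI_ex) (use coset_self[OF x] in blast)
    then have y: "?y \<in> carrier M" "B +>\<^bsub>M\<^esub> ?y = B +>\<^bsub>M\<^esub> x"
      using coset_member[OF _ x] by blast+
    then have "f (?y \<ominus>\<^bsub>M\<^esub> x) = \<zero>\<^bsub>N\<^esub>" using coset_eq_iff x assms(2) by blast
    then have "f ?y \<ominus>\<^bsub>N\<^esub> f x = \<zero>\<^bsub>N\<^esub>" using is_hom_diff[OF M assms(3,1) y(1) x] by simp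
    then show ?thesis
      unfolding f'_def using is_hom_closed[OF assms(1)] y(1) x by (simp only: N.diff_eq_zero_iff)
  qed
  have "is_hom R (quotient_module M B) N f'"
    by (rule is_homI)
      (auto elim!: quotient_cases simp: f' quotient_add quotient_smult
        is_hom_closed[OF assms(1)] is_hom_add[OF assms(1)] is_hom_smult[OF assms(1)])
  then show thesis using that f' by blast
qed

text \<open>A homomorphism up to isomorphism may be given by a total relation instead of a map, so that
  no choices have to be made coherently.\<close>

lemma quotient_iso_relation:
  assumes N: "left_module R N"
    and G_sub: "\<And>x y. (x, y) \<in> G \<Longrightarrow> x \<in> carrier M \<and> y \<in> carrier N"
    and total: "\<And>x. x \<in> carrier M \<Longrightarrow> \<exists>y. (x, y) \<in> G"
    and surj: "\<And>y. y \<in> carrier N \<Longrightarrow> \<exists>x. (x, y) \<in> G"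
    and add: "\<And>x y x' y'. \<lbrakk>(x, y) \<in> G; (x', y') \<in> G\<rbrakk> \<Longrightarrow> (x \<oplus>\<^bsub>M\<^esub> x', y \<oplus>\<^bsub>N\<^esub> y') \<in> G"
    and smult: "\<And>a x y. \<lbrakk>a \<in> carrier R; (x, y) \<in> G\<rbrakk> \<Longrightarrow> (a \<odot>\<^bsub>M\<^esub> x, a \<odot>\<^bsub>N\<^esub> y) \<in> G"
    and null: "\<And>x y. (x, y) \<in> G \<Longrightarrow> x \<in> B \<longleftrightarrow> y = \<zero>\<^bsub>N\<^esub>"
  shows "mod_iso R (quotient_module M B) N"
proof -
  interpret N: left_module R N by fact
  define g where "g x = (SOME y. (x, y) \<in> G)" for x
  have gG: "(x, g x) \<in> G" if "x \<in> carrier M" for x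
    unfolding g_def using total[OF that] by (rule someI_ex)
  have diff: "(x \<ominus>\<^bsub>M\<^esub> x', y \<ominus>\<^bsub>N\<^esub> y') \<in> G" if "(x, y) \<in> G" "(x', y') \<in> G" for x y x' y'
    using add[OF that(1) smult[OF _ that(2)], of "\<ominus>\<^bsub>R\<^esub> \<one>\<^bsub>R\<^esub>"] G_sub[OF that(2)]
    by (simp add: M.smult_minus_one N.smult_minus_one a_minus_def)
  \<comment> \<open>Applied to a difference of pairs, \<open>null\<close> says two things:
    \<open>G\<close> is single-valued (take \<open>x = x'\<close>), and it is injective modulo
    \<open>B\<close>.\<close>
  have key: "x \<ominus>\<^bsub>M\<^esub> x' \<in> B \<longleftrightarrow> y = y'" if "(x, y) \<in> G" "(x', y') \<in> G" for x y x' y'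
    using null[OF diff[OF that]] G_sub[OF that(1)] G_sub[OF that(2)] N.diff_eq_zero_iff by simp
  have g_eq: "g x = y" if "(x, y) \<in> G" for x y
  proof -
    have "x \<in> carrier M" using G_sub that by blast
    then show ?thesis
      using key[OF gG that, of x] M.submodule_zero[OF B] M.diff_eq_zero_iff[of x x] by simp
  qed
  have g: "is_hom R M N g"
    by (rule is_homI) (use gG G_sub in \<open>blast intro: g_eq add smult\<close>)+
  have g0: "g x = \<zero>\<^bsub>N\<^esub>" if "x \<in> B" for x
    using null[OF gG, of x] that M.submodule_subset[OF B] by blast
  obtain f where f: "is_hom R (quotient_module M B) N f"
    "\<And>x. x \<in> carrier M \<Longrightarrow> f (B +>\<^bsub>M\<^esub> x) = g x"
    using quotient_lift[OF g g0 N] by blast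
  have "bij_betw f (carrier (quotient_module M B)) (carrier N)"
  proof (intro bij_betw_imageI inj_onI)
    fix X X' assume X: "X \<in> carrier (quotient_module M B)" "X' \<in> carrier (quotient_module M B)"
      and eq: "f X = f X'"
    obtain x x' where x: "x \<in> carrier M" "X = B +>\<^bsub>M\<^esub> x" "x' \<in> carrier M" "X' = B +>\<^bsub>M\<^esub> x'"
      using X by (auto elim!: quotient_cases)
    then show "X = X'"
      using key[OF gG gG, of x x'] eq by (simp add: coset_eq_iff f(2))
  next
    show "f ` carrier (quotient_module M B) = carrier N"
    proof (intro equalityI subsetI)
      fix y assume "y \<in> carrier N"
      then obtain x where x: "(x, y) \<in> G" using surj by blast
      then have "f (B +>\<^bsub>M\<^esub> x) = y" using f(2) G_sub g_eq by auto
      then show "y \<in> f ` carrier (quotient_module M B)"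
        using x G_sub quotient_closed by (metis imageI)
    qed (use is_hom_closed[OF f(1)] in auto)
  qed
  then show ?thesis using f(1) by (auto simp: mod_iso_def)
qed

end

text \<open>Most comparisons of homology below have this form: \<open>x\<close> and \<open>y\<close>
  are cycles produced from a common datum, and \<open>null\<close> says that boundaries correspond
  to boundaries. The second coordinate is followed by the coset map of \<open>C\<close> to reduce to
  a single quotient.\<close>

lemma quotient_iso_quotient_relation:
  assumes M: "left_module R M" and N: "left_module R N"
    and B: "submodule B R M" and C: "submodule C R N"
    and G_sub: "\<And>x y. (x, y) \<in> G \<Longrightarrow> x \<in> carrier M \<and> y \<in> carrier N"
    and total: "\<And>x. x \<in> carrier M \<Longrightarrow> \<exists>y. (x, y) \<in> G"
    and surj: "\<And>y. y \<in> carrier N \<Longrightarrow> \<exists>x. (x, y) \<in> G"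
    and add: "\<And>x y x' y'. \<lbrakk>(x, y) \<in> G; (x', y') \<in> G\<rbrakk> \<Longrightarrow> (x \<oplus>\<^bsub>M\<^esub> x', y \<oplus>\<^bsub>N\<^esub> y') \<in> G"
    and smult: "\<And>a x y. \<lbrakk>a \<in> carrier R; (x, y) \<in> G\<rbrakk> \<Longrightarrow> (a \<odot>\<^bsub>M\<^esub> x, a \<odot>\<^bsub>N\<^esub> y) \<in> G"
    and null: "\<And>x y. (x, y) \<in> G \<Longrightarrow> x \<in> B \<longleftrightarrow> y \<in> C"
  shows "mod_iso R (quotient_module M B) (quotient_module N C)"
proof -
  let ?G = "{(x, C +>\<^bsub>N\<^esub> y) | x y. (x, y) \<in> G}"
  have G: "(x, Y) \<in> ?G \<longleftrightarrow> (\<exists>y. Y = C +>\<^bsub>N\<^esub> y \<and> (x, y) \<in> G)" for x Y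
    by blast
  show ?thesis
  proof (rule quotient_iso_relation[OF M B left_module_quotient[OF N C], of ?G]; unfold G)
    fix Y assume "Y \<in> carrier (quotient_module N C)"
    then show "\<exists>x y. Y = C +>\<^bsub>N\<^esub> y \<and> (x, y) \<in> G"
      by (rule quotient_cases[OF N C]) (use surj in blast)
  next
    fix x Y x' Y' assume "\<exists>y. Y = C +>\<^bsub>N\<^esub> y \<and> (x, y) \<in> G" "\<exists>y. Y' = C +>\<^bsub>N\<^esub> y \<and> (x', y) \<in> G"
    then obtain y y' where *: "Y = C +>\<^bsub>N\<^esub> y" "(x, y) \<in> G" "Y' = C +>\<^bsub>N\<^esub> y'" "(x', y') \<in> G"
      by blast
    then show "\<exists>y. Y \<oplus>\<^bsub>quotient_module N C\<^esub> Y' = C +>\<^bsub>N\<^esub> y \<and> (x \<oplus>\<^bsub>M\<^esub> x', y) \<in> G"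
      using add[OF *(2,4)] G_sub[OF *(2)] G_sub[OF *(4)] quotient_add[OF N C, of y y'] by auto
  next
    fix a x Y assume a: "a \<in> carrier R" and "\<exists>y. Y = C +>\<^bsub>N\<^esub> y \<and> (x, y) \<in> G"
    then obtain y where *: "Y = C +>\<^bsub>N\<^esub> y" "(x, y) \<in> G" by blast
    then show "\<exists>y. a \<odot>\<^bsub>quotient_module N C\<^esub> Y = C +>\<^bsub>N\<^esub> y \<and> (a \<odot>\<^bsub>M\<^esub> x, y) \<in> G"
      using smult[OF a *(2)] G_sub[OF *(2)] quotient_smult[OF N C a, of y] by auto
  next
    fix x Y assume "\<exists>y. Y = C +>\<^bsub>N\<^esub> y \<and> (x, y) \<in> G"
    then obtain y where *: "Y = C +>\<^bsub>N\<^esub> y" "(x, y) \<in> G" by blast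
    then show "x \<in> B \<longleftrightarrow> Y = \<zero>\<^bsub>quotient_module N C\<^esub>"
      using null[OF *(2)] G_sub[OF *(2)] coset_eq_zero_iff[OF N C, of y] by simp
    show "x \<in> carrier M \<and> Y \<in> carrier (quotient_module N C)"
      using * G_sub[OF *(2)] quotient_closed[OF N C, of y] by simp
  next
    fix x assume "x \<in> carrier M"
    then show "\<exists>Y y. Y = C +>\<^bsub>N\<^esub> y \<and> (x, y) \<in> G" using total by blast
  qed
qed

section \<open>Modules of homomorphisms\<close>

lemma regular_simps [simp]:
  "carrier (regular R) = carrier R"
  "\<zero>\<^bsub>regular R\<^esub> = \<zero>\<^bsub>R\<^esub>"
  "x \<oplus>\<^bsub>regular R\<^esub> y = x \<oplus>\<^bsub>R\<^esub> y"
  "a \<odot>\<^bsub>regular R\<^esub> x = a \<otimes>\<^bsub>R\<^esub> x"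
  by (simp_all add: regular_def)

lemma left_module_regular: "ring R \<Longrightarrow> left_module R (regular R)"
proof -
  assume "ring R"
  then interpret ring R .
  show ?thesis
    by (rule left_moduleI) (simp_all add: ring_axioms a_ac m_assoc l_distr r_distr)
qed

lemma Hom_setI: "\<lbrakk>left_module R M; is_hom R M N f\<rbrakk> \<Longrightarrow> restrict f (carrier M) \<in> Hom_set R M N"
  by (auto simp: Hom_set_def intro: is_hom_cong)

lemma Hom_set_hom: "f \<in> Hom_set R M N \<Longrightarrow> is_hom R M N f"
  by (simp add: Hom_set_def)

lemma Hom_set_closed: "\<lbrakk>f \<in> Hom_set R M N; x \<in> carrier M\<rbrakk> \<Longrightarrow> f x \<in> carrier N"
  by (auto simp: Hom_set_def is_hom_def)

lemma Hom_set_eqI: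
  "\<lbrakk>f \<in> Hom_set R M N; g \<in> Hom_set R M N; \<And>x. x \<in> carrier M \<Longrightarrow> f x = g x\<rbrakk> \<Longrightarrow> f = g"
  by (auto simp: Hom_set_def intro: extensionalityI)

lemma Hom_set_restrict: "f \<in> Hom_set R M N \<Longrightarrow> restrict f (carrier M) = f"
  by (simp add: Hom_set_def extensional_restrict)

text \<open>All the modules of homomorphisms in the theorem have pointwise addition and differ only in
  the action of the scalars.\<close>

lemma left_module_Hom_set:
  assumes M: "left_module R M" and N: "left_module R N" and S: "ring S"
    and hom: "\<And>a f. \<lbrakk>a \<in> carrier S; f \<in> Hom_set R M N\<rbrakk> \<Longrightarrow> is_hom R M N (t a f)"
    and l_distr: "\<And>a b f x. \<lbrakk>a \<in> carrier S; b \<in> carrier S; f \<in> Hom_set R M N; x \<in> carrier M\<rbrakk> \<Longrightarrow>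
        t (a \<oplus>\<^bsub>S\<^esub> b) f x = t a f x \<oplus>\<^bsub>N\<^esub> t b f x"
    and r_distr: "\<And>a f g x. \<lbrakk>a \<in> carrier S; f \<in> Hom_set R M N; g \<in> Hom_set R M N; x \<in> carrier M\<rbrakk> \<Longrightarrow>
        t a (\<lambda>x\<in>carrier M. f x \<oplus>\<^bsub>N\<^esub> g x) x = t a f x \<oplus>\<^bsub>N\<^esub> t a g x"
    and assoc: "\<And>a b f x. \<lbrakk>a \<in> carrier S; b \<in> carrier S; f \<in> Hom_set R M N; x \<in> carrier M\<rbrakk> \<Longrightarrow>
        t (a \<otimes>\<^bsub>S\<^esub> b) f x = t a (\<lambda>x\<in>carrier M. t b f x) x"
    and one: "\<And>f x. \<lbrakk>f \<in> Hom_set R M N; x \<in> carrier M\<rbrakk> \<Longrightarrow> t \<one>\<^bsub>S\<^esub> f x = f x"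
    and zero: "\<And>f x. \<lbrakk>f \<in> Hom_set R M N; x \<in> carrier M\<rbrakk> \<Longrightarrow> t \<zero>\<^bsub>S\<^esub> f x = \<zero>\<^bsub>N\<^esub>"
  shows "left_module S (mk_module (Hom_set R M N) (\<lambda>x\<in>carrier M. \<zero>\<^bsub>N\<^esub>)
    (\<lambda>f g. \<lambda>x\<in>carrier M. f x \<oplus>\<^bsub>N\<^esub> g x) (\<lambda>a f. \<lambda>x\<in>carrier M. t a f x))"
proof -
  interpret M: left_module R M by fact
  interpret N: left_module R N by fact
  have add: "(\<lambda>x\<in>carrier M. f x \<oplus>\<^bsub>N\<^esub> g x) \<in> Hom_set R M N"
    if "f \<in> Hom_set R M N" "g \<in> Hom_set R M N" for f g
    using that by (intro Hom_setI[OF M] is_hom_add_map[OF N] Hom_set_hom)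
  show ?thesis
  proof (rule left_moduleI, unfold mk_module_simps)
    show "ring S" by fact
    show "(\<lambda>x\<in>carrier M. \<zero>\<^bsub>N\<^esub>) \<in> Hom_set R M N"
      by (intro Hom_setI[OF M] is_hom_zero_map[OF N])
    fix f assume f: "f \<in> Hom_set R M N"
    show "(\<lambda>x\<in>carrier M. (\<lambda>x\<in>carrier M. \<zero>\<^bsub>N\<^esub>) x \<oplus>\<^bsub>N\<^esub> f x) = f"
      using Hom_set_closed[OF f] by (subst (2) Hom_set_restrict[OF f, symmetric]) (auto intro!: restrict_ext)
    show "(\<lambda>x\<in>carrier M. t \<one>\<^bsub>S\<^esub> f x) = f"
      using one[OF f] by (subst (2) Hom_set_restrict[OF f, symmetric]) (auto intro!: restrict_ext)
    show "(\<lambda>x\<in>carrier M. t \<zero>\<^bsub>S\<^esub> f x) = (\<lambda>x\<in>carrier M. \<zero>\<^bsub>N\<^esub>)"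
      using zero[OF f] by (auto intro!: restrict_ext)
    fix g assume g: "g \<in> Hom_set R M N"
    show "(\<lambda>x\<in>carrier M. f x \<oplus>\<^bsub>N\<^esub> g x) = (\<lambda>x\<in>carrier M. g x \<oplus>\<^bsub>N\<^esub> f x)"
      using Hom_set_closed[OF f] Hom_set_closed[OF g] N.M.a_comm by (auto intro!: restrict_ext)
    fix h assume h: "h \<in> Hom_set R M N"
    show "(\<lambda>x\<in>carrier M. (\<lambda>x\<in>carrier M. f x \<oplus>\<^bsub>N\<^esub> g x) x \<oplus>\<^bsub>N\<^esub> h x) =
       (\<lambda>x\<in>carrier M. f x \<oplus>\<^bsub>N\<^esub> (\<lambda>x\<in>carrier M. g x \<oplus>\<^bsub>N\<^esub> h x) x)"
      using Hom_set_closed[OF f] Hom_set_closed[OF g] Hom_set_closed[OF h] N.M.a_assoc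
      by (auto intro!: restrict_ext)
  next
    fix a f assume a: "a \<in> carrier S" and f: "f \<in> Hom_set R M N"
    show "(\<lambda>x\<in>carrier M. t a f x) \<in> Hom_set R M N"
      by (intro Hom_setI[OF M] hom a f)
    fix b assume b: "b \<in> carrier S"
    show "(\<lambda>x\<in>carrier M. t (a \<oplus>\<^bsub>S\<^esub> b) f x) =
        (\<lambda>x\<in>carrier M. (\<lambda>x\<in>carrier M. t a f x) x \<oplus>\<^bsub>N\<^esub> (\<lambda>x\<in>carrier M. t b f x) x)"
      using l_distr[OF a b f] by (auto intro!: restrict_ext)
    show "(\<lambda>x\<in>carrier M. t (a \<otimes>\<^bsub>S\<^esub> b) f x) = (\<lambda>x\<in>carrier M. t a (\<lambda>x\<in>carrier M. t b f x) x)"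
      using assoc[OF a b f] by (auto intro!: restrict_ext)
  next
    fix a f g assume a: "a \<in> carrier S" and f: "f \<in> Hom_set R M N" and g: "g \<in> Hom_set R M N"
    show "(\<lambda>x\<in>carrier M. t a (\<lambda>x\<in>carrier M. f x \<oplus>\<^bsub>N\<^esub> g x) x) =
       (\<lambda>x\<in>carrier M. (\<lambda>x\<in>carrier M. t a f x) x \<oplus>\<^bsub>N\<^esub> (\<lambda>x\<in>carrier M. t a g x) x)"
      using r_distr[OF a f g] by (auto intro!: restrict_ext)
  qed (rule add)
qed

section \<open>Linear algebra\<close>

text \<open>Only additivity is asked of \<open>f\<close>, and the two rings may differ. So it also
  covers the evaluation of a sum of homomorphisms at a point and the map
  \<open>x \<mapsto> y \<otimes> x\<close>, which go from a module over one ring to a module over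
  another.\<close>

lemma finsum_additive:
  assumes "left_module R M" "left_module S N"
    and f: "\<And>x. x \<in> carrier M \<Longrightarrow> f x \<in> carrier N"
    and add: "\<And>x y. \<lbrakk>x \<in> carrier M; y \<in> carrier M\<rbrakk> \<Longrightarrow> f (x \<oplus>\<^bsub>M\<^esub> y) = f x \<oplus>\<^bsub>N\<^esub> f y"
    and u: "\<And>i. i \<in> I \<Longrightarrow> u i \<in> carrier M"
  shows "f (\<Oplus>\<^bsub>M\<^esub> i\<in>I. u i) = (\<Oplus>\<^bsub>N\<^esub> i\<in>I. f (u i))"
proof -
  interpret M: left_module R M by fact
  interpret N: left_module S N by fact
  have f0: "f \<zero>\<^bsub>M\<^esub> = \<zero>\<^bsub>N\<^esub>"
    using add[of "\<zero>\<^bsub>M\<^esub>" "\<zero>\<^bsub>M\<^esub>"] f[of "\<zero>\<^bsub>M\<^esub>"] by simp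
  show ?thesis
    using u
  proof (induction I rule: infinite_finite_induct)
    case (insert i I)
    then show ?case
      by (subst M.M.finsum_insert, simp_all add: Pi_iff) (subst N.M.finsum_insert, simp_all add: Pi_iff f add M.M.finsum_closed)
  \<comment> \<open>Over an infinite index set both sums are zero by convention, and
    \<open>f0\<close> settles this case as well.\<close>
  qed (simp_all add: f0 M.M.finsum_infinite N.M.finsum_infinite)
qed

lemma is_hom_finsum:
  assumes "left_module R M" "left_module R N" "is_hom R M N f" "\<And>i. i \<in> I \<Longrightarrow> u i \<in> carrier M"
  shows "f (\<Oplus>\<^bsub>M\<^esub> i\<in>I. u i) = (\<Oplus>\<^bsub>N\<^esub> i\<in>I. f (u i))"
  by (rule finsum_additive[OF assms(1,2)]) (use assms(4) is_hom_closed[OF assms(3)] is_hom_add[OF assms(3)] in auto)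

lemma smult_finsum:
  assumes "left_module R M" "a \<in> carrier R" "\<And>i. i \<in> I \<Longrightarrow> u i \<in> carrier M"
  shows "a \<odot>\<^bsub>M\<^esub> (\<Oplus>\<^bsub>M\<^esub> i\<in>I. u i) = (\<Oplus>\<^bsub>M\<^esub> i\<in>I. a \<odot>\<^bsub>M\<^esub> u i)"
proof -
  interpret M: left_module R M by fact
  show ?thesis
    by (rule finsum_additive[OF assms(1,1)]) (use assms(2,3) M.smult_r_distr in auto)
qed

section \<open>Complements and separating functionals over a field\<close>

context
  fixes K :: "'k ring"
  assumes K: "field K"
begin

interpretation K: field K by (rule K)

text \<open>A subspace \<open>H\<close> that is maximal among those meeting \<open>S\<close> only in
  zero is a complement of \<open>S\<close>, and \<open>p\<close> is the projection along it. Zorn's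
  lemma provides \<open>H\<close>, because the result is applied to tensor products whose dimension
  is not yet controlled.\<close>

lemma complement_projection:
  assumes V: "left_module K V" and S: "submodule S K V"
  obtains p where "is_hom K V V p" "\<And>x. x \<in> carrier V \<Longrightarrow> p x \<in> S" "\<And>x. x \<in> S \<Longrightarrow> p x = x"
proof -
  interpret V: left_module K V by (rule V)
  define A where "A = {H. submodule H K V \<and> H \<inter> S = {\<zero>\<^bsub>V\<^esub>}}"
  have "\<exists>M\<in>A. \<forall>X\<in>A. M \<subseteq> X \<longrightarrow> X = M"
  proof (rule subset_Zorn_nonempty)
    show "A \<noteq> {}"
      using V.submodule_zero_set V.submodule_zero[OF S] by (auto simp: A_def)
    fix C assume C: "C \<noteq> {}" "subset.chain A C"
    then have sub: "submodule H K V" "H \<inter> S = {\<zero>\<^bsub>V\<^esub>}" if "H \<in> C" for H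
      using that by (auto simp: A_def subset.chain_def)
    have tot: "H \<subseteq> H' \<or> H' \<subseteq> H" if "H \<in> C" "H' \<in> C" for H H'
      using C(2) that by (auto simp: subset.chain_def)
    have "submodule (\<Union>C) K V"
    proof (rule V.submoduleI)
      show "\<Union>C \<subseteq> carrier V" using sub V.submodule_subset by blast
      show "\<zero>\<^bsub>V\<^esub> \<in> \<Union>C" using C(1) sub V.submodule_zero by blast
      fix x y assume "x \<in> \<Union>C" "y \<in> \<Union>C"
      then obtain H H' where H: "x \<in> H" "H \<in> C" "y \<in> H'" "H' \<in> C" by blast
      then have "\<exists>H''\<in>C. x \<in> H'' \<and> y \<in> H''"
        using tot[OF H(2,4)] by blast
      then show "x \<oplus>\<^bsub>V\<^esub> y \<in> \<Union>C" using sub V.submodule_add by blast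
    next
      fix a x assume a: "a \<in> carrier K" and "x \<in> \<Union>C"
      then show "a \<odot>\<^bsub>V\<^esub> x \<in> \<Union>C" using V.submodule_smult[OF sub(1) a] by blast
    qed
    moreover have "\<Union>C \<inter> S = {\<zero>\<^bsub>V\<^esub>}" using sub(2) C(1) by blast
    ultimately show "\<Union>C \<in> A" by (simp add: A_def)
  qed
  then obtain H where HA: "H \<in> A" and maxA: "\<forall>X\<in>A. H \<subseteq> X \<longrightarrow> X = H" by (rule bexE)
  have H: "submodule H K V" "H \<inter> S = {\<zero>\<^bsub>V\<^esub>}" using HA by (simp_all add: A_def)
  have max: "X = H" if "submodule X K V" "X \<inter> S = {\<zero>\<^bsub>V\<^esub>}" "H \<subseteq> X" for X
    using maxA that by (simp add: A_def)
  note Hc = V.submodule_subset[OF H(1), THEN subsetD] and Sc = V.submodule_subset[OF S, THEN subsetD]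
  have sum: "\<exists>s\<in>S. v \<ominus>\<^bsub>V\<^esub> s \<in> H" if v: "v \<in> carrier V" for v
  proof (rule ccontr)
    assume neg: "\<not> (\<exists>s\<in>S. v \<ominus>\<^bsub>V\<^esub> s \<in> H)"
    \<comment> \<open>\<open>X = H + K v\<close> still meets \<open>S\<close> trivially, so
      maximality makes it equal to \<open>H\<close>. Then \<open>v\<close> lies in \<open>H\<close>,
      and \<open>s = 0\<close> contradicts \<open>neg\<close>.\<close>
    define X where "X = {h \<oplus>\<^bsub>V\<^esub> c \<odot>\<^bsub>V\<^esub> v | h c. h \<in> H \<and> c \<in> carrier K}"
    have XI: "h \<oplus>\<^bsub>V\<^esub> c \<odot>\<^bsub>V\<^esub> v \<in> X" if "h \<in> H" "c \<in> carrier K" for h c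
      using that unfolding X_def by blast
    have XE: "\<exists>h c. h \<in> H \<and> c \<in> carrier K \<and> x = h \<oplus>\<^bsub>V\<^esub> c \<odot>\<^bsub>V\<^esub> v" if "x \<in> X" for x
      using that unfolding X_def by blast
    have "X = H"
    proof (rule max)
      show "H \<subseteq> X"
      proof
        fix h assume "h \<in> H"
        then show "h \<in> X" using XI[of h "\<zero>\<^bsub>K\<^esub>"] v Hc by simp
      qed
      show "submodule X K V"
      proof (rule V.submoduleI)
        show "X \<subseteq> carrier V" using v Hc by (auto dest!: XE)
        show "\<zero>\<^bsub>V\<^esub> \<in> X" using XI[of "\<zero>\<^bsub>V\<^esub>" "\<zero>\<^bsub>K\<^esub>"] v V.submodule_zero[OF H(1)] by simp
        fix x y assume "x \<in> X" "y \<in> X"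
        then obtain h c h' c' where *: "h \<in> H" "c \<in> carrier K" "x = h \<oplus>\<^bsub>V\<^esub> c \<odot>\<^bsub>V\<^esub> v"
          "h' \<in> H" "c' \<in> carrier K" "y = h' \<oplus>\<^bsub>V\<^esub> c' \<odot>\<^bsub>V\<^esub> v" by (blast dest: XE)
        have "x \<oplus>\<^bsub>V\<^esub> y = (h \<oplus>\<^bsub>V\<^esub> h') \<oplus>\<^bsub>V\<^esub> (c \<oplus>\<^bsub>K\<^esub> c') \<odot>\<^bsub>V\<^esub> v"
          using * v Hc by (simp add: V.smult_l_distr V.M.a_ac)
        then show "x \<oplus>\<^bsub>V\<^esub> y \<in> X"
          using XI[of "h \<oplus>\<^bsub>V\<^esub> h'" "c \<oplus>\<^bsub>K\<^esub> c'"] * V.submodule_add[OF H(1)] by simp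
      next
        fix a x assume a: "a \<in> carrier K" and "x \<in> X"
        then obtain h c where *: "h \<in> H" "c \<in> carrier K" "x = h \<oplus>\<^bsub>V\<^esub> c \<odot>\<^bsub>V\<^esub> v" by (blast dest: XE)
        have "a \<odot>\<^bsub>V\<^esub> x = a \<odot>\<^bsub>V\<^esub> h \<oplus>\<^bsub>V\<^esub> (a \<otimes>\<^bsub>K\<^esub> c) \<odot>\<^bsub>V\<^esub> v"
          using * v Hc a by (simp add: V.smult_r_distr V.smult_assoc1)
        then show "a \<odot>\<^bsub>V\<^esub> x \<in> X"
          using XI[of "a \<odot>\<^bsub>V\<^esub> h" "a \<otimes>\<^bsub>K\<^esub> c"] * a V.submodule_smult[OF H(1)] by simp
      qed
      have "x = \<zero>\<^bsub>V\<^esub>" if "x \<in> X" "x \<in> S" for x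
      proof -
        obtain h c where *: "h \<in> H" "c \<in> carrier K" "x = h \<oplus>\<^bsub>V\<^esub> c \<odot>\<^bsub>V\<^esub> v" using XE \<open>x \<in> X\<close> by blast
        show ?thesis
        proof (cases "c = \<zero>\<^bsub>K\<^esub>")
          case True
          then have "x = h" using * v Hc by simp
          then show ?thesis using H(2) * \<open>x \<in> S\<close> by blast
        next
          case False
          then have c: "inv\<^bsub>K\<^esub> c \<in> carrier K" "inv\<^bsub>K\<^esub> c \<otimes>\<^bsub>K\<^esub> c = \<one>\<^bsub>K\<^esub>"
            using *(2) K.field_Units by auto
          \<comment> \<open>Division by \<open>c\<close> splits \<open>v\<close> into an element of
            \<open>S\<close> and one of \<open>H\<close>, which \<open>neg\<close> excludes.\<close>
          have "inv\<^bsub>K\<^esub> c \<odot>\<^bsub>V\<^esub> x = inv\<^bsub>K\<^esub> c \<odot>\<^bsub>V\<^esub> h \<oplus>\<^bsub>V\<^esub> (inv\<^bsub>K\<^esub> c \<otimes>\<^bsub>K\<^esub> c) \<odot>\<^bsub>V\<^esub> v"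
            using * v Hc c(1) by (simp add: V.smult_r_distr V.smult_assoc1)
          then have "inv\<^bsub>K\<^esub> c \<odot>\<^bsub>V\<^esub> x = inv\<^bsub>K\<^esub> c \<odot>\<^bsub>V\<^esub> h \<oplus>\<^bsub>V\<^esub> v" using c(2) v by simp
          then have "v \<ominus>\<^bsub>V\<^esub> inv\<^bsub>K\<^esub> c \<odot>\<^bsub>V\<^esub> x = \<ominus>\<^bsub>V\<^esub> (inv\<^bsub>K\<^esub> c \<odot>\<^bsub>V\<^esub> h)"
            using v Hc *(1) c(1) by (simp add: a_minus_def V.M.minus_add V.M.a_ac V.M.r_neg2 V.M.r_neg V.M.r_neg1)
          also have "\<dots> \<in> H"
            using V.submodule_smult[OF H(1), of "\<ominus>\<^bsub>K\<^esub> \<one>\<^bsub>K\<^esub>" "inv\<^bsub>K\<^esub> c \<odot>\<^bsub>V\<^esub> h"]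
              V.submodule_smult[OF H(1) c(1) *(1)] Hc *(1) c(1) by (simp add: V.smult_minus_one)
          finally have False using neg V.submodule_smult[OF S c(1) \<open>x \<in> S\<close>] by blast
          then show ?thesis ..
        qed
      qed
      moreover have "\<zero>\<^bsub>V\<^esub> \<in> X" using \<open>submodule X K V\<close> by (rule V.submodule_zero)
      ultimately show "X \<inter> S = {\<zero>\<^bsub>V\<^esub>}" using V.submodule_zero[OF S] by blast
    qed
    then have "v \<in> H"
      using XI[of "\<zero>\<^bsub>V\<^esub>" "\<one>\<^bsub>K\<^esub>"] v V.submodule_zero[OF H(1)] by simp
    then have "v \<ominus>\<^bsub>V\<^esub> \<zero>\<^bsub>V\<^esub> \<in> H" using v by (simp add: a_minus_def V.diff_zero)
    then show False using neg V.submodule_zero[OF S] by blast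
  qed
  define p where "p v = (SOME s. s \<in> S \<and> v \<ominus>\<^bsub>V\<^esub> s \<in> H)" for v
  have p: "p v \<in> S" "v \<ominus>\<^bsub>V\<^esub> p v \<in> H" if "v \<in> carrier V" for v
    using someI_ex[of "\<lambda>s. s \<in> S \<and> v \<ominus>\<^bsub>V\<^esub> s \<in> H"] sum[OF that] by (auto simp: p_def)
  have p_eq: "p v = s" if v: "v \<in> carrier V" and s: "s \<in> S" "v \<ominus>\<^bsub>V\<^esub> s \<in> H" for v s
  proof -
    \<comment> \<open>Two decompositions of \<open>v\<close> differ by an element of both
      \<open>S\<close> and \<open>H\<close>. This uniqueness makes the chosen \<open>p\<close>
      linear.\<close>
    have "(v \<ominus>\<^bsub>V\<^esub> s) \<ominus>\<^bsub>V\<^esub> (v \<ominus>\<^bsub>V\<^esub> p v) = p v \<ominus>\<^bsub>V\<^esub> s"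
      using v Sc[OF s(1)] Sc[OF p(1)[OF v]] by (rule V.diff_diff)
    then have "p v \<ominus>\<^bsub>V\<^esub> s \<in> H" using V.submodule_diff[OF H(1) s(2) p(2)[OF v]] by simp
    moreover have "p v \<ominus>\<^bsub>V\<^esub> s \<in> S" using V.submodule_diff[OF S p(1)[OF v] s(1)] .
    ultimately have "p v \<ominus>\<^bsub>V\<^esub> s = \<zero>\<^bsub>V\<^esub>" using H(2) by blast
    then show ?thesis using V.diff_eq_zero_iff[OF Sc[OF p(1)[OF v]] Sc[OF s(1)]] by simp
  qed
  show thesis
  proof
    show "p x \<in> S" if "x \<in> carrier V" for x using p that by blast
    show "p x = x" if "x \<in> S" for x
      using p_eq[OF Sc[OF that] that] V.submodule_zero[OF H(1)] V.diff_eq_zero_iff[of x x] Sc[OF that] by simp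
    show "is_hom K V V p"
    proof (rule is_homI)
      show "p x \<in> carrier V" if "x \<in> carrier V" for x using p Sc that by blast
      show "p (x \<oplus>\<^bsub>V\<^esub> y) = p x \<oplus>\<^bsub>V\<^esub> p y" if "x \<in> carrier V" "y \<in> carrier V" for x y
      proof (rule p_eq)
        show "(x \<oplus>\<^bsub>V\<^esub> y) \<ominus>\<^bsub>V\<^esub> (p x \<oplus>\<^bsub>V\<^esub> p y) \<in> H"
          using that p Sc V.submodule_add[OF H(1)] by (simp add: V.add_diff_add)
      qed (use that p V.submodule_add[OF S] in auto)
      show "p (a \<odot>\<^bsub>V\<^esub> x) = a \<odot>\<^bsub>V\<^esub> p x" if "a \<in> carrier K" "x \<in> carrier V" for a x
      proof (rule p_eq)
        show "a \<odot>\<^bsub>V\<^esub> x \<ominus>\<^bsub>V\<^esub> a \<odot>\<^bsub>V\<^esub> p x \<in> H"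
          using that p Sc V.submodule_smult[OF H(1)] by (simp flip: V.smult_diff)
      qed (use that p V.submodule_smult[OF S] in auto)
    qed
  qed
qed

lemma extend_linear:
  assumes V: "left_module K V" and S: "submodule S K V" and f: "is_hom K (V\<lparr>carrier := S\<rparr>) N f"
  obtains g where "is_hom K V N g" "\<And>x. x \<in> S \<Longrightarrow> g x = f x"
proof -
  obtain p where p: "is_hom K V V p" "\<And>x. x \<in> carrier V \<Longrightarrow> p x \<in> S" "\<And>x. x \<in> S \<Longrightarrow> p x = x"
    using complement_projection[OF V S] by blast
  show thesis
  proof
    show "is_hom K V N (\<lambda>x. f (p x))"
      by (rule is_hom_comp[OF is_hom_restrict_carrier[OF p(1,2)] f])
  qed (simp add: p)
qed

lemma functional_separates:
  assumes V: "left_module K V" and v: "v \<in> carrier V" "v \<noteq> \<zero>\<^bsub>V\<^esub>"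
  obtains g where "is_hom K V (regular K) g" "g v = \<one>\<^bsub>K\<^esub>"
proof -
  interpret V: left_module K V by (rule V)
  let ?S = "{c \<odot>\<^bsub>V\<^esub> v | c. c \<in> carrier K}"
  have S: "submodule ?S K V"
  proof (rule V.submoduleI)
    show "\<zero>\<^bsub>V\<^esub> \<in> ?S" using V.smult_l_null[OF v(1)] K.zero_closed by force
    show "x \<oplus>\<^bsub>V\<^esub> y \<in> ?S" if "x \<in> ?S" "y \<in> ?S" for x y
      using that v(1) V.smult_l_distr K.a_closed by (smt (verit, ccfv_threshold) mem_Collect_eq)
    show "a \<odot>\<^bsub>V\<^esub> x \<in> ?S" if "a \<in> carrier K" "x \<in> ?S" for a x
      using that v(1) V.smult_assoc1 K.m_closed by (smt (verit, ccfv_threshold) mem_Collect_eq)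
  qed (use v in auto)
  have uniq: "c = c'" if "c \<in> carrier K" "c' \<in> carrier K" "c \<odot>\<^bsub>V\<^esub> v = c' \<odot>\<^bsub>V\<^esub> v" for c c'
  proof (rule ccontr)
    assume "c \<noteq> c'"
    define d where "d = c \<oplus>\<^bsub>K\<^esub> (\<ominus>\<^bsub>K\<^esub> \<one>\<^bsub>K\<^esub>) \<otimes>\<^bsub>K\<^esub> c'"
    have "d \<odot>\<^bsub>V\<^esub> v = c \<odot>\<^bsub>V\<^esub> v \<ominus>\<^bsub>V\<^esub> c' \<odot>\<^bsub>V\<^esub> v"
      using that(1,2) v(1) by (simp add: d_def V.smult_l_distr V.smult_assoc1 V.smult_minus_one a_minus_def)
    then have d0: "d \<odot>\<^bsub>V\<^esub> v = \<zero>\<^bsub>V\<^esub>" using that v(1) V.diff_eq_zero_iff by simp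
    have "d \<in> carrier K" "d \<noteq> \<zero>\<^bsub>K\<^esub>" using that(1,2) \<open>c \<noteq> c'\<close> K.minus_equality[of c "\<ominus>\<^bsub>K\<^esub> c'"]
      by (auto simp: d_def K.l_minus)
    then have "inv\<^bsub>K\<^esub> d \<in> carrier K" "inv\<^bsub>K\<^esub> d \<otimes>\<^bsub>K\<^esub> d = \<one>\<^bsub>K\<^esub>" "d \<in> carrier K"
      using K.field_Units by auto
    then have "v = \<zero>\<^bsub>V\<^esub>" using d0 V.smult_assoc1[of "inv\<^bsub>K\<^esub> d" d v] v(1) by simp
    then show False using v(2) by simp
  qed
  define f where "f x = (THE c. c \<in> carrier K \<and> x = c \<odot>\<^bsub>V\<^esub> v)" for x
  have f: "f (c \<odot>\<^bsub>V\<^esub> v) = c" if "c \<in> carrier K" for c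
    unfolding f_def using that uniq by (intro the_equality) auto
  have "is_hom K (V\<lparr>carrier := ?S\<rparr>) (regular K) f"
    by (rule is_homI) (auto simp: f v(1) simp flip: V.smult_l_distr V.smult_assoc1)
  then obtain g where g: "is_hom K V (regular K) g" "\<And>x. x \<in> ?S \<Longrightarrow> g x = f x"
    using extend_linear[OF V S] by blast
  have "v \<in> ?S" using V.smult_one[OF v(1)] K.one_closed by force
  then have "g v = \<one>\<^bsub>K\<^esub>" using g(2) f[OF K.one_closed] v(1) by simp
  then show thesis using g(1) that by blast
qed

end

section \<open>Dual spaces and finite dimension\<close>

definition lin_dual :: "'k ring \<Rightarrow> ('k, 'v) module \<Rightarrow> ('k, 'v \<Rightarrow> 'k) module"
  where "lin_dual K V =
    mk_module (Hom_set K V (regular K)) (\<lambda>x\<in>carrier V. \<zero>\<^bsub>K\<^esub>)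
      (\<lambda>f g. \<lambda>x\<in>carrier V. f x \<oplus>\<^bsub>K\<^esub> g x) (\<lambda>c f. \<lambda>x\<in>carrier V. c \<otimes>\<^bsub>K\<^esub> f x)"

text \<open>Finite dimensionality of \<open>V\<close>, expressed by the existence of an injective linear map from
  \<open>V\<close> to \<open>K\<close>-tuples.  In this form it passes to subspaces and spaces of homomorphisms at once.\<close>

definition fin_dim :: "'k ring \<Rightarrow> ('k, 'v) module \<Rightarrow> bool"
  where "fin_dim K V \<longleftrightarrow> (\<exists>F. finite F \<and> (\<forall>f\<in>F. is_hom K V (regular K) f) \<and>
    (\<forall>v\<in>carrier V. (\<forall>f\<in>F. f v = \<zero>\<^bsub>K\<^esub>) \<longrightarrow> v = \<zero>\<^bsub>V\<^esub>))"

lemma lin_dual_simps [simp]: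
  "carrier (lin_dual K V) = Hom_set K V (regular K)"
  "\<zero>\<^bsub>lin_dual K V\<^esub> = (\<lambda>x\<in>carrier V. \<zero>\<^bsub>K\<^esub>)"
  "f \<oplus>\<^bsub>lin_dual K V\<^esub> g = (\<lambda>x\<in>carrier V. f x \<oplus>\<^bsub>K\<^esub> g x)"
  "c \<odot>\<^bsub>lin_dual K V\<^esub> f = (\<lambda>x\<in>carrier V. c \<otimes>\<^bsub>K\<^esub> f x)"
  by (simp_all add: lin_dual_def)

lemma fin_dim_injective:
  assumes "is_hom K V V' h" "\<And>v. \<lbrakk>v \<in> carrier V; h v = \<zero>\<^bsub>V'\<^esub>\<rbrakk> \<Longrightarrow> v = \<zero>\<^bsub>V\<^esub>" "fin_dim K V'"
  shows "fin_dim K V"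
proof -
  obtain F where F: "finite F" "\<forall>f\<in>F. is_hom K V' (regular K) f"
    "\<forall>v\<in>carrier V'. (\<forall>f\<in>F. f v = \<zero>\<^bsub>K\<^esub>) \<longrightarrow> v = \<zero>\<^bsub>V'\<^esub>"
    using assms(3) by (auto simp: fin_dim_def)
  have "\<forall>f\<in>(\<lambda>f x. f (h x)) ` F. is_hom K V (regular K) f"
    using F(2) is_hom_comp[OF assms(1)] by blast
  moreover have "v = \<zero>\<^bsub>V\<^esub>" if "v \<in> carrier V" "\<forall>f\<in>(\<lambda>f x. f (h x)) ` F. f v = \<zero>\<^bsub>K\<^esub>" for v
    using that F(3) assms(2) is_hom_closed[OF assms(1)] by auto
  ultimately show ?thesis
    unfolding fin_dim_def by (intro exI[of _ "(\<lambda>f x. f (h x)) ` F"] conjI finite_imageI F(1) ballI impI)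
      auto
qed

lemma finsum_delta:
  assumes "ring K" "finite F" "f \<in> F" "\<And>g. g \<in> F \<Longrightarrow> u g \<in> carrier K"
  shows "(\<Oplus>\<^bsub>K\<^esub> g\<in>F. u g \<otimes>\<^bsub>K\<^esub> (if f = g then \<one>\<^bsub>K\<^esub> else \<zero>\<^bsub>K\<^esub>)) = u f"
proof -
  interpret K: ring K by fact
  have "(\<Oplus>\<^bsub>K\<^esub> g\<in>F. u g \<otimes>\<^bsub>K\<^esub> (if f = g then \<one>\<^bsub>K\<^esub> else \<zero>\<^bsub>K\<^esub>)) = (\<Oplus>\<^bsub>K\<^esub> g\<in>F. if f = g then u g else \<zero>\<^bsub>K\<^esub>)"
    by (rule K.finsum_cong') (use assms(4) in \<open>auto simp: Pi_iff\<close>)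
  also have "\<dots> = u f"
    by (rule K.finsum_singleton) (use assms in auto)
  finally show ?thesis .
qed

lemma finsum_regular: "(\<Oplus>\<^bsub>regular K\<^esub> i\<in>I. u i) = (\<Oplus>\<^bsub>K\<^esub> i\<in>I. u i)"
  by (simp add: finsum_def finprod_def regular_def mk_module_def)

lemma regular_minus: "x \<ominus>\<^bsub>regular R\<^esub> y = x \<ominus>\<^bsub>R\<^esub> y"
  by (simp add: a_minus_def a_inv_def m_inv_def)

context
  fixes K :: "'k ring"
  assumes K: "field K"
begin

interpretation K: field K by (rule K)

lemma left_module_regular_field: "left_module K (regular K)"
  by (rule left_module_regular) (rule K.ring_axioms)

lemma left_module_lin_dual: "left_module K V \<Longrightarrow> left_module K (lin_dual K V)"
proof -
  assume V: "left_module K V"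
  have hom: "is_hom K V (regular K) (\<lambda>x. a \<otimes>\<^bsub>K\<^esub> f x)" if "a \<in> carrier K" "f \<in> Hom_set K V (regular K)" for a f
    using that by (auto simp: Hom_set_def is_hom_def Pi_iff K.r_distr K.m_lcomm)
  have "left_module K (mk_module (Hom_set K V (regular K)) (\<lambda>x\<in>carrier V. \<zero>\<^bsub>regular K\<^esub>)
    (\<lambda>f g. \<lambda>x\<in>carrier V. f x \<oplus>\<^bsub>regular K\<^esub> g x) (\<lambda>c f. \<lambda>x\<in>carrier V. c \<otimes>\<^bsub>K\<^esub> f x))"
  proof (rule left_module_Hom_set[OF V left_module_regular_field K.ring_axioms hom])
  qed (use Hom_set_closed[of _ K V "regular K"] in \<open>auto simp: K.l_distr K.r_distr K.m_assoc\<close>)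
  then show ?thesis by (simp add: lin_dual_def)
qed

text \<open>Gaussian elimination by induction on \<open>F\<close>. A new functional that vanishes on
  the common zeros of the chosen ones is dropped. Otherwise it is nonzero at such a zero
  \<open>v\<close>; a multiple of \<open>v\<close> becomes its dual vector, and the earlier dual
  vectors are corrected.\<close>

lemma biorthogonal_family:
  assumes V: "left_module K V" and "finite F" "\<forall>f\<in>F. is_hom K V (regular K) f"
  shows "\<exists>F0 b. F0 \<subseteq> F \<and> (\<forall>f\<in>F0. b f \<in> carrier V) \<and>
    (\<forall>f\<in>F0. \<forall>g\<in>F0. f (b g) = (if f = g then \<one>\<^bsub>K\<^esub> else \<zero>\<^bsub>K\<^esub>)) \<and>
    (\<forall>v\<in>carrier V. (\<forall>f\<in>F0. f v = \<zero>\<^bsub>K\<^esub>) \<longrightarrow> (\<forall>f\<in>F. f v = \<zero>\<^bsub>K\<^esub>))"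
  using assms(2,3)
proof (induction F)
  case empty
  then show ?case by blast
next
  case (insert f F)
  interpret V: left_module K V by (rule V)
  obtain F0 b where F0: "F0 \<subseteq> F" and b: "\<forall>f\<in>F0. b f \<in> carrier V"
    and d: "\<forall>f\<in>F0. \<forall>g\<in>F0. f (b g) = (if f = g then \<one>\<^bsub>K\<^esub> else \<zero>\<^bsub>K\<^esub>)"
    and z: "\<forall>v\<in>carrier V. (\<forall>f\<in>F0. f v = \<zero>\<^bsub>K\<^esub>) \<longrightarrow> (\<forall>f\<in>F. f v = \<zero>\<^bsub>K\<^esub>)"
    using insert.IH insert.prems by auto
  show ?case
  proof (cases "\<forall>v\<in>carrier V. (\<forall>g\<in>F0. g v = \<zero>\<^bsub>K\<^esub>) \<longrightarrow> f v = \<zero>\<^bsub>K\<^esub>")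
    case True
    then show ?thesis
      using F0 b d z by (intro exI[of _ F0] exI[of _ b]) auto
  next
    case False
    then obtain v where v: "v \<in> carrier V" "\<forall>g\<in>F0. g v = \<zero>\<^bsub>K\<^esub>" "f v \<noteq> \<zero>\<^bsub>K\<^esub>" by blast
    have f: "is_hom K V (regular K) f" and hom: "\<And>g. g \<in> F0 \<Longrightarrow> is_hom K V (regular K) g"
      using insert.prems F0 by auto
    have fv: "f v \<in> carrier K" using is_hom_closed[OF f v(1)] by simp
    have i: "inv\<^bsub>K\<^esub> f v \<in> carrier K" "inv\<^bsub>K\<^esub> f v \<otimes>\<^bsub>K\<^esub> f v = \<one>\<^bsub>K\<^esub>"
      using fv v(3) K.field_Units by auto
    define w where "w = inv\<^bsub>K\<^esub> f v \<odot>\<^bsub>V\<^esub> v"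
    have w: "w \<in> carrier V" "f w = \<one>\<^bsub>K\<^esub>"
      using i v(1,2) is_hom_smult[OF f i(1) v(1)] by (auto simp: w_def)
    have w0: "g w = \<zero>\<^bsub>K\<^esub>" if "g \<in> F0" for g
      using i v(2) that is_hom_smult[OF hom[OF that] i(1) v(1)] by (auto simp: w_def)
    \<comment> \<open>The correction makes \<open>f\<close> vanish at the old dual vectors and
      leaves the values of the functionals in \<open>F0\<close> unchanged, since these vanish at
      \<open>w\<close>.\<close>
    define b' where "b' g = (if g = f then w else b g \<ominus>\<^bsub>V\<^esub> f (b g) \<odot>\<^bsub>V\<^esub> w)" for g
    have fF: "f \<notin> F0" using insert.hyps F0 by blast
    have fb: "f (b g) \<in> carrier K" "b g \<in> carrier V" if "g \<in> F0" for g
      using that b is_hom_closed[OF f] by auto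
    have hb: "h (b' g) = h (b g) \<ominus>\<^bsub>K\<^esub> f (b g) \<otimes>\<^bsub>K\<^esub> h w" "h w \<in> carrier K" "h (b g) \<in> carrier K"
      if "g \<in> F0" "is_hom K V (regular K) h" for g h
      using that fF fb[OF that(1)] w(1) is_hom_diff[OF V left_module_regular_field that(2)] is_hom_smult[OF that(2)]
        is_hom_closed[OF that(2)] regular_minus[of K]
      by (auto simp: b'_def)
    show ?thesis
    proof (intro exI[of _ "insert f F0"] exI[of _ b'] conjI ballI impI)
      show "insert f F0 \<subseteq> insert f F" using F0 by blast
      show "b' g \<in> carrier V" if "g \<in> insert f F0" for g
        using that fb w(1) by (auto simp: b'_def)
      show "h (b' g) = (if h = g then \<one>\<^bsub>K\<^esub> else \<zero>\<^bsub>K\<^esub>)" if "h \<in> insert f F0" "g \<in> insert f F0" for h g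
      proof (cases "g = f")
        case True
        then show ?thesis using that w w0 fF by (auto simp: b'_def)
      next
        case False
        then have g: "g \<in> F0" using that by simp
        show ?thesis
        proof (cases "h = f")
          case True
          then show ?thesis using hb[OF g f] fb[OF g] w(2) False by (simp add: a_minus_def K.r_neg)
        next
          case hf: False
          then have h: "h \<in> F0" using that by simp
          then show ?thesis using hb(1,3)[OF g hom[OF h]] d g w0[OF h] fb[OF g]
            by (simp add: a_minus_def)
        qed
      qed
      show "h u = \<zero>\<^bsub>K\<^esub>" if "u \<in> carrier V" "\<forall>h\<in>insert f F0. h u = \<zero>\<^bsub>K\<^esub>" "h \<in> insert f F" for u h
        using that z by blast
    qed
  qed
qed

text \<open>From the separating functionals of \<open>fin_dim\<close> one gets a basis
  \<open>b\<close> indexed by its own coordinate functionals. The biorthogonal subfamily still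
  separates points, which yields the expansion of each vector.\<close>

lemma fin_dim_basis:
  assumes V: "left_module K V" and fin: "fin_dim K V"
  obtains F b where "finite F" "\<And>f. f \<in> F \<Longrightarrow> is_hom K V (regular K) f"
    "\<And>f. f \<in> F \<Longrightarrow> b f \<in> carrier V"
    "\<And>f g. \<lbrakk>f \<in> F; g \<in> F\<rbrakk> \<Longrightarrow> f (b g) = (if f = g then \<one>\<^bsub>K\<^esub> else \<zero>\<^bsub>K\<^esub>)"
    "\<And>v. \<lbrakk>v \<in> carrier V; \<And>f. f \<in> F \<Longrightarrow> f v = \<zero>\<^bsub>K\<^esub>\<rbrakk> \<Longrightarrow> v = \<zero>\<^bsub>V\<^esub>"
    "\<And>v. v \<in> carrier V \<Longrightarrow> v = (\<Oplus>\<^bsub>V\<^esub> f\<in>F. f v \<odot>\<^bsub>V\<^esub> b f)"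
proof -
  interpret V: left_module K V by (rule V)
  obtain F where F: "finite F" "\<forall>f\<in>F. is_hom K V (regular K) f"
    "\<forall>v\<in>carrier V. (\<forall>f\<in>F. f v = \<zero>\<^bsub>K\<^esub>) \<longrightarrow> v = \<zero>\<^bsub>V\<^esub>"
    using fin by (auto simp: fin_dim_def)
  obtain F0 b where F0: "F0 \<subseteq> F" and b: "\<forall>f\<in>F0. b f \<in> carrier V"
    and d: "\<forall>f\<in>F0. \<forall>g\<in>F0. f (b g) = (if f = g then \<one>\<^bsub>K\<^esub> else \<zero>\<^bsub>K\<^esub>)"
    and z: "\<forall>v\<in>carrier V. (\<forall>f\<in>F0. f v = \<zero>\<^bsub>K\<^esub>) \<longrightarrow> (\<forall>f\<in>F. f v = \<zero>\<^bsub>K\<^esub>)"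
    using biorthogonal_family[OF V F(1,2)] by blast
  have fin0: "finite F0" using F0 F(1) finite_subset by blast
  have hom: "is_hom K V (regular K) f" if "f \<in> F0" for f using that F0 F(2) by blast
  have z0: "v = \<zero>\<^bsub>V\<^esub>" if "v \<in> carrier V" "\<And>f. f \<in> F0 \<Longrightarrow> f v = \<zero>\<^bsub>K\<^esub>" for v
    using that z F(3) by blast
  have exp: "v = (\<Oplus>\<^bsub>V\<^esub> f\<in>F0. f v \<odot>\<^bsub>V\<^esub> b f)" if v: "v \<in> carrier V" for v
  proof -
    let ?w = "\<Oplus>\<^bsub>V\<^esub> f\<in>F0. f v \<odot>\<^bsub>V\<^esub> b f"
    have c: "f v \<in> carrier K" if "f \<in> F0" for f using is_hom_closed[OF hom[OF that] v] by simp
    have cb: "f v \<odot>\<^bsub>V\<^esub> b f \<in> carrier V" if "f \<in> F0" for f using c that b by auto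
    have w: "?w \<in> carrier V" by (rule V.M.finsum_closed) (use cb in auto)
    \<comment> \<open>The vector and its proposed expansion have the same coordinates, so their
      difference is killed by all of \<open>F0\<close>.\<close>
    have "f (v \<ominus>\<^bsub>V\<^esub> ?w) = \<zero>\<^bsub>K\<^esub>" if f: "f \<in> F0" for f
    proof -
      have "f ?w = (\<Oplus>\<^bsub>regular K\<^esub> g\<in>F0. f (g v \<odot>\<^bsub>V\<^esub> b g))"
        by (rule is_hom_finsum[OF V left_module_regular_field hom[OF f] cb])
      also have "\<dots> = (\<Oplus>\<^bsub>K\<^esub> g\<in>F0. f (g v \<odot>\<^bsub>V\<^esub> b g))"
        by (simp add: finsum_def finprod_def regular_def mk_module_def)
      also have "\<dots> = (\<Oplus>\<^bsub>K\<^esub> g\<in>F0. g v \<otimes>\<^bsub>K\<^esub> (if f = g then \<one>\<^bsub>K\<^esub> else \<zero>\<^bsub>K\<^esub>))"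
      proof (rule K.finsum_cong')
        show "f (g v \<odot>\<^bsub>V\<^esub> b g) = g v \<otimes>\<^bsub>K\<^esub> (if f = g then \<one>\<^bsub>K\<^esub> else \<zero>\<^bsub>K\<^esub>)" if "g \<in> F0" for g
          using is_hom_smult[OF hom[OF f] c[OF that], of "b g"] b d f that by simp
      qed (use c in auto)
      also have "\<dots> = f v" by (rule finsum_delta) (use fin0 f c K.ring_axioms in auto)
      finally have "f ?w = f v" .
      then have "f (v \<ominus>\<^bsub>V\<^esub> ?w) = f v \<ominus>\<^bsub>regular K\<^esub> f v"
        using is_hom_diff[OF V left_module_regular_field hom[OF f] v w] by simp
      also have "\<dots> = \<zero>\<^bsub>K\<^esub>" using left_module.diff_eq_zero_iff[OF left_module_regular_field] c[OF f] by simp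
      finally show ?thesis .
    qed
    then have "v \<ominus>\<^bsub>V\<^esub> ?w = \<zero>\<^bsub>V\<^esub>" using z0 v w by simp
    then show ?thesis using V.diff_eq_zero_iff[OF v w] by simp
  qed
  show thesis
    by (rule that[of F0 b]) (use fin0 hom b d z0 exp in auto)
qed

text \<open>The basis \<open>b\<close> is sent to its dual basis: \<open>h (b g)\<close> is
  \<open>g\<close>. Since \<open>h v\<close> takes the value \<open>g v\<close> at
  \<open>b g\<close>, the coordinates of \<open>v\<close> can be read off from
  \<open>h v\<close>.\<close>

lemma fin_dim_iso_dual:
  assumes V: "left_module K V" and fin: "fin_dim K V"
  shows "mod_iso K V (lin_dual K V)"
proof -
  interpret V: left_module K V by (rule V)
  obtain F b where F: "finite F" "\<And>f. f \<in> F \<Longrightarrow> is_hom K V (regular K) f"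
    "\<And>f. f \<in> F \<Longrightarrow> b f \<in> carrier V"
    "\<And>f g. \<lbrakk>f \<in> F; g \<in> F\<rbrakk> \<Longrightarrow> f (b g) = (if f = g then \<one>\<^bsub>K\<^esub> else \<zero>\<^bsub>K\<^esub>)"
    "\<And>v. \<lbrakk>v \<in> carrier V; \<And>f. f \<in> F \<Longrightarrow> f v = \<zero>\<^bsub>K\<^esub>\<rbrakk> \<Longrightarrow> v = \<zero>\<^bsub>V\<^esub>"
    "\<And>v. v \<in> carrier V \<Longrightarrow> v = (\<Oplus>\<^bsub>V\<^esub> f\<in>F. f v \<odot>\<^bsub>V\<^esub> b f)"
    using fin_dim_basis[OF V fin] by blast
  have c: "f v \<in> carrier K" if "f \<in> F" "v \<in> carrier V" for f v
    using is_hom_closed[OF F(2)[OF that(1)] that(2)] by simp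
  define h where "h v = (\<lambda>x\<in>carrier V. \<Oplus>\<^bsub>K\<^esub> f\<in>F. f v \<otimes>\<^bsub>K\<^esub> f x)" for v
  have sum: "(\<Oplus>\<^bsub>K\<^esub> f\<in>F. f v \<otimes>\<^bsub>K\<^esub> f x) \<in> carrier K" if "v \<in> carrier V" "x \<in> carrier V" for v x
    by (rule K.finsum_closed) (use that c in auto)
  have h_hom: "is_hom K V (regular K) (\<lambda>x. \<Oplus>\<^bsub>K\<^esub> f\<in>F. f v \<otimes>\<^bsub>K\<^esub> f x)" if v: "v \<in> carrier V" for v
  proof (rule is_homI)
    fix x y assume x: "x \<in> carrier V" and y: "y \<in> carrier V"
    have "(\<Oplus>\<^bsub>K\<^esub> f\<in>F. f v \<otimes>\<^bsub>K\<^esub> f (x \<oplus>\<^bsub>V\<^esub> y)) = (\<Oplus>\<^bsub>K\<^esub> f\<in>F. f v \<otimes>\<^bsub>K\<^esub> f x \<oplus>\<^bsub>K\<^esub> f v \<otimes>\<^bsub>K\<^esub> f y)"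
    proof (rule K.finsum_cong')
      show "f v \<otimes>\<^bsub>K\<^esub> f (x \<oplus>\<^bsub>V\<^esub> y) = f v \<otimes>\<^bsub>K\<^esub> f x \<oplus>\<^bsub>K\<^esub> f v \<otimes>\<^bsub>K\<^esub> f y" if "f \<in> F" for f
        using is_hom_add[OF F(2)[OF that] x y] c[OF that] v x y by (simp add: K.r_distr)
    qed (use c v x y in auto)
    then show "(\<Oplus>\<^bsub>K\<^esub> f\<in>F. f v \<otimes>\<^bsub>K\<^esub> f (x \<oplus>\<^bsub>V\<^esub> y)) =
        (\<Oplus>\<^bsub>K\<^esub> f\<in>F. f v \<otimes>\<^bsub>K\<^esub> f x) \<oplus>\<^bsub>regular K\<^esub> (\<Oplus>\<^bsub>K\<^esub> f\<in>F. f v \<otimes>\<^bsub>K\<^esub> f y)"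
      using c v x y by (simp add: K.finsum_addf)
  next
    fix a x assume a: "a \<in> carrier K" and x: "x \<in> carrier V"
    have "(\<Oplus>\<^bsub>K\<^esub> f\<in>F. f v \<otimes>\<^bsub>K\<^esub> f (a \<odot>\<^bsub>V\<^esub> x)) = (\<Oplus>\<^bsub>K\<^esub> f\<in>F. a \<otimes>\<^bsub>K\<^esub> (f v \<otimes>\<^bsub>K\<^esub> f x))"
    proof (rule K.finsum_cong')
      show "f v \<otimes>\<^bsub>K\<^esub> f (a \<odot>\<^bsub>V\<^esub> x) = a \<otimes>\<^bsub>K\<^esub> (f v \<otimes>\<^bsub>K\<^esub> f x)" if "f \<in> F" for f
        using is_hom_smult[OF F(2)[OF that] a x] c[OF that] a v x by (simp add: K.m_lcomm)
    qed (use c v x a in auto)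
    then show "(\<Oplus>\<^bsub>K\<^esub> f\<in>F. f v \<otimes>\<^bsub>K\<^esub> f (a \<odot>\<^bsub>V\<^esub> x)) = a \<odot>\<^bsub>regular K\<^esub> (\<Oplus>\<^bsub>K\<^esub> f\<in>F. f v \<otimes>\<^bsub>K\<^esub> f x)"
      using smult_finsum[OF left_module_regular_field a, of F "\<lambda>f. f v \<otimes>\<^bsub>K\<^esub> f x"] c v x
      by (simp add: finsum_regular)
  qed (use sum v in auto)
  have hD: "h v \<in> carrier (lin_dual K V)" if "v \<in> carrier V" for v
    unfolding h_def lin_dual_simps by (rule Hom_setI[OF V h_hom[OF that]])
  have hom: "is_hom K V (lin_dual K V) h"
  proof (rule is_homI[OF hD])
    fix v w assume v: "v \<in> carrier V" and w: "w \<in> carrier V"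
    have "(\<Oplus>\<^bsub>K\<^esub> f\<in>F. f (v \<oplus>\<^bsub>V\<^esub> w) \<otimes>\<^bsub>K\<^esub> f x) = (\<Oplus>\<^bsub>K\<^esub> f\<in>F. f v \<otimes>\<^bsub>K\<^esub> f x) \<oplus>\<^bsub>K\<^esub> (\<Oplus>\<^bsub>K\<^esub> f\<in>F. f w \<otimes>\<^bsub>K\<^esub> f x)"
      if x: "x \<in> carrier V" for x
    proof -
      have "(\<Oplus>\<^bsub>K\<^esub> f\<in>F. f (v \<oplus>\<^bsub>V\<^esub> w) \<otimes>\<^bsub>K\<^esub> f x) = (\<Oplus>\<^bsub>K\<^esub> f\<in>F. f v \<otimes>\<^bsub>K\<^esub> f x \<oplus>\<^bsub>K\<^esub> f w \<otimes>\<^bsub>K\<^esub> f x)"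
      proof (rule K.finsum_cong')
        show "f (v \<oplus>\<^bsub>V\<^esub> w) \<otimes>\<^bsub>K\<^esub> f x = f v \<otimes>\<^bsub>K\<^esub> f x \<oplus>\<^bsub>K\<^esub> f w \<otimes>\<^bsub>K\<^esub> f x" if "f \<in> F" for f
          using is_hom_add[OF F(2)[OF that] v w] c[OF that] v x w by (simp add: K.l_distr)
      qed (use c v x w in auto)
      then show ?thesis using c v w x by (simp add: K.finsum_addf)
    qed
    then show "h (v \<oplus>\<^bsub>V\<^esub> w) = h v \<oplus>\<^bsub>lin_dual K V\<^esub> h w"
      by (auto simp: h_def intro!: restrict_ext)
  next
    fix a v assume a: "a \<in> carrier K" and v: "v \<in> carrier V"
    have "(\<Oplus>\<^bsub>K\<^esub> f\<in>F. f (a \<odot>\<^bsub>V\<^esub> v) \<otimes>\<^bsub>K\<^esub> f x) = a \<otimes>\<^bsub>K\<^esub> (\<Oplus>\<^bsub>K\<^esub> f\<in>F. f v \<otimes>\<^bsub>K\<^esub> f x)"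
      if x: "x \<in> carrier V" for x
    proof -
      have "(\<Oplus>\<^bsub>K\<^esub> f\<in>F. f (a \<odot>\<^bsub>V\<^esub> v) \<otimes>\<^bsub>K\<^esub> f x) = (\<Oplus>\<^bsub>K\<^esub> f\<in>F. a \<otimes>\<^bsub>K\<^esub> (f v \<otimes>\<^bsub>K\<^esub> f x))"
      proof (rule K.finsum_cong')
        show "f (a \<odot>\<^bsub>V\<^esub> v) \<otimes>\<^bsub>K\<^esub> f x = a \<otimes>\<^bsub>K\<^esub> (f v \<otimes>\<^bsub>K\<^esub> f x)" if "f \<in> F" for f
          using is_hom_smult[OF F(2)[OF that] a v] c[OF that] a v x by (simp add: K.m_assoc)
      qed (use c v x a in auto)
      then show ?thesis
        using smult_finsum[OF left_module_regular_field a, of F "\<lambda>f. f v \<otimes>\<^bsub>K\<^esub> f x"] c v x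
        by (simp add: finsum_regular)
    qed
    then show "h (a \<odot>\<^bsub>V\<^esub> v) = a \<odot>\<^bsub>lin_dual K V\<^esub> h v"
      by (auto simp: h_def intro!: restrict_ext)
  qed
  have h_b: "h v (b g) = g v" if v: "v \<in> carrier V" and g: "g \<in> F" for v g
  proof -
    have "(\<Oplus>\<^bsub>K\<^esub> f\<in>F. f v \<otimes>\<^bsub>K\<^esub> f (b g)) = (\<Oplus>\<^bsub>K\<^esub> f\<in>F. f v \<otimes>\<^bsub>K\<^esub> (if g = f then \<one>\<^bsub>K\<^esub> else \<zero>\<^bsub>K\<^esub>))"
    proof (rule K.finsum_cong')
      show "f v \<otimes>\<^bsub>K\<^esub> f (b g) = f v \<otimes>\<^bsub>K\<^esub> (if g = f then \<one>\<^bsub>K\<^esub> else \<zero>\<^bsub>K\<^esub>)" if "f \<in> F" for f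
        using F(4)[OF that g] by auto
    qed (use c v in auto)
    also have "\<dots> = g v" by (rule finsum_delta) (use F(1) g c v K.ring_axioms in auto)
    finally show ?thesis using F(3)[OF g] by (simp add: h_def)
  qed
  have "bij_betw h (carrier V) (carrier (lin_dual K V))"
  proof (intro bij_betw_imageI inj_onI)
    fix v w assume v: "v \<in> carrier V" and w: "w \<in> carrier V" and eq: "h v = h w"
    have "g (v \<ominus>\<^bsub>V\<^esub> w) = \<zero>\<^bsub>K\<^esub>" if g: "g \<in> F" for g
    proof -
      have "g v = g w" using h_b[OF v g] h_b[OF w g] eq by simp
      then show ?thesis
        using is_hom_diff[OF V left_module_regular_field F(2)[OF g] v w] c[OF g w]
          left_module.diff_eq_zero_iff[OF left_module_regular_field, of "g w" "g w"] by simp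
    qed
    then have "v \<ominus>\<^bsub>V\<^esub> w = \<zero>\<^bsub>V\<^esub>" using F(5) v w by simp
    then show "v = w" using V.diff_eq_zero_iff[OF v w] by simp
  next
    show "h ` carrier V = carrier (lin_dual K V)"
    proof (intro equalityI subsetI)
      fix G assume G: "G \<in> carrier (lin_dual K V)"
      then have GH: "G \<in> Hom_set K V (regular K)" by simp
      have Gc: "G x \<in> carrier K" if "x \<in> carrier V" for x using Hom_set_closed[OF GH that] by simp
      \<comment> \<open>A functional in the image of \<open>h\<close> must have the coordinates of
        its preimage as values on the basis, so these values are used as coordinates.\<close>
      define v where "v = (\<Oplus>\<^bsub>V\<^esub> f\<in>F. G (b f) \<odot>\<^bsub>V\<^esub> b f)"
      have cb: "G (b f) \<odot>\<^bsub>V\<^esub> b f \<in> carrier V" if "f \<in> F" for f using Gc F(3) that by simp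
      have v: "v \<in> carrier V" unfolding v_def by (rule V.M.finsum_closed) (use cb in auto)
      have gv: "g v = G (b g)" if g: "g \<in> F" for g
      proof -
        have "g v = (\<Oplus>\<^bsub>K\<^esub> f\<in>F. g (G (b f) \<odot>\<^bsub>V\<^esub> b f))"
          unfolding v_def using is_hom_finsum[OF V left_module_regular_field F(2)[OF g] cb, of F "\<lambda>x. x"]
          by (simp add: finsum_regular)
        also have "\<dots> = (\<Oplus>\<^bsub>K\<^esub> f\<in>F. G (b f) \<otimes>\<^bsub>K\<^esub> (if g = f then \<one>\<^bsub>K\<^esub> else \<zero>\<^bsub>K\<^esub>))"
        proof (rule K.finsum_cong')
          show "g (G (b f) \<odot>\<^bsub>V\<^esub> b f) = G (b f) \<otimes>\<^bsub>K\<^esub> (if g = f then \<one>\<^bsub>K\<^esub> else \<zero>\<^bsub>K\<^esub>)" if "f \<in> F" for f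
            using is_hom_smult[OF F(2)[OF g], of "G (b f)" "b f"] Gc F(3,4) g that by simp
        qed (use Gc F(3) in auto)
        also have "\<dots> = G (b g)" by (rule finsum_delta) (use F(1,3) g Gc K.ring_axioms in auto)
        finally show ?thesis .
      qed
      have "h v = G"
      proof (rule Hom_set_eqI[of _ K V "regular K"])
        fix x assume x: "x \<in> carrier V"
        have xb: "f x \<odot>\<^bsub>V\<^esub> b f \<in> carrier V" if "f \<in> F" for f using c x F(3) that by simp
        have "G x = G (\<Oplus>\<^bsub>V\<^esub> f\<in>F. f x \<odot>\<^bsub>V\<^esub> b f)" using F(6)[OF x] by simp
        also have "\<dots> = (\<Oplus>\<^bsub>K\<^esub> f\<in>F. G (f x \<odot>\<^bsub>V\<^esub> b f))"
          using is_hom_finsum[OF V left_module_regular_field Hom_set_hom[OF GH] xb, of F "\<lambda>x. x"]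
          by (simp add: finsum_regular)
        also have "\<dots> = (\<Oplus>\<^bsub>K\<^esub> f\<in>F. f v \<otimes>\<^bsub>K\<^esub> f x)"
        proof (rule K.finsum_cong')
          show "G (f x \<odot>\<^bsub>V\<^esub> b f) = f v \<otimes>\<^bsub>K\<^esub> f x" if "f \<in> F" for f
            using is_hom_smult[OF Hom_set_hom[OF GH], of "f x" "b f"] c[OF that x] F(3)[OF that] gv[OF that]
              Gc K.m_comm by simp
        qed (use c v x in auto)
        finally show "h v x = G x" using x by (simp add: h_def)
      qed (use hD[OF v] GH in auto)
      then show "G \<in> h ` carrier V" using v by blast
    qed (use hD in auto)
  qed
  then show ?thesis using hom by (auto simp: mod_iso_def)
qed

text \<open>A basis of the dual is a finite family of functionals on \<open>V\<close>. Where all of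
  them vanish, every functional does, and functionals separate points. In this way Tate homology
  becomes finite dimensional through its dual, and finitely generated modules through
  theirs.\<close>

lemma fin_dim_dual_imp_fin_dim:
  assumes V: "left_module K V" and fin: "fin_dim K (lin_dual K V)"
  shows "fin_dim K V"
proof -
  note D = left_module_lin_dual[OF V]
  interpret D: left_module K "lin_dual K V" by (rule D)
  obtain F b where F: "finite F" "\<And>f. f \<in> F \<Longrightarrow> is_hom K (lin_dual K V) (regular K) f"
    "\<And>f. f \<in> F \<Longrightarrow> b f \<in> carrier (lin_dual K V)"
    "\<And>G. G \<in> carrier (lin_dual K V) \<Longrightarrow> G = (\<Oplus>\<^bsub>lin_dual K V\<^esub> f\<in>F. f G \<odot>\<^bsub>lin_dual K V\<^esub> b f)"
    using fin_dim_basis[OF D fin] by (smt (verit))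
  show ?thesis
    unfolding fin_dim_def
  proof (intro exI[of _ "b ` F"] conjI ballI impI)
    show "is_hom K V (regular K) f" if f: "f \<in> b ` F" for f
    proof -
      obtain g where "g \<in> F" "f = b g" using f by blast
      then show ?thesis using Hom_set_hom[of f K V "regular K"] F(3)[of g] by simp
    qed
    fix v assume v: "v \<in> carrier V" and z: "\<forall>f\<in>b ` F. f v = \<zero>\<^bsub>K\<^esub>"
    have ev: "is_hom K (lin_dual K V) (regular K) (\<lambda>G. G v)"
      using v Hom_set_closed[of _ K V "regular K"] by (intro is_homI) auto
    have Gv: "G v = \<zero>\<^bsub>K\<^esub>" if G: "G \<in> carrier (lin_dual K V)" for G
    proof -
      have fb: "f G \<odot>\<^bsub>lin_dual K V\<^esub> b f \<in> carrier (lin_dual K V)" if "f \<in> F" for f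
        using D.smult_closed[of "f G" "b f"] F(3)[OF that] is_hom_closed[OF F(2)[OF that] G] by simp
      have "G v = (\<Oplus>\<^bsub>lin_dual K V\<^esub> f\<in>F. f G \<odot>\<^bsub>lin_dual K V\<^esub> b f) v"
        using F(4)[OF G] by simp
      also have "\<dots> = (\<Oplus>\<^bsub>regular K\<^esub> f\<in>F. (f G \<odot>\<^bsub>lin_dual K V\<^esub> b f) v)"
        by (rule is_hom_finsum[OF D left_module_regular_field ev fb])
      also have "\<dots> = (\<Oplus>\<^bsub>K\<^esub> f\<in>F. \<zero>\<^bsub>K\<^esub>)"
        unfolding finsum_regular
        by (rule K.finsum_cong') (use z v is_hom_closed[OF F(2) G] in auto)
      finally show ?thesis by simp
    qed
    show "v = \<zero>\<^bsub>V\<^esub>"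
    proof (rule ccontr)
      assume "v \<noteq> \<zero>\<^bsub>V\<^esub>"
      then obtain g where "is_hom K V (regular K) g" "g v = \<one>\<^bsub>K\<^esub>"
        using functional_separates[OF K V v] by blast
      then show False
        using Gv[of "restrict g (carrier V)"] Hom_setI[OF V, of "regular K" g] v K.zero_not_one by simp
    qed
  qed (use F(1) in auto)
qed

end

text \<open>Inverses in a record with a smaller carrier are given by a definite description over
  that carrier. They have to be identified with the inverses of \<open>M\<close> before the subgroup
  property carries over.\<close>

lemma (in left_module) submodule_restrict:
  assumes "submodule H R M" "H \<subseteq> C" "C \<subseteq> carrier M"
  shows "submodule H R (M\<lparr>carrier := C\<rparr>)"
proof -
  have "subgroup H (add_monoid (M\<lparr>carrier := C\<rparr>))"
  proof (rule subgroup.intro)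
    show "inv\<^bsub>add_monoid (M\<lparr>carrier := C\<rparr>)\<^esub> x \<in> H" if "x \<in> H" for x
    proof -
      have x: "x \<in> carrier M" "\<ominus>\<^bsub>M\<^esub> x \<in> H"
        using that assms submodule_smult[OF assms(1), of "\<ominus> \<one>" x] by (auto simp: smult_minus_one)
      have "inv\<^bsub>add_monoid (M\<lparr>carrier := C\<rparr>)\<^esub> x = \<ominus>\<^bsub>M\<^esub> x"
        unfolding m_inv_def
      proof (rule the_equality)
        fix y assume "y \<in> carrier (add_monoid (M\<lparr>carrier := C\<rparr>)) \<and>
          x \<otimes>\<^bsub>add_monoid (M\<lparr>carrier := C\<rparr>)\<^esub> y = \<one>\<^bsub>add_monoid (M\<lparr>carrier := C\<rparr>)\<^esub> \<and>
          y \<otimes>\<^bsub>add_monoid (M\<lparr>carrier := C\<rparr>)\<^esub> x = \<one>\<^bsub>add_monoid (M\<lparr>carrier := C\<rparr>)\<^esub>"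
        then show "y = \<ominus>\<^bsub>M\<^esub> x" using M.minus_equality[of y x] x(1) assms(3) by auto
      qed (use x assms in \<open>auto simp: M.l_neg M.r_neg\<close>)
      then show ?thesis using x by simp
    qed
  qed (use assms submodule_add submodule_zero in auto)
  then show ?thesis
    using submodule_smult[OF assms(1)] by (simp add: submodule_def submodule_axioms_def)
qed

section \<open>The homology of the dual complex\<close>

lemma lin_dual_precomp:
  assumes "left_module K A" "is_hom K A B h" "f \<in> carrier (lin_dual K B)"
  shows "(\<lambda>x\<in>carrier A. f (h x)) \<in> carrier (lin_dual K A)"
  using Hom_setI[OF assms(1) is_hom_comp[OF assms(2) Hom_set_hom[of f K B "regular K"]]] assms(3)
  by simp

text \<open>Dualising over a field is exact, so homology commutes with it up to reversal of arrows.
  The maps \<open>\<Theta>A\<close>, \<open>\<Theta>B\<close>, \<open>\<Theta>C\<close> allow any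
  model of the dual sequence: injectivity at \<open>A\<close> identifies the cycles at
  \<open>B'\<close>, and surjectivity at \<open>C\<close> the boundaries. In the application the
  model is \<open>Hom(T, D(N))\<close>.\<close>

lemma lin_dual_homology:
  fixes K :: "'k ring"
  assumes K: "field K"
    and A: "left_module K A" and B: "left_module K B" and C: "left_module K C"
    and A': "left_module K A'" and B': "left_module K B'" and C': "left_module K C'"
    and \<alpha>: "is_hom K A B \<alpha>" and \<beta>: "is_hom K B C \<beta>" and \<beta>\<alpha>: "\<And>x. x \<in> carrier A \<Longrightarrow> \<beta> (\<alpha> x) = \<zero>\<^bsub>C\<^esub>"
    and \<alpha>': "is_hom K B' A' \<alpha>'" and \<beta>': "is_hom K C' B' \<beta>'"
    and \<Theta>A: "is_hom K (lin_dual K A) A' \<Theta>A" "inj_on \<Theta>A (carrier (lin_dual K A))"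
    and \<Theta>B: "is_hom K (lin_dual K B) B' \<Theta>B" "bij_betw \<Theta>B (carrier (lin_dual K B)) (carrier B')"
    and \<Theta>C: "is_hom K (lin_dual K C) C' \<Theta>C" "carrier C' \<subseteq> \<Theta>C ` carrier (lin_dual K C)"
    and comm_\<alpha>: "\<And>f. f \<in> carrier (lin_dual K B) \<Longrightarrow> \<alpha>' (\<Theta>B f) = \<Theta>A (\<lambda>x\<in>carrier A. f (\<alpha> x))"
    and comm_\<beta>: "\<And>f. f \<in> carrier (lin_dual K C) \<Longrightarrow> \<beta>' (\<Theta>C f) = \<Theta>B (\<lambda>x\<in>carrier B. f (\<beta> x))"
  shows "mod_iso K (quotient_module (B'\<lparr>carrier := {y \<in> carrier B'. \<alpha>' y = \<zero>\<^bsub>A'\<^esub>}\<rparr>) (\<beta>' ` carrier C'))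
    (lin_dual K (quotient_module (B\<lparr>carrier := {x \<in> carrier B. \<beta> x = \<zero>\<^bsub>C\<^esub>}\<rparr>) (\<alpha> ` carrier A)))"
proof -
  interpret K: field K by (rule K)
  interpret A: left_module K A by (rule A)
  interpret B: left_module K B by (rule B)
  interpret C: left_module K C by (rule C)
  interpret B': left_module K B' by (rule B')
  note DA = left_module_lin_dual[OF K A] and DB = left_module_lin_dual[OF K B]
    and DC = left_module_lin_dual[OF K C]
  have KK: "left_module K (regular K)" by (rule left_module_regular_field[OF K])
  define Z where "Z = {x \<in> carrier B. \<beta> x = \<zero>\<^bsub>C\<^esub>}"
  define I where "I = \<alpha> ` carrier A"
  define Z' where "Z' = {y \<in> carrier B'. \<alpha>' y = \<zero>\<^bsub>A'\<^esub>}"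
  define I' where "I' = \<beta>' ` carrier C'"
  define BZ where "BZ = B\<lparr>carrier := Z\<rparr>"
  have Z: "submodule Z K B" unfolding Z_def by (rule submodule_kernel[OF B C \<beta>])
  have I: "submodule I K B" unfolding I_def by (rule submodule_image[OF A B \<alpha> A.submodule_carrier])
  have IZ: "I \<subseteq> Z" using \<beta>\<alpha> is_hom_closed[OF \<alpha>] by (auto simp: I_def Z_def)
  have ZB: "Z \<subseteq> carrier B" by (auto simp: Z_def)
  have BZ: "left_module K BZ" unfolding BZ_def by (rule B.left_module_restrict[OF Z])
  have BZc: "carrier BZ = Z" by (simp add: BZ_def)
  have IBZ: "submodule I K BZ" unfolding BZ_def by (rule B.submodule_restrict[OF I IZ ZB])
  let ?H = "quotient_module BZ I"
  have H: "left_module K ?H" by (rule left_module_quotient[OF BZ IBZ])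
  have DH: "left_module K (lin_dual K ?H)" by (rule left_module_lin_dual[OF K H])
  have Z': "submodule Z' K B'" unfolding Z'_def by (rule submodule_kernel[OF B' A' \<alpha>'])
  have I': "submodule I' K B'" unfolding I'_def
    by (rule submodule_image[OF C' B' \<beta>' left_module.submodule_carrier[OF C']])
  have zero_comp: "\<Theta>B (\<lambda>x\<in>carrier B. (\<lambda>x\<in>carrier C. \<zero>\<^bsub>K\<^esub>) (\<beta> x)) = \<zero>\<^bsub>B'\<^esub>"
  proof -
    have "(\<lambda>x\<in>carrier B. (\<lambda>x\<in>carrier C. \<zero>\<^bsub>K\<^esub>) (\<beta> x)) = \<zero>\<^bsub>lin_dual K B\<^esub>"
      using is_hom_closed[OF \<beta>] by (auto intro!: restrict_ext)
    then show ?thesis using is_hom_zero[OF DB B' \<Theta>B(1)] by simp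
  qed
  have \<Theta>B_inj: "f = g" if "f \<in> carrier (lin_dual K B)" "g \<in> carrier (lin_dual K B)" "\<Theta>B f = \<Theta>B g" for f g
    using that \<Theta>B(2) by (auto simp: bij_betw_def inj_on_def)
  have ker_iff: "\<alpha>' (\<Theta>B f) = \<zero>\<^bsub>A'\<^esub> \<longleftrightarrow> (\<forall>x\<in>carrier A. f (\<alpha> x) = \<zero>\<^bsub>K\<^esub>)"
    if f: "f \<in> carrier (lin_dual K B)" for f
  proof -
    have fA: "(\<lambda>x\<in>carrier A. f (\<alpha> x)) \<in> carrier (lin_dual K A)"
      by (rule lin_dual_precomp[OF A \<alpha> f])
    have "\<alpha>' (\<Theta>B f) = \<zero>\<^bsub>A'\<^esub> \<longleftrightarrow> \<Theta>A (\<lambda>x\<in>carrier A. f (\<alpha> x)) = \<Theta>A \<zero>\<^bsub>lin_dual K A\<^esub>"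
      using comm_\<alpha>[OF f] is_hom_zero[OF DA A' \<Theta>A(1)] by simp
    also have "\<dots> \<longleftrightarrow> (\<lambda>x\<in>carrier A. f (\<alpha> x)) = \<zero>\<^bsub>lin_dual K A\<^esub>"
      by (rule inj_on_eq_iff[OF \<Theta>A(2) fA left_module.submodule_zero[OF DA left_module.submodule_carrier[OF DA]]])
    also have "\<dots> \<longleftrightarrow> (\<forall>x\<in>carrier A. f (\<alpha> x) = \<zero>\<^bsub>K\<^esub>)"
      by (auto simp: restrict_def fun_eq_iff)
    finally show ?thesis .
  qed
  have im_iff: "\<Theta>B f \<in> I' \<longleftrightarrow> (\<forall>x\<in>Z. f x = \<zero>\<^bsub>K\<^esub>)" if f: "f \<in> carrier (lin_dual K B)" for f
  proof
    assume "\<Theta>B f \<in> I'"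
    then obtain y where "y \<in> carrier C'" "\<Theta>B f = \<beta>' y" by (auto simp: I'_def)
    then obtain g where g: "g \<in> carrier (lin_dual K C)" "\<Theta>B f = \<beta>' (\<Theta>C g)" using \<Theta>C(2) by blast
    then have "f = (\<lambda>x\<in>carrier B. g (\<beta> x))"
      using \<Theta>B_inj[OF f lin_dual_precomp[OF B \<beta> g(1)]] comm_\<beta>[OF g(1)] by simp
    moreover have "g \<zero>\<^bsub>C\<^esub> = \<zero>\<^bsub>K\<^esub>"
      using is_hom_zero[OF C KK Hom_set_hom[of g]] g(1) by simp
    ultimately show "\<forall>x\<in>Z. f x = \<zero>\<^bsub>K\<^esub>" by (auto simp: Z_def)
  next
    assume fZ: "\<forall>x\<in>Z. f x = \<zero>\<^bsub>K\<^esub>"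
    have fh: "is_hom K B (regular K) f" using f Hom_set_hom by auto
    \<comment> \<open>A functional that kills the kernel of \<open>\<beta>\<close> descends to the
      image of \<open>\<beta>\<close>, with \<open>s\<close> choosing preimages, and then extends to
      \<open>C\<close> because subspaces have complements.\<close>
    have wd: "f x = f y" if "x \<in> carrier B" "y \<in> carrier B" "\<beta> x = \<beta> y" for x y
    proof -
      have "x \<ominus>\<^bsub>B\<^esub> y \<in> Z"
        using that is_hom_diff[OF B C \<beta> that(1,2)] C.diff_eq_zero_iff[of "\<beta> y" "\<beta> y"] is_hom_closed[OF \<beta>]
        by (simp add: Z_def)
      then have "f x \<ominus>\<^bsub>regular K\<^esub> f y = \<zero>\<^bsub>K\<^esub>" using fZ is_hom_diff[OF B KK fh that(1,2)] by simp
      then show ?thesis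
        using left_module.diff_eq_zero_iff[OF KK] is_hom_closed[OF fh that(1)] is_hom_closed[OF fh that(2)] by simp
    qed
    define s where "s z = (SOME x. x \<in> carrier B \<and> \<beta> x = z)" for z
    have s: "f (s (\<beta> x)) = f x" if "x \<in> carrier B" for x
    proof -
      have "s (\<beta> x) \<in> carrier B \<and> \<beta> (s (\<beta> x)) = \<beta> x"
        unfolding s_def by (rule someI_ex) (use that in blast)
      then show ?thesis using wd that by blast
    qed
    have im: "submodule (\<beta> ` carrier B) K C" by (rule submodule_image[OF B C \<beta> B.submodule_carrier])
    have "is_hom K (C\<lparr>carrier := \<beta> ` carrier B\<rparr>) (regular K) (\<lambda>z. f (s z))"
      by (rule is_homI)
        (auto simp: s is_hom_closed[OF fh, simplified] is_hom_add[OF fh] is_hom_smult[OF fh]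
          simp flip: is_hom_add[OF \<beta>] is_hom_smult[OF \<beta>])
    then obtain g where g: "is_hom K C (regular K) g" "\<And>z. z \<in> \<beta> ` carrier B \<Longrightarrow> g z = f (s z)"
      using extend_linear[OF K C im] by blast
    have gC: "restrict g (carrier C) \<in> carrier (lin_dual K C)" using Hom_setI[OF C g(1)] by simp
    have "f = (\<lambda>x\<in>carrier B. restrict g (carrier C) (\<beta> x))"
    proof (rule Hom_set_eqI[of _ K B "regular K"])
      show "f \<in> Hom_set K B (regular K)" using f by simp
      show "(\<lambda>x\<in>carrier B. restrict g (carrier C) (\<beta> x)) \<in> Hom_set K B (regular K)"
        using lin_dual_precomp[OF B \<beta> gC] by simp
    qed (use g(2) s is_hom_closed[OF \<beta>] in auto)
    then have "\<Theta>B f = \<beta>' (\<Theta>C (restrict g (carrier C)))" using comm_\<beta>[OF gC] by simp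
    then show "\<Theta>B f \<in> I'" using is_hom_closed[OF \<Theta>C(1) gC] by (auto simp: I'_def)
  qed
  have IZ': "I' \<subseteq> Z'"
  proof
    fix y assume y: "y \<in> I'"
    then have "y \<in> carrier B'" using B'.submodule_subset[OF I'] by blast
    then obtain f where f: "f \<in> carrier (lin_dual K B)" "y = \<Theta>B f" using \<Theta>B(2) by (auto simp: bij_betw_def)
    then have "\<forall>x\<in>carrier A. f (\<alpha> x) = \<zero>\<^bsub>K\<^esub>" using y im_iff[OF f(1)] IZ by (auto simp: I_def)
    then show "y \<in> Z'" using ker_iff[OF f(1)] f(2) \<open>y \<in> carrier B'\<close> by (simp add: Z'_def)
  qed
  let ?B' = "B'\<lparr>carrier := Z'\<rparr>"
  have B'Z: "left_module K ?B'" by (rule B'.left_module_restrict[OF Z'])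
  have I'Z: "submodule I' K ?B'"
    by (rule B'.submodule_restrict[OF I' IZ']) (auto simp: Z'_def)
  \<comment> \<open>A cycle of the dual sequence is related to the functional that it induces on
    homology. That functional exists by \<open>ker_iff\<close>, and it vanishes exactly for
    boundaries by \<open>im_iff\<close>.\<close>
  define G where "G = {(\<Theta>B f, h) | f h. f \<in> carrier (lin_dual K B) \<and> \<Theta>B f \<in> Z' \<and>
    h \<in> carrier (lin_dual K ?H) \<and> (\<forall>x\<in>Z. h (I +>\<^bsub>BZ\<^esub> x) = f x)}"
  have GI: "(\<Theta>B f, h) \<in> G" if "f \<in> carrier (lin_dual K B)" "\<Theta>B f \<in> Z'"
    "h \<in> carrier (lin_dual K ?H)" "\<forall>x\<in>Z. h (I +>\<^bsub>BZ\<^esub> x) = f x" for f h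
    using that unfolding G_def by blast
  have GE: "\<exists>f. y = \<Theta>B f \<and> f \<in> carrier (lin_dual K B) \<and> \<Theta>B f \<in> Z' \<and>
    h \<in> carrier (lin_dual K ?H) \<and> (\<forall>x\<in>Z. h (I +>\<^bsub>BZ\<^esub> x) = f x)" if "(y, h) \<in> G" for y h
    using that unfolding G_def by blast
  have coset: "I +>\<^bsub>BZ\<^esub> x \<in> carrier ?H" if "x \<in> Z" for x
    using quotient_closed[OF BZ IBZ] that BZc by simp
  have "mod_iso K (quotient_module ?B' I') (lin_dual K ?H)"
  proof (rule quotient_iso_relation[OF B'Z I'Z DH, of G])
    fix y h assume yh: "(y, h) \<in> G"
    then obtain f where f: "y = \<Theta>B f" "f \<in> carrier (lin_dual K B)" "\<Theta>B f \<in> Z'"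
      "h \<in> carrier (lin_dual K ?H)" "\<forall>x\<in>Z. h (I +>\<^bsub>BZ\<^esub> x) = f x" using GE by blast
    show "y \<in> carrier ?B' \<and> h \<in> carrier (lin_dual K ?H)" using f by simp
    have "(\<forall>x\<in>Z. f x = \<zero>\<^bsub>K\<^esub>) \<longleftrightarrow> h = \<zero>\<^bsub>lin_dual K ?H\<^esub>"
    proof
      assume z: "\<forall>x\<in>Z. f x = \<zero>\<^bsub>K\<^esub>"
      show "h = \<zero>\<^bsub>lin_dual K ?H\<^esub>"
      proof (rule Hom_set_eqI[of _ K ?H "regular K"])
        show "\<zero>\<^bsub>lin_dual K ?H\<^esub> \<in> Hom_set K ?H (regular K)"
          using left_module.submodule_zero[OF DH left_module.submodule_carrier[OF DH]] by simp
        show "h X = \<zero>\<^bsub>lin_dual K ?H\<^esub> X" if "X \<in> carrier ?H" for X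
          using quotient_cases[OF BZ IBZ that] z f(5) BZc that by (metis lin_dual_simps(2) restrict_apply')
      qed (use f in simp)
    next
      assume "h = \<zero>\<^bsub>lin_dual K ?H\<^esub>"
      then show "\<forall>x\<in>Z. f x = \<zero>\<^bsub>K\<^esub>" using f(5) coset by auto
    qed
    then show "y \<in> I' \<longleftrightarrow> h = \<zero>\<^bsub>lin_dual K ?H\<^esub>" using im_iff[OF f(2)] f(1) by simp
  next
    fix a y h assume a: "a \<in> carrier K" and "(y, h) \<in> G"
    then obtain f where f: "y = \<Theta>B f" "f \<in> carrier (lin_dual K B)" "\<Theta>B f \<in> Z'"
      "h \<in> carrier (lin_dual K ?H)" "\<forall>x\<in>Z. h (I +>\<^bsub>BZ\<^esub> x) = f x" using GE by blast
    have "(\<Theta>B (a \<odot>\<^bsub>lin_dual K B\<^esub> f), a \<odot>\<^bsub>lin_dual K ?H\<^esub> h) \<in> G"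
    proof (rule GI)
      show "\<Theta>B (a \<odot>\<^bsub>lin_dual K B\<^esub> f) \<in> Z'"
        using is_hom_smult[OF \<Theta>B(1) a f(2)] B'.submodule_smult[OF Z' a f(3)] by simp
      show "\<forall>x\<in>Z. (a \<odot>\<^bsub>lin_dual K ?H\<^esub> h) (I +>\<^bsub>BZ\<^esub> x) = (a \<odot>\<^bsub>lin_dual K B\<^esub> f) x"
        using f(5) coset ZB by auto
    qed (use left_module.smult_closed[OF DB a f(2)] left_module.smult_closed[OF DH a f(4)] in auto)
    then show "(a \<odot>\<^bsub>?B'\<^esub> y, a \<odot>\<^bsub>lin_dual K ?H\<^esub> h) \<in> G"
      using is_hom_smult[OF \<Theta>B(1) a f(2)] f(1) by simp
  next
    fix y h y' h' assume "(y, h) \<in> G" and yh': "(y', h') \<in> G"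
    then obtain f where f: "y = \<Theta>B f" "f \<in> carrier (lin_dual K B)" "\<Theta>B f \<in> Z'"
      "h \<in> carrier (lin_dual K ?H)" "\<forall>x\<in>Z. h (I +>\<^bsub>BZ\<^esub> x) = f x" using GE by blast
    from yh' obtain f' where f': "y' = \<Theta>B f'" "f' \<in> carrier (lin_dual K B)" "\<Theta>B f' \<in> Z'"
      "h' \<in> carrier (lin_dual K ?H)" "\<forall>x\<in>Z. h' (I +>\<^bsub>BZ\<^esub> x) = f' x" using GE by blast
    interpret DB: left_module K "lin_dual K B" by (rule DB)
    interpret DH: left_module K "lin_dual K ?H" by (rule DH)
    have "(\<Theta>B (f \<oplus>\<^bsub>lin_dual K B\<^esub> f'), h \<oplus>\<^bsub>lin_dual K ?H\<^esub> h') \<in> G"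
    proof (rule GI)
      show "\<Theta>B (f \<oplus>\<^bsub>lin_dual K B\<^esub> f') \<in> Z'"
        using is_hom_add[OF \<Theta>B(1) f(2) f'(2)] B'.submodule_add[OF Z' f(3) f'(3)] by simp
      show "\<forall>x\<in>Z. (h \<oplus>\<^bsub>lin_dual K ?H\<^esub> h') (I +>\<^bsub>BZ\<^esub> x) = (f \<oplus>\<^bsub>lin_dual K B\<^esub> f') x"
        using f(5) f'(5) coset ZB by auto
    qed (use DB.M.a_closed[OF f(2) f'(2)] DH.M.a_closed[OF f(4) f'(4)] in auto)
    then show "(y \<oplus>\<^bsub>?B'\<^esub> y', h \<oplus>\<^bsub>lin_dual K ?H\<^esub> h') \<in> G"
      using is_hom_add[OF \<Theta>B(1) f(2) f'(2)] f(1) f'(1) by simp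
  next
    fix y assume "y \<in> carrier ?B'"
    then have y: "y \<in> Z'" by simp
    then obtain f where f: "f \<in> carrier (lin_dual K B)" "y = \<Theta>B f"
      using \<Theta>B(2) by (auto simp: bij_betw_def Z'_def)
    have fI: "f x = \<zero>\<^bsub>regular K\<^esub>" if "x \<in> I" for x
      using ker_iff[OF f(1)] y f(2) that by (auto simp: Z'_def I_def)
    have fBZ: "is_hom K BZ (regular K) f"
      unfolding BZ_def by (rule is_hom_sub) (use f ZB Hom_set_hom in auto)
    then obtain h where h: "is_hom K ?H (regular K) h" "\<And>x. x \<in> carrier BZ \<Longrightarrow> h (I +>\<^bsub>BZ\<^esub> x) = f x"
      using quotient_lift[where f = f and N = "regular K", OF BZ IBZ fBZ fI KK] by blast
    have "(\<Theta>B f, restrict h (carrier ?H)) \<in> G"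
      by (rule GI) (use f y h(2) BZc coset Hom_setI[OF H h(1)] in auto)
    then show "\<exists>h. (y, h) \<in> G" using f(2) by blast
  next
    fix h assume h: "h \<in> carrier (lin_dual K ?H)"
    then have hh: "is_hom K ?H (regular K) h" using Hom_set_hom by auto
    \<comment> \<open>A functional on homology is pulled back to the cycles and extended from there
      to \<open>B\<close>; it still kills the boundaries \<open>I\<close>, so it is a cycle of the
      dual sequence.\<close>
    have "is_hom K BZ (regular K) (\<lambda>x. h (I +>\<^bsub>BZ\<^esub> x))"
      by (rule is_hom_comp[OF is_hom_coset[OF BZ IBZ] hh])
    then obtain f where f: "is_hom K B (regular K) f" "\<And>x. x \<in> Z \<Longrightarrow> f x = h (I +>\<^bsub>BZ\<^esub> x)"
      using extend_linear[OF K B Z] unfolding BZ_def by blast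
    have fB: "restrict f (carrier B) \<in> carrier (lin_dual K B)" using Hom_setI[OF B f(1)] by simp
    have "f x = \<zero>\<^bsub>K\<^esub>" if "x \<in> I" for x
    proof -
      have "I +>\<^bsub>BZ\<^esub> x = \<zero>\<^bsub>?H\<^esub>" using coset_eq_zero_iff[OF BZ IBZ, of x] that IZ BZc by auto
      then show ?thesis using f(2) that IZ is_hom_zero[OF H KK hh] by auto
    qed
    then have "\<Theta>B (restrict f (carrier B)) \<in> Z'"
      using ker_iff[OF fB] is_hom_closed[OF \<Theta>B(1) fB] is_hom_closed[OF \<alpha>] by (auto simp: Z'_def I_def)
    then have "(\<Theta>B (restrict f (carrier B)), h) \<in> G"
      by (intro GI fB h) (use f(2) ZB in auto)
    then show "\<exists>y. (y, h) \<in> G" by blast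
  qed
  then show ?thesis
    by (simp only: BZ_def Z_def I_def Z'_def I'_def)
qed

section \<open>Free and projective modules\<close>

lemma free_module_simps [simp]:
  "\<zero>\<^bsub>free_module R S\<^esub> = (\<lambda>_. \<zero>\<^bsub>R\<^esub>)"
  "u \<oplus>\<^bsub>free_module R S\<^esub> v = (\<lambda>x. u x \<oplus>\<^bsub>R\<^esub> v x)"
  "a \<odot>\<^bsub>free_module R S\<^esub> u = (\<lambda>x. a \<otimes>\<^bsub>R\<^esub> u x)"
  by (simp_all add: free_module_def)

lemma free_module_carrier:
  "u \<in> carrier (free_module R S) \<longleftrightarrow>
    (\<forall>x\<in>S. u x \<in> carrier R) \<and> (\<forall>x. x \<notin> S \<longrightarrow> u x = \<zero>\<^bsub>R\<^esub>) \<and> finite {x. u x \<noteq> \<zero>\<^bsub>R\<^esub>}"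
  by (simp add: free_module_def)

context
  fixes R :: "('a, 'b) ring_scheme" (structure)
  assumes R: "ring R"
begin

interpretation R: ring R by (rule R)

lemma free_module_closed: "u \<in> carrier (free_module R S) \<Longrightarrow> u x \<in> carrier R"
  by (cases "x \<in> S") (auto simp: free_module_carrier)

lemma left_module_free_module: "left_module R (free_module R S)"
proof (rule left_moduleI)
  show "u \<oplus>\<^bsub>free_module R S\<^esub> v \<in> carrier (free_module R S)"
    if "u \<in> carrier (free_module R S)" "v \<in> carrier (free_module R S)" for u v
  proof -
    have "finite {x. u x \<oplus> v x \<noteq> \<zero>}"
      by (rule finite_subset[of _ "{x. u x \<noteq> \<zero>} \<union> {x. v x \<noteq> \<zero>}"])
        (use that in \<open>auto simp: free_module_carrier\<close>)
    then show ?thesis using that by (auto simp: free_module_carrier)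
  qed
  show "a \<odot>\<^bsub>free_module R S\<^esub> u \<in> carrier (free_module R S)"
    if "a \<in> carrier R" "u \<in> carrier (free_module R S)" for u a
  proof -
    have "finite {x. a \<otimes> u x \<noteq> \<zero>}"
      by (rule finite_subset[of _ "{x. u x \<noteq> \<zero>}"])
        (use that in \<open>auto simp: free_module_carrier\<close>)
    then show ?thesis using that by (auto simp: free_module_carrier)
  qed
qed (auto simp: R.ring_axioms free_module_closed R.a_ac R.m_assoc R.l_distr R.r_distr
  free_module_carrier[of "\<lambda>_. \<zero>"])

lemma free_gen_closed: "s \<in> S \<Longrightarrow> free_gen R s \<in> carrier (free_module R S)"
  by (auto simp: free_module_carrier free_gen_def)

text \<open>The set \<open>A\<close> may be larger than the support, so that one \<open>A\<close>
  can serve a whole family of elements.\<close>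

lemma free_expansion:
  assumes u: "u \<in> carrier (free_module R S)" and A: "finite A" "{x. u x \<noteq> \<zero>} \<subseteq> A" "A \<subseteq> S"
  shows "u = (\<Oplus>\<^bsub>free_module R S\<^esub> x\<in>A. u x \<odot>\<^bsub>free_module R S\<^esub> free_gen R x)"
proof
  fix y
  note F = left_module_free_module
  have c: "u x \<odot>\<^bsub>free_module R S\<^esub> free_gen R x \<in> carrier (free_module R S)" if "x \<in> A" for x
    by (rule left_module.smult_closed[OF F free_module_closed[OF u] free_gen_closed]) (use that A(3) in auto)
  have "(\<Oplus>\<^bsub>free_module R S\<^esub> x\<in>A. u x \<odot>\<^bsub>free_module R S\<^esub> free_gen R x) y =
      (\<Oplus>\<^bsub>regular R\<^esub> x\<in>A. (u x \<odot>\<^bsub>free_module R S\<^esub> free_gen R x) y)"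
    by (rule finsum_additive[OF F left_module_regular[OF R], where f = "\<lambda>u. u y"]) (use c in \<open>auto simp: free_module_closed\<close>)
  also have "\<dots> = (\<Oplus>\<^bsub>R\<^esub> x\<in>A. if y = x then u x else \<zero>)"
    unfolding finsum_regular
    by (rule R.finsum_cong') (auto simp: free_gen_def free_module_closed[OF u])
  also have "\<dots> = u y"
  proof (cases "y \<in> A")
    case True
    then show ?thesis
      by (intro R.finsum_singleton) (auto simp: A free_module_closed[OF u])
  next
    case False
    then have "(\<Oplus>\<^bsub>R\<^esub> x\<in>A. if y = x then u x else \<zero>) = (\<Oplus>\<^bsub>R\<^esub> x\<in>A. \<zero>)"
      by (intro R.finsum_cong') auto
    moreover have "u y = \<zero>" using False A(2) by blast
    ultimately show ?thesis by simp
  qed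
  finally show "u y = (\<Oplus>\<^bsub>free_module R S\<^esub> x\<in>A. u x \<odot>\<^bsub>free_module R S\<^esub> free_gen R x) y" by simp
qed

lemma free_hom_eqI:
  assumes M: "left_module R M" and h: "is_hom R (free_module R S) M h" and h': "is_hom R (free_module R S) M h'"
    and eq: "\<And>s. s \<in> S \<Longrightarrow> h (free_gen R s) = h' (free_gen R s)" and u: "u \<in> carrier (free_module R S)"
  shows "h u = h' u"
proof -
  interpret M: left_module R M by (rule M)
  note F = left_module_free_module
  let ?A = "{x. u x \<noteq> \<zero>}"
  have A: "finite ?A" "?A \<subseteq> S" using u by (auto simp: free_module_carrier)
  have c: "u x \<odot>\<^bsub>free_module R S\<^esub> free_gen R x \<in> carrier (free_module R S)" if "x \<in> ?A" for x
    by (rule left_module.smult_closed[OF F free_module_closed[OF u] free_gen_closed]) (use that A(2) in auto)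
  have *: "g u = (\<Oplus>\<^bsub>M\<^esub> x\<in>?A. u x \<odot>\<^bsub>M\<^esub> g (free_gen R x))" if g: "is_hom R (free_module R S) M g" for g
  proof -
    have "g u = (\<Oplus>\<^bsub>M\<^esub> x\<in>?A. g (u x \<odot>\<^bsub>free_module R S\<^esub> free_gen R x))"
      by (subst free_expansion[OF u A(1) order_refl A(2)]) (rule is_hom_finsum[OF F M g c])
    also have "\<dots> = (\<Oplus>\<^bsub>M\<^esub> x\<in>?A. u x \<odot>\<^bsub>M\<^esub> g (free_gen R x))"
      by (rule M.M.finsum_cong')
        (use A(2)[THEN subsetD] free_module_closed[OF u] free_gen_closed[of _ S] is_hom_closed[OF g]
          is_hom_smult[OF g] in \<open>auto simp del: free_module_simps\<close>)
    finally show ?thesis .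
  qed
  show ?thesis
    unfolding *[OF h] *[OF h']
    by (rule M.M.finsum_cong')
      (use eq A(2)[THEN subsetD] free_module_closed[OF u] free_gen_closed[of _ S] is_hom_closed[OF h'] in auto)
qed

lemma free_lift:
  assumes M: "left_module R M" and r: "\<And>s. s \<in> S \<Longrightarrow> r s \<in> carrier M"
  obtains h where "is_hom R (free_module R S) M h" "\<And>s. s \<in> S \<Longrightarrow> h (free_gen R s) = r s"
proof -
  interpret M: left_module R M by (rule M)
  define h where "h u = (\<Oplus>\<^bsub>M\<^esub> x\<in>{x. u x \<noteq> \<zero>}. u x \<odot>\<^bsub>M\<^esub> r x)" for u
  \<comment> \<open>The sum may run over any finite set between the support and \<open>S\<close>;
    for a sum \<open>u + v\<close> the union of both supports is taken.\<close>
  have h_eq: "h u = (\<Oplus>\<^bsub>M\<^esub> x\<in>A. u x \<odot>\<^bsub>M\<^esub> r x)"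
    if u: "u \<in> carrier (free_module R S)" and A: "finite A" "{x. u x \<noteq> \<zero>} \<subseteq> A" "A \<subseteq> S" for u A
    unfolding h_def
    by (rule M.M.add.finprod_mono_neutral_cong_left)
      (use A r free_module_closed[OF u] in auto)
  have closed: "h u \<in> carrier M" if u: "u \<in> carrier (free_module R S)" for u
    unfolding h_def
    by (rule M.M.finsum_closed) (use r free_module_closed[OF u] u in \<open>auto simp: free_module_carrier\<close>)
  have supp: "finite {x. u x \<noteq> \<zero>}" "{x. u x \<noteq> \<zero>} \<subseteq> S" if "u \<in> carrier (free_module R S)" for u
    using that by (auto simp: free_module_carrier)
  show thesis
  proof
    show "is_hom R (free_module R S) M h"
    proof (rule is_homI[OF closed])
      fix u v assume u: "u \<in> carrier (free_module R S)" and v: "v \<in> carrier (free_module R S)"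
      let ?A = "{x. u x \<noteq> \<zero>} \<union> {x. v x \<noteq> \<zero>}"
      have uv: "u \<oplus>\<^bsub>free_module R S\<^esub> v \<in> carrier (free_module R S)"
        using left_module.submodule_add[OF left_module_free_module left_module.submodule_carrier[OF left_module_free_module] u v] .
      have A: "finite ?A" "?A \<subseteq> S" using supp[OF u] supp[OF v] by auto
      have c: "u x \<odot>\<^bsub>M\<^esub> r x \<in> carrier M" "v x \<odot>\<^bsub>M\<^esub> r x \<in> carrier M" if "x \<in> ?A" for x
        using that A(2) r free_module_closed[OF u] free_module_closed[OF v] by auto
      have "h (u \<oplus>\<^bsub>free_module R S\<^esub> v) = (\<Oplus>\<^bsub>M\<^esub> x\<in>?A. (u \<oplus>\<^bsub>free_module R S\<^esub> v) x \<odot>\<^bsub>M\<^esub> r x)"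
        by (rule h_eq[OF uv A(1) _ A(2)]) auto
      also have "\<dots> = (\<Oplus>\<^bsub>M\<^esub> x\<in>?A. u x \<odot>\<^bsub>M\<^esub> r x \<oplus>\<^bsub>M\<^esub> v x \<odot>\<^bsub>M\<^esub> r x)"
        by (rule M.M.finsum_cong')
          (use c A(2) r free_module_closed[OF u] free_module_closed[OF v] in \<open>auto simp: M.smult_l_distr subset_iff\<close>)
      also have "\<dots> = (\<Oplus>\<^bsub>M\<^esub> x\<in>?A. u x \<odot>\<^bsub>M\<^esub> r x) \<oplus>\<^bsub>M\<^esub> (\<Oplus>\<^bsub>M\<^esub> x\<in>?A. v x \<odot>\<^bsub>M\<^esub> r x)"
        by (rule M.M.finsum_addf) (use c in auto)
      also have "\<dots> = h u \<oplus>\<^bsub>M\<^esub> h v"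
        using h_eq[OF u A(1) _ A(2)] h_eq[OF v A(1) _ A(2)] by simp
      finally show "h (u \<oplus>\<^bsub>free_module R S\<^esub> v) = h u \<oplus>\<^bsub>M\<^esub> h v" .
    next
      fix a u assume a: "a \<in> carrier R" and u: "u \<in> carrier (free_module R S)"
      let ?A = "{x. u x \<noteq> \<zero>}"
      have au: "a \<odot>\<^bsub>free_module R S\<^esub> u \<in> carrier (free_module R S)"
        using left_module.smult_closed[OF left_module_free_module a u] .
      have c: "u x \<odot>\<^bsub>M\<^esub> r x \<in> carrier M" if "x \<in> ?A" for x
        using that supp(2)[OF u] r free_module_closed[OF u] by auto
      have "h (a \<odot>\<^bsub>free_module R S\<^esub> u) = (\<Oplus>\<^bsub>M\<^esub> x\<in>?A. (a \<odot>\<^bsub>free_module R S\<^esub> u) x \<odot>\<^bsub>M\<^esub> r x)"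
        by (rule h_eq[OF au supp(1)[OF u] _ supp(2)[OF u]]) (use a in auto)
      also have "\<dots> = (\<Oplus>\<^bsub>M\<^esub> x\<in>?A. a \<odot>\<^bsub>M\<^esub> (u x \<odot>\<^bsub>M\<^esub> r x))"
        by (rule M.M.finsum_cong')
          (use c a supp(2)[OF u] r free_module_closed[OF u] in \<open>auto simp: M.smult_assoc1 subset_iff\<close>)
      also have "\<dots> = a \<odot>\<^bsub>M\<^esub> h u"
        unfolding h_def by (rule smult_finsum[OF M a c, symmetric])
      finally show "h (a \<odot>\<^bsub>free_module R S\<^esub> u) = a \<odot>\<^bsub>M\<^esub> h u" .
    qed
    show "h (free_gen R s) = r s" if s: "s \<in> S" for s
    proof -
      have "h (free_gen R s) = (\<Oplus>\<^bsub>M\<^esub> x\<in>{s}. free_gen R s x \<odot>\<^bsub>M\<^esub> r x)"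
        by (rule h_eq[OF free_gen_closed[OF s]]) (use s in \<open>auto simp: free_gen_def\<close>)
      also have "\<dots> = r s" using r[OF s] by (simp add: free_gen_def)
      finally show ?thesis .
    qed
  qed
qed

lemma is_hom_finsum_map:
  assumes M: "left_module R M" and N: "left_module R N" and f: "\<And>i. i \<in> I \<Longrightarrow> is_hom R M N (f i)"
  shows "is_hom R M N (\<lambda>x. \<Oplus>\<^bsub>N\<^esub> i\<in>I. f i x)"
  using f
proof (induction I rule: infinite_finite_induct)
  case (insert i I)
  interpret N: left_module R N by (rule N)
  have h: "is_hom R M N (\<lambda>x. f i x \<oplus>\<^bsub>N\<^esub> (\<Oplus>\<^bsub>N\<^esub> i\<in>I. f i x))"
    using insert by (intro is_hom_add_map[OF N]) auto
  have eq: "(\<Oplus>\<^bsub>N\<^esub> j\<in>insert i I. f j x) = f i x \<oplus>\<^bsub>N\<^esub> (\<Oplus>\<^bsub>N\<^esub> i\<in>I. f i x)" if "x \<in> carrier M" for x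
    using insert.hyps insert.prems[THEN is_hom_closed, OF _ that] by (intro N.M.finsum_insert) auto
  show ?case by (rule is_hom_cong[OF M h]) (simp add: eq)
next
  case (infinite I)
  interpret N: left_module R N by (rule N)
  show ?case using infinite is_hom_zero_map[OF N] by (simp add: N.M.finsum_infinite)
next
  case empty
  interpret N: left_module R N by (rule N)
  show ?case using is_hom_zero_map[OF N] by simp
qed

text \<open>Preimages are chosen at the free generators and the resulting map is pulled back along
  the split inclusion \<open>i\<close>. The premise \<open>im\<close> replaces surjectivity of
  \<open>q\<close>, because the lifts are mostly taken along differentials, which are onto their
  images only.\<close>

lemma projective_lift:
  fixes P :: "('a, 'p) module"
  assumes P: "projective R P" and Q: "left_module R Q" and Y: "left_module R Y"
    and q: "is_hom R Q Y q" and f: "is_hom R P Y f"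
    and im: "\<And>x. x \<in> carrier P \<Longrightarrow> f x \<in> q ` carrier Q"
  obtains h where "is_hom R P Q h" "\<And>x. x \<in> carrier P \<Longrightarrow> q (h x) = f x"
proof -
  obtain X :: "'p set" and i p where i: "is_hom R P (free_module R X) i" and p: "is_hom R (free_module R X) P p"
    and pi: "\<And>x. x \<in> carrier P \<Longrightarrow> p (i x) = x"
    using P by (auto simp: projective_def)
  define r where "r s = (SOME y. y \<in> carrier Q \<and> q y = f (p (free_gen R s)))" for s
  have r: "r s \<in> carrier Q \<and> q (r s) = f (p (free_gen R s))" if "s \<in> X" for s
    unfolding r_def
    by (rule someI_ex) (use im[OF is_hom_closed[OF p free_gen_closed[OF that]]] in auto)
  obtain h where h: "is_hom R (free_module R X) Q h" "\<And>s. s \<in> X \<Longrightarrow> h (free_gen R s) = r s"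
    using free_lift[OF Q, of X r] r by blast
  have "q (h u) = f (p u)" if "u \<in> carrier (free_module R X)" for u
    by (rule free_hom_eqI[OF Y is_hom_comp[OF h(1) q] is_hom_comp[OF p f] _ that]) (simp add: h(2) r)
  then show thesis
    using that[OF is_hom_comp[OF i h(1)]] is_hom_closed[OF i] pi by simp
qed

text \<open>A dual basis of \<open>Q\<close>, cut down to the finitely many coordinates that the
  images of the generators of \<open>M\<close> involve. The finiteness comes from \<open>M\<close>,
  so \<open>Q\<close> may be a term of an arbitrary projective resolution. With \<open>f\<close> the
  identity it is the usual dual basis of a finitely generated projective module.\<close>

lemma projective_coordinates:
  fixes Q :: "('a, 'q) module"
  assumes Q: "projective R Q" and M: "left_module R M" and fg: "fin_gen R M" and f: "is_hom R M Q f"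
  obtains A :: "'q set" and \<xi> c where "finite A" "\<And>a. a \<in> A \<Longrightarrow> is_hom R Q (regular R) (\<xi> a)"
    "\<And>a. a \<in> A \<Longrightarrow> c a \<in> carrier Q"
    "\<And>x. x \<in> carrier M \<Longrightarrow> f x = (\<Oplus>\<^bsub>Q\<^esub> a\<in>A. \<xi> a (f x) \<odot>\<^bsub>Q\<^esub> c a)"
proof -
  obtain X :: "'q set" and i p where i: "is_hom R Q (free_module R X) i" and p: "is_hom R (free_module R X) Q p"
    and pi: "\<And>x. x \<in> carrier Q \<Longrightarrow> p (i x) = x" and Q': "left_module R Q"
    using Q by (auto simp: projective_def)
  interpret Q: left_module R Q by (rule Q')
  interpret M: left_module R M by (rule M)
  note F = left_module_free_module
  obtain S where S: "finite S" "S \<subseteq> carrier M" "gen_submodule R M S = carrier M"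
    using fg by (auto simp: fin_gen_def)
  have if_closed: "i (f x) \<in> carrier (free_module R X)" if "x \<in> carrier M" for x
    using is_hom_closed[OF i] is_hom_closed[OF f] that by blast
  define A where "A = (\<Union>s\<in>S. {x. i (f s) x \<noteq> \<zero>})"
  have supp_s: "finite {x. i (f s) x \<noteq> \<zero>}" "{x. i (f s) x \<noteq> \<zero>} \<subseteq> X" if "s \<in> S" for s
    using if_closed[OF subsetD[OF S(2) that]] by (auto simp: free_module_carrier)
  have A: "finite A" "A \<subseteq> X"
    unfolding A_def using S(1) supp_s by (simp, intro UN_least)
  \<comment> \<open>The elements whose image has all its coordinates in \<open>A\<close> form a
    submodule, and it contains the generators.\<close>
  have "submodule {x \<in> carrier M. \<forall>y. y \<notin> A \<longrightarrow> i (f x) y = \<zero>} R M"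
    using is_hom_zero[OF M F is_hom_comp[OF f i]] is_hom_add[OF is_hom_comp[OF f i]]
      is_hom_smult[OF is_hom_comp[OF f i]]
    by (intro M.submoduleI) auto
  then have "gen_submodule R M S \<subseteq> {x \<in> carrier M. \<forall>y. y \<notin> A \<longrightarrow> i (f x) y = \<zero>}"
    by (rule gen_submodule_least) (use S(2) in \<open>auto simp: A_def\<close>)
  then have supp: "{y. i (f x) y \<noteq> \<zero>} \<subseteq> A" if "x \<in> carrier M" for x
    using that S(3) by blast
  have c: "p (free_gen R a) \<in> carrier Q" if "a \<in> A" for a
    using is_hom_closed[OF p free_gen_closed] A(2) that by blast
  show thesis
  proof (rule that[OF A(1), of "\<lambda>a y. i y a" "\<lambda>a. p (free_gen R a)"])
    show "is_hom R Q (regular R) (\<lambda>y. i y a)" for a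
      using is_hom_closed[OF i] is_hom_add[OF i] is_hom_smult[OF i] free_module_closed[of _ X]
      by (intro is_homI) auto
    show "f x = (\<Oplus>\<^bsub>Q\<^esub> a\<in>A. i (f x) a \<odot>\<^bsub>Q\<^esub> p (free_gen R a))" if x: "x \<in> carrier M" for x
    proof -
      note u = if_closed[OF x]
      have cF: "i (f x) a \<odot>\<^bsub>free_module R X\<^esub> free_gen R a \<in> carrier (free_module R X)" if "a \<in> A" for a
        by (rule left_module.smult_closed[OF F free_module_closed[OF u] free_gen_closed]) (use that A(2) in auto)
      have "f x = p (i (f x))" using pi is_hom_closed[OF f x] by simp
      also have "\<dots> = (\<Oplus>\<^bsub>Q\<^esub> a\<in>A. p (i (f x) a \<odot>\<^bsub>free_module R X\<^esub> free_gen R a))"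
        by (subst free_expansion[OF u A(1) supp[OF x] A(2)]) (rule is_hom_finsum[OF F Q' p cF])
      also have "\<dots> = (\<Oplus>\<^bsub>Q\<^esub> a\<in>A. i (f x) a \<odot>\<^bsub>Q\<^esub> p (free_gen R a))"
        by (rule Q.M.finsum_cong')
          (use c A(2)[THEN subsetD] free_module_closed[OF u] free_gen_closed[of _ X] is_hom_smult[OF p] in \<open>auto simp del: free_module_simps\<close>)
      finally show ?thesis .
    qed
  qed (use c in simp)
qed

text \<open>A map to a projective module is extended along \<open>d\<close> one coordinate at a
  time: each coordinate is a map to the ring, to which \<open>ext\<close> applies, and the
  extensions are recombined with the vectors \<open>c a\<close>. Finitely many coordinates are
  enough because \<open>T1\<close> is finitely generated.\<close>

lemma extend_to_projective:
  fixes Q :: "('a, 'q) module"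
  assumes T1: "left_module R T1" "fin_gen R T1" and T0: "left_module R T0"
    and d: "is_hom R T1 T0 d" and Q: "projective R Q" and f: "is_hom R T1 Q f"
    and ext: "\<And>u. \<lbrakk>is_hom R T1 (regular R) u; \<And>x. \<lbrakk>x \<in> carrier T1; f x = \<zero>\<^bsub>Q\<^esub>\<rbrakk> \<Longrightarrow> u x = \<zero>\<rbrakk> \<Longrightarrow>
      \<exists>v. is_hom R T0 (regular R) v \<and> (\<forall>x\<in>carrier T1. u x = v (d x))"
  obtains h where "is_hom R T0 Q h" "\<And>x. x \<in> carrier T1 \<Longrightarrow> f x = h (d x)"
proof -
  have Q': "left_module R Q" using Q by (simp add: projective_def)
  interpret Q: left_module R Q by (rule Q')
  obtain A :: "'q set" and \<xi> c where A: "finite A" "\<And>a. a \<in> A \<Longrightarrow> is_hom R Q (regular R) (\<xi> a)"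
    "\<And>a. a \<in> A \<Longrightarrow> c a \<in> carrier Q"
    "\<And>x. x \<in> carrier T1 \<Longrightarrow> f x = (\<Oplus>\<^bsub>Q\<^esub> a\<in>A. \<xi> a (f x) \<odot>\<^bsub>Q\<^esub> c a)"
    using projective_coordinates[OF Q T1 f] by blast
  have "\<forall>a\<in>A. \<exists>v. is_hom R T0 (regular R) v \<and> (\<forall>x\<in>carrier T1. \<xi> a (f x) = v (d x))"
    using ext[OF is_hom_comp[OF f A(2)]] is_hom_zero[OF Q' left_module_regular[OF R] A(2)] by simp
  then obtain v where v: "\<And>a. a \<in> A \<Longrightarrow> is_hom R T0 (regular R) (v a)"
    "\<And>a x. \<lbrakk>a \<in> A; x \<in> carrier T1\<rbrakk> \<Longrightarrow> \<xi> a (f x) = v a (d x)"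
    by metis
  show thesis
  proof
    have "is_hom R T0 Q (\<lambda>x. v a x \<odot>\<^bsub>Q\<^esub> c a)" if "a \<in> A" for a
      using v(1)[OF that] A(3)[OF that] Q.smult_l_distr Q.smult_assoc1
      by (auto simp: is_hom_def Pi_iff)
    then show "is_hom R T0 Q (\<lambda>x. \<Oplus>\<^bsub>Q\<^esub> a\<in>A. v a x \<odot>\<^bsub>Q\<^esub> c a)"
      by (rule is_hom_finsum_map[OF T0 Q'])
    show "f x = (\<Oplus>\<^bsub>Q\<^esub> a\<in>A. v a (d x) \<odot>\<^bsub>Q\<^esub> c a)" if x: "x \<in> carrier T1" for x
      by (subst A(4)[OF x], rule Q.M.finsum_cong')
        (use v(2) x A(3) is_hom_closed[OF v(1) is_hom_closed[OF d x]] in auto)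
  qed
qed

end

section \<open>Modules over algebras\<close>

lemma opp_simps [simp]:
  "carrier (opp R) = carrier R" "\<zero>\<^bsub>opp R\<^esub> = \<zero>\<^bsub>R\<^esub>" "\<one>\<^bsub>opp R\<^esub> = \<one>\<^bsub>R\<^esub>"
  "x \<oplus>\<^bsub>opp R\<^esub> y = x \<oplus>\<^bsub>R\<^esub> y" "x \<otimes>\<^bsub>opp R\<^esub> y = y \<otimes>\<^bsub>R\<^esub> x"
  by (simp_all add: opp_def)

lemma opp_smult [simp]: "c \<odot>\<^bsub>opp A\<^esub> x = c \<odot>\<^bsub>(A :: ('k, 'a) module)\<^esub> x"
  by (simp add: opp_def)

lemma opp_opp [simp]: "opp (opp R) = R"
  by (simp add: opp_def)

lemma ring_opp: "ring R \<Longrightarrow> ring (opp R)"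
proof -
  assume "ring R"
  then interpret R: ring R .
  show ?thesis
  proof (rule ringI)
    show "abelian_group (opp R)"
      by (rule abelian_groupI) (auto simp: R.a_ac intro: R.add.l_inv_ex)
    show "Group.monoid (opp R)"
      by (rule monoidI) (auto simp: R.m_assoc)
  qed (auto simp: R.l_distr R.r_distr)
qed

lemma k_space_simps [simp]:
  "carrier (k_space A M) = carrier M" "\<zero>\<^bsub>k_space A M\<^esub> = \<zero>\<^bsub>M\<^esub>"
  "x \<oplus>\<^bsub>k_space A M\<^esub> y = x \<oplus>\<^bsub>M\<^esub> y" "c \<odot>\<^bsub>k_space A M\<^esub> x = k_smult A M c x"
  by (simp_all add: k_space_def)

lemma Hom_space_simps [simp]:
  "carrier (Hom_space A M N) = Hom_set A M N" "\<zero>\<^bsub>Hom_space A M N\<^esub> = (\<lambda>x\<in>carrier M. \<zero>\<^bsub>N\<^esub>)"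
  "f \<oplus>\<^bsub>Hom_space A M N\<^esub> g = (\<lambda>x\<in>carrier M. f x \<oplus>\<^bsub>N\<^esub> g x)"
  "c \<odot>\<^bsub>Hom_space A M N\<^esub> f = (\<lambda>x\<in>carrier M. k_smult A N c (f x))"
  by (simp_all add: Hom_space_def)

lemma k_dual_simps [simp]:
  "carrier (k_dual K A M) = Hom_set K (k_space A M) (regular K)"
  "\<zero>\<^bsub>k_dual K A M\<^esub> = (\<lambda>x\<in>carrier M. \<zero>\<^bsub>K\<^esub>)"
  "f \<oplus>\<^bsub>k_dual K A M\<^esub> g = (\<lambda>x\<in>carrier M. f x \<oplus>\<^bsub>K\<^esub> g x)"
  "a \<odot>\<^bsub>k_dual K A M\<^esub> f = (\<lambda>x\<in>carrier M. f (a \<odot>\<^bsub>M\<^esub> x))"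
  by (simp_all add: k_dual_def)

lemma ring_dual_simps [simp]:
  "carrier (ring_dual R M) = Hom_set R M (regular R)"
  "\<zero>\<^bsub>ring_dual R M\<^esub> = (\<lambda>x\<in>carrier M. \<zero>\<^bsub>R\<^esub>)"
  "f \<oplus>\<^bsub>ring_dual R M\<^esub> g = (\<lambda>x\<in>carrier M. f x \<oplus>\<^bsub>R\<^esub> g x)"
  "a \<odot>\<^bsub>ring_dual R M\<^esub> f = (\<lambda>x\<in>carrier M. f x \<otimes>\<^bsub>R\<^esub> a)"
  by (simp_all add: ring_dual_def)

lemma left_module_ring_dual:
  assumes M: "left_module R M"
  shows "left_module (opp R) (ring_dual R M)"
proof -
  interpret M: left_module R M by fact
  have hom: "is_hom R M (regular R) (\<lambda>x. f x \<otimes>\<^bsub>R\<^esub> a)" if "a \<in> carrier (opp R)" "f \<in> Hom_set R M (regular R)" for a f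
    using that by (auto simp: Hom_set_def is_hom_def Pi_iff M.R.l_distr M.R.m_assoc)
  have "left_module (opp R) (mk_module (Hom_set R M (regular R)) (\<lambda>x\<in>carrier M. \<zero>\<^bsub>regular R\<^esub>)
    (\<lambda>f g. \<lambda>x\<in>carrier M. f x \<oplus>\<^bsub>regular R\<^esub> g x) (\<lambda>a f. \<lambda>x\<in>carrier M. f x \<otimes>\<^bsub>R\<^esub> a))"
  proof (rule left_module_Hom_set[OF M left_module_regular[OF M.R.ring_axioms] ring_opp[OF M.R.ring_axioms] hom])
  qed (use Hom_set_closed[of _ R M "regular R"] in \<open>auto simp: M.R.l_distr M.R.r_distr M.R.m_assoc\<close>)
  then show ?thesis by (simp add: ring_dual_def)
qed

lemma k_algebra_opp:
  assumes "k_algebra K A"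
  shows "k_algebra K (opp A)"
proof -
  interpret A: k_algebra K A by fact
  have op: "ring (opp A)" by (rule ring_opp[OF A.A.ring_axioms])
  have "Module.module K (opp A)"
    by (rule moduleI)
      (use op in \<open>auto simp: ring.axioms(1) A.R.cring_axioms A.smult_l_distr A.smult_r_distr A.smult_assoc1
        intro: ring.is_abelian_group\<close>)
  moreover have "k_algebra_axioms K (opp A)"
    by unfold_locales (simp_all add: A.smult_mult_left A.smult_mult_right)
  ultimately show ?thesis
    using op k_algebra.axioms(2)[OF assms] by (intro k_algebra.intro)
qed

context
  fixes K :: "'k ring" and A :: "('k, 'a) module"
  assumes KA: "k_algebra K A"
begin

interpretation A: k_algebra K A by (rule KA)

lemma k_algebra_field: "field K" ..

lemma k_algebra_ring: "ring A" ..

lemma scalar_closed: "c \<in> carrier K \<Longrightarrow> c \<odot>\<^bsub>A\<^esub> \<one>\<^bsub>A\<^esub> \<in> carrier A"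
  by simp

lemma scalar_mult: "\<lbrakk>c \<in> carrier K; c' \<in> carrier K\<rbrakk> \<Longrightarrow>
    (c \<otimes>\<^bsub>K\<^esub> c') \<odot>\<^bsub>A\<^esub> \<one>\<^bsub>A\<^esub> = (c \<odot>\<^bsub>A\<^esub> \<one>\<^bsub>A\<^esub>) \<otimes>\<^bsub>A\<^esub> (c' \<odot>\<^bsub>A\<^esub> \<one>\<^bsub>A\<^esub>)"
  by (simp add: A.smult_mult_left A.smult_assoc1)

lemma scalar_central: "\<lbrakk>c \<in> carrier K; a \<in> carrier A\<rbrakk> \<Longrightarrow>
    (c \<odot>\<^bsub>A\<^esub> \<one>\<^bsub>A\<^esub>) \<otimes>\<^bsub>A\<^esub> a = a \<otimes>\<^bsub>A\<^esub> (c \<odot>\<^bsub>A\<^esub> \<one>\<^bsub>A\<^esub>)"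
  by (simp add: A.smult_mult_left A.smult_mult_right)

lemma left_module_k_space:
  assumes M: "left_module A M"
  shows "left_module K (k_space A M)"
proof -
  interpret M: left_module A M by fact
  show ?thesis
    by (rule left_moduleI)
      (auto simp: k_smult_def A.R.ring_axioms M.M.a_ac A.smult_l_distr M.smult_l_distr M.smult_r_distr
        scalar_mult M.smult_assoc1)
qed

lemma k_smult_closed: "\<lbrakk>left_module A M; c \<in> carrier K; x \<in> carrier M\<rbrakk> \<Longrightarrow> k_smult A M c x \<in> carrier M"
  using left_module.smult_closed[OF left_module_k_space] by simp

lemma is_hom_k_smult:
  assumes "is_hom A M N f" "c \<in> carrier K" "x \<in> carrier M"
  shows "f (k_smult A M c x) = k_smult A N c (f x)"
  unfolding k_smult_def using is_hom_smult[OF assms(1) scalar_closed[OF assms(2)] assms(3)] .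

lemma smult_k_smult:
  assumes "left_module A M" "a \<in> carrier A" "c \<in> carrier K" "x \<in> carrier M"
  shows "a \<odot>\<^bsub>M\<^esub> k_smult A M c x = k_smult A M c (a \<odot>\<^bsub>M\<^esub> x)"
proof -
  interpret M: left_module A M by fact
  show ?thesis
    unfolding k_smult_def using assms(2-)
    by (simp add: scalar_central flip: M.smult_assoc1)
qed

text \<open>A scalar multiple of a homomorphism is again one because the multiples of the identity
  are central in \<open>A\<close>.\<close>

lemma left_module_Hom_space:
  assumes M: "left_module A M" and N: "left_module A N"
  shows "left_module K (Hom_space A M N)"
proof -
  interpret N: left_module A N by fact
  interpret NK: left_module K "k_space A N" by (rule left_module_k_space[OF N])
  have hom: "is_hom A M N (\<lambda>x. k_smult A N c (f x))" if "c \<in> carrier K" "f \<in> Hom_set A M N" for c f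
    using that Hom_set_closed[OF that(2)] is_hom_add[OF Hom_set_hom[OF that(2)]]
      is_hom_smult[OF Hom_set_hom[OF that(2)]] NK.smult_r_distr
    by (intro is_homI) (simp_all add: k_smult_closed[OF N] smult_k_smult[OF N])
  show ?thesis
    unfolding Hom_space_def
    by (rule left_module_Hom_set[OF M N A.R.ring_axioms hom])
      (use NK.smult_l_distr NK.smult_r_distr NK.smult_assoc1 NK.smult_one NK.smult_l_null
        Hom_set_closed[of _ A M N] in simp_all)
qed

lemma is_hom_smult_k_space:
  assumes "left_module A M" "a \<in> carrier A"
  shows "is_hom K (k_space A M) (k_space A M) (\<lambda>x. a \<odot>\<^bsub>M\<^esub> x)"
proof -
  interpret M: left_module A M by fact
  show ?thesis
    by (rule is_homI) (simp_all add: assms M.smult_r_distr smult_k_smult)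
qed

lemma left_module_k_dual:
  assumes M: "left_module A M"
  shows "left_module (opp A) (k_dual K A M)"
proof -
  interpret M: left_module A M by fact
  note MK = left_module_k_space[OF M] and KK = left_module_regular_field[OF k_algebra_field]
  have hom: "is_hom K (k_space A M) (regular K) (\<lambda>x. f (a \<odot>\<^bsub>M\<^esub> x))"
    if "a \<in> carrier (opp A)" "f \<in> Hom_set K (k_space A M) (regular K)" for a f
    using is_hom_comp[OF is_hom_smult_k_space[OF M, of a] Hom_set_hom[OF that(2)]] that(1) by simp
  have add: "f (x \<oplus>\<^bsub>M\<^esub> y) = f x \<oplus>\<^bsub>K\<^esub> f y"
    if "f \<in> Hom_set K (k_space A M) (regular K)" "x \<in> carrier M" "y \<in> carrier M" for f x y
    using is_hom_add[OF Hom_set_hom[OF that(1)], of x y] that(2,3) by simp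
  have zero: "f \<zero>\<^bsub>M\<^esub> = \<zero>\<^bsub>K\<^esub>" if "f \<in> Hom_set K (k_space A M) (regular K)" for f
    using is_hom_zero[OF MK KK Hom_set_hom[OF that]] by simp
  have "left_module (opp A) (mk_module (Hom_set K (k_space A M) (regular K)) (\<lambda>x\<in>carrier (k_space A M). \<zero>\<^bsub>regular K\<^esub>)
    (\<lambda>f g. \<lambda>x\<in>carrier (k_space A M). f x \<oplus>\<^bsub>regular K\<^esub> g x) (\<lambda>a f. \<lambda>x\<in>carrier (k_space A M). f (a \<odot>\<^bsub>M\<^esub> x)))"
    by (rule left_module_Hom_set[OF MK KK ring_opp[OF k_algebra_ring] hom])
      (simp_all add: add zero M.smult_l_distr M.smult_assoc1)
  then show ?thesis by (simp add: k_dual_def)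
qed

end

lemma left_module_k_dual_opp:
  fixes K :: "'k ring" and A :: "('k, 'a) module" and N :: "('a, 'n) module"
  assumes "k_algebra K A" "left_module (opp A) N"
  shows "left_module A (k_dual K (opp A) N)"
  using left_module_k_dual[OF k_algebra_opp[OF assms(1)] assms(2)] by simp

section \<open>Stable homomorphisms from the syzygies of a complex\<close>

text \<open>What a complete resolution says about the complex alone. Dimension shifting uses just
  this; the resolved module returns when images in the complex are compared with syzygies.\<close>

definition totally_acyclic :: "('a, 'b) ring_scheme \<Rightarrow> ('a, 't) complx \<Rightarrow> bool"
  where "totally_acyclic R T \<longleftrightarrow> is_complex R T \<and> (\<forall>n. projective R (obj T n) \<and> fin_gen R (obj T n)) \<and>
    acyclic T \<and> acyclic (dual_complex R T)"

context
  fixes R :: "('a, 'b) ring_scheme" and T :: "('a, 't) complx"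
  assumes T: "totally_acyclic R T"
begin

lemma totally_acyclic_left_module: "left_module R (obj T n)"
  and totally_acyclic_projective: "projective R (obj T n)"
  and totally_acyclic_fin_gen: "fin_gen R (obj T n)"
  and totally_acyclic_hom: "is_hom R (obj T n) (obj T (n - 1)) (diff T n)"
  and totally_acyclic_hom': "is_hom R (obj T (n + 1)) (obj T n) (diff T (n + 1))"
  using T spec[of "\<lambda>n. is_hom R (obj T n) (obj T (n - 1)) (diff T n)" "n + 1"]
  by (auto simp: totally_acyclic_def is_complex_def)

lemma totally_acyclic_diff_diff:
  "x \<in> carrier (obj T (n + 1)) \<Longrightarrow> diff T n (diff T (n + 1) x) = \<zero>\<^bsub>obj T (n - 1)\<^esub>"
  using T spec[of "\<lambda>n. \<forall>x\<in>carrier (obj T n). diff T (n - 1) (diff T n x) = \<zero>\<^bsub>obj T (n - 2)\<^esub>" "n + 1"]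
  by (auto simp: totally_acyclic_def is_complex_def)

lemma totally_acyclic_exact:
  assumes "x \<in> carrier (obj T n)" "diff T n x = \<zero>\<^bsub>obj T (n - 1)\<^esub>"
  obtains y where "y \<in> carrier (obj T (n + 1))" "x = diff T (n + 1) y"
proof -
  have "cycles T n = boundaries T n" using T by (simp add: totally_acyclic_def acyclic_def)
  then have "x \<in> boundaries T n" using assms by (auto simp: cycles_def a_kernel_eq)
  then show thesis using that by (auto simp: boundaries_def)
qed

lemma totally_acyclic_dual_exact:
  assumes u: "is_hom R (obj T n) (regular R) u"
    and z: "\<And>x. x \<in> carrier (obj T (n + 1)) \<Longrightarrow> u (diff T (n + 1) x) = \<zero>\<^bsub>R\<^esub>"
  shows "\<exists>v. is_hom R (obj T (n - 1)) (regular R) v \<and> (\<forall>x\<in>carrier (obj T n). u x = v (diff T n x))"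
proof -
  let ?u = "restrict u (carrier (obj T n))"
  \<comment> \<open>The dual complex has the dual of \<open>obj T n\<close> in degree
    \<open>- n\<close>; its cycles there are the maps that vanish on the image of
    \<open>diff T (n + 1)\<close>.\<close>
  have "cycles (dual_complex R T) (- n) = boundaries (dual_complex R T) (- n)"
    using T by (simp add: totally_acyclic_def acyclic_def)
  moreover have "?u \<in> cycles (dual_complex R T) (- n)"
    using z is_hom_closed[OF totally_acyclic_hom'[of n]] Hom_setI[OF totally_acyclic_left_module u]
    by (auto simp: cycles_def a_kernel_eq dual_complex_def compose_def add.commute intro!: restrict_ext)
  ultimately have "?u \<in> boundaries (dual_complex R T) (- n)" by simp
  then obtain v where v: "v \<in> Hom_set R (obj T (n - 1)) (regular R)" "?u = compose (carrier (obj T n)) v (diff T n)"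
    by (auto simp: boundaries_def dual_complex_def)
  have "u x = v (diff T n x)" if "x \<in> carrier (obj T n)" for x
    using fun_cong[OF v(2), of x] that by (simp add: compose_def)
  then show ?thesis using Hom_set_hom[OF v(1)] by blast
qed

lemma totally_acyclic_ring: "ring R"
proof -
  interpret left_module R "obj T 0" by (rule totally_acyclic_left_module)
  show ?thesis by (rule R.ring_axioms)
qed

text \<open>Acyclicity of the ring dual concerns maps to the ring. Through coordinates it spreads to
  exactness of \<open>Hom(T, Q)\<close> for every projective \<open>Q\<close>, which makes shifts of
  the first argument reversible.\<close>

lemma totally_acyclic_extend:
  fixes Q :: "('a, 'q) module"
  assumes Q: "projective R Q" and f: "is_hom R (obj T n) Q f"
    and z: "\<And>x. x \<in> carrier (obj T (n + 1)) \<Longrightarrow> f (diff T (n + 1) x) = \<zero>\<^bsub>Q\<^esub>"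
  obtains h where "is_hom R (obj T (n - 1)) Q h" "\<And>x. x \<in> carrier (obj T n) \<Longrightarrow> f x = h (diff T n x)"
proof (rule extend_to_projective[OF totally_acyclic_ring totally_acyclic_left_module totally_acyclic_fin_gen
      totally_acyclic_left_module totally_acyclic_hom Q f])
  fix u assume u: "is_hom R (obj T n) (regular R) u"
    and *: "\<And>x. \<lbrakk>x \<in> carrier (obj T n); f x = \<zero>\<^bsub>Q\<^esub>\<rbrakk> \<Longrightarrow> u x = \<zero>\<^bsub>R\<^esub>"
  show "\<exists>v. is_hom R (obj T (n - 1)) (regular R) v \<and> (\<forall>x\<in>carrier (obj T n). u x = v (diff T n x))"
    by (rule totally_acyclic_dual_exact[OF u])
      (use * z is_hom_closed[OF totally_acyclic_hom'] in blast)
qed (rule that)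

end

text \<open>For a surjection from \<open>Q\<close> onto \<open>q Q\<close> with \<open>Q\<close> projective, the following is the space of stable
  homomorphisms from the image of \<open>diff T i\<close> to \<open>q Q\<close>: homomorphisms modulo those that
  factor through a projective module.\<close>

definition stable_cocycles ::
    "('a, 'b) ring_scheme \<Rightarrow> ('a, 't) complx \<Rightarrow> int \<Rightarrow> ('a, 'q) module \<Rightarrow> ('q \<Rightarrow> 'y) \<Rightarrow> ('a, 'y) module \<Rightarrow> ('t \<Rightarrow> 'y) set"
  where "stable_cocycles R T i Q q Y = {f \<in> Hom_set R (obj T i) Y.
    (\<forall>x\<in>carrier (obj T (i + 1)). f (diff T (i + 1) x) = \<zero>\<^bsub>Y\<^esub>) \<and> (\<forall>x\<in>carrier (obj T i). f x \<in> q ` carrier Q)}"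

definition stable_coboundaries ::
    "('a, 'b) ring_scheme \<Rightarrow> ('a, 't) complx \<Rightarrow> int \<Rightarrow> ('a, 'q) module \<Rightarrow> ('q \<Rightarrow> 'y) \<Rightarrow> ('t \<Rightarrow> 'y) set"
  where "stable_coboundaries R T i Q q =
    {\<lambda>x\<in>carrier (obj T i). q (h (diff T i x)) | h. is_hom R (obj T (i - 1)) Q h}"

definition stable_Hom ::
    "('k, 'a) module \<Rightarrow> ('a, 't) complx \<Rightarrow> int \<Rightarrow> ('a, 'q) module \<Rightarrow> ('q \<Rightarrow> 'y) \<Rightarrow> ('a, 'y) module \<Rightarrow>
      ('k, ('t \<Rightarrow> 'y) set) module"
  where "stable_Hom A T i Q q Y =
    quotient_module ((Hom_space A (obj T i) Y)\<lparr>carrier := stable_cocycles A T i Q q Y\<rparr>)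
      (stable_coboundaries A T i Q q)"

context
  fixes K :: "'k ring" and A :: "('k, 'a) module" and T :: "('a, 't) complx"
  assumes KA: "k_algebra K A" and T: "totally_acyclic A T"
begin

lemma submodule_stable_cocycles:
  assumes Q: "left_module A Q" and Y: "left_module A Y" and q: "is_hom A Q Y q"
  shows "submodule (stable_cocycles A T i Q q Y) K (Hom_space A (obj T i) Y)"
proof -
  note Ti = totally_acyclic_left_module[OF T, of i] and d = totally_acyclic_hom'[OF T, of i]
  interpret Y: left_module A Y by (rule Y)
  interpret YK: left_module K "k_space A Y" by (rule left_module_k_space[OF KA Y])
  interpret H: left_module K "Hom_space A (obj T i) Y" by (rule left_module_Hom_space[OF KA Ti Y])
  have im: "submodule (q ` carrier Q) A Y" by (rule submodule_image[OF Q Y q left_module.submodule_carrier[OF Q]])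
  have sc: "k_smult A Y c x \<in> q ` carrier Q" if "c \<in> carrier K" "x \<in> q ` carrier Q" for c x
    unfolding k_smult_def by (rule Y.submodule_smult[OF im scalar_closed[OF KA that(1)] that(2)])
  show ?thesis
  proof (rule H.submoduleI)
    show "\<zero>\<^bsub>Hom_space A (obj T i) Y\<^esub> \<in> stable_cocycles A T i Q q Y"
      using H.M.zero_closed Y.submodule_zero[OF im] is_hom_closed[OF d]
      by (simp add: stable_cocycles_def)
  next
    fix f g assume f: "f \<in> stable_cocycles A T i Q q Y" and g: "g \<in> stable_cocycles A T i Q q Y"
    then show "f \<oplus>\<^bsub>Hom_space A (obj T i) Y\<^esub> g \<in> stable_cocycles A T i Q q Y"
      using H.M.a_closed[of f g] Y.submodule_add[OF im] is_hom_closed[OF d]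
      by (simp add: stable_cocycles_def)
  next
    fix c f assume c: "c \<in> carrier K" and f: "f \<in> stable_cocycles A T i Q q Y"
    then show "c \<odot>\<^bsub>Hom_space A (obj T i) Y\<^esub> f \<in> stable_cocycles A T i Q q Y"
      using H.smult_closed[of c f] sc[OF c] is_hom_closed[OF d] YK.smult_r_null[OF c]
      by (simp add: stable_cocycles_def)
  qed (auto simp: stable_cocycles_def)
qed

lemma stable_coboundary: "is_hom A (obj T (i - 1)) Q h \<Longrightarrow>
    (\<lambda>x\<in>carrier (obj T i). q (h (diff T i x))) \<in> stable_coboundaries A T i Q q"
  by (auto simp: stable_coboundaries_def)

lemma stable_coboundaries_subset:
  assumes Q: "left_module A Q" and Y: "left_module A Y" and q: "is_hom A Q Y q"
  shows "stable_coboundaries A T i Q q \<subseteq> stable_cocycles A T i Q q Y"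
proof
  fix f assume "f \<in> stable_coboundaries A T i Q q"
  then obtain h where h: "is_hom A (obj T (i - 1)) Q h" and f: "f = (\<lambda>x\<in>carrier (obj T i). q (h (diff T i x)))"
    by (auto simp: stable_coboundaries_def)
  note Ti = totally_acyclic_left_module[OF T] and d = totally_acyclic_hom[OF T] and d' = totally_acyclic_hom'[OF T]
  have "is_hom A (obj T i) Y (\<lambda>x. q (h (diff T i x)))"
    by (rule is_hom_comp[OF is_hom_comp[OF d h] q])
  moreover have "q (h \<zero>\<^bsub>obj T (i - 1)\<^esub>) = \<zero>\<^bsub>Y\<^esub>"
    by (rule is_hom_zero[OF Ti Y is_hom_comp[OF h q]])
  ultimately show "f \<in> stable_cocycles A T i Q q Y"
    unfolding f stable_cocycles_def
    using Hom_setI[OF Ti] is_hom_closed[OF d'] is_hom_closed[OF d] is_hom_closed[OF h]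
      totally_acyclic_diff_diff[OF T] by auto
qed

lemma submodule_stable_coboundaries:
  assumes Q: "left_module A Q" and Y: "left_module A Y" and q: "is_hom A Q Y q"
  shows "submodule (stable_coboundaries A T i Q q) K (Hom_space A (obj T i) Y)"
proof -
  note Ti = totally_acyclic_left_module[OF T] and d = totally_acyclic_hom[OF T]
  interpret Q: left_module A Q by (rule Q)
  interpret Y: left_module A Y by (rule Y)
  interpret QK: left_module K "k_space A Q" by (rule left_module_k_space[OF KA Q])
  interpret H: left_module K "Hom_space A (obj T i) Y" by (rule left_module_Hom_space[OF KA Ti Y])
  interpret H': left_module K "Hom_space A (obj T (i - 1)) Q" by (rule left_module_Hom_space[OF KA Ti Q])
  let ?p = "\<lambda>h. \<lambda>x\<in>carrier (obj T i). q (h (diff T i x))"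
  have "is_hom K (Hom_space A (obj T (i - 1)) Q) (Hom_space A (obj T i) Y) ?p"
  proof (rule is_homI)
    fix f assume f: "f \<in> carrier (Hom_space A (obj T (i - 1)) Q)"
    show "?p f \<in> carrier (Hom_space A (obj T i) Y)"
      using f Hom_setI[OF Ti is_hom_comp[OF is_hom_comp[OF d Hom_set_hom[of f A "obj T (i - 1)" Q]] q]] by simp
    fix c assume c: "c \<in> carrier K"
    show "?p (c \<odot>\<^bsub>Hom_space A (obj T (i - 1)) Q\<^esub> f) = c \<odot>\<^bsub>Hom_space A (obj T i) Y\<^esub> ?p f"
      using f c is_hom_k_smult[OF KA q c] Hom_set_closed[of f A "obj T (i - 1)" Q] is_hom_closed[OF d]
      by (auto intro!: restrict_ext)
  next
    fix f g assume f: "f \<in> carrier (Hom_space A (obj T (i - 1)) Q)"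
      and g: "g \<in> carrier (Hom_space A (obj T (i - 1)) Q)"
    show "?p (f \<oplus>\<^bsub>Hom_space A (obj T (i - 1)) Q\<^esub> g) = ?p f \<oplus>\<^bsub>Hom_space A (obj T i) Y\<^esub> ?p g"
      using f g is_hom_add[OF q] Hom_set_closed[of _ A "obj T (i - 1)" Q] is_hom_closed[OF d]
      by (auto intro!: restrict_ext)
  qed
  from submodule_image[OF H'.left_module H.left_module this H'.submodule_carrier]
  have "submodule (?p ` carrier (Hom_space A (obj T (i - 1)) Q)) K (Hom_space A (obj T i) Y)" .
  moreover have "?p ` carrier (Hom_space A (obj T (i - 1)) Q) = stable_coboundaries A T i Q q"
  proof (intro equalityI subsetI)
    fix f assume "f \<in> stable_coboundaries A T i Q q"
    then obtain h where h: "is_hom A (obj T (i - 1)) Q h" and f: "f = ?p h"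
      by (auto simp: stable_coboundaries_def)
    have "f = ?p (restrict h (carrier (obj T (i - 1))))"
      unfolding f using is_hom_closed[OF d] by (auto intro!: restrict_ext)
    then show "f \<in> ?p ` carrier (Hom_space A (obj T (i - 1)) Q)"
      by (rule image_eqI[where x = "restrict h (carrier (obj T (i - 1)))"]) (use Hom_setI[OF Ti h] in simp)
  qed (auto simp: stable_coboundaries_def Hom_set_def)
  ultimately show ?thesis by simp
qed

lemma left_module_stable_cocycles:
  assumes "left_module A Q" "left_module A Y" "is_hom A Q Y q"
  shows "left_module K ((Hom_space A (obj T i) Y)\<lparr>carrier := stable_cocycles A T i Q q Y\<rparr>)"
  by (rule left_module.left_module_restrict[OF
        left_module_Hom_space[OF KA totally_acyclic_left_module[OF T] assms(2)] submodule_stable_cocycles[OF assms]])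

lemma submodule_stable_coboundaries':
  assumes "left_module A Q" "left_module A Y" "is_hom A Q Y q"
  shows "submodule (stable_coboundaries A T i Q q) K
    ((Hom_space A (obj T i) Y)\<lparr>carrier := stable_cocycles A T i Q q Y\<rparr>)"
  by (rule left_module.submodule_restrict[OF left_module_Hom_space[OF KA totally_acyclic_left_module[OF T] assms(2)]
        submodule_stable_coboundaries[OF assms] stable_coboundaries_subset[OF assms]])
    (auto simp: stable_cocycles_def)

lemma left_module_stable_Hom:
  assumes "left_module A Q" "left_module A Y" "is_hom A Q Y q"
  shows "left_module K (stable_Hom A T i Q q Y)"
  unfolding stable_Hom_def
  by (rule left_module_quotient[OF left_module_stable_cocycles[OF assms] submodule_stable_coboundaries'[OF assms]])

end

lemma bij_inverse_hom:
  assumes M: "left_module R M" and f: "is_hom R M N f" and b: "bij_betw f (carrier M) (carrier N)"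
  obtains g where "is_hom R N M g" "\<And>x. x \<in> carrier M \<Longrightarrow> g (f x) = x" "\<And>y. y \<in> carrier N \<Longrightarrow> f (g y) = y"
proof -
  interpret M: left_module R M by (rule M)
  let ?g = "inv_into (carrier M) f"
  have fg: "f (?g y) = y" if "y \<in> carrier N" for y
    using b that by (auto simp: bij_betw_def f_inv_into_f)
  have gf: "?g (f x) = x" if "x \<in> carrier M" for x
    using b that by (auto simp: bij_betw_def)
  have g: "?g y \<in> carrier M" if "y \<in> carrier N" for y
    using b that by (auto simp: bij_betw_def inv_into_into)
  have "is_hom R N M ?g"
  proof (rule is_homI[OF g])
    fix x y assume "x \<in> carrier N" "y \<in> carrier N"
    then show "?g (x \<oplus>\<^bsub>N\<^esub> y) = ?g x \<oplus>\<^bsub>M\<^esub> ?g y"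
      using gf[of "?g x \<oplus>\<^bsub>M\<^esub> ?g y"] is_hom_add[OF f g g] fg g by simp
  next
    fix a x assume "a \<in> carrier R" "x \<in> carrier N"
    then show "?g (a \<odot>\<^bsub>N\<^esub> x) = a \<odot>\<^bsub>M\<^esub> ?g x"
      using gf[of "a \<odot>\<^bsub>M\<^esub> ?g x"] is_hom_smult[OF f _ g] fg g by simp
  qed
  then show thesis using that fg gf by blast
qed

lemma factor_surjection:
  assumes M: "left_module R M" and N: "left_module R N" and Y: "left_module R Y"
    and p: "is_hom R M N p" "p ` carrier M = carrier N" and f: "is_hom R M Y f"
    and z: "\<And>x. \<lbrakk>x \<in> carrier M; p x = \<zero>\<^bsub>N\<^esub>\<rbrakk> \<Longrightarrow> f x = \<zero>\<^bsub>Y\<^esub>"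
  obtains g where "is_hom R N Y g" "\<And>x. x \<in> carrier M \<Longrightarrow> g (p x) = f x"
proof -
  interpret M: left_module R M by (rule M)
  interpret N: left_module R N by (rule N)
  interpret Y: left_module R Y by (rule Y)
  define s where "s y = (SOME x. x \<in> carrier M \<and> p x = y)" for y
  have s: "s y \<in> carrier M \<and> p (s y) = y" if "y \<in> carrier N" for y
    unfolding s_def by (rule someI_ex) (use that p(2) in \<open>metis imageE\<close>)
  have wd: "f x = f y" if xy: "x \<in> carrier M" "y \<in> carrier M" "p x = p y" for x y
  proof -
    have "p (x \<ominus>\<^bsub>M\<^esub> y) = \<zero>\<^bsub>N\<^esub>"
      using is_hom_diff[OF M N p(1) xy(1,2)] xy(3) N.diff_eq_zero_iff[of "p y" "p y"] is_hom_closed[OF p(1) xy(2)] by simp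
    then have "f x \<ominus>\<^bsub>Y\<^esub> f y = \<zero>\<^bsub>Y\<^esub>"
      using z[of "x \<ominus>\<^bsub>M\<^esub> y"] is_hom_diff[OF M Y f xy(1,2)] xy by simp
    then show ?thesis
      using Y.diff_eq_zero_iff[OF is_hom_closed[OF f xy(1)] is_hom_closed[OF f xy(2)]] by simp
  qed
  have g: "f (s (p x)) = f x" if "x \<in> carrier M" for x
    using s[OF is_hom_closed[OF p(1) that]] wd that by blast
  have "is_hom R N Y (\<lambda>y. f (s y))"
  proof (rule is_homI)
    fix x y assume x: "x \<in> carrier N" and y: "y \<in> carrier N"
    show "f (s (x \<oplus>\<^bsub>N\<^esub> y)) = f (s x) \<oplus>\<^bsub>Y\<^esub> f (s y)"
      using g[of "s x \<oplus>\<^bsub>M\<^esub> s y"] s[OF x] s[OF y] is_hom_add[OF p(1), of "s x" "s y"]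
        is_hom_add[OF f, of "s x" "s y"] by simp
  next
    fix a x assume a: "a \<in> carrier R" and x: "x \<in> carrier N"
    show "f (s (a \<odot>\<^bsub>N\<^esub> x)) = a \<odot>\<^bsub>Y\<^esub> f (s x)"
      using g[of "a \<odot>\<^bsub>M\<^esub> s x"] s[OF x] is_hom_smult[OF p(1) a, of "s x"]
        is_hom_smult[OF f a, of "s x"] a by simp
  qed (use s is_hom_closed[OF f] in blast)
  then show thesis using that g by blast
qed

lemma stable_cocyclesD:
  assumes "f \<in> stable_cocycles A T i Q q Y"
  shows "is_hom A (obj T i) Y f" "f \<in> extensional (carrier (obj T i))"
    "\<And>x. x \<in> carrier (obj T (i + 1)) \<Longrightarrow> f (diff T (i + 1) x) = \<zero>\<^bsub>Y\<^esub>"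
    "\<And>x. x \<in> carrier (obj T i) \<Longrightarrow> f x \<in> q ` carrier Q"
  using assms by (auto simp: stable_cocycles_def Hom_set_def)

section \<open>Dimension shifting for stable homomorphisms\<close>

context
  fixes K :: "'k ring" and A :: "('k, 'a) module" and T :: "('a, 't) complx"
  assumes KA: "k_algebra K A" and T: "totally_acyclic A T"
begin

text \<open>One step of dimension shifting in both arguments at once; a class in degree \<open>i\<close> and
  one in degree \<open>i + 1\<close> correspond if both come from a common map \<open>obj T i \<rightarrow> Q1\<close>.\<close>

lemma stable_Hom_shift:
  fixes Q1 :: "('a, 'q) module" and Q2 :: "('a, 'r) module" and Y :: "('a, 'y) module"
  assumes Y: "left_module A Y" and Q1: "projective A Q1" and Q2: "left_module A Q2"
    and q1: "is_hom A Q1 Y q1" and q2: "is_hom A Q2 Q1 q2"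
    and ex: "q2 ` carrier Q2 = {x \<in> carrier Q1. q1 x = \<zero>\<^bsub>Y\<^esub>}"
  shows "mod_iso K (stable_Hom A T i Q1 q1 Y) (stable_Hom A T (i + 1) Q2 q2 Q1)"
proof -
  have Q1': "left_module A Q1" using Q1 by (simp add: projective_def)
  interpret Y: left_module A Y by (rule Y)
  interpret Q1: left_module A Q1 by (rule Q1')
  interpret Q2: left_module A Q2 by (rule Q2)
  note Tl = totally_acyclic_left_module[OF T] and Tp = totally_acyclic_projective[OF T]
    and d = totally_acyclic_hom[OF T] and d' = totally_acyclic_hom'[OF T] and dd = totally_acyclic_diff_diff[OF T]
  have ii: "i + 1 - 1 = i" by simp
  define G where "G = {(\<lambda>x\<in>carrier (obj T i). q1 (h x), \<lambda>x\<in>carrier (obj T (i + 1)). h (diff T (i + 1) x)) | h.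
    is_hom A (obj T i) Q1 h \<and> (\<forall>x\<in>carrier (obj T (i + 1)). q1 (h (diff T (i + 1) x)) = \<zero>\<^bsub>Y\<^esub>)}"
  have GI: "(u, v) \<in> G" if "is_hom A (obj T i) Q1 h" "\<And>x. x \<in> carrier (obj T (i + 1)) \<Longrightarrow> q1 (h (diff T (i + 1) x)) = \<zero>\<^bsub>Y\<^esub>"
    "u = (\<lambda>x\<in>carrier (obj T i). q1 (h x))" "v = (\<lambda>x\<in>carrier (obj T (i + 1)). h (diff T (i + 1) x))" for u v h
    using that unfolding G_def by blast
  have GE: "\<exists>h. is_hom A (obj T i) Q1 h \<and> (\<forall>x\<in>carrier (obj T (i + 1)). q1 (h (diff T (i + 1) x)) = \<zero>\<^bsub>Y\<^esub>) \<and>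
    u = (\<lambda>x\<in>carrier (obj T i). q1 (h x)) \<and> v = (\<lambda>x\<in>carrier (obj T (i + 1)). h (diff T (i + 1) x))"
    if "(u, v) \<in> G" for u v
    using that unfolding G_def by blast
  let ?M = "(Hom_space A (obj T i) Y)\<lparr>carrier := stable_cocycles A T i Q1 q1 Y\<rparr>"
  let ?N = "(Hom_space A (obj T (i + 1)) Q1)\<lparr>carrier := stable_cocycles A T (i + 1) Q2 q2 Q1\<rparr>"
  show ?thesis
    unfolding stable_Hom_def
  proof (rule quotient_iso_quotient_relation[OF left_module_stable_cocycles[OF KA T Q1' Y q1]
        left_module_stable_cocycles[OF KA T Q2 Q1' q2]
        submodule_stable_coboundaries'[OF KA T Q1' Y q1] submodule_stable_coboundaries'[OF KA T Q2 Q1' q2], of G])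
    fix u v assume "(u, v) \<in> G"
    then obtain h where h: "is_hom A (obj T i) Q1 h" "\<forall>x\<in>carrier (obj T (i + 1)). q1 (h (diff T (i + 1) x)) = \<zero>\<^bsub>Y\<^esub>"
      "u = (\<lambda>x\<in>carrier (obj T i). q1 (h x))" "v = (\<lambda>x\<in>carrier (obj T (i + 1)). h (diff T (i + 1) x))"
      using GE by blast
    have "u \<in> stable_cocycles A T i Q1 q1 Y"
      using Hom_setI[OF Tl is_hom_comp[OF h(1) q1]] is_hom_closed[OF d'] h(2) is_hom_closed[OF h(1)]
      by (auto simp: stable_cocycles_def h(3))
    moreover have "v \<in> stable_cocycles A T (i + 1) Q2 q2 Q1"
      using Hom_setI[OF Tl is_hom_comp[OF d' h(1)]] is_hom_closed[OF d'] is_hom_closed[OF d'[of "i + 1"]]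
        h(2) is_hom_closed[OF h(1)] dd[of _ "i + 1"] is_hom_zero[OF Tl Q1' h(1)]
      by (auto simp: stable_cocycles_def h(4) ex)
    ultimately show "u \<in> carrier ?M \<and> v \<in> carrier ?N" by simp
    show "u \<in> stable_coboundaries A T i Q1 q1 \<longleftrightarrow> v \<in> stable_coboundaries A T (i + 1) Q2 q2"
    proof
      assume "u \<in> stable_coboundaries A T i Q1 q1"
      then obtain k where k: "is_hom A (obj T (i - 1)) Q1 k" "u = (\<lambda>x\<in>carrier (obj T i). q1 (k (diff T i x)))"
        by (auto simp: stable_coboundaries_def)
      have kd: "is_hom A (obj T i) Q1 (\<lambda>x. k (diff T i x))" by (rule is_hom_comp[OF d k(1)])
      \<comment> \<open>\<open>h - k d\<close> takes values in the kernel of \<open>q1\<close>,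
        which is the image of \<open>q2\<close>, so it lifts to some \<open>s\<close> by
        projectivity of \<open>obj T i\<close>. Restriction to boundaries removes the summand with
        \<open>k\<close>.\<close>
      have diff: "is_hom A (obj T i) Q1 (\<lambda>x. h x \<ominus>\<^bsub>Q1\<^esub> k (diff T i x))"
        by (rule is_hom_diff_map[OF Q1' h(1) kd])
      have "h x \<ominus>\<^bsub>Q1\<^esub> k (diff T i x) \<in> q2 ` carrier Q2" if x: "x \<in> carrier (obj T i)" for x
      proof -
        have "q1 (h x) = q1 (k (diff T i x))" using fun_cong[OF k(2), of x] x h(3) by simp
        then have "q1 (h x \<ominus>\<^bsub>Q1\<^esub> k (diff T i x)) = \<zero>\<^bsub>Y\<^esub>"
          using is_hom_diff[OF Q1' Y q1 is_hom_closed[OF h(1) x] is_hom_closed[OF kd x]]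
            Y.diff_eq_zero_iff is_hom_closed[OF q1 is_hom_closed[OF kd x]] by simp
        then show ?thesis using is_hom_closed[OF diff x] by (simp add: ex)
      qed
      then obtain s where s: "is_hom A (obj T i) Q2 s"
        "\<And>x. x \<in> carrier (obj T i) \<Longrightarrow> q2 (s x) = h x \<ominus>\<^bsub>Q1\<^esub> k (diff T i x)"
        using projective_lift[OF k_algebra_ring[OF KA] Tp Q2 Q1' q2 diff] by blast
      have "v = (\<lambda>x\<in>carrier (obj T (i + 1)). q2 (s (diff T (i + 1) x)))"
        using s(2) is_hom_closed[OF d'] dd is_hom_zero[OF Tl Q1' k(1)] is_hom_closed[OF h(1)]
        by (auto simp: h(4) a_minus_def Q1.diff_zero intro!: restrict_ext)
      then show "v \<in> stable_coboundaries A T (i + 1) Q2 q2"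
        using stable_coboundary[OF KA T, of "i + 1" Q2 s q2] s(1) by simp
    next
      assume "v \<in> stable_coboundaries A T (i + 1) Q2 q2"
      then obtain s where s: "is_hom A (obj T i) Q2 s"
        "v = (\<lambda>x\<in>carrier (obj T (i + 1)). q2 (s (diff T (i + 1) x)))"
        by (auto simp: stable_coboundaries_def)
      have q2s: "is_hom A (obj T i) Q1 (\<lambda>x. q2 (s x))" by (rule is_hom_comp[OF s(1) q2])
      \<comment> \<open>\<open>h - q2 s\<close> vanishes on boundaries and therefore extends to
        \<open>obj T (i - 1)\<close>, as \<open>Q1\<close> is projective. Composition with
        \<open>q1\<close> removes the summand with \<open>q2\<close>.\<close>
      have diff: "is_hom A (obj T i) Q1 (\<lambda>x. h x \<ominus>\<^bsub>Q1\<^esub> q2 (s x))"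
        by (rule is_hom_diff_map[OF Q1' h(1) q2s])
      have "h (diff T (i + 1) x) \<ominus>\<^bsub>Q1\<^esub> q2 (s (diff T (i + 1) x)) = \<zero>\<^bsub>Q1\<^esub>" if x: "x \<in> carrier (obj T (i + 1))" for x
        using fun_cong[OF s(2), of x] x h(4) Q1.diff_eq_zero_iff is_hom_closed[OF q2s is_hom_closed[OF d' x]] by simp
      then obtain k where k: "is_hom A (obj T (i - 1)) Q1 k"
        "\<And>x. x \<in> carrier (obj T i) \<Longrightarrow> h x \<ominus>\<^bsub>Q1\<^esub> q2 (s x) = k (diff T i x)"
        using totally_acyclic_extend[OF T Q1 diff] by blast
      have "q1 (h x) = q1 (k (diff T i x))" if x: "x \<in> carrier (obj T i)" for x
      proof -
        have c: "h x \<in> carrier Q1" "q2 (s x) \<in> carrier Q1" "q1 (q2 (s x)) = \<zero>\<^bsub>Y\<^esub>"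
          using is_hom_closed[OF h(1) x] is_hom_closed[OF q2s x] is_hom_closed[OF s(1) x] ex by auto
        then show ?thesis
          using is_hom_diff[OF Q1' Y q1 c(1,2)] k(2)[OF x] is_hom_closed[OF q1 c(1)]
          by (simp add: a_minus_def Y.diff_zero)
      qed
      then have "u = (\<lambda>x\<in>carrier (obj T i). q1 (k (diff T i x)))"
        by (auto simp: h(3) intro!: restrict_ext)
      then show "u \<in> stable_coboundaries A T i Q1 q1"
        using stable_coboundary[OF KA T k(1)] by simp
    qed
  next
    fix u assume "u \<in> carrier ?M"
    then have "u \<in> stable_cocycles A T i Q1 q1 Y" by simp
    note u = stable_cocyclesD[OF this]
    obtain h where h: "is_hom A (obj T i) Q1 h" "\<And>x. x \<in> carrier (obj T i) \<Longrightarrow> q1 (h x) = u x"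
      using projective_lift[OF k_algebra_ring[OF KA] Tp Q1' Y q1 u(1) u(4)] by blast
    have "u = (\<lambda>x\<in>carrier (obj T i). q1 (h x))"
      using u(2) h(2) by (auto intro!: extensionalityI)
    then have "(u, \<lambda>x\<in>carrier (obj T (i + 1)). h (diff T (i + 1) x)) \<in> G"
      using h u(3) is_hom_closed[OF d'] by (intro GI[of h]) auto
    then show "\<exists>v. (u, v) \<in> G" by blast
  next
    fix v assume "v \<in> carrier ?N"
    then have "v \<in> stable_cocycles A T (i + 1) Q2 q2 Q1" by simp
    note v = stable_cocyclesD[OF this]
    \<comment> \<open>A cocycle in degree \<open>i\<close> came from \<open>h\<close> by lifting it
      along \<open>q1\<close>; one in degree \<open>i + 1\<close> comes from an extension along the
      differential, which rests on acyclicity of the dual complex.\<close>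
    obtain h where h: "is_hom A (obj T i) Q1 h" "\<And>x. x \<in> carrier (obj T (i + 1)) \<Longrightarrow> v x = h (diff T (i + 1) x)"
      using totally_acyclic_extend[OF T Q1 v(1) v(3)] unfolding ii by blast
    have "v = (\<lambda>x\<in>carrier (obj T (i + 1)). h (diff T (i + 1) x))"
      using v(2) h(2) by (auto intro!: extensionalityI)
    then have "(\<lambda>x\<in>carrier (obj T i). q1 (h x), v) \<in> G"
      using h v(4) ex by (intro GI[of h]) auto
    then show "\<exists>u. (u, v) \<in> G" by blast
  next
    fix u v u' v' assume "(u, v) \<in> G" "(u', v') \<in> G"
    then obtain h h' where h: "is_hom A (obj T i) Q1 h" "\<forall>x\<in>carrier (obj T (i + 1)). q1 (h (diff T (i + 1) x)) = \<zero>\<^bsub>Y\<^esub>"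
      "u = (\<lambda>x\<in>carrier (obj T i). q1 (h x))" "v = (\<lambda>x\<in>carrier (obj T (i + 1)). h (diff T (i + 1) x))"
      and h': "is_hom A (obj T i) Q1 h'" "\<forall>x\<in>carrier (obj T (i + 1)). q1 (h' (diff T (i + 1) x)) = \<zero>\<^bsub>Y\<^esub>"
      "u' = (\<lambda>x\<in>carrier (obj T i). q1 (h' x))" "v' = (\<lambda>x\<in>carrier (obj T (i + 1)). h' (diff T (i + 1) x))"
      using GE by meson
    have "(\<lambda>x\<in>carrier (obj T i). u x \<oplus>\<^bsub>Y\<^esub> u' x, \<lambda>x\<in>carrier (obj T (i + 1)). v x \<oplus>\<^bsub>Q1\<^esub> v' x) \<in> G"
      by (rule GI[OF is_hom_add_map[OF Q1' h(1) h'(1)]])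
        (use h h' is_hom_closed[OF d'] is_hom_closed[OF h(1)] is_hom_closed[OF h'(1)] is_hom_add[OF q1]
          in \<open>auto intro!: restrict_ext\<close>)
    then show "(u \<oplus>\<^bsub>?M\<^esub> u', v \<oplus>\<^bsub>?N\<^esub> v') \<in> G" by simp
  next
    fix c u v assume c: "c \<in> carrier K" and "(u, v) \<in> G"
    then obtain h where h: "is_hom A (obj T i) Q1 h" "\<forall>x\<in>carrier (obj T (i + 1)). q1 (h (diff T (i + 1) x)) = \<zero>\<^bsub>Y\<^esub>"
      "u = (\<lambda>x\<in>carrier (obj T i). q1 (h x))" "v = (\<lambda>x\<in>carrier (obj T (i + 1)). h (diff T (i + 1) x))"
      using GE by blast
    have ch: "is_hom A (obj T i) Q1 (\<lambda>x. k_smult A Q1 c (h x))"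
      using is_hom_closed[OF h(1)] is_hom_add[OF h(1)] is_hom_smult[OF h(1)] k_smult_closed[OF KA Q1' c]
        left_module.smult_r_distr[OF left_module_k_space[OF KA Q1'] c] smult_k_smult[OF KA Q1' _ c]
      by (intro is_homI) auto
    have 0: "k_smult A Y c \<zero>\<^bsub>Y\<^esub> = \<zero>\<^bsub>Y\<^esub>"
      using left_module.smult_r_null[OF left_module_k_space[OF KA Y] c] by simp
    have "(\<lambda>x\<in>carrier (obj T i). k_smult A Y c (u x), \<lambda>x\<in>carrier (obj T (i + 1)). k_smult A Q1 c (v x)) \<in> G"
      by (rule GI[OF ch])
        (use h is_hom_closed[OF d'] is_hom_closed[OF h(1)] is_hom_k_smult[OF KA q1 c] 0 in \<open>auto intro!: restrict_ext\<close>)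
    then show "(c \<odot>\<^bsub>?M\<^esub> u, c \<odot>\<^bsub>?N\<^esub> v) \<in> G" by simp
  qed
qed

end

text \<open>With boundaries as \<open>B\<close> and \<open>C\<close> this treats maps that are
  inverse to each other up to boundaries. Stable equivalences and genuine isomorphisms of the
  arguments both enter homology through it.\<close>

lemma quotient_iso_inverse_maps:
  assumes M: "left_module R M" and N: "left_module R N" and B: "submodule B R M" and C: "submodule C R N"
    and r: "is_hom R M N r" and p: "is_hom R N M p"
    and rB: "\<And>x. x \<in> B \<Longrightarrow> r x \<in> C" and pC: "\<And>y. y \<in> C \<Longrightarrow> p y \<in> B"
    and pr: "\<And>x. x \<in> carrier M \<Longrightarrow> \<exists>b\<in>B. x = p (r x) \<oplus>\<^bsub>M\<^esub> b"
    and rp: "\<And>y. y \<in> carrier N \<Longrightarrow> \<exists>c\<in>C. y = r (p y) \<oplus>\<^bsub>N\<^esub> c"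
  shows "mod_iso R (quotient_module M B) (quotient_module N C)"
proof -
  interpret M: left_module R M by (rule M)
  interpret N: left_module R N by (rule N)
  note Bc = M.submodule_subset[OF B, THEN subsetD] and Cc = N.submodule_subset[OF C, THEN subsetD]
  define G where "G = {(p y \<oplus>\<^bsub>M\<^esub> b, y) | y b. y \<in> carrier N \<and> b \<in> B}"
  have GI: "(x, y) \<in> G" if "y \<in> carrier N" "b \<in> B" "x = p y \<oplus>\<^bsub>M\<^esub> b" for x y b
    using that unfolding G_def by blast
  have GE: "\<exists>b\<in>B. y \<in> carrier N \<and> x = p y \<oplus>\<^bsub>M\<^esub> b" if "(x, y) \<in> G" for x y
    using that unfolding G_def by blast
  have cancel: "x \<in> B" if xc: "x \<in> carrier M" and b: "b \<in> B" and xb: "x \<oplus>\<^bsub>M\<^esub> b \<in> B" for x b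
  proof -
    have "(x \<oplus>\<^bsub>M\<^esub> b) \<ominus>\<^bsub>M\<^esub> b = x" using xc Bc[OF b] by (simp add: a_minus_def M.M.a_assoc M.M.r_neg)
    then show ?thesis using M.submodule_diff[OF B xb b] by simp
  qed
  show ?thesis
  proof (rule quotient_iso_quotient_relation[OF M N B C, of G])
    fix x y assume "(x, y) \<in> G"
    then obtain b where b: "b \<in> B" "y \<in> carrier N" "x = p y \<oplus>\<^bsub>M\<^esub> b" using GE by blast
    show "x \<in> carrier M \<and> y \<in> carrier N" using b Bc is_hom_closed[OF p] by simp
    show "x \<in> B \<longleftrightarrow> y \<in> C"
    proof
      assume "x \<in> B"
      then have "p y \<in> B" using cancel[OF is_hom_closed[OF p b(2)] b(1)] b(3) by simp
      then have *: "r (p y) \<in> C" by (rule rB)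
      obtain c where "c \<in> C" "y = r (p y) \<oplus>\<^bsub>N\<^esub> c" using rp[OF b(2)] by blast
      then show "y \<in> C" using N.submodule_add[OF C *] by metis
    next
      assume "y \<in> C"
      then show "x \<in> B" using M.submodule_add[OF B pC b(1)] b(3) by simp
    qed
  next
    fix x assume x: "x \<in> carrier M"
    then obtain b where "b \<in> B" "x = p (r x) \<oplus>\<^bsub>M\<^esub> b" using pr by blast
    then show "\<exists>y. (x, y) \<in> G" using GI is_hom_closed[OF r x] by blast
  next
    fix y assume "y \<in> carrier N"
    then show "\<exists>x. (x, y) \<in> G" using GI M.submodule_zero[OF B] by blast
  next
    fix x y x' y' assume "(x, y) \<in> G" "(x', y') \<in> G"
    then obtain b b' where b: "b \<in> B" "y \<in> carrier N" "x = p y \<oplus>\<^bsub>M\<^esub> b" "b' \<in> B" "y' \<in> carrier N" "x' = p y' \<oplus>\<^bsub>M\<^esub> b'"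
      using GE by meson
    show "(x \<oplus>\<^bsub>M\<^esub> x', y \<oplus>\<^bsub>N\<^esub> y') \<in> G"
      by (rule GI[OF _ M.submodule_add[OF B b(1,4)]])
        (use b Bc is_hom_closed[OF p] in \<open>simp_all add: is_hom_add[OF p] M.M.a_ac\<close>)
  next
    fix a x y assume a: "a \<in> carrier R" and "(x, y) \<in> G"
    then obtain b where b: "b \<in> B" "y \<in> carrier N" "x = p y \<oplus>\<^bsub>M\<^esub> b" using GE by blast
    show "(a \<odot>\<^bsub>M\<^esub> x, a \<odot>\<^bsub>N\<^esub> y) \<in> G"
      by (rule GI[OF _ M.submodule_smult[OF B a b(1)]])
        (use b a Bc is_hom_closed[OF p] in \<open>simp_all add: is_hom_smult[OF p] M.smult_r_distr\<close>)
  qed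
qed

text \<open>In degree \<open>m\<close>, \<open>Hom A W U\<close> computes stable homomorphisms from \<open>W\<close> to the kernel of
  \<open>diff U m\<close>.\<close>

definition cov_homology ::
    "('k, 'a) module \<Rightarrow> ('a, 'w) module \<Rightarrow> ('a, 'u) complx \<Rightarrow> int \<Rightarrow> ('k, ('w \<Rightarrow> 'u) set) module"
  where "cov_homology A W U m =
    quotient_module
      ((Hom_space A W (obj U m))\<lparr>carrier := {h \<in> carrier (Hom_space A W (obj U m)).
        (\<lambda>w\<in>carrier W. diff U m (h w)) = \<zero>\<^bsub>Hom_space A W (obj U (m - 1))\<^esub>}\<rparr>)
      ((\<lambda>h. \<lambda>w\<in>carrier W. diff U (m + 1) (h w)) ` carrier (Hom_space A W (obj U (m + 1))))"

text \<open>Isomorphism modulo maps that factor through a projective module: the identity differs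
  from \<open>\<beta> \<alpha>\<close> by a map through \<open>F\<close>, and from
  \<open>\<alpha> \<beta>\<close> by one through \<open>G\<close>. Keeping the factorisations
  instead of an isomorphism of \<open>X \<oplus> G\<close> with \<open>Y \<oplus> F\<close> avoids
  direct sums, and these factorisations are what the lifting argument for kernels consumes and
  returns.\<close>

definition stably_equivalent ::
    "('a, 'b) ring_scheme \<Rightarrow> ('a, 'x) module \<Rightarrow> ('a, 'f) module \<Rightarrow> ('a, 'y) module \<Rightarrow> ('a, 'g) module \<Rightarrow> bool"
  where "stably_equivalent R X F Y G \<longleftrightarrow> projective R F \<and> projective R G \<and>
    (\<exists>\<alpha> \<beta> u v u' v'. is_hom R X Y \<alpha> \<and> is_hom R Y X \<beta> \<and>
      is_hom R X F u \<and> is_hom R F X v \<and> (\<forall>x\<in>carrier X. x = \<beta> (\<alpha> x) \<oplus>\<^bsub>X\<^esub> v (u x)) \<and>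
      is_hom R Y G u' \<and> is_hom R G Y v' \<and> (\<forall>y\<in>carrier Y. y = \<alpha> (\<beta> y) \<oplus>\<^bsub>Y\<^esub> v' (u' y)))"

section \<open>Homology of Hom(W, U) under stable equivalence of W\<close>

context
  fixes K :: "'k ring" and A :: "('k, 'a) module"
  assumes KA: "k_algebra K A"
begin

lemma is_hom_Hom_post:
  assumes W: "left_module A W" and q: "is_hom A Y Y' q"
  shows "is_hom K (Hom_space A W Y) (Hom_space A W Y') (\<lambda>h. \<lambda>w\<in>carrier W. q (h w))"
proof (rule is_homI)
  fix h assume h: "h \<in> carrier (Hom_space A W Y)"
  show "(\<lambda>w\<in>carrier W. q (h w)) \<in> carrier (Hom_space A W Y')"
    using Hom_setI[OF W is_hom_comp[OF Hom_set_hom[of h A W Y] q]] h by simp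
next
  fix h h' assume "h \<in> carrier (Hom_space A W Y)" "h' \<in> carrier (Hom_space A W Y)"
  then show "(\<lambda>w\<in>carrier W. q ((h \<oplus>\<^bsub>Hom_space A W Y\<^esub> h') w)) =
      (\<lambda>w\<in>carrier W. q (h w)) \<oplus>\<^bsub>Hom_space A W Y'\<^esub> (\<lambda>w\<in>carrier W. q (h' w))"
    using Hom_set_closed[of _ A W Y] is_hom_add[OF q] by (auto intro!: restrict_ext)
next
  fix c h assume "c \<in> carrier K" "h \<in> carrier (Hom_space A W Y)"
  then show "(\<lambda>w\<in>carrier W. q ((c \<odot>\<^bsub>Hom_space A W Y\<^esub> h) w)) =
      c \<odot>\<^bsub>Hom_space A W Y'\<^esub> (\<lambda>w\<in>carrier W. q (h w))"
    using Hom_set_closed[of _ A W Y] is_hom_k_smult[OF KA q] by (auto intro!: restrict_ext)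
qed

context
  fixes U :: "('a, 'u) complx" and m :: int
  assumes U: "totally_acyclic A U"
begin

abbreviation (input) cov_cycles :: "('a, 'w) module \<Rightarrow> ('w \<Rightarrow> 'u) set"
  where "cov_cycles W \<equiv> {h \<in> carrier (Hom_space A W (obj U m)).
        (\<lambda>w\<in>carrier W. diff U m (h w)) = \<zero>\<^bsub>Hom_space A W (obj U (m - 1))\<^esub>}"

abbreviation (input) cov_boundaries :: "('a, 'w) module \<Rightarrow> ('w \<Rightarrow> 'u) set"
  where "cov_boundaries W \<equiv>
    (\<lambda>h. \<lambda>w\<in>carrier W. diff U (m + 1) (h w)) ` carrier (Hom_space A W (obj U (m + 1)))"

lemma cov_cycles_iff: "h \<in> cov_cycles W \<longleftrightarrow>
    h \<in> Hom_set A W (obj U m) \<and> (\<forall>w\<in>carrier W. diff U m (h w) = \<zero>\<^bsub>obj U (m - 1)\<^esub>)"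
  by (auto simp: restrict_def fun_eq_iff)

lemma cov_boundariesI: "left_module A W \<Longrightarrow> is_hom A W (obj U (m + 1)) k \<Longrightarrow>
    (\<lambda>w\<in>carrier W. diff U (m + 1) (k w)) \<in> cov_boundaries W"
  by (rule image_eqI[where x = "restrict k (carrier W)"]) (use Hom_setI[of A W _ k] in \<open>auto intro!: restrict_ext\<close>)

lemma cov_boundariesE:
  assumes "h \<in> cov_boundaries W"
  obtains k where "is_hom A W (obj U (m + 1)) k" "h = (\<lambda>w\<in>carrier W. diff U (m + 1) (k w))"
  using assms by (auto simp: Hom_set_def)

lemma submodule_cov_cycles:
  assumes W: "left_module A W"
  shows "submodule (cov_cycles W) K (Hom_space A W (obj U m))"
  by (rule submodule_kernel[OF left_module_Hom_space[OF KA W] left_module_Hom_space[OF KA W]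
        is_hom_Hom_post[OF W totally_acyclic_hom[OF U]]]) (rule totally_acyclic_left_module[OF U])+

lemma left_module_cov_cycles:
  assumes W: "left_module A W"
  shows "left_module K ((Hom_space A W (obj U m))\<lparr>carrier := cov_cycles W\<rparr>)"
  by (rule left_module.left_module_restrict[OF left_module_Hom_space[OF KA W] submodule_cov_cycles[OF W]])
    (rule totally_acyclic_left_module[OF U])

lemma submodule_cov_boundaries:
  assumes W: "left_module A W"
  shows "submodule (cov_boundaries W) K ((Hom_space A W (obj U m))\<lparr>carrier := cov_cycles W\<rparr>)"
proof (rule left_module.submodule_restrict)
  note H = left_module_Hom_space[OF KA W totally_acyclic_left_module[OF U]]
  show "left_module K (Hom_space A W (obj U m))" by (rule H)
  show "submodule (cov_boundaries W) K (Hom_space A W (obj U m))"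
    by (rule submodule_image[OF H H is_hom_Hom_post[OF W totally_acyclic_hom'[OF U]] left_module.submodule_carrier[OF H]])
  show "cov_boundaries W \<subseteq> cov_cycles W"
  proof
    fix h assume "h \<in> cov_boundaries W"
    then obtain k where k: "is_hom A W (obj U (m + 1)) k" "h = (\<lambda>w\<in>carrier W. diff U (m + 1) (k w))"
      by (rule cov_boundariesE)
    then show "h \<in> cov_cycles W"
      unfolding cov_cycles_iff
      using Hom_setI[OF W is_hom_comp[OF k(1) totally_acyclic_hom'[OF U]]]
        totally_acyclic_diff_diff[OF U] is_hom_closed[OF k(1)] by simp
  qed
qed auto

text \<open>Cycles of \<open>U\<close> are boundaries, and \<open>F\<close> is projective: hence
  \<open>Hom(F, U)\<close> is exact, which makes every map through a projective module null.\<close>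

lemma cov_cycle_lift:
  assumes F: "projective A F" and h: "is_hom A F (obj U m) h"
    and z: "\<And>x. x \<in> carrier F \<Longrightarrow> diff U m (h x) = \<zero>\<^bsub>obj U (m - 1)\<^esub>"
  obtains k where "is_hom A F (obj U (m + 1)) k" "\<And>x. x \<in> carrier F \<Longrightarrow> diff U (m + 1) (k x) = h x"
proof -
  have "h x \<in> diff U (m + 1) ` carrier (obj U (m + 1))" if "x \<in> carrier F" for x
    using totally_acyclic_exact[OF U is_hom_closed[OF h that] z[OF that]] by blast
  then show thesis
    using projective_lift[OF k_algebra_ring[OF KA] F totally_acyclic_left_module[OF U] totally_acyclic_left_module[OF U]
        totally_acyclic_hom'[OF U] h] that by blast
qed

lemma cov_cycles_pull:
  assumes X: "left_module A X" and Y: "left_module A Y" and \<alpha>: "is_hom A X Y \<alpha>"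
  shows "is_hom K ((Hom_space A Y (obj U m))\<lparr>carrier := cov_cycles Y\<rparr>)
    ((Hom_space A X (obj U m))\<lparr>carrier := cov_cycles X\<rparr>) (\<lambda>h. \<lambda>x\<in>carrier X. h (\<alpha> x))"
proof (rule is_homI)
  fix h assume "h \<in> carrier ((Hom_space A Y (obj U m))\<lparr>carrier := cov_cycles Y\<rparr>)"
  then have h: "h \<in> Hom_set A Y (obj U m)" "\<forall>w\<in>carrier Y. diff U m (h w) = \<zero>\<^bsub>obj U (m - 1)\<^esub>"
    by (simp_all add: restrict_def fun_eq_iff) metis
  have "(\<lambda>x\<in>carrier X. h (\<alpha> x)) \<in> cov_cycles X"
    unfolding cov_cycles_iff
    using Hom_setI[OF X is_hom_comp[OF \<alpha> Hom_set_hom[OF h(1)]]] h(2) is_hom_closed[OF \<alpha>] by simp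
  then show "(\<lambda>x\<in>carrier X. h (\<alpha> x)) \<in> carrier ((Hom_space A X (obj U m))\<lparr>carrier := cov_cycles X\<rparr>)"
    by simp
qed (use is_hom_closed[OF \<alpha>] in \<open>auto intro!: restrict_ext\<close>)

lemma cov_boundaries_pull:
  assumes X: "left_module A X" and \<alpha>: "is_hom A X Y \<alpha>" and h: "h \<in> cov_boundaries Y"
  shows "(\<lambda>x\<in>carrier X. h (\<alpha> x)) \<in> cov_boundaries X"
proof -
  obtain k where k: "is_hom A Y (obj U (m + 1)) k" "h = (\<lambda>w\<in>carrier Y. diff U (m + 1) (k w))"
    using h by (rule cov_boundariesE)
  have "(\<lambda>x\<in>carrier X. h (\<alpha> x)) = (\<lambda>x\<in>carrier X. diff U (m + 1) (k (\<alpha> x)))"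
    using is_hom_closed[OF \<alpha>] by (auto simp: k(2) intro!: restrict_ext)
  then show ?thesis using cov_boundariesI[OF X is_hom_comp[OF \<alpha> k(1)]] by simp
qed

text \<open>\<open>h\<close> differs from \<open>h \<beta> \<alpha>\<close> by \<open>h v u\<close>.
  The part \<open>h v\<close> starts at the projective \<open>F\<close> and consists of cycles, so
  it lifts to \<open>obj U (m + 1)\<close>; the lift composed with \<open>u\<close> bounds the
  difference.\<close>

lemma cov_homology_null:
  assumes X: "left_module A X" and F: "projective A F"
    and \<alpha>: "is_hom A X Y \<alpha>" and \<beta>: "is_hom A Y X \<beta>" and u: "is_hom A X F u" and v: "is_hom A F X v"
    and uv: "\<And>x. x \<in> carrier X \<Longrightarrow> x = \<beta> (\<alpha> x) \<oplus>\<^bsub>X\<^esub> v (u x)"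
    and h: "h \<in> cov_cycles X"
  shows "\<exists>b\<in>cov_boundaries X. h = (\<lambda>x\<in>carrier X. (\<lambda>y\<in>carrier Y. h (\<beta> y)) (\<alpha> x)) \<oplus>\<^bsub>Hom_space A X (obj U m)\<^esub> b"
proof -
  have hX: "h \<in> Hom_set A X (obj U m)" "\<And>x. x \<in> carrier X \<Longrightarrow> diff U m (h x) = \<zero>\<^bsub>obj U (m - 1)\<^esub>"
    using h unfolding cov_cycles_iff by auto
  note hh = Hom_set_hom[OF hX(1)]
  obtain k where k: "is_hom A F (obj U (m + 1)) k" "\<And>x. x \<in> carrier F \<Longrightarrow> diff U (m + 1) (k x) = h (v x)"
    using cov_cycle_lift[OF F is_hom_comp[OF v hh]] hX(2) is_hom_closed[OF v] by blast
  have "h x = h (\<beta> (\<alpha> x)) \<oplus>\<^bsub>obj U m\<^esub> diff U (m + 1) (k (u x))" if x: "x \<in> carrier X" for x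
  proof -
    have c: "\<beta> (\<alpha> x) \<in> carrier X" "v (u x) \<in> carrier X" "u x \<in> carrier F"
      using is_hom_closed[OF \<beta> is_hom_closed[OF \<alpha> x]] is_hom_closed[OF v is_hom_closed[OF u x]]
        is_hom_closed[OF u x] by auto
    have "h x = h (\<beta> (\<alpha> x) \<oplus>\<^bsub>X\<^esub> v (u x))" using uv[OF x] by simp
    then show ?thesis using is_hom_add[OF hh c(1,2)] k(2)[OF c(3)] by simp
  qed
  then have "h = (\<lambda>x\<in>carrier X. (\<lambda>y\<in>carrier Y. h (\<beta> y)) (\<alpha> x)) \<oplus>\<^bsub>Hom_space A X (obj U m)\<^esub>
      (\<lambda>x\<in>carrier X. diff U (m + 1) (k (u x)))"
    using is_hom_closed[OF \<alpha>] by (subst Hom_set_restrict[OF hX(1), symmetric]) (auto intro!: restrict_ext)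
  then show ?thesis using cov_boundariesI[OF X is_hom_comp[OF u k(1)]] by blast
qed

lemma cov_homology_stably_equivalent:
  assumes X: "left_module A X" and Y: "left_module A Y" and XY: "stably_equivalent A X F Y G"
  shows "mod_iso K (cov_homology A X U m) (cov_homology A Y U m)"
proof -
  obtain \<alpha> \<beta> u v u' v' where F: "projective A F" and G: "projective A G"
    and \<alpha>: "is_hom A X Y \<alpha>" and \<beta>: "is_hom A Y X \<beta>" and u: "is_hom A X F u" and v: "is_hom A F X v"
    and uv: "\<And>x. x \<in> carrier X \<Longrightarrow> x = \<beta> (\<alpha> x) \<oplus>\<^bsub>X\<^esub> v (u x)"
    and u': "is_hom A Y G u'" and v': "is_hom A G Y v'"
    and uv': "\<And>y. y \<in> carrier Y \<Longrightarrow> y = \<alpha> (\<beta> y) \<oplus>\<^bsub>Y\<^esub> v' (u' y)"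
    using XY by (auto simp: stably_equivalent_def)
  show ?thesis
    unfolding cov_homology_def
  proof (rule quotient_iso_inverse_maps[OF left_module_cov_cycles[OF X] left_module_cov_cycles[OF Y]
        submodule_cov_boundaries[OF X] submodule_cov_boundaries[OF Y]
        cov_cycles_pull[OF Y X \<beta>] cov_cycles_pull[OF X Y \<alpha>]
        cov_boundaries_pull[OF Y \<beta>] cov_boundaries_pull[OF X \<alpha>]])
  qed (use cov_homology_null[OF X F \<alpha> \<beta> u v uv] cov_homology_null[OF Y G \<beta> \<alpha> u' v' uv'] in simp_all)
qed

end

end

section \<open>Tate cohomology in terms of stable homomorphisms\<close>

context
  fixes K :: "'k ring" and A :: "('k, 'a) module" and T :: "('a, 't) complx"
  assumes KA: "k_algebra K A" and T: "totally_acyclic A T"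
begin

text \<open>An equality of modules for each surjection \<open>q\<close>: the image condition on
  cocycles holds automatically, and every map from the projective \<open>obj T (n - 1)\<close> to
  \<open>L\<close> lifts along \<open>q\<close>, so the coboundaries are the same.\<close>

lemma tate_Ext_eq_stable_Hom:
  assumes Q: "left_module A Q" and L: "left_module A L"
    and q: "is_hom A Q L q" and surj: "q ` carrier Q = carrier L"
  shows "tate_Ext A T L n = stable_Hom A T n Q q L"
proof -
  note Tl = totally_acyclic_left_module[OF T] and d = totally_acyclic_hom[OF T]
  have cyc: "cycles (Hom_complex A T L) (- n) = stable_cocycles A T n Q q L"
  proof (rule Set.set_eqI)
    fix f
    have "f \<in> cycles (Hom_complex A T L) (- n) \<longleftrightarrow> f \<in> Hom_set A (obj T n) L \<and>
      compose (carrier (obj T (n + 1))) f (diff T (n + 1)) = (\<lambda>x\<in>carrier (obj T (n + 1)). \<zero>\<^bsub>L\<^esub>)"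
      by (simp add: cycles_def a_kernel_eq Hom_complex_def add.commute)
    also have "\<dots> \<longleftrightarrow> f \<in> stable_cocycles A T n Q q L"
      using Hom_set_closed[of f A "obj T n" L] surj
      by (auto simp: stable_cocycles_def compose_def restrict_def fun_eq_iff)
    finally show "f \<in> cycles (Hom_complex A T L) (- n) \<longleftrightarrow> f \<in> stable_cocycles A T n Q q L" .
  qed
  have bd: "boundaries (Hom_complex A T L) (- n) = stable_coboundaries A T n Q q"
  proof (rule Set.set_eqI)
    fix f
    have "f \<in> boundaries (Hom_complex A T L) (- n) \<longleftrightarrow>
      (\<exists>h\<in>Hom_set A (obj T (n - 1)) L. f = compose (carrier (obj T n)) h (diff T n))"
      by (auto simp: boundaries_def Hom_complex_def)
    also have "\<dots> \<longleftrightarrow> f \<in> stable_coboundaries A T n Q q"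
    proof
      assume "\<exists>h\<in>Hom_set A (obj T (n - 1)) L. f = compose (carrier (obj T n)) h (diff T n)"
      then obtain h where h: "h \<in> Hom_set A (obj T (n - 1)) L" "f = compose (carrier (obj T n)) h (diff T n)" by blast
      obtain k where k: "is_hom A (obj T (n - 1)) Q k" "\<And>x. x \<in> carrier (obj T (n - 1)) \<Longrightarrow> q (k x) = h x"
        using projective_lift[OF k_algebra_ring[OF KA] totally_acyclic_projective[OF T] Q L q Hom_set_hom[OF h(1)]]
          surj Hom_set_closed[OF h(1)] by blast
      have "f = (\<lambda>x\<in>carrier (obj T n). q (k (diff T n x)))"
        using k(2) is_hom_closed[OF d] by (auto simp: h(2) compose_def intro!: restrict_ext)
      then show "f \<in> stable_coboundaries A T n Q q" using k(1) by (auto simp: stable_coboundaries_def)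
    next
      assume "f \<in> stable_coboundaries A T n Q q"
      then obtain k where k: "is_hom A (obj T (n - 1)) Q k" "f = (\<lambda>x\<in>carrier (obj T n). q (k (diff T n x)))"
        by (auto simp: stable_coboundaries_def)
      have "f = compose (carrier (obj T n)) (\<lambda>x\<in>carrier (obj T (n - 1)). q (k x)) (diff T n)"
        using is_hom_closed[OF d] by (auto simp: k(2) compose_def intro!: restrict_ext)
      then show "\<exists>h\<in>Hom_set A (obj T (n - 1)) L. f = compose (carrier (obj T n)) h (diff T n)"
        using Hom_setI[OF Tl is_hom_comp[OF k(1) q]] by blast
    qed
    finally show "f \<in> boundaries (Hom_complex A T L) (- n) \<longleftrightarrow> f \<in> stable_coboundaries A T n Q q" .
  qed
  show ?thesis
    unfolding tate_Ext_def homology_def stable_Hom_def cyc bd by (simp add: Hom_complex_def)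
qed

lemma stable_post:
  assumes Y1: "left_module A Y1" and Y2: "left_module A Y2"
    and f: "is_hom A Y1 Y2 f" and k: "is_hom A Q1 Q2 k" and comm: "\<And>x. x \<in> carrier Q1 \<Longrightarrow> f (q1 x) = q2 (k x)"
  shows "is_hom K ((Hom_space A (obj T i) Y1)\<lparr>carrier := stable_cocycles A T i Q1 q1 Y1\<rparr>)
      ((Hom_space A (obj T i) Y2)\<lparr>carrier := stable_cocycles A T i Q2 q2 Y2\<rparr>) (\<lambda>h. \<lambda>x\<in>carrier (obj T i). f (h x))"
    and "\<And>h. h \<in> stable_coboundaries A T i Q1 q1 \<Longrightarrow> (\<lambda>x\<in>carrier (obj T i). f (h x)) \<in> stable_coboundaries A T i Q2 q2"
proof -
  note Tl = totally_acyclic_left_module[OF T] and d = totally_acyclic_hom[OF T] and d' = totally_acyclic_hom'[OF T]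
  show "is_hom K ((Hom_space A (obj T i) Y1)\<lparr>carrier := stable_cocycles A T i Q1 q1 Y1\<rparr>)
    ((Hom_space A (obj T i) Y2)\<lparr>carrier := stable_cocycles A T i Q2 q2 Y2\<rparr>) (\<lambda>h. \<lambda>x\<in>carrier (obj T i). f (h x))"
  proof (rule is_hom_restrict_carrier[OF is_hom_sub[OF is_hom_Hom_post[OF KA Tl f]]])
    fix h assume "h \<in> carrier ((Hom_space A (obj T i) Y1)\<lparr>carrier := stable_cocycles A T i Q1 q1 Y1\<rparr>)"
    then have "h \<in> stable_cocycles A T i Q1 q1 Y1" by simp
    note h = stable_cocyclesD[OF this]
    have "f (h x) \<in> q2 ` carrier Q2" if x: "x \<in> carrier (obj T i)" for x
    proof -
      obtain z where "z \<in> carrier Q1" "h x = q1 z" using h(4)[OF x] by blast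
      then show ?thesis using comm is_hom_closed[OF k] by auto
    qed
    then show "(\<lambda>x\<in>carrier (obj T i). f (h x)) \<in> stable_cocycles A T i Q2 q2 Y2"
      using Hom_setI[OF Tl is_hom_comp[OF h(1) f]] h(3) is_hom_zero[OF Y1 Y2 f] is_hom_closed[OF d']
      by (simp add: stable_cocycles_def)
  qed (auto simp: stable_cocycles_def)
  fix h assume "h \<in> stable_coboundaries A T i Q1 q1"
  then obtain s where s: "is_hom A (obj T (i - 1)) Q1 s" "h = (\<lambda>x\<in>carrier (obj T i). q1 (s (diff T i x)))"
    by (auto simp: stable_coboundaries_def)
  have "(\<lambda>x\<in>carrier (obj T i). f (h x)) = (\<lambda>x\<in>carrier (obj T i). q2 (k (s (diff T i x))))"
    using comm is_hom_closed[OF d] is_hom_closed[OF s(1)] by (auto simp: s(2) intro!: restrict_ext)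
  then show "(\<lambda>x\<in>carrier (obj T i). f (h x)) \<in> stable_coboundaries A T i Q2 q2"
    using is_hom_comp[OF s(1) k] by (auto simp: stable_coboundaries_def)
qed

text \<open>Serves to exchange the terms of a projective resolution for those of a complete
  resolution in the degrees where the two agree.\<close>

lemma stable_Hom_bij:
  assumes Q: "left_module A Q" and Y: "left_module A Y" and Q': "left_module A Q'" and Y': "left_module A Y'"
    and q: "is_hom A Q Y q" and q': "is_hom A Q' Y' q'"
    and f: "is_hom A Y Y' f" "bij_betw f (carrier Y) (carrier Y')"
    and k: "is_hom A Q Q' k" "bij_betw k (carrier Q) (carrier Q')"
    and comm: "\<And>x. x \<in> carrier Q \<Longrightarrow> f (q x) = q' (k x)"
  shows "mod_iso K (stable_Hom A T i Q q Y) (stable_Hom A T i Q' q' Y')"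
proof -
  note Tl = totally_acyclic_left_module[OF T] and d = totally_acyclic_hom[OF T] and d' = totally_acyclic_hom'[OF T]
  obtain f' where f': "is_hom A Y' Y f'" "\<And>x. x \<in> carrier Y \<Longrightarrow> f' (f x) = x" "\<And>y. y \<in> carrier Y' \<Longrightarrow> f (f' y) = y"
    using bij_inverse_hom[OF Y f] by blast
  obtain k' where k': "is_hom A Q' Q k'" "\<And>x. x \<in> carrier Q \<Longrightarrow> k' (k x) = x" "\<And>y. y \<in> carrier Q' \<Longrightarrow> k (k' y) = y"
    using bij_inverse_hom[OF Q k] by blast
  have comm': "f' (q' x) = q (k' x)" if "x \<in> carrier Q'" for x
    using comm[OF is_hom_closed[OF k'(1) that]] k'(3)[OF that] f'(2)[OF is_hom_closed[OF q is_hom_closed[OF k'(1) that]]]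
    by simp
  let ?M = "(Hom_space A (obj T i) Y)\<lparr>carrier := stable_cocycles A T i Q q Y\<rparr>"
  let ?N = "(Hom_space A (obj T i) Y')\<lparr>carrier := stable_cocycles A T i Q' q' Y'\<rparr>"
  note M = left_module_stable_cocycles[OF KA T Q Y q, of i] and N = left_module_stable_cocycles[OF KA T Q' Y' q', of i]
  note B = submodule_stable_coboundaries'[OF KA T Q Y q, of i] and C = submodule_stable_coboundaries'[OF KA T Q' Y' q', of i]
  interpret M: left_module K ?M by (rule M)
  interpret N: left_module K ?N by (rule N)
  show ?thesis
    unfolding stable_Hom_def
  proof (rule quotient_iso_inverse_maps[OF M N B C
        stable_post(1)[where ?q1.0 = q and ?q2.0 = q', OF Y Y' f(1) k(1) comm]
        stable_post(1)[where ?q1.0 = q' and ?q2.0 = q, OF Y' Y f'(1) k'(1) comm']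
        stable_post(2)[where ?q1.0 = q and ?q2.0 = q', OF Y Y' f(1) k(1) comm]
        stable_post(2)[where ?q1.0 = q' and ?q2.0 = q, OF Y' Y f'(1) k'(1) comm']])
    fix h assume h: "h \<in> carrier ?M"
    then have hc: "h \<in> Hom_set A (obj T i) Y" by (simp add: stable_cocycles_def)
    have "(\<lambda>x\<in>carrier (obj T i). f' ((\<lambda>x\<in>carrier (obj T i). f (h x)) x)) = h"
      using f'(2) Hom_set_closed[OF hc] by (subst (2) Hom_set_restrict[OF hc, symmetric]) (auto intro!: restrict_ext)
    then show "\<exists>b\<in>stable_coboundaries A T i Q q. h = (\<lambda>x\<in>carrier (obj T i). f' ((\<lambda>x\<in>carrier (obj T i). f (h x)) x)) \<oplus>\<^bsub>?M\<^esub> b"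
      using M.submodule_zero[OF B] M.M.r_zero[OF h] by metis
  next
    fix h assume h: "h \<in> carrier ?N"
    then have hc: "h \<in> Hom_set A (obj T i) Y'" by (simp add: stable_cocycles_def)
    have "(\<lambda>x\<in>carrier (obj T i). f ((\<lambda>x\<in>carrier (obj T i). f' (h x)) x)) = h"
      using f'(3) Hom_set_closed[OF hc] by (subst (2) Hom_set_restrict[OF hc, symmetric]) (auto intro!: restrict_ext)
    then show "\<exists>c\<in>stable_coboundaries A T i Q' q'. h = (\<lambda>x\<in>carrier (obj T i). f ((\<lambda>x\<in>carrier (obj T i). f' (h x)) x)) \<oplus>\<^bsub>?N\<^esub> c"
      using N.submodule_zero[OF C] N.M.r_zero[OF h] by metis
  qed
qed

text \<open>\<open>Z\<close> is a copy of the image of \<open>diff T i\<close>. Cocycles are maps on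
  \<open>Z\<close> into the image of \<open>diff U (m + 1)\<close>, that is, into the kernel of
  \<open>diff U m\<close>. The coboundaries use maps on \<open>obj T (i - 1)\<close> on the one side
  and maps on \<open>Z\<close> on the other; these match because maps from \<open>Z\<close> to
  projective modules extend to \<open>obj T (i - 1)\<close>.\<close>

lemma stable_Hom_iso_cov_homology:
  fixes U :: "('a, 'u) complx"
  assumes U: "totally_acyclic A U" and Z: "left_module A Z"
    and p: "is_hom A (obj T i) Z p" "p ` carrier (obj T i) = carrier Z"
    and ker: "{x \<in> carrier (obj T i). p x = \<zero>\<^bsub>Z\<^esub>} = diff T (i + 1) ` carrier (obj T (i + 1))"
  shows "mod_iso K (stable_Hom A T i (obj U (m + 1)) (diff U (m + 1)) (obj U m)) (cov_homology A Z U m)"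
proof -
  note Tl = totally_acyclic_left_module[OF T] and d = totally_acyclic_hom[OF T] and d' = totally_acyclic_hom'[OF T]
  note Ul = totally_acyclic_left_module[OF U] and dU = totally_acyclic_hom[OF U] and dU' = totally_acyclic_hom'[OF U]
  let ?M = "(Hom_space A (obj T i) (obj U m))\<lparr>carrier := stable_cocycles A T i (obj U (m + 1)) (diff U (m + 1)) (obj U m)\<rparr>"
  let ?C = "{h \<in> carrier (Hom_space A Z (obj U m)).
        (\<lambda>w\<in>carrier Z. diff U m (h w)) = \<zero>\<^bsub>Hom_space A Z (obj U (m - 1))\<^esub>}"
  let ?N = "(Hom_space A Z (obj U m))\<lparr>carrier := ?C\<rparr>"
  have C_iff: "h \<in> ?C \<longleftrightarrow> h \<in> Hom_set A Z (obj U m) \<and> (\<forall>w\<in>carrier Z. diff U m (h w) = \<zero>\<^bsub>obj U (m - 1)\<^esub>)" for h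
    by (rule cov_cycles_iff[OF KA U])
  have pc: "p x \<in> carrier Z" if "x \<in> carrier (obj T i)" for x by (rule is_hom_closed[OF p(1) that])
  define G where "G = {(\<lambda>x\<in>carrier (obj T i). h (p x), h) | h. h \<in> ?C}"
  have GI: "(u, h) \<in> G" if "h \<in> ?C" "u = (\<lambda>x\<in>carrier (obj T i). h (p x))" for u h
    using that unfolding G_def by blast
  have GE: "h \<in> ?C \<and> u = (\<lambda>x\<in>carrier (obj T i). h (p x))" if "(u, h) \<in> G" for u h
    using that unfolding G_def by blast
  note N = left_module_cov_cycles[OF KA U Z, of m]
  interpret N: left_module K ?N by (rule N)
  show ?thesis
    unfolding stable_Hom_def cov_homology_def
  proof (rule quotient_iso_quotient_relation[OF left_module_stable_cocycles[OF KA T Ul Ul dU']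
        N submodule_stable_coboundaries'[OF KA T Ul Ul dU'] submodule_cov_boundaries[OF KA U Z], of G])
    fix u h assume "(u, h) \<in> G"
    then have hC: "h \<in> ?C" and u: "u = (\<lambda>x\<in>carrier (obj T i). h (p x))" using GE by auto
    then have h: "h \<in> Hom_set A Z (obj U m)" "\<forall>w\<in>carrier Z. diff U m (h w) = \<zero>\<^bsub>obj U (m - 1)\<^esub>"
      unfolding C_iff by auto
    note hh = Hom_set_hom[OF h(1)]
    have "h (p x) \<in> diff U (m + 1) ` carrier (obj U (m + 1))" if "x \<in> carrier (obj T i)" for x
      using totally_acyclic_exact[OF U is_hom_closed[OF hh pc[OF that]]] h(2) pc[OF that] by blast
    moreover have "h (p (diff T (i + 1) x)) = \<zero>\<^bsub>obj U m\<^esub>" if "x \<in> carrier (obj T (i + 1))" for x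
    proof -
      have "p (diff T (i + 1) x) = \<zero>\<^bsub>Z\<^esub>" using ker that by blast
      then show ?thesis using is_hom_zero[OF Z Ul hh] by simp
    qed
    ultimately have "u \<in> stable_cocycles A T i (obj U (m + 1)) (diff U (m + 1)) (obj U m)"
      unfolding u using Hom_setI[OF Tl is_hom_comp[OF p(1) hh]] is_hom_closed[OF d']
      by (simp add: stable_cocycles_def)
    then show "u \<in> carrier ?M \<and> h \<in> carrier ?N" using hC by simp
    show "u \<in> stable_coboundaries A T i (obj U (m + 1)) (diff U (m + 1)) \<longleftrightarrow>
      h \<in> (\<lambda>h. \<lambda>w\<in>carrier Z. diff U (m + 1) (h w)) ` carrier (Hom_space A Z (obj U (m + 1)))" (is "_ \<longleftrightarrow> h \<in> ?B")
    proof
      assume "u \<in> stable_coboundaries A T i (obj U (m + 1)) (diff U (m + 1))"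
      then obtain k where k: "is_hom A (obj T (i - 1)) (obj U (m + 1)) k"
        "u = (\<lambda>x\<in>carrier (obj T i). diff U (m + 1) (k (diff T i x)))"
        by (auto simp: stable_coboundaries_def)
      have kd: "is_hom A (obj T i) (obj U (m + 1)) (\<lambda>x. k (diff T i x))" by (rule is_hom_comp[OF d k(1)])
      \<comment> \<open>\<open>k d\<close> kills the kernel of \<open>p\<close>, which is the image
        of the next differential, so it descends to \<open>Z\<close>.\<close>
      have "k (diff T i x) = \<zero>\<^bsub>obj U (m + 1)\<^esub>" if x: "x \<in> carrier (obj T i)" "p x = \<zero>\<^bsub>Z\<^esub>" for x
      proof -
        obtain y where "y \<in> carrier (obj T (i + 1))" "x = diff T (i + 1) y" using ker x by blast
        then show ?thesis using totally_acyclic_diff_diff[OF T] is_hom_zero[OF Tl Ul k(1)] by simp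
      qed
      then obtain s where s: "is_hom A Z (obj U (m + 1)) s" "\<And>x. x \<in> carrier (obj T i) \<Longrightarrow> s (p x) = k (diff T i x)"
        using factor_surjection[OF Tl Z Ul p kd] by blast
      have "h z = diff U (m + 1) (s z)" if z: "z \<in> carrier Z" for z
      proof -
        obtain x where x: "x \<in> carrier (obj T i)" "z = p x" using z p(2) by blast
        then show ?thesis using fun_cong[OF trans[OF u[symmetric] k(2)], of x] s(2) by simp
      qed
      then have "h = (\<lambda>w\<in>carrier Z. diff U (m + 1) (s w))"
        by (subst Hom_set_restrict[OF h(1), symmetric]) (auto intro!: restrict_ext)
      then show "h \<in> ?B" using cov_boundariesI[OF KA U Z s(1)] by simp
    next
      assume "h \<in> ?B"
      then obtain s where s: "is_hom A Z (obj U (m + 1)) s" "h = (\<lambda>w\<in>carrier Z. diff U (m + 1) (s w))"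
        by (rule cov_boundariesE[OF KA U])
      \<comment> \<open>In the other direction \<open>s p\<close> vanishes on boundaries, and the
        projective target allows an extension to \<open>obj T (i - 1)\<close>.\<close>
      have "s (p (diff T (i + 1) x)) = \<zero>\<^bsub>obj U (m + 1)\<^esub>" if "x \<in> carrier (obj T (i + 1))" for x
      proof -
        have "p (diff T (i + 1) x) = \<zero>\<^bsub>Z\<^esub>" using ker that by blast
        then show ?thesis using is_hom_zero[OF Z Ul s(1)] by simp
      qed
      then obtain k where k: "is_hom A (obj T (i - 1)) (obj U (m + 1)) k" "\<And>x. x \<in> carrier (obj T i) \<Longrightarrow> s (p x) = k (diff T i x)"
        using totally_acyclic_extend[OF T totally_acyclic_projective[OF U] is_hom_comp[OF p(1) s(1)]] by blast
      have "u = (\<lambda>x\<in>carrier (obj T i). diff U (m + 1) (k (diff T i x)))"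
        using k(2) pc by (auto simp: u s(2) intro!: restrict_ext)
      then show "u \<in> stable_coboundaries A T i (obj U (m + 1)) (diff U (m + 1))"
        using k(1) by (auto simp: stable_coboundaries_def)
    qed
  next
    fix u assume "u \<in> carrier ?M"
    then have "u \<in> stable_cocycles A T i (obj U (m + 1)) (diff U (m + 1)) (obj U m)" by simp
    note u = stable_cocyclesD[OF this]
    have "u x = \<zero>\<^bsub>obj U m\<^esub>" if x: "x \<in> carrier (obj T i)" "p x = \<zero>\<^bsub>Z\<^esub>" for x
    proof -
      obtain y where "y \<in> carrier (obj T (i + 1))" "x = diff T (i + 1) y" using ker x by blast
      then show ?thesis using u(3) by simp
    qed
    then obtain h where h: "is_hom A Z (obj U m) h" "\<And>x. x \<in> carrier (obj T i) \<Longrightarrow> h (p x) = u x"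
      using factor_surjection[OF Tl Z Ul p u(1)] by blast
    have "restrict h (carrier Z) \<in> ?C"
    proof -
      have "diff U m (h w) = \<zero>\<^bsub>obj U (m - 1)\<^esub>" if w: "w \<in> carrier Z" for w
      proof -
        obtain x where x: "x \<in> carrier (obj T i)" "w = p x" using w p(2) by blast
        obtain y where "y \<in> carrier (obj U (m + 1))" "u x = diff U (m + 1) y" using u(4)[OF x(1)] by blast
        then show ?thesis using h(2)[OF x(1)] x(2) totally_acyclic_diff_diff[OF U] by simp
      qed
      then show ?thesis unfolding C_iff using Hom_setI[OF Z h(1)] by simp
    qed
    moreover have "u = (\<lambda>x\<in>carrier (obj T i). (restrict h (carrier Z)) (p x))"
      using u(2) h(2) pc by (auto intro!: extensionalityI)
    ultimately have "(u, restrict h (carrier Z)) \<in> G" by (rule GI)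
    then show "\<exists>h. (u, h) \<in> G" by blast
  next
    fix h assume "h \<in> carrier ?N"
    then have "(\<lambda>x\<in>carrier (obj T i). h (p x), h) \<in> G" by (intro GI) auto
    then show "\<exists>u. (u, h) \<in> G" by blast
  next
    fix u h u' h' assume "(u, h) \<in> G" "(u', h') \<in> G"
    then have *: "h \<in> ?C" "u = (\<lambda>x\<in>carrier (obj T i). h (p x))" "h' \<in> ?C" "u' = (\<lambda>x\<in>carrier (obj T i). h' (p x))"
      using GE by auto
    show "(u \<oplus>\<^bsub>?M\<^esub> u', h \<oplus>\<^bsub>?N\<^esub> h') \<in> G"
      by (rule GI) (use N.M.a_closed[of h h'] * pc in \<open>auto intro!: restrict_ext\<close>)
  next
    fix c u h assume c: "c \<in> carrier K" and "(u, h) \<in> G"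
    then have *: "h \<in> ?C" "u = (\<lambda>x\<in>carrier (obj T i). h (p x))" using GE by auto
    show "(c \<odot>\<^bsub>?M\<^esub> u, c \<odot>\<^bsub>?N\<^esub> h) \<in> G"
      by (rule GI) (use N.smult_closed[OF c, of h] * pc in \<open>auto intro!: restrict_ext\<close>)
  qed
qed

end

section \<open>Syzygies in different resolutions\<close>

text \<open>One half of the lifting argument in Schanuel's lemma.\<close>

lemma kernel_null_lift:
  assumes R: "ring R" and X: "left_module R X" and P: "left_module R P" and F: "projective R F"
    and p: "is_hom R P X p" "p ` carrier P = carrier X"
    and c: "is_hom R P P c" and \<gamma>: "\<And>z. z \<in> carrier P \<Longrightarrow> p (c z) = \<gamma> (p z)"
    and u: "is_hom R X F u" and v: "is_hom R F X v" and uv: "\<And>x. x \<in> carrier X \<Longrightarrow> x = \<gamma> x \<oplus>\<^bsub>X\<^esub> v (u x)"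
    and \<gamma>X: "\<And>x. x \<in> carrier X \<Longrightarrow> \<gamma> x \<in> carrier X"
  obtains h where "is_hom R P (P\<lparr>carrier := {z \<in> carrier P. p z = \<zero>\<^bsub>X\<^esub>}\<rparr>) h"
    "\<And>z. \<lbrakk>z \<in> carrier P; p z = \<zero>\<^bsub>X\<^esub>\<rbrakk> \<Longrightarrow> z = c z \<oplus>\<^bsub>P\<^esub> h z"
proof -
  interpret X: left_module R X by (rule X)
  interpret P: left_module R P by (rule P)
  have F': "left_module R F" using F by (simp add: projective_def)
  obtain w where w: "is_hom R F P w" "\<And>y. y \<in> carrier F \<Longrightarrow> p (w y) = v y"
    using projective_lift[OF R F P X p(1) v] is_hom_closed[OF v] p(2) by blast
  \<comment> \<open>\<open>w\<close> lifts \<open>v\<close> along \<open>p\<close>, so that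
    \<open>p h = p - \<gamma> p - v u p = 0\<close> and \<open>h\<close> maps to the kernel. On the
    kernel itself the term \<open>w u p\<close> vanishes, which leaves \<open>h z = z - c z\<close>.
    Thus the deviation of \<open>c\<close> from the identity on the kernel factors through
    \<open>P\<close>.\<close>
  define h where "h z = z \<ominus>\<^bsub>P\<^esub> (c z \<oplus>\<^bsub>P\<^esub> w (u (p z)))" for z
  have wup: "is_hom R P P (\<lambda>z. w (u (p z)))"
    by (rule is_hom_comp[OF is_hom_comp[OF p(1) u] w(1)])
  have h: "is_hom R P P h"
    unfolding h_def by (rule is_hom_diff_map[OF P is_hom_id is_hom_add_map[OF P c wup]])
  have "p (h z) = \<zero>\<^bsub>X\<^esub>" if z: "z \<in> carrier P" for z
  proof -
    have pz: "p z \<in> carrier X" by (rule is_hom_closed[OF p(1) z])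
    have cl: "c z \<in> carrier P" "w (u (p z)) \<in> carrier P" "c z \<oplus>\<^bsub>P\<^esub> w (u (p z)) \<in> carrier P"
      using is_hom_closed[OF c z] is_hom_closed[OF wup z] by auto
    have "p (c z \<oplus>\<^bsub>P\<^esub> w (u (p z))) = p z"
      using is_hom_add[OF p(1) cl(1,2)] \<gamma>[OF z] w(2)[OF is_hom_closed[OF u pz]] uv[OF pz] by simp
    then show ?thesis
      unfolding h_def using is_hom_diff[OF P X p(1) z cl(3)] X.diff_eq_zero_iff[OF pz pz] by simp
  qed
  then have "is_hom R P (P\<lparr>carrier := {z \<in> carrier P. p z = \<zero>\<^bsub>X\<^esub>}\<rparr>) h"
    using is_hom_closed[OF h] by (intro is_hom_restrict_carrier[OF h]) auto
  moreover have "z = c z \<oplus>\<^bsub>P\<^esub> h z" if z: "z \<in> carrier P" "p z = \<zero>\<^bsub>X\<^esub>" for z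
  proof -
    have "w (u (p z)) = \<zero>\<^bsub>P\<^esub>"
      using z(2) is_hom_zero[OF X P is_hom_comp[OF u w(1)]] by simp
    then have "h z = z \<ominus>\<^bsub>P\<^esub> c z" using is_hom_closed[OF c z(1)] by (simp add: h_def)
    then show ?thesis
      using P.diff_add_cancel[OF z(1) is_hom_closed[OF c z(1)]] z(1) is_hom_closed[OF c z(1)]
      by (simp add: P.M.a_comm)
  qed
  ultimately show thesis by (rule that)
qed

text \<open>The stable equivalence lifts to maps \<open>a\<close> and \<open>b\<close> between
  \<open>P\<close> and \<open>Q\<close>, and these restrict to the kernels. Their composites differ
  from the identity of a kernel by its inclusion into \<open>P\<close> or \<open>Q\<close> followed
  by the map from \<open>kernel_null_lift\<close>, so \<open>P\<close> and \<open>Q\<close> are the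
  new projective modules.\<close>

lemma stably_equivalent_kernels:
  assumes R: "ring R" and X: "left_module R X" and Y: "left_module R Y"
    and XY: "stably_equivalent R X F Y G"
    and P: "projective R P" and p: "is_hom R P X p" "p ` carrier P = carrier X"
    and Q: "projective R Q" and q: "is_hom R Q Y q" "q ` carrier Q = carrier Y"
  shows "stably_equivalent R (P\<lparr>carrier := {z \<in> carrier P. p z = \<zero>\<^bsub>X\<^esub>}\<rparr>) P
    (Q\<lparr>carrier := {z \<in> carrier Q. q z = \<zero>\<^bsub>Y\<^esub>}\<rparr>) Q"
proof -
  have P': "left_module R P" and Q': "left_module R Q" using P Q by (simp_all add: projective_def)
  obtain \<alpha> \<beta> u v u' v' where F: "projective R F" and G: "projective R G"
    and \<alpha>: "is_hom R X Y \<alpha>" and \<beta>: "is_hom R Y X \<beta>" and u: "is_hom R X F u" and v: "is_hom R F X v"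
    and uv: "\<And>x. x \<in> carrier X \<Longrightarrow> x = \<beta> (\<alpha> x) \<oplus>\<^bsub>X\<^esub> v (u x)"
    and u': "is_hom R Y G u'" and v': "is_hom R G Y v'"
    and uv': "\<And>y. y \<in> carrier Y \<Longrightarrow> y = \<alpha> (\<beta> y) \<oplus>\<^bsub>Y\<^esub> v' (u' y)"
    using XY by (auto simp: stably_equivalent_def)
  obtain a where a: "is_hom R P Q a" "\<And>z. z \<in> carrier P \<Longrightarrow> q (a z) = \<alpha> (p z)"
    using projective_lift[OF R P Q' Y q(1) is_hom_comp[OF p(1) \<alpha>]] is_hom_closed[OF is_hom_comp[OF p(1) \<alpha>]] q(2)
    by blast
  obtain b where b: "is_hom R Q P b" "\<And>z. z \<in> carrier Q \<Longrightarrow> p (b z) = \<beta> (q z)"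
    using projective_lift[OF R Q P' X p(1) is_hom_comp[OF q(1) \<beta>]] is_hom_closed[OF is_hom_comp[OF q(1) \<beta>]] p(2)
    by blast
  note ac = is_hom_closed[OF a(1)] and bc = is_hom_closed[OF b(1)]
  let ?X = "{z \<in> carrier P. p z = \<zero>\<^bsub>X\<^esub>}" and ?Y = "{z \<in> carrier Q. q z = \<zero>\<^bsub>Y\<^esub>}"
  have "p (b (a z)) = \<beta> (\<alpha> (p z))" if "z \<in> carrier P" for z using a(2) b(2) ac that by simp
  then obtain h where h: "is_hom R P (P\<lparr>carrier := ?X\<rparr>) h"
    "\<And>z. \<lbrakk>z \<in> carrier P; p z = \<zero>\<^bsub>X\<^esub>\<rbrakk> \<Longrightarrow> z = b (a z) \<oplus>\<^bsub>P\<^esub> h z"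
    using kernel_null_lift[OF R X P' F p is_hom_comp[OF a(1) b(1)] _ u v uv] is_hom_closed[OF \<beta>] is_hom_closed[OF \<alpha>]
    by blast
  have "q (a (b z)) = \<alpha> (\<beta> (q z))" if "z \<in> carrier Q" for z using a(2) b(2) bc that by simp
  then obtain h' where h': "is_hom R Q (Q\<lparr>carrier := ?Y\<rparr>) h'"
    "\<And>z. \<lbrakk>z \<in> carrier Q; q z = \<zero>\<^bsub>Y\<^esub>\<rbrakk> \<Longrightarrow> z = a (b z) \<oplus>\<^bsub>Q\<^esub> h' z"
    using kernel_null_lift[OF R Y Q' G q is_hom_comp[OF b(1) a(1)] _ u' v' uv'] is_hom_closed[OF \<beta>] is_hom_closed[OF \<alpha>]
    by blast
  have a1: "is_hom R (P\<lparr>carrier := ?X\<rparr>) (Q\<lparr>carrier := ?Y\<rparr>) a"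
    by (rule is_hom_restrict_carrier[OF is_hom_sub[OF a(1)]]) (use a(2) ac is_hom_zero[OF X Y \<alpha>] in auto)
  have b1: "is_hom R (Q\<lparr>carrier := ?Y\<rparr>) (P\<lparr>carrier := ?X\<rparr>) b"
    by (rule is_hom_restrict_carrier[OF is_hom_sub[OF b(1)]]) (use b(2) bc is_hom_zero[OF Y X \<beta>] in auto)
  have iX: "is_hom R (P\<lparr>carrier := ?X\<rparr>) P (\<lambda>x. x)" and iY: "is_hom R (Q\<lparr>carrier := ?Y\<rparr>) Q (\<lambda>x. x)"
    by (auto intro: is_hom_incl)
  show ?thesis
    unfolding stably_equivalent_def
    by (intro conjI P Q exI[of _ a] exI[of _ b] exI[of _ "\<lambda>x. x"] exI[of _ h] exI[of _ h'] a1 b1 iX iY h(1) h'(1))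
      (use h(2) h'(2) in auto)
qed

text \<open>The deviations from the identity are zero, so they factor through any projective
  \<open>F\<close>.\<close>

lemma stably_equivalent_iso:
  assumes X: "left_module R X" and Y: "left_module R Y" and F: "projective R F" and XY: "mod_iso R X Y"
  shows "stably_equivalent R X F Y F"
proof -
  interpret X: left_module R X by (rule X)
  interpret Y: left_module R Y by (rule Y)
  have F': "left_module R F" using F by (simp add: projective_def)
  obtain f where f: "is_hom R X Y f" "bij_betw f (carrier X) (carrier Y)" using XY by (auto simp: mod_iso_def)
  obtain g where g: "is_hom R Y X g" "\<And>x. x \<in> carrier X \<Longrightarrow> g (f x) = x" "\<And>y. y \<in> carrier Y \<Longrightarrow> f (g y) = y"
    using bij_inverse_hom[OF X f] by blast
  show ?thesis
    unfolding stably_equivalent_def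
    by (intro conjI F exI[of _ f] exI[of _ g] exI[of _ "\<lambda>_. \<zero>\<^bsub>F\<^esub>"] exI[of _ "\<lambda>_. \<zero>\<^bsub>X\<^esub>"] exI[of _ "\<lambda>_. \<zero>\<^bsub>Y\<^esub>"]
        f(1) g(1) is_hom_zero_map X Y F') (simp_all add: g)
qed

text \<open>Index shift: \<open>syzygy_module P i\<close> is the syzygy of order \<open>i + 1\<close>.\<close>

definition syzygy_module ::
    "('a, 'p) complx \<Rightarrow> nat \<Rightarrow> ('a, 'p) module"
  where "syzygy_module P i = (obj P (int i))\<lparr>carrier := diff P (int i + 1) ` carrier (obj P (int i + 1))\<rparr>"

lemma resolution_diff:
  assumes P: "projective_resolution R M P e" and M: "left_module R M"
  shows "projective R (obj P (int i))"
    and "left_module R (obj P j)"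
    and "is_hom R (obj P j) (obj P (j - 1)) (diff P j)"
    and "is_hom R (obj P (j + 1)) (obj P j) (diff P (j + 1))"
    and "is_hom R (obj P 0) M e" "e ` carrier (obj P 0) = carrier M"
    and "{x \<in> carrier (obj P 0). e x = \<zero>\<^bsub>M\<^esub>} = carrier (syzygy_module P 0)"
    and "{x \<in> carrier (obj P (int i + 1)). diff P (int i + 1) x = \<zero>\<^bsub>obj P (int i)\<^esub>} = carrier (syzygy_module P (Suc i))"
  subgoal using P by (simp add: projective_resolution_def)
  subgoal using P by (simp add: projective_resolution_def is_complex_def)
  subgoal using P by (simp add: projective_resolution_def is_complex_def)
  subgoal using P spec[of "\<lambda>n. is_hom R (obj P n) (obj P (n - 1)) (diff P n)" "j + 1"]
    by (auto simp: projective_resolution_def is_complex_def)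
  subgoal using P by (simp add: projective_resolution_def)
  subgoal using P by (simp add: projective_resolution_def)
  subgoal using P by (simp add: projective_resolution_def boundaries_def a_kernel_eq syzygy_module_def)
  subgoal
  proof -
    have "cycles P (int i + 1) = boundaries P (int i + 1)"
      using P by (simp add: projective_resolution_def)
    then show ?thesis
      by (simp add: cycles_def boundaries_def a_kernel_eq syzygy_module_def add.commute)
  qed
  done

lemma left_module_syzygy_module:
  assumes P: "projective_resolution R M P e" and M: "left_module R M"
  shows "left_module R (syzygy_module P i)"
  unfolding syzygy_module_def
  by (intro left_module.left_module_restrict[OF resolution_diff(2)[OF P M]]
      submodule_image[OF resolution_diff(2)[OF P M] resolution_diff(2)[OF P M] resolution_diff(4)[OF P M]]
      left_module.submodule_carrier[OF resolution_diff(2)[OF P M]])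

text \<open>Exactness rewrites the image as a kernel, the form in which
  \<open>stably_equivalent_kernels\<close> delivers the next syzygy.\<close>

lemma syzygy_module_Suc:
  assumes P: "projective_resolution R M P e" and M: "left_module R M"
  shows "syzygy_module P (Suc i) =
    (obj P (int i + 1))\<lparr>carrier := {x \<in> carrier (obj P (int i + 1)). diff P (int i + 1) x = \<zero>\<^bsub>syzygy_module P i\<^esub>}\<rparr>"
  using resolution_diff(8)[OF P M, of i] by (simp add: syzygy_module_def add.commute)

text \<open>Schanuel's argument iterated, starting from \<open>M\<close> as stably equivalent to
  itself. It links the resolution inside a complete resolution with the minimal one that defines the
  syzygy; the element types of the two may differ.\<close>

lemma resolution_syzygies_stably_equivalent:
  fixes P :: "('a, 'p) complx" and Q :: "('a, 'q) complx"
  assumes M: "left_module R M"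
    and P: "projective_resolution R M P e" and Q: "projective_resolution R M Q e'"
  shows "\<exists>(F :: ('a, 'p) module) (G :: ('a, 'q) module). stably_equivalent R (syzygy_module P i) F (syzygy_module Q i) G"
proof (induction i)
  case 0
  interpret M: left_module R M by (rule M)
  \<comment> \<open>Zero maps through \<open>obj P 0\<close> and \<open>obj Q 0\<close> make
    \<open>M\<close> stably equivalent to itself; the kernels of the augmentations are then the
    first syzygies.\<close>
  have "is_hom R M (obj P 0) (\<lambda>_. \<zero>\<^bsub>obj P 0\<^esub>)" "is_hom R M (obj Q 0) (\<lambda>_. \<zero>\<^bsub>obj Q 0\<^esub>)"
    by (rule is_hom_zero_map[OF resolution_diff(2)[OF P M]], rule is_hom_zero_map[OF resolution_diff(2)[OF Q M]])
  then have "stably_equivalent R M (obj P 0) M (obj Q 0)"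
    unfolding stably_equivalent_def
    using resolution_diff(1)[OF P M, of 0] resolution_diff(1)[OF Q M, of 0] M
    by (intro conjI exI[of _ "\<lambda>x. x"] exI[of _ "\<lambda>_. \<zero>\<^bsub>obj P 0\<^esub>"] exI[of _ "\<lambda>_. \<zero>\<^bsub>obj Q 0\<^esub>"] exI[of _ "\<lambda>_. \<zero>\<^bsub>M\<^esub>"])
      (simp_all add: is_hom_id is_hom_zero_map)
  from stably_equivalent_kernels[OF M.R.ring_axioms M M this resolution_diff(1)[OF P M, of 0, simplified]
      resolution_diff(5,6)[OF P M] resolution_diff(1)[OF Q M, of 0, simplified] resolution_diff(5,6)[OF Q M]]
  have "stably_equivalent R (syzygy_module P 0) (obj P 0) (syzygy_module Q 0) (obj Q 0)"
    using resolution_diff(7)[OF P M] resolution_diff(7)[OF Q M] by (simp add: syzygy_module_def)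
  then show ?case by blast
next
  case (Suc i)
  interpret M: left_module R M by (rule M)
  obtain F :: "('a, 'p) module" and G :: "('a, 'q) module"
    where FG: "stably_equivalent R (syzygy_module P i) F (syzygy_module Q i) G" using Suc by blast
  have p: "is_hom R (obj S (int i + 1)) (syzygy_module S i) (diff S (int i + 1))"
    "diff S (int i + 1) ` carrier (obj S (int i + 1)) = carrier (syzygy_module S i)"
    if "projective_resolution R M S e''" for S :: "('a, 's) complx" and e''
    using is_hom_restrict_carrier[OF resolution_diff(4)[OF that M, of "int i"]] by (auto simp: syzygy_module_def)
  have pr: "projective R (obj S (int i + 1))" if "projective_resolution R M S e''" for S :: "('a, 's) complx" and e''
    using resolution_diff(1)[OF that M, of "Suc i"] by (simp add: add.commute)
  have "stably_equivalent R (syzygy_module P (Suc i)) (obj P (int i + 1)) (syzygy_module Q (Suc i)) (obj Q (int i + 1))"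
    unfolding syzygy_module_Suc[OF P M] syzygy_module_Suc[OF Q M]
    by (rule stably_equivalent_kernels[OF M.R.ring_axioms left_module_syzygy_module[OF P M]
          left_module_syzygy_module[OF Q M] FG pr[OF P] p[OF P] pr[OF Q] p[OF Q]])
  then show ?case by blast
qed

section \<open>Balance of Tate cohomology\<close>

context
  fixes K :: "'k ring" and A :: "('k, 'a) module" and T :: "('a, 't) complx"
  assumes KA: "k_algebra K A" and T: "totally_acyclic A T"
begin

text \<open>\<open>U\<close> extends in both directions and is exact everywhere, so a step can be
  taken at every index and undone by symmetry. Hence \<open>k\<close> may be negative, in contrast
  to shifts along a projective resolution.\<close>

lemma stable_Hom_shift_int:
  fixes U :: "('a, 'u) complx"
  assumes U: "totally_acyclic A U"
  shows "mod_iso K (stable_Hom A T i (obj U (j + 1)) (diff U (j + 1)) (obj U j))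
    (stable_Hom A T (i + k) (obj U (j + k + 1)) (diff U (j + k + 1)) (obj U (j + k)))"
proof -
  note Ul = totally_acyclic_left_module[OF U] and dU' = totally_acyclic_hom'[OF U]
  let ?S = "\<lambda>k. stable_Hom A T (i + k) (obj U (j + k + 1)) (diff U (j + k + 1)) (obj U (j + k))"
  have S: "left_module K (?S k)" for k by (rule left_module_stable_Hom[OF KA T Ul Ul dU'])
  have step: "mod_iso K (?S k) (?S (k + 1))" for k
  proof -
    have ex: "diff U (j + k + 1 + 1) ` carrier (obj U (j + k + 1 + 1)) =
        {x \<in> carrier (obj U (j + k + 1)). diff U (j + k + 1) x = \<zero>\<^bsub>obj U (j + k)\<^esub>}"
      using is_hom_closed[OF dU'[of "j + k + 1"]] totally_acyclic_diff_diff[OF U, of _ "j + k + 1"]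
        totally_acyclic_exact[OF U, of _ "j + k + 1"] by auto blast
    show ?thesis
      using stable_Hom_shift[OF KA T Ul totally_acyclic_projective[OF U] Ul dU' dU' ex, of "i + k"]
      by (simp add: add.assoc)
  qed
  have id: "mod_iso K (?S 0) (?S 0)"
    unfolding mod_iso_def by (intro exI[of _ "\<lambda>x. x"]) (simp add: is_hom_id bij_betw_def)
  have "mod_iso K (?S 0) (?S k)"
  proof (induction k rule: int_induct[where k = 0])
    case base
    show ?case by (rule id)
  next
    case (step1 k)
    show ?case by (rule mod_iso_trans[OF step1(2) step])
  next
    case (step2 k)
    have "mod_iso K (?S (k - 1)) (?S k)" using step[of "k - 1"] by simp
    then show ?case by (rule mod_iso_trans[OF step2(2) mod_iso_sym[OF S]])
  qed
  then show ?thesis by simp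
qed

text \<open>The first shift replaces \<open>L\<close> by the kernel of the augmentation, which is
  the image of \<open>diff P 1\<close>. Each further step increases both indices, whose difference
  \<open>n + 1\<close> records that the target is the syzygy of order \<open>j + 1\<close>.\<close>

lemma tate_Ext_iso_stable_Hom_resolution:
  fixes P :: "('a, 'p) complx"
  assumes L: "left_module A L" and P: "projective_resolution A L P e"
  shows "mod_iso K (tate_Ext A T L n)
    (stable_Hom A T (n + 1 + int j) (obj P (int j + 1)) (diff P (int j + 1)) (obj P (int j)))"
proof (induction j)
  case 0
  note Pl = resolution_diff(2)[OF P L]
  have "tate_Ext A T L n = stable_Hom A T n (obj P 0) e L"
    by (rule tate_Ext_eq_stable_Hom[OF KA T Pl L resolution_diff(5,6)[OF P L]])
  moreover have "mod_iso K (stable_Hom A T n (obj P 0) e L)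
      (stable_Hom A T (n + 1) (obj P (0 + 1)) (diff P (0 + 1)) (obj P 0))"
    by (rule stable_Hom_shift[OF KA T L resolution_diff(1)[OF P L, of 0, simplified] Pl resolution_diff(5)[OF P L]
          resolution_diff(4)[OF P L]])
      (use resolution_diff(7)[OF P L] in \<open>simp add: syzygy_module_def\<close>)
  ultimately show ?case by simp
next
  case (Suc j)
  note Pl = resolution_diff(2)[OF P L]
  have "mod_iso K (stable_Hom A T (n + 1 + int j) (obj P (int j + 1)) (diff P (int j + 1)) (obj P (int j)))
      (stable_Hom A T (n + 1 + int j + 1) (obj P (int j + 1 + 1)) (diff P (int j + 1 + 1)) (obj P (int j + 1)))"
  proof (rule stable_Hom_shift[OF KA T Pl _ Pl resolution_diff(4)[OF P L] resolution_diff(4)[OF P L]])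
    show "projective A (obj P (int j + 1))" using resolution_diff(1)[OF P L, of "Suc j"] by (simp add: add.commute)
  qed (use resolution_diff(8)[OF P L, of j] in \<open>simp add: syzygy_module_def add.commute\<close>)
  from mod_iso_trans[OF Suc this] show ?case by (simp add: ac_simps)
qed

end

lemma complete_resolution_totally_acyclic: "complete_resolution R g M T P e f \<Longrightarrow> totally_acyclic R T"
  by (simp add: complete_resolution_def totally_acyclic_def)

text \<open>The passage from one complex to the other: afterwards \<open>M\<close> is represented by
  its syzygy \<open>W\<close>, and the degree is counted on \<open>U\<close> instead of
  \<open>T\<close>.\<close>

lemma tate_Ext_iso_cov_homology:
  fixes K :: "'k ring" and A :: "('k, 'a) module" and T :: "('a, 't) complx" and P :: "('a, 'p) complx"
    and U :: "('a, 'u) complx" and Q :: "('a, 'q) complx"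
  assumes KA: "k_algebra K A" and M: "left_module A M" and L: "left_module A L"
    and T: "complete_resolution A g M T P e f" and U: "complete_resolution A g L U Q e' f'"
    and W: "is_syzygy A d M W" and gd: "g \<le> d"
  shows "mod_iso K (tate_Ext A T L n) (cov_homology A W U (int d - 1 - n))"
proof -
  note TT = complete_resolution_totally_acyclic[OF T] and UU = complete_resolution_totally_acyclic[OF U]

  have P: "projective_resolution A M P e" and fT: "\<And>n. is_hom A (obj T n) (obj P n) (f n)"
    and fTd: "\<And>n x. x \<in> carrier (obj T n) \<Longrightarrow> f (n - 1) (diff T n x) = diff P n (f n x)"
    and bT: "\<And>n. n \<ge> int g \<Longrightarrow> bij_betw (f n) (carrier (obj T n)) (carrier (obj P n))"
    using T by (auto simp: complete_resolution_def chain_map_def)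
  have Q: "projective_resolution A L Q e'" and fU: "\<And>n. is_hom A (obj U n) (obj Q n) (f' n)"
    and fUd: "\<And>n x. x \<in> carrier (obj U n) \<Longrightarrow> f' (n - 1) (diff U n x) = diff Q n (f' n x)"
    and bU: "\<And>n. n \<ge> int g \<Longrightarrow> bij_betw (f' n) (carrier (obj U n)) (carrier (obj Q n))"
    using U by (auto simp: complete_resolution_def chain_map_def)
  note Tl = totally_acyclic_left_module[OF TT] and Ul = totally_acyclic_left_module[OF UU]
  note Pl = resolution_diff(2)[OF P M] and Ql = resolution_diff(2)[OF Q L]
  define m where "m = int d - 1 - n"
  let ?S = "\<lambda>i j. stable_Hom A T i (obj U (j + 1)) (diff U (j + 1)) (obj U j)"
  have 1: "mod_iso K (tate_Ext A T L n)
      (stable_Hom A T (n + 1 + int g) (obj Q (int g + 1)) (diff Q (int g + 1)) (obj Q (int g)))"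
    by (rule tate_Ext_iso_stable_Hom_resolution[OF KA TT L Q])
  \<comment> \<open>The target is the image of the differential from degree \<open>g + 1\<close> to
    degree \<open>g\<close>; in both degrees the chain map from \<open>U\<close> to \<open>Q\<close>
    is bijective.\<close>
  have "mod_iso K (?S (n + 1 + int g) (int g))
      (stable_Hom A T (n + 1 + int g) (obj Q (int g + 1)) (diff Q (int g + 1)) (obj Q (int g)))"
  proof (rule stable_Hom_bij[OF KA TT Ul Ul Ql Ql totally_acyclic_hom'[OF UU] resolution_diff(4)[OF Q L]
        fU bU fU bU])
    show "f' (int g) (diff U (int g + 1) x) = diff Q (int g + 1) (f' (int g + 1) x)"
      if "x \<in> carrier (obj U (int g + 1))" for x
      using fUd[OF that] by simp
  qed auto
  then have 2: "mod_iso K (stable_Hom A T (n + 1 + int g) (obj Q (int g + 1)) (diff Q (int g + 1)) (obj Q (int g)))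
      (?S (n + 1 + int g) (int g))"
    by (rule mod_iso_sym[OF left_module_stable_Hom[OF KA TT Ul Ul totally_acyclic_hom'[OF UU]]])
  \<comment> \<open>The shift by \<open>d - (n + 1 + g)\<close>, of either sign, brings the first
    index to \<open>d\<close>; the second becomes \<open>d - 1 - n\<close>, which is
    \<open>m\<close>.\<close>
  have 3: "mod_iso K (?S (n + 1 + int g) (int g)) (?S (int d) m)"
    using stable_Hom_shift_int[OF KA TT UU, of "n + 1 + int g" "int g" "int d - (n + 1 + int g)"]
    by (simp add: m_def algebra_simps)
  obtain R :: "('a, nat \<Rightarrow> 'a) complx" and e'' where R: "projective_resolution A M R e''"
    and WR: "if d = 0 then mod_iso A W (M\<lparr>carrier := e'' ` carrier (obj R 0)\<rparr>)
       else mod_iso A W ((obj R (int d - 1))\<lparr>carrier := diff R (int d) ` carrier (obj R (int d))\<rparr>)"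
    and Wl: "left_module A W"
    using W by (auto simp: is_syzygy_def minimal_projective_resolution_def)
  note Rl = resolution_diff(2)[OF R M]
  \<comment> \<open>If \<open>X\<close> is the cokernel of \<open>P\<close> in degree
    \<open>d\<close>, then it is also the cokernel of \<open>T\<close> there, as \<open>f\<close> is
    bijective in degrees \<open>d\<close> and \<open>d + 1\<close>. This is where
    \<open>g \<le> d\<close> is used.\<close>
  have step: "mod_iso K (?S (int d) m) (cov_homology A X U m)"
    if X: "left_module A X" and p: "is_hom A (obj P (int d)) X p" "p ` carrier (obj P (int d)) = carrier X"
      and ker: "{x \<in> carrier (obj P (int d)). p x = \<zero>\<^bsub>X\<^esub>} = diff P (int d + 1) ` carrier (obj P (int d + 1))"
    for X :: "('a, 'x) module" and p
  proof (rule stable_Hom_iso_cov_homology[OF KA TT UU X is_hom_comp[OF fT p(1)]])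
    have b: "bij_betw (f (int d)) (carrier (obj T (int d))) (carrier (obj P (int d)))"
      and b': "bij_betw (f (int d + 1)) (carrier (obj T (int d + 1))) (carrier (obj P (int d + 1)))"
      using bT gd by auto
    have f1: "f (int d) (diff T (int d + 1) x) = diff P (int d + 1) (f (int d + 1) x)"
      if "x \<in> carrier (obj T (int d + 1))" for x
      using fTd[OF that] by simp
    have "(\<lambda>x. p (f (int d) x)) ` carrier (obj T (int d)) = p ` (f (int d) ` carrier (obj T (int d)))"
      by (simp add: image_image)
    then show "(\<lambda>x. p (f (int d) x)) ` carrier (obj T (int d)) = carrier X"
      using bij_betw_imp_surj_on[OF b] p(2) by simp
    show "{x \<in> carrier (obj T (int d)). p (f (int d) x) = \<zero>\<^bsub>X\<^esub>} = diff T (int d + 1) ` carrier (obj T (int d + 1))"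
    proof (intro equalityI subsetI)
      fix x assume "x \<in> {x \<in> carrier (obj T (int d)). p (f (int d) x) = \<zero>\<^bsub>X\<^esub>}"
      then have x: "x \<in> carrier (obj T (int d))" "p (f (int d) x) = \<zero>\<^bsub>X\<^esub>" by auto
      then have "f (int d) x \<in> diff P (int d + 1) ` carrier (obj P (int d + 1))"
        using ker is_hom_closed[OF fT x(1)] by blast
      then obtain y where y: "y \<in> carrier (obj P (int d + 1))" "f (int d) x = diff P (int d + 1) y" by blast
      obtain z where z: "z \<in> carrier (obj T (int d + 1))" "y = f (int d + 1) z"
        using b' y(1) by (auto simp: bij_betw_def)
      have "f (int d) x = f (int d) (diff T (int d + 1) z)" using y z f1 by simp
      then have "x = diff T (int d + 1) z"
        using b x(1) is_hom_closed[OF totally_acyclic_hom'[OF TT] z(1)] by (auto simp: bij_betw_def inj_on_def)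
      then show "x \<in> diff T (int d + 1) ` carrier (obj T (int d + 1))" using z by blast
    next
      fix x assume "x \<in> diff T (int d + 1) ` carrier (obj T (int d + 1))"
      then obtain z where z: "z \<in> carrier (obj T (int d + 1))" "x = diff T (int d + 1) z" by blast
      have "f (int d) x \<in> diff P (int d + 1) ` carrier (obj P (int d + 1))"
        using f1[OF z(1)] z is_hom_closed[OF fT z(1)] by simp
      then have "p (f (int d) x) = \<zero>\<^bsub>X\<^esub>" using ker by blast
      then show "x \<in> {x \<in> carrier (obj T (int d)). p (f (int d) x) = \<zero>\<^bsub>X\<^esub>}"
        using z is_hom_closed[OF totally_acyclic_hom'[OF TT] z(1)] by simp
    qed
  qed
  have 4: "mod_iso K (?S (int d) m) (cov_homology A W U m)"
  proof (cases d)
    case 0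
    \<comment> \<open>For \<open>d = 0\<close> the syzygy is \<open>M\<close> up to isomorphism, and
      the augmentation plays the part of the differential.\<close>
    have ker: "{x \<in> carrier (obj P (int d)). e x = \<zero>\<^bsub>M\<^esub>} = diff P (int d + 1) ` carrier (obj P (int d + 1))"
      using resolution_diff(7)[OF P M] 0 by (simp add: syzygy_module_def)
    have "mod_iso K (?S (int d) m) (cov_homology A M U m)"
      by (rule step[OF M _ _ ker]) (use resolution_diff(5,6)[OF P M] 0 in auto)
    moreover have "mod_iso A W M" using WR 0 resolution_diff(6)[OF R M] by simp
    then have MW: "mod_iso A M W" by (rule mod_iso_sym[OF Wl])
    have "mod_iso K (cov_homology A M U m) (cov_homology A W U m)"
      by (rule cov_homology_stably_equivalent[OF KA UU M Wl
            stably_equivalent_iso[OF M Wl resolution_diff(1)[OF P M, of 0] MW]])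
    ultimately show ?thesis by (rule mod_iso_trans)
  next
    case (Suc i)
    \<comment> \<open>The order of \<open>syzygy_module P i\<close> is \<open>i + 1\<close>, which
      is \<open>d\<close>.\<close>
    let ?Z = "syzygy_module P i" and ?Z' = "syzygy_module R i"
    have dS: "int d = int i + 1" using Suc by simp
    note Zl = left_module_syzygy_module[OF P M, of i] and Zl' = left_module_syzygy_module[OF R M, of i]
    have ker: "{x \<in> carrier (obj P (int d)). diff P (int d) x = \<zero>\<^bsub>?Z\<^esub>} = diff P (int d + 1) ` carrier (obj P (int d + 1))"
      using resolution_diff(8)[OF P M, of i] by (simp add: syzygy_module_def dS add.commute)
    have SZ: "mod_iso K (?S (int d) m) (cov_homology A ?Z U m)"
      by (rule step[OF Zl _ _ ker])
        (use is_hom_restrict_carrier[OF resolution_diff(4)[OF P M, of "int i"]] in \<open>auto simp: syzygy_module_def dS\<close>)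
    obtain F :: "('a, 'p) module" and G :: "('a, nat \<Rightarrow> 'a) module"
      where "stably_equivalent A ?Z F ?Z' G"
      using resolution_syzygies_stably_equivalent[OF M P R] by blast
    then have ZZ: "mod_iso K (cov_homology A ?Z U m) (cov_homology A ?Z' U m)"
      by (rule cov_homology_stably_equivalent[OF KA UU Zl Zl'])
    have "mod_iso A W ?Z'" using WR Suc by (simp add: syzygy_module_def add.commute)
    then have ZW: "mod_iso A ?Z' W" by (rule mod_iso_sym[OF Wl])
    have ZW': "mod_iso K (cov_homology A ?Z' U m) (cov_homology A W U m)"
      by (rule cov_homology_stably_equivalent[OF KA UU Zl' Wl
            stably_equivalent_iso[OF Zl' Wl resolution_diff(1)[OF P M, of 0] ZW]])
    show ?thesis by (rule mod_iso_trans[OF SZ mod_iso_trans[OF ZZ ZW']])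
  qed
  show ?thesis
    using mod_iso_trans[OF 1 mod_iso_trans[OF 2 mod_iso_trans[OF 3 4]]] by (simp add: m_def)
qed

section \<open>Tensor products\<close>

lemma k_smult_opp [simp]: "k_smult (opp A) N = k_smult A N"
  by (simp add: k_smult_def fun_eq_iff)

text \<open>The generating set inside \<open>tensor_relations\<close>, separated from the submodule
  that it spans so that minimality of the span can be used.\<close>

definition tensor_relators ::
    "('k, 'c) ring_scheme \<Rightarrow> ('k, 'a) module \<Rightarrow> ('a, 'n) module \<Rightarrow> ('a, 'm) module \<Rightarrow>
      ('n \<times> 'm \<Rightarrow> 'k) set"
  where "tensor_relators K A N M =
    (let F = free_module K (carrier N \<times> carrier M); \<delta> = free_gen K in
       ({\<delta> (y \<oplus>\<^bsub>N\<^esub> y', x) \<ominus>\<^bsub>F\<^esub> (\<delta> (y, x) \<oplus>\<^bsub>F\<^esub> \<delta> (y', x)) | y y' x.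
           y \<in> carrier N \<and> y' \<in> carrier N \<and> x \<in> carrier M} \<union>
        {\<delta> (y, x \<oplus>\<^bsub>M\<^esub> x') \<ominus>\<^bsub>F\<^esub> (\<delta> (y, x) \<oplus>\<^bsub>F\<^esub> \<delta> (y, x')) | y x x'.
           y \<in> carrier N \<and> x \<in> carrier M \<and> x' \<in> carrier M} \<union>
        {\<delta> (a \<odot>\<^bsub>N\<^esub> y, x) \<ominus>\<^bsub>F\<^esub> \<delta> (y, a \<odot>\<^bsub>M\<^esub> x) | a y x.
           a \<in> carrier A \<and> y \<in> carrier N \<and> x \<in> carrier M} \<union>
        {\<delta> (k_smult A N c y, x) \<ominus>\<^bsub>F\<^esub> (c \<odot>\<^bsub>F\<^esub> \<delta> (y, x)) | c y x.
           c \<in> carrier K \<and> y \<in> carrier N \<and> x \<in> carrier M}))"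

lemma tensor_relations_eq:
  "tensor_relations K A N M = gen_submodule K (free_module K (carrier N \<times> carrier M)) (tensor_relators K A N M)"
  by (simp add: tensor_relations_def tensor_relators_def Let_def)

context
  fixes K :: "'k ring" and A :: "('k, 'a) module" and N :: "('a, 'n) module" and M :: "('a, 'm) module"
  assumes KA: "k_algebra K A" and N: "left_module (opp A) N" and M: "left_module A M"
begin

interpretation K: field K by (rule k_algebra_field[OF KA])
interpretation N: left_module "opp A" N by (rule N)
interpretation M: left_module A M by (rule M)
interpretation F: left_module K "free_module K (carrier N \<times> carrier M)"
  by (rule left_module_free_module[OF K.ring_axioms])

private abbreviation (input) "F \<equiv> free_module K (carrier N \<times> carrier M)"
private abbreviation (input) "\<delta> \<equiv> free_gen K"
private abbreviation (input) "B \<equiv> tensor_relations K A N M"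
private abbreviation (input) "T \<equiv> tensor K A N M"
private abbreviation (input) "pt \<equiv> pure_tensor K A N M"

lemma k_smult_closed_opp: "\<lbrakk>c \<in> carrier K; y \<in> carrier N\<rbrakk> \<Longrightarrow> k_smult A N c y \<in> carrier N"
  using k_smult_closed[OF k_algebra_opp[OF KA] N] by simp

private lemma \<delta>_closed: "\<lbrakk>y \<in> carrier N; x \<in> carrier M\<rbrakk> \<Longrightarrow> \<delta> (y, x) \<in> carrier F"
  by (rule free_gen_closed[OF K.ring_axioms]) simp

private lemma relators_closed: "tensor_relators K A N M \<subseteq> carrier F"
  unfolding tensor_relators_def Let_def
  by (auto simp del: free_module_simps intro!: F.M.minus_closed F.M.a_closed F.smult_closed \<delta>_closed
      k_smult_closed_opp N.M.a_closed N.smult_closed)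

private lemma relations_submodule: "submodule B K F"
  unfolding tensor_relations_eq by (rule gen_submodule[OF F.left_module relators_closed])

lemma left_module_tensor: "left_module K T"
  unfolding tensor_def by (rule left_module_quotient[OF F.left_module relations_submodule])

lemma pure_tensor_closed: "\<lbrakk>y \<in> carrier N; x \<in> carrier M\<rbrakk> \<Longrightarrow> pt y x \<in> carrier T"
  unfolding tensor_def pure_tensor_def
  by (rule quotient_closed[OF F.left_module relations_submodule \<delta>_closed])

private lemma relator_eq:
  assumes "u \<in> carrier F" "v \<in> carrier F" "u \<ominus>\<^bsub>F\<^esub> v \<in> tensor_relators K A N M"
  shows "B +>\<^bsub>F\<^esub> u = B +>\<^bsub>F\<^esub> v"
  using coset_eq_iff[OF F.left_module relations_submodule assms(1,2)]
    subsetD[OF gen_submodule_incl assms(3), of K F] by (simp only: tensor_relations_eq)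

lemma pure_tensor_add_left:
  assumes "y \<in> carrier N" "y' \<in> carrier N" "x \<in> carrier M"
  shows "pt (y \<oplus>\<^bsub>N\<^esub> y') x = pt y x \<oplus>\<^bsub>T\<^esub> pt y' x"
proof -
  have "B +>\<^bsub>F\<^esub> \<delta> (y \<oplus>\<^bsub>N\<^esub> y', x) = B +>\<^bsub>F\<^esub> (\<delta> (y, x) \<oplus>\<^bsub>F\<^esub> \<delta> (y', x))"
  proof (rule relator_eq)
    show "\<delta> (y \<oplus>\<^bsub>N\<^esub> y', x) \<ominus>\<^bsub>F\<^esub> (\<delta> (y, x) \<oplus>\<^bsub>F\<^esub> \<delta> (y', x)) \<in> tensor_relators K A N M"
      unfolding tensor_relators_def Let_def using assms by blast
  qed (intro \<delta>_closed F.M.a_closed N.M.a_closed assms)+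
  then show ?thesis
    unfolding tensor_def pure_tensor_def
    using quotient_add[OF F.left_module relations_submodule \<delta>_closed[OF assms(1,3)] \<delta>_closed[OF assms(2,3)]] by simp
qed

lemma pure_tensor_add_right:
  assumes "y \<in> carrier N" "x \<in> carrier M" "x' \<in> carrier M"
  shows "pt y (x \<oplus>\<^bsub>M\<^esub> x') = pt y x \<oplus>\<^bsub>T\<^esub> pt y x'"
proof -
  have "B +>\<^bsub>F\<^esub> \<delta> (y, x \<oplus>\<^bsub>M\<^esub> x') = B +>\<^bsub>F\<^esub> (\<delta> (y, x) \<oplus>\<^bsub>F\<^esub> \<delta> (y, x'))"
  proof (rule relator_eq)
    show "\<delta> (y, x \<oplus>\<^bsub>M\<^esub> x') \<ominus>\<^bsub>F\<^esub> (\<delta> (y, x) \<oplus>\<^bsub>F\<^esub> \<delta> (y, x')) \<in> tensor_relators K A N M"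
      unfolding tensor_relators_def Let_def using assms by blast
  qed (intro \<delta>_closed F.M.a_closed M.M.a_closed assms)+
  then show ?thesis
    unfolding tensor_def pure_tensor_def
    using quotient_add[OF F.left_module relations_submodule \<delta>_closed[OF assms(1,2)] \<delta>_closed[OF assms(1,3)]] by simp
qed

lemma pure_tensor_balanced:
  assumes "a \<in> carrier A" "y \<in> carrier N" "x \<in> carrier M"
  shows "pt (a \<odot>\<^bsub>N\<^esub> y) x = pt y (a \<odot>\<^bsub>M\<^esub> x)"
  unfolding pure_tensor_def
proof (rule relator_eq)
  show "\<delta> (a \<odot>\<^bsub>N\<^esub> y, x) \<ominus>\<^bsub>F\<^esub> \<delta> (y, a \<odot>\<^bsub>M\<^esub> x) \<in> tensor_relators K A N M"
    unfolding tensor_relators_def Let_def using assms by blast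
  show "\<delta> (a \<odot>\<^bsub>N\<^esub> y, x) \<in> carrier F" using N.smult_closed[of a y] assms \<delta>_closed by simp
qed (intro \<delta>_closed M.smult_closed assms)

lemma pure_tensor_k_smult:
  assumes "c \<in> carrier K" "y \<in> carrier N" "x \<in> carrier M"
  shows "pt (k_smult A N c y) x = c \<odot>\<^bsub>T\<^esub> pt y x"
proof -
  have "B +>\<^bsub>F\<^esub> \<delta> (k_smult A N c y, x) = B +>\<^bsub>F\<^esub> (c \<odot>\<^bsub>F\<^esub> \<delta> (y, x))"
  proof (rule relator_eq)
    show "\<delta> (k_smult A N c y, x) \<ominus>\<^bsub>F\<^esub> (c \<odot>\<^bsub>F\<^esub> \<delta> (y, x)) \<in> tensor_relators K A N M"
      unfolding tensor_relators_def Let_def using assms by blast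
  qed (intro \<delta>_closed F.smult_closed k_smult_closed_opp assms)+
  then show ?thesis
    unfolding tensor_def pure_tensor_def
    using quotient_smult[OF F.left_module relations_submodule assms(1) \<delta>_closed[OF assms(2,3)]] by simp
qed

lemma tensor_hom_eqI:
  assumes V: "left_module K V" and h: "is_hom K T V h" and h': "is_hom K T V h'"
    and eq: "\<And>y x. \<lbrakk>y \<in> carrier N; x \<in> carrier M\<rbrakk> \<Longrightarrow> h (pt y x) = h' (pt y x)" and t: "t \<in> carrier T"
  shows "h t = h' t"
proof -
  obtain u where u: "u \<in> carrier F" "t = B +>\<^bsub>F\<^esub> u"
    using t unfolding tensor_def by (rule quotient_cases[OF F.left_module relations_submodule])
  have c: "is_hom K F T (\<lambda>u. B +>\<^bsub>F\<^esub> u)"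
    unfolding tensor_def by (rule is_hom_coset[OF F.left_module relations_submodule])
  show ?thesis
    unfolding u(2)
    by (rule free_hom_eqI[OF K.ring_axioms V is_hom_comp[OF c h] is_hom_comp[OF c h'] _ u(1)])
      (use eq in \<open>auto simp: pure_tensor_def\<close>)
qed

text \<open>The universal property. \<open>b\<close> extends to the free space, and each kind of
  relator is killed by one of the hypotheses on \<open>b\<close>, so the extension passes to the
  quotient.\<close>

lemma tensor_lift:
  assumes V: "left_module K V"
    and closed: "\<And>y x. \<lbrakk>y \<in> carrier N; x \<in> carrier M\<rbrakk> \<Longrightarrow> b y x \<in> carrier V"
    and addl: "\<And>y y' x. \<lbrakk>y \<in> carrier N; y' \<in> carrier N; x \<in> carrier M\<rbrakk> \<Longrightarrow> b (y \<oplus>\<^bsub>N\<^esub> y') x = b y x \<oplus>\<^bsub>V\<^esub> b y' x"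
    and addr: "\<And>y x x'. \<lbrakk>y \<in> carrier N; x \<in> carrier M; x' \<in> carrier M\<rbrakk> \<Longrightarrow> b y (x \<oplus>\<^bsub>M\<^esub> x') = b y x \<oplus>\<^bsub>V\<^esub> b y x'"
    and bal: "\<And>a y x. \<lbrakk>a \<in> carrier A; y \<in> carrier N; x \<in> carrier M\<rbrakk> \<Longrightarrow> b (a \<odot>\<^bsub>N\<^esub> y) x = b y (a \<odot>\<^bsub>M\<^esub> x)"
    and sc: "\<And>c y x. \<lbrakk>c \<in> carrier K; y \<in> carrier N; x \<in> carrier M\<rbrakk> \<Longrightarrow> b (k_smult A N c y) x = c \<odot>\<^bsub>V\<^esub> b y x"
  obtains h where "is_hom K T V h" "\<And>y x. \<lbrakk>y \<in> carrier N; x \<in> carrier M\<rbrakk> \<Longrightarrow> h (pt y x) = b y x"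
proof -
  interpret V: left_module K V by (rule V)
  obtain f where f: "is_hom K F V f" "\<And>s. s \<in> carrier N \<times> carrier M \<Longrightarrow> f (\<delta> s) = (case s of (y, x) \<Rightarrow> b y x)"
    by (rule free_lift[OF K.ring_axioms V, of "carrier N \<times> carrier M" "\<lambda>(y, x). b y x"]) (use closed in auto)
  have f\<delta>: "f (\<delta> (y, x)) = b y x" if "y \<in> carrier N" "x \<in> carrier M" for y x
    using f(2)[of "(y, x)"] that by simp
  note fdiff = is_hom_diff[OF F.left_module V f(1)]
  have vv: "v \<ominus>\<^bsub>V\<^esub> v = \<zero>\<^bsub>V\<^esub>" if "v \<in> carrier V" for v using V.diff_eq_zero_iff[OF that that] by simp
  have *: "f (u \<ominus>\<^bsub>F\<^esub> v) = \<zero>\<^bsub>V\<^esub>" if "u \<in> carrier F" "v \<in> carrier F" "f u = f v" for u v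
    using fdiff[OF that(1,2)] that(3) vv is_hom_closed[OF f(1) that(2)] by simp
  have "tensor_relators K A N M \<subseteq> {u \<in> carrier F. f u = \<zero>\<^bsub>V\<^esub>}"
  proof
    fix r assume r: "r \<in> tensor_relators K A N M"
    have "f r = \<zero>\<^bsub>V\<^esub>"
      using r unfolding tensor_relators_def Let_def
    proof (elim UnE CollectE exE conjE; hypsubst)
      fix y y' x assume a: "y \<in> carrier N" "y' \<in> carrier N" "x \<in> carrier M"
      show "f (\<delta> (y \<oplus>\<^bsub>N\<^esub> y', x) \<ominus>\<^bsub>F\<^esub> (\<delta> (y, x) \<oplus>\<^bsub>F\<^esub> \<delta> (y', x))) = \<zero>\<^bsub>V\<^esub>"
        by (rule *) (intro \<delta>_closed F.M.a_closed N.M.a_closed a,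
          intro \<delta>_closed F.M.a_closed a, use a in \<open>simp add: is_hom_add[OF f(1)] \<delta>_closed f\<delta> addl del: free_module_simps\<close>)
    next
      fix y x x' assume a: "y \<in> carrier N" "x \<in> carrier M" "x' \<in> carrier M"
      show "f (\<delta> (y, x \<oplus>\<^bsub>M\<^esub> x') \<ominus>\<^bsub>F\<^esub> (\<delta> (y, x) \<oplus>\<^bsub>F\<^esub> \<delta> (y, x'))) = \<zero>\<^bsub>V\<^esub>"
        by (rule *) (intro \<delta>_closed F.M.a_closed M.M.a_closed a,
          intro \<delta>_closed F.M.a_closed a, use a in \<open>simp add: is_hom_add[OF f(1)] \<delta>_closed f\<delta> addr del: free_module_simps\<close>)
    next
      fix a y x assume a: "a \<in> carrier A" "y \<in> carrier N" "x \<in> carrier M"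
      have ay: "a \<odot>\<^bsub>N\<^esub> y \<in> carrier N" using N.smult_closed[of a y] a by simp
      show "f (\<delta> (a \<odot>\<^bsub>N\<^esub> y, x) \<ominus>\<^bsub>F\<^esub> \<delta> (y, a \<odot>\<^bsub>M\<^esub> x)) = \<zero>\<^bsub>V\<^esub>"
        by (rule *) (use a ay in \<open>simp_all add: \<delta>_closed f\<delta> bal del: free_module_simps\<close>)
    next
      fix c y x assume a: "c \<in> carrier K" "y \<in> carrier N" "x \<in> carrier M"
      show "f (\<delta> (k_smult A N c y, x) \<ominus>\<^bsub>F\<^esub> (c \<odot>\<^bsub>F\<^esub> \<delta> (y, x))) = \<zero>\<^bsub>V\<^esub>"
        by (rule *) (intro \<delta>_closed k_smult_closed_opp a, intro F.smult_closed \<delta>_closed a,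
          use a in \<open>simp add: is_hom_smult[OF f(1)] \<delta>_closed k_smult_closed_opp f\<delta> sc del: free_module_simps\<close>)
    qed
    then show "r \<in> {u \<in> carrier F. f u = \<zero>\<^bsub>V\<^esub>}" using r relators_closed by blast
  qed
  then have "B \<subseteq> {u \<in> carrier F. f u = \<zero>\<^bsub>V\<^esub>}"
    unfolding tensor_relations_eq
    by (rule gen_submodule_least[OF submodule_kernel[OF F.left_module V f(1)]])
  then have fB: "f u = \<zero>\<^bsub>V\<^esub>" if "u \<in> B" for u using that by blast
  obtain h where h: "is_hom K (quotient_module F B) V h" "\<And>u. u \<in> carrier F \<Longrightarrow> h (B +>\<^bsub>F\<^esub> u) = f u"
    using quotient_lift[OF F.left_module relations_submodule f(1) fB V] by blast
  show thesis
    by (rule that[of h]) (use h \<delta>_closed f\<delta> in \<open>simp_all add: tensor_def pure_tensor_def\<close>)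
qed

end

text \<open>The adjunction that identifies \<open>D(N \<otimes> M)\<close> with
  \<open>Hom(M, D(N))\<close>.\<close>

definition tensor_curry ::
    "('k, 'c) ring_scheme \<Rightarrow> ('k, 'a) module \<Rightarrow> ('a, 'n) module \<Rightarrow> ('a, 'm) module \<Rightarrow>
      (('n \<times> 'm \<Rightarrow> 'k) set \<Rightarrow> 'k) \<Rightarrow> 'm \<Rightarrow> 'n \<Rightarrow> 'k"
  where "tensor_curry K A N M G = (\<lambda>x\<in>carrier M. \<lambda>y\<in>carrier N. G (pure_tensor K A N M y x))"

context
  fixes K :: "'k ring" and A :: "('k, 'a) module" and N :: "('a, 'n) module"
  assumes KA: "k_algebra K A" and N: "left_module (opp A) N"
begin

interpretation K: field K by (rule k_algebra_field[OF KA])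
interpretation N: left_module "opp A" N by (rule N)

text \<open>The definite description in \<open>tensor_map\<close> denotes: the universal property
  yields such a map, and its values on pure tensors determine it.\<close>

lemma tensor_map:
  assumes M: "left_module A M" and M': "left_module A M'" and g: "is_hom A M M' g"
  shows "is_hom K (tensor K A N M) (tensor K A N M') (tensor_map K A N M M' g)"
    and "\<lbrakk>y \<in> carrier N; x \<in> carrier M\<rbrakk> \<Longrightarrow>
      tensor_map K A N M M' g (pure_tensor K A N M y x) = pure_tensor K A N M' y (g x)"
proof -
  let ?P = "\<lambda>h. h \<in> Hom_set K (tensor K A N M) (tensor K A N M') \<and>
      (\<forall>y\<in>carrier N. \<forall>x\<in>carrier M. h (pure_tensor K A N M y x) = pure_tensor K A N M' y (g x))"
  note gc = is_hom_closed[OF g]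
  note T = left_module_tensor[OF KA N M] and T' = left_module_tensor[OF KA N M']
  obtain h where h: "is_hom K (tensor K A N M) (tensor K A N M') h"
    "\<And>y x. \<lbrakk>y \<in> carrier N; x \<in> carrier M\<rbrakk> \<Longrightarrow> h (pure_tensor K A N M y x) = pure_tensor K A N M' y (g x)"
    by (rule tensor_lift[OF KA N M T', of "\<lambda>y x. pure_tensor K A N M' y (g x)"])
      (auto simp: pure_tensor_closed[OF KA N M'] pure_tensor_add_left[OF KA N M'] pure_tensor_add_right[OF KA N M']
        pure_tensor_balanced[OF KA N M'] pure_tensor_k_smult[OF KA N M'] gc is_hom_add[OF g] is_hom_smult[OF g])
  have "?P (restrict h (carrier (tensor K A N M)))"
    using Hom_setI[OF T h(1)] h(2) pure_tensor_closed[OF KA N M] by simp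
  moreover have "h1 = h2" if "?P h1" "?P h2" for h1 h2
  proof (rule Hom_set_eqI)
    show "h1 \<in> Hom_set K (tensor K A N M) (tensor K A N M')" "h2 \<in> Hom_set K (tensor K A N M) (tensor K A N M')"
      using that by auto
    show "h1 t = h2 t" if "t \<in> carrier (tensor K A N M)" for t
      by (rule tensor_hom_eqI[OF KA N M T' _ _ _ that]) (use \<open>?P h1\<close> \<open>?P h2\<close> Hom_set_hom in auto)
  qed
  ultimately have "\<exists>!h. ?P h" by blast
  then have P: "?P (tensor_map K A N M M' g)"
    unfolding tensor_map_def by (rule theI')
  then show "is_hom K (tensor K A N M) (tensor K A N M') (tensor_map K A N M M' g)"
    by (simp add: Hom_set_def)
  show "tensor_map K A N M M' g (pure_tensor K A N M y x) = pure_tensor K A N M' y (g x)"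
    if "y \<in> carrier N" "x \<in> carrier M"
    using P that by blast
qed

lemma tensor_curry:
  assumes M: "left_module A M"
  shows "is_hom K (lin_dual K (tensor K A N M)) (Hom_space A M (k_dual K (opp A) N)) (tensor_curry K A N M)"
    and "bij_betw (tensor_curry K A N M) (carrier (lin_dual K (tensor K A N M)))
      (carrier (Hom_space A M (k_dual K (opp A) N)))"
proof -
  interpret M: left_module A M by (rule M)
  let ?D = "k_dual K (opp A) N"
  let ?pt = "pure_tensor K A N M"
  note T = left_module_tensor[OF KA N M] and D = left_module_k_dual_opp[OF KA N]
    and NK = left_module_k_space[OF k_algebra_opp[OF KA] N] and KK = left_module_regular_field[OF k_algebra_field[OF KA]]
  note ptc = pure_tensor_closed[OF KA N M]
  have Nsm: "a \<odot>\<^bsub>N\<^esub> y \<in> carrier N" if "a \<in> carrier A" "y \<in> carrier N" for a y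
    using N.smult_closed[of a y] that by simp
  have closed: "tensor_curry K A N M G \<in> carrier (Hom_space A M ?D)" if "G \<in> carrier (lin_dual K (tensor K A N M))" for G
  proof -
    have G: "is_hom K (tensor K A N M) (regular K) G" using that Hom_set_hom by auto
    have D: "(\<lambda>y\<in>carrier N. G (?pt y x)) \<in> carrier ?D" if x: "x \<in> carrier M" for x
    proof -
      have "is_hom K (k_space (opp A) N) (regular K) (\<lambda>y. G (?pt y x))"
        by (rule is_homI)
          (use x ptc is_hom_closed[OF G] is_hom_add[OF G] is_hom_smult[OF G]
            pure_tensor_add_left[OF KA N M] pure_tensor_k_smult[OF KA N M] in auto)
      from Hom_setI[OF NK this] show ?thesis by simp
    qed
    have "is_hom A M ?D (\<lambda>x. \<lambda>y\<in>carrier N. G (?pt y x))"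
    proof (rule is_homI[OF D])
      show "(\<lambda>y\<in>carrier N. G (?pt y (x \<oplus>\<^bsub>M\<^esub> x'))) = (\<lambda>y\<in>carrier N. G (?pt y x)) \<oplus>\<^bsub>?D\<^esub> (\<lambda>y\<in>carrier N. G (?pt y x'))"
        if "x \<in> carrier M" "x' \<in> carrier M" for x x'
        using that ptc is_hom_add[OF G] pure_tensor_add_right[OF KA N M] by (auto intro!: restrict_ext)
      show "(\<lambda>y\<in>carrier N. G (?pt y (a \<odot>\<^bsub>M\<^esub> x))) = a \<odot>\<^bsub>?D\<^esub> (\<lambda>y\<in>carrier N. G (?pt y x))"
        if "a \<in> carrier A" "x \<in> carrier M" for a x
        using that Nsm pure_tensor_balanced[OF KA N M] by (auto intro!: restrict_ext)
    qed
    from Hom_setI[OF M this] show ?thesis by (simp add: tensor_curry_def)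
  qed
  show "is_hom K (lin_dual K (tensor K A N M)) (Hom_space A M ?D) (tensor_curry K A N M)"
  proof (rule is_homI[OF closed])
    fix G G'
    show "tensor_curry K A N M (G \<oplus>\<^bsub>lin_dual K (tensor K A N M)\<^esub> G') =
        tensor_curry K A N M G \<oplus>\<^bsub>Hom_space A M ?D\<^esub> tensor_curry K A N M G'"
      using ptc by (auto simp: tensor_curry_def intro!: restrict_ext)
  next
    fix c G assume c: "c \<in> carrier K" and "G \<in> carrier (lin_dual K (tensor K A N M))"
    then have G: "is_hom K (tensor K A N M) (regular K) G" using Hom_set_hom by auto
    \<comment> \<open>On \<open>D(N)\<close> a scalar acts through the argument \<open>y\<close>, on
      the dual of the tensor product through the value; the last kind of tensor relation makes the
      two agree.\<close>
    have "c \<otimes>\<^bsub>K\<^esub> G (?pt y x) = G (?pt ((c \<odot>\<^bsub>A\<^esub> \<one>\<^bsub>A\<^esub>) \<odot>\<^bsub>N\<^esub> y) x)" if "y \<in> carrier N" "x \<in> carrier M" for y x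
      using pure_tensor_k_smult[OF KA N M c that] is_hom_smult[OF G c ptc[OF that]] by (simp add: k_smult_def)
    then show "tensor_curry K A N M (c \<odot>\<^bsub>lin_dual K (tensor K A N M)\<^esub> G) = c \<odot>\<^bsub>Hom_space A M ?D\<^esub> tensor_curry K A N M G"
      using ptc Nsm scalar_closed[OF KA c] by (auto simp: tensor_curry_def k_smult_def intro!: restrict_ext)
  qed
  show "bij_betw (tensor_curry K A N M) (carrier (lin_dual K (tensor K A N M))) (carrier (Hom_space A M ?D))"
  proof (intro bij_betw_imageI inj_onI)
    fix G G' assume G: "G \<in> carrier (lin_dual K (tensor K A N M))" "G' \<in> carrier (lin_dual K (tensor K A N M))"
      and eq: "tensor_curry K A N M G = tensor_curry K A N M G'"
    have "G (?pt y x) = G' (?pt y x)" if "y \<in> carrier N" "x \<in> carrier M" for y x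
      using fun_cong[OF fun_cong[OF eq, of x], of y] that by (simp add: tensor_curry_def)
    then show "G = G'"
      using G tensor_hom_eqI[OF KA N M KK, of G G'] Hom_set_hom[of _ K "tensor K A N M" "regular K"]
      by (intro Hom_set_eqI[of _ K "tensor K A N M" "regular K"]) auto
  next
    show "tensor_curry K A N M ` carrier (lin_dual K (tensor K A N M)) = carrier (Hom_space A M ?D)"
    proof (intro equalityI subsetI)
      fix h assume "h \<in> carrier (Hom_space A M ?D)"
      then have hH: "h \<in> Hom_set A M ?D" by simp
      note h = Hom_set_hom[OF hH]
      have hx: "h x \<in> Hom_set K (k_space (opp A) N) (regular K)" if "x \<in> carrier M" for x
        using is_hom_closed[OF h that] by simp
      note hxh = Hom_set_hom[OF hx]
      obtain G where G: "is_hom K (tensor K A N M) (regular K) G"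
        "\<And>y x. \<lbrakk>y \<in> carrier N; x \<in> carrier M\<rbrakk> \<Longrightarrow> G (?pt y x) = h x y"
      \<comment> \<open>The inverse of currying: balancedness of \<open>h x y\<close> is the
        \<open>A\<close>-linearity of \<open>h\<close>, since \<open>A\<close> acts on
        \<open>D(N)\<close> through the argument.\<close>
      proof (rule tensor_lift[OF KA N M KK, of "\<lambda>y x. h x y"])
        show "h x y \<in> carrier (regular K)" if "y \<in> carrier N" "x \<in> carrier M" for y x
          using Hom_set_closed[OF hx] that by simp
        show "h x (y \<oplus>\<^bsub>N\<^esub> y') = h x y \<oplus>\<^bsub>regular K\<^esub> h x y'" if "y \<in> carrier N" "y' \<in> carrier N" "x \<in> carrier M" for y y' x
          using is_hom_add[OF hxh[OF that(3)], of y y'] that by simp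
        show "h (x \<oplus>\<^bsub>M\<^esub> x') y = h x y \<oplus>\<^bsub>regular K\<^esub> h x' y" if "y \<in> carrier N" "x \<in> carrier M" "x' \<in> carrier M" for y x x'
          using is_hom_add[OF h that(2,3)] that by simp
        show "h x (a \<odot>\<^bsub>N\<^esub> y) = h (a \<odot>\<^bsub>M\<^esub> x) y" if "a \<in> carrier A" "y \<in> carrier N" "x \<in> carrier M" for a y x
          using is_hom_smult[OF h that(1,3)] that by simp
        show "h x (k_smult A N c y) = c \<odot>\<^bsub>regular K\<^esub> h x y" if "c \<in> carrier K" "y \<in> carrier N" "x \<in> carrier M" for c y x
          using is_hom_smult[OF hxh[OF that(3)] that(1), of y] that by simp
      qed blast
      have "h = tensor_curry K A N M (restrict G (carrier (tensor K A N M)))"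
      proof (rule Hom_set_eqI[OF hH])
        show "tensor_curry K A N M (restrict G (carrier (tensor K A N M))) \<in> Hom_set A M ?D"
          using closed[of "restrict G (carrier (tensor K A N M))"] Hom_setI[OF T G(1)] by simp
        show "h x = tensor_curry K A N M (restrict G (carrier (tensor K A N M))) x" if x: "x \<in> carrier M" for x
        proof -
          have "h x = restrict (h x) (carrier N)" using Hom_set_restrict[OF hx[OF x]] by simp
          also have "\<dots> = (\<lambda>y\<in>carrier N. restrict G (carrier (tensor K A N M)) (?pt y x))"
            using G(2) x ptc by (auto intro!: restrict_ext)
          finally show ?thesis using x by (simp add: tensor_curry_def)
        qed
      qed
      then show "h \<in> tensor_curry K A N M ` carrier (lin_dual K (tensor K A N M))"
        using Hom_setI[OF T G(1)] by auto
    qed (use closed in auto)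
  qed
qed

end

section \<open>Duality between the homologies\<close>

context
  fixes K :: "'k ring" and A :: "('k, 'a) module"
  assumes KA: "k_algebra K A"
begin

interpretation K: field K by (rule k_algebra_field[OF KA])

lemma is_hom_Hom_pre:
  assumes X: "left_module A X" and Y: "left_module A Y" and d: "is_hom A X Y d"
  shows "is_hom K (Hom_space A Y D) (Hom_space A X D) (\<lambda>f. compose (carrier X) f d)"
proof (rule is_homI)
  fix f assume f: "f \<in> carrier (Hom_space A Y D)"
  show "compose (carrier X) f d \<in> carrier (Hom_space A X D)"
    using Hom_setI[OF X is_hom_comp[OF d Hom_set_hom[of f A Y D]]] f by (simp add: compose_def)
qed (use is_hom_closed[OF d] in \<open>auto simp: compose_def intro!: restrict_ext\<close>)

lemma tensor_diff_diff:
  assumes N: "left_module (opp A) N" and T: "totally_acyclic A T"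
    and t: "t \<in> carrier (tensor K A N (obj T (n + 1)))"
  shows "tensor_map K A N (obj T n) (obj T (n - 1)) (diff T n)
    (tensor_map K A N (obj T (n + 1)) (obj T n) (diff T (n + 1)) t) = \<zero>\<^bsub>tensor K A N (obj T (n - 1))\<^esub>"
proof -
  note Tl = totally_acyclic_left_module[OF T] and d = totally_acyclic_hom[OF T] and d' = totally_acyclic_hom'[OF T]
  note TT = left_module_tensor[OF KA N Tl]
  let ?\<alpha> = "tensor_map K A N (obj T (n + 1)) (obj T n) (diff T (n + 1))"
  let ?\<beta> = "tensor_map K A N (obj T n) (obj T (n - 1)) (diff T n)"
  note \<alpha> = tensor_map[OF KA N Tl Tl d'] and \<beta> = tensor_map[OF KA N Tl Tl d]
  note ptc = pure_tensor_closed[OF KA N Tl]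
  show ?thesis
  proof (rule tensor_hom_eqI[OF KA N Tl TT is_hom_comp[OF \<alpha>(1) \<beta>(1)] is_hom_zero_map[OF TT] _ t])
    fix y x assume y: "y \<in> carrier N" and x: "x \<in> carrier (obj T (n + 1))"
    interpret Tn: left_module A "obj T (n - 1)" by (rule Tl)
    interpret TTn: left_module K "tensor K A N (obj T (n - 1))" by (rule TT)
    have p0: "pure_tensor K A N (obj T (n - 1)) y \<zero>\<^bsub>obj T (n - 1)\<^esub> = \<zero>\<^bsub>tensor K A N (obj T (n - 1))\<^esub>"
      using pure_tensor_add_right[OF KA N Tl[of "n - 1"] y, of "\<zero>\<^bsub>obj T (n - 1)\<^esub>" "\<zero>\<^bsub>obj T (n - 1)\<^esub>"]
        ptc[OF y, of "\<zero>\<^bsub>obj T (n - 1)\<^esub>" "n - 1"] by simp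
    show "?\<beta> (?\<alpha> (pure_tensor K A N (obj T (n + 1)) y x)) = \<zero>\<^bsub>tensor K A N (obj T (n - 1))\<^esub>"
      using \<alpha>(2)[OF y x] \<beta>(2)[OF y is_hom_closed[OF d' x]] totally_acyclic_diff_diff[OF T x] p0 by simp
  qed
qed

text \<open>Currying identifies the dual of the complex \<open>N \<otimes> T\<close> with
  \<open>Hom(T, D(N))\<close> degree by degree, and exactness of the dual carries this to homology.
  The dual stands on the side of homology because \<open>Hom(T, D(N))\<close> is the full dual of
  \<open>N \<otimes> T\<close>, whatever the dimension.\<close>

lemma tate_Ext_iso_dual_tate_Tor:
  assumes N: "left_module (opp A) N" and T: "totally_acyclic A T"
  shows "mod_iso K (tate_Ext A T (k_dual K (opp A) N) n) (lin_dual K (tate_Tor K A N T n))"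
proof -
  let ?D = "k_dual K (opp A) N"
  note D = left_module_k_dual_opp[OF KA N]
  note Tl = totally_acyclic_left_module[OF T] and d = totally_acyclic_hom[OF T] and d' = totally_acyclic_hom'[OF T]
  note TT = left_module_tensor[OF KA N Tl] and H = left_module_Hom_space[OF KA Tl D]
  note curry = tensor_curry[OF KA N Tl]
  let ?\<alpha> = "tensor_map K A N (obj T (n + 1)) (obj T n) (diff T (n + 1))"
  let ?\<beta> = "tensor_map K A N (obj T n) (obj T (n - 1)) (diff T n)"
  note \<alpha> = tensor_map[OF KA N Tl Tl d'] and \<beta> = tensor_map[OF KA N Tl Tl d]
  note ptc = pure_tensor_closed[OF KA N Tl]
  have \<beta>\<alpha>: "?\<beta> (?\<alpha> t) = \<zero>\<^bsub>tensor K A N (obj T (n - 1))\<^esub>" if "t \<in> carrier (tensor K A N (obj T (n + 1)))" for t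
    by (rule tensor_diff_diff[OF N T that])
  \<comment> \<open>Currying is natural: composition with \<open>f\<close> on one side is
    composition with \<open>N \<otimes> f\<close> on the other. The case of a differential gives
    both commuting squares.\<close>
  have comm: "compose (carrier X) (tensor_curry K A N Y G) f =
      tensor_curry K A N X (\<lambda>t\<in>carrier (tensor K A N X). G (tensor_map K A N X Y f t))"
    if f: "is_hom A X Y f" and X: "left_module A X" and Y: "left_module A Y" for X Y :: "('a, 't) module" and f G
    using is_hom_closed[OF f] pure_tensor_closed[OF KA N X] tensor_map(2)[OF KA N X Y f]
    by (auto simp: tensor_curry_def compose_def intro!: restrict_ext)
  have "mod_iso K
    (quotient_module
      ((Hom_space A (obj T n) ?D)\<lparr>carrier := {y \<in> carrier (Hom_space A (obj T n) ?D).
         compose (carrier (obj T (n + 1))) y (diff T (n + 1)) = \<zero>\<^bsub>Hom_space A (obj T (n + 1)) ?D\<^esub>}\<rparr>)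
      ((\<lambda>f. compose (carrier (obj T n)) f (diff T n)) ` carrier (Hom_space A (obj T (n - 1)) ?D)))
    (lin_dual K (quotient_module
      ((tensor K A N (obj T n))\<lparr>carrier := {x \<in> carrier (tensor K A N (obj T n)).
        ?\<beta> x = \<zero>\<^bsub>tensor K A N (obj T (n - 1))\<^esub>}\<rparr>)
      (?\<alpha> ` carrier (tensor K A N (obj T (n + 1))))))"
  proof (rule lin_dual_homology[OF k_algebra_field[OF KA] TT[of "n + 1"] TT[of n] TT[of "n - 1"]
          H[of "n + 1"] H[of n] H[of "n - 1"] \<alpha>(1)[of n] \<beta>(1)[of n] \<beta>\<alpha>
          is_hom_Hom_pre[OF Tl Tl d'[of n]] is_hom_Hom_pre[OF Tl Tl d[of n]]
          curry(1)[of "n + 1"] bij_betw_imp_inj_on[OF curry(2)[of "n + 1"]] curry[of n] curry(1)[of "n - 1"]])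
    show "carrier (Hom_space A (obj T (n - 1)) ?D) \<subseteq>
        tensor_curry K A N (obj T (n - 1)) ` carrier (lin_dual K (tensor K A N (obj T (n - 1))))"
      using bij_betw_imp_surj_on[OF curry(2)[of "n - 1"]] by simp
  qed (assumption, rule comm[OF d' Tl Tl], rule comm[OF d Tl Tl])
  then show ?thesis
    by (simp add: tate_Ext_def tate_Tor_def homology_def cycles_def boundaries_def a_kernel_eq
        Hom_complex_def tensor_complex_def add.commute del: Hom_space_simps)
qed

text \<open>A dual basis of \<open>Y\<close> inverts the map that sends
  \<open>\<phi> \<otimes> u\<close> to \<open>w \<mapsto> \<phi> w u\<close>. The values on pure
  tensors belong to the conclusion because naturality in \<open>Y\<close>, needed for the
  differentials, is checked on them.\<close>

lemma dual_tensor_iso: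
  fixes Y :: "('a, 'y) module"
  assumes W: "left_module A W" and Y: "projective A Y" and fg: "fin_gen A Y"
  obtains h where "is_hom K (tensor K A (ring_dual A W) Y) (Hom_space A W Y) h"
    "bij_betw h (carrier (tensor K A (ring_dual A W) Y)) (carrier (Hom_space A W Y))"
    "\<And>\<phi> u. \<lbrakk>\<phi> \<in> carrier (ring_dual A W); u \<in> carrier Y\<rbrakk> \<Longrightarrow>
      h (pure_tensor K A (ring_dual A W) Y \<phi> u) = (\<lambda>w\<in>carrier W. \<phi> w \<odot>\<^bsub>Y\<^esub> u)"
proof -
  let ?N = "ring_dual A W" and ?H = "Hom_space A W Y"
  let ?T = "tensor K A ?N Y" and ?pt = "pure_tensor K A ?N Y"
  have Y': "left_module A Y" using Y by (simp add: projective_def)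
  interpret W: left_module A W by (rule W)
  interpret Y: left_module A Y by (rule Y')
  note N = left_module_ring_dual[OF W]
  interpret N: left_module "opp A" ?N by (rule N)
  note T = left_module_tensor[OF KA N Y'] and H = left_module_Hom_space[OF KA W Y']
  interpret T: left_module K ?T by (rule T)
  interpret H: left_module K ?H by (rule H)
  note ptc = pure_tensor_closed[OF KA N Y']
  have \<phi>c: "\<phi> w \<in> carrier A" if "\<phi> \<in> Hom_set A W (regular A)" "w \<in> carrier W" for \<phi> w
    using Hom_set_closed[OF that] by simp
  have outer: "(\<lambda>w\<in>carrier W. \<phi> w \<odot>\<^bsub>Y\<^esub> u) \<in> Hom_set A W Y" if \<phi>: "\<phi> \<in> Hom_set A W (regular A)" and u: "u \<in> carrier Y" for \<phi> u
  proof (rule Hom_setI[OF W is_homI])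
    show "\<phi> w \<odot>\<^bsub>Y\<^esub> u \<in> carrier Y" if "w \<in> carrier W" for w using \<phi>c[OF \<phi> that] u by simp
    show "\<phi> (w \<oplus>\<^bsub>W\<^esub> w') \<odot>\<^bsub>Y\<^esub> u = \<phi> w \<odot>\<^bsub>Y\<^esub> u \<oplus>\<^bsub>Y\<^esub> \<phi> w' \<odot>\<^bsub>Y\<^esub> u" if "w \<in> carrier W" "w' \<in> carrier W" for w w'
      using is_hom_add[OF Hom_set_hom[OF \<phi>] that] \<phi>c[OF \<phi>] that u by (simp add: Y.smult_l_distr)
    show "\<phi> (a \<odot>\<^bsub>W\<^esub> w) \<odot>\<^bsub>Y\<^esub> u = a \<odot>\<^bsub>Y\<^esub> (\<phi> w \<odot>\<^bsub>Y\<^esub> u)" if "a \<in> carrier A" "w \<in> carrier W" for a w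
      using is_hom_smult[OF Hom_set_hom[OF \<phi>] that] \<phi>c[OF \<phi>] that u by (simp add: Y.smult_assoc1)
  qed
  obtain h where h: "is_hom K ?T ?H h"
    "\<And>\<phi> u. \<lbrakk>\<phi> \<in> carrier ?N; u \<in> carrier Y\<rbrakk> \<Longrightarrow> h (?pt \<phi> u) = (\<lambda>w\<in>carrier W. \<phi> w \<odot>\<^bsub>Y\<^esub> u)"
  proof (rule tensor_lift[OF KA N Y' H, of "\<lambda>\<phi> u. \<lambda>w\<in>carrier W. \<phi> w \<odot>\<^bsub>Y\<^esub> u"])
    fix \<phi> u assume "\<phi> \<in> carrier ?N" and u: "u \<in> carrier Y"
    then have \<phi>: "\<phi> \<in> Hom_set A W (regular A)" by simp
    show "(\<lambda>w\<in>carrier W. \<phi> w \<odot>\<^bsub>Y\<^esub> u) \<in> carrier ?H" using outer[OF \<phi> u] by simp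
  next
    fix \<phi> \<phi>' u assume "\<phi> \<in> carrier ?N" "\<phi>' \<in> carrier ?N" "u \<in> carrier Y"
    then show "(\<lambda>w\<in>carrier W. (\<phi> \<oplus>\<^bsub>?N\<^esub> \<phi>') w \<odot>\<^bsub>Y\<^esub> u) = (\<lambda>w\<in>carrier W. \<phi> w \<odot>\<^bsub>Y\<^esub> u) \<oplus>\<^bsub>?H\<^esub> (\<lambda>w\<in>carrier W. \<phi>' w \<odot>\<^bsub>Y\<^esub> u)"
      using \<phi>c by (auto simp: Y.smult_l_distr intro!: restrict_ext)
  next
    fix \<phi> u u' assume "\<phi> \<in> carrier ?N" "u \<in> carrier Y" "u' \<in> carrier Y"
    then show "(\<lambda>w\<in>carrier W. \<phi> w \<odot>\<^bsub>Y\<^esub> (u \<oplus>\<^bsub>Y\<^esub> u')) = (\<lambda>w\<in>carrier W. \<phi> w \<odot>\<^bsub>Y\<^esub> u) \<oplus>\<^bsub>?H\<^esub> (\<lambda>w\<in>carrier W. \<phi> w \<odot>\<^bsub>Y\<^esub> u')"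
      using \<phi>c by (auto simp: Y.smult_r_distr intro!: restrict_ext)
  next
    fix a \<phi> u assume "a \<in> carrier A" "\<phi> \<in> carrier ?N" "u \<in> carrier Y"
    then show "(\<lambda>w\<in>carrier W. (a \<odot>\<^bsub>?N\<^esub> \<phi>) w \<odot>\<^bsub>Y\<^esub> u) = (\<lambda>w\<in>carrier W. \<phi> w \<odot>\<^bsub>Y\<^esub> (a \<odot>\<^bsub>Y\<^esub> u))"
      using \<phi>c by (auto simp: Y.smult_assoc1 intro!: restrict_ext)
  next
    fix c \<phi> u assume c: "c \<in> carrier K" and "\<phi> \<in> carrier ?N" "u \<in> carrier Y"
    \<comment> \<open>On the ring dual the scalar multiplies \<open>\<phi> w\<close> from the right,
      on homomorphisms from the left; its image in the algebra is central.\<close>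
    then show "(\<lambda>w\<in>carrier W. k_smult A ?N c \<phi> w \<odot>\<^bsub>Y\<^esub> u) = c \<odot>\<^bsub>?H\<^esub> (\<lambda>w\<in>carrier W. \<phi> w \<odot>\<^bsub>Y\<^esub> u)"
      using \<phi>c scalar_closed[OF KA c] scalar_central[OF KA c, symmetric]
      by (auto simp: k_smult_def Y.smult_assoc1 intro!: restrict_ext simp flip: Y.smult_assoc1)
  qed blast
  obtain I :: "'y set" and \<xi> c where I: "finite I" "\<And>a. a \<in> I \<Longrightarrow> is_hom A Y (regular A) (\<xi> a)"
    "\<And>a. a \<in> I \<Longrightarrow> c a \<in> carrier Y" "\<And>x. x \<in> carrier Y \<Longrightarrow> x = (\<Oplus>\<^bsub>Y\<^esub> a\<in>I. \<xi> a x \<odot>\<^bsub>Y\<^esub> c a)"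
    using projective_coordinates[OF k_algebra_ring[OF KA] Y Y' fg is_hom_id] by blast
  have \<xi>c: "\<xi> a x \<in> carrier A" if "a \<in> I" "x \<in> carrier Y" for a x
    using is_hom_closed[OF I(2)[OF that(1)] that(2)] by simp
  \<comment> \<open>the inverse of \<open>h\<close>, written down with the coordinates \<open>\<xi>\<close> and \<open>c\<close> on \<open>Y\<close>\<close>
  define p where "p a f = (\<lambda>w\<in>carrier W. \<xi> a (f w))" for a f
  have p: "p a f \<in> carrier ?N" if "a \<in> I" "f \<in> carrier ?H" for a f
    unfolding p_def using Hom_setI[OF W is_hom_comp[OF Hom_set_hom[of f A W Y] I(2)[OF that(1)]]] that(2) by simp
  define g where "g f = (\<Oplus>\<^bsub>?T\<^esub> a\<in>I. ?pt (p a f) (c a))" for f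
  have g: "is_hom K ?H ?T g"
    unfolding g_def
  proof (rule is_hom_finsum_map[OF K.ring_axioms H T])
    fix a assume a: "a \<in> I"
    show "is_hom K ?H ?T (\<lambda>f. ?pt (p a f) (c a))"
    proof (rule is_homI)
      show "?pt (p a f) (c a) \<in> carrier ?T" if "f \<in> carrier ?H" for f by (rule ptc[OF p[OF a that] I(3)[OF a]])
      show "?pt (p a (f \<oplus>\<^bsub>?H\<^esub> f')) (c a) = ?pt (p a f) (c a) \<oplus>\<^bsub>?T\<^esub> ?pt (p a f') (c a)"
        if f: "f \<in> carrier ?H" "f' \<in> carrier ?H" for f f'
      proof -
        have "p a (f \<oplus>\<^bsub>?H\<^esub> f') = p a f \<oplus>\<^bsub>?N\<^esub> p a f'"
          using f Hom_set_closed[of _ A W Y] is_hom_add[OF I(2)[OF a]] by (auto simp: p_def intro!: restrict_ext)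
        then show ?thesis using pure_tensor_add_left[OF KA N Y' p[OF a f(1)] p[OF a f(2)] I(3)[OF a]] by simp
      qed
      show "?pt (p a (k \<odot>\<^bsub>?H\<^esub> f)) (c a) = k \<odot>\<^bsub>?T\<^esub> ?pt (p a f) (c a)" if k: "k \<in> carrier K" and f: "f \<in> carrier ?H" for k f
      proof -
        have "p a (k \<odot>\<^bsub>?H\<^esub> f) = k_smult A ?N k (p a f)"
          using f Hom_set_closed[of f A W Y] is_hom_smult[OF I(2)[OF a] scalar_closed[OF KA k]]
            scalar_central[OF KA k] \<xi>c[OF a]
          by (auto simp: p_def k_smult_def intro!: restrict_ext)
        then show ?thesis using pure_tensor_k_smult[OF KA N Y' k p[OF a f] I(3)[OF a]] by simp
      qed
    qed
  qed
  have gh: "g (h t) = t" if t: "t \<in> carrier ?T" for t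
  proof (rule tensor_hom_eqI[OF KA N Y' T is_hom_comp[OF h(1) g] is_hom_id _ t])
    fix \<phi> u assume \<phi>: "\<phi> \<in> carrier ?N" and u: "u \<in> carrier Y"
    have "g (h (?pt \<phi> u)) = (\<Oplus>\<^bsub>?T\<^esub> a\<in>I. ?pt \<phi> (\<xi> a u \<odot>\<^bsub>Y\<^esub> c a))"
      unfolding g_def
    proof (rule T.M.finsum_cong')
      fix a assume a: "a \<in> I"
      \<comment> \<open>\<open>p a\<close> picks the coordinate \<open>\<xi> a u\<close> as a right
        multiple of \<open>\<phi>\<close>. Balancedness moves it across the tensor sign, where the
        sum over \<open>a\<close> reassembles \<open>u\<close>.\<close>
      have "p a (h (?pt \<phi> u)) = \<xi> a u \<odot>\<^bsub>?N\<^esub> \<phi>"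
        using \<phi> u \<phi>c[of \<phi>] is_hom_smult[OF I(2)[OF a] _ u] by (auto simp: p_def h(2) intro!: restrict_ext)
      then show "?pt (p a (h (?pt \<phi> u))) (c a) = ?pt \<phi> (\<xi> a u \<odot>\<^bsub>Y\<^esub> c a)"
        using pure_tensor_balanced[OF KA N Y' \<xi>c[OF a u] \<phi> I(3)[OF a]] by simp
    qed (use ptc \<phi> \<xi>c u I(3) in auto)
    also have "\<dots> = ?pt \<phi> (\<Oplus>\<^bsub>Y\<^esub> a\<in>I. \<xi> a u \<odot>\<^bsub>Y\<^esub> c a)"
      by (rule finsum_additive[OF Y' T, symmetric])
        (use ptc \<phi> \<xi>c u I(3) pure_tensor_add_right[OF KA N Y' \<phi>] in auto)
    also have "\<dots> = ?pt \<phi> u" using I(4)[OF u] by simp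
    finally show "g (h (?pt \<phi> u)) = ?pt \<phi> u" .
  qed
  have hg: "h (g f) = f" if f: "f \<in> carrier ?H" for f
  proof -
    have fH: "f \<in> Hom_set A W Y" using f by simp
    have hpt: "h (?pt (p a f) (c a)) = (\<lambda>w\<in>carrier W. p a f w \<odot>\<^bsub>Y\<^esub> c a)" if "a \<in> I" for a
      by (rule h(2)[OF p[OF that f] I(3)[OF that]])
    have "h (g f) = (\<Oplus>\<^bsub>?H\<^esub> a\<in>I. h (?pt (p a f) (c a)))"
      unfolding g_def by (rule is_hom_finsum[OF T H h(1)]) (use ptc p f I(3) in auto)
    moreover have hgc: "h (g f) \<in> carrier ?H" using is_hom_closed[OF h(1) is_hom_closed[OF g f]] .
    \<comment> \<open>Evaluation at \<open>w\<close> turns the claim into the expansion of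
      \<open>f w\<close> by the dual basis.\<close>
    moreover have "(\<Oplus>\<^bsub>?H\<^esub> a\<in>I. h (?pt (p a f) (c a))) w = f w" if w: "w \<in> carrier W" for w
    proof -
      have fw: "f w \<in> carrier Y" using Hom_set_closed[OF fH w] .
      have "(\<Oplus>\<^bsub>?H\<^esub> a\<in>I. h (?pt (p a f) (c a))) w = (\<Oplus>\<^bsub>Y\<^esub> a\<in>I. h (?pt (p a f) (c a)) w)"
        by (rule finsum_additive[OF H Y', where f = "\<lambda>f. f w"])
          (use w Hom_set_closed[of _ A W Y] is_hom_closed[OF h(1)] ptc p f I(3) in auto)
      also have "\<dots> = (\<Oplus>\<^bsub>Y\<^esub> a\<in>I. \<xi> a (f w) \<odot>\<^bsub>Y\<^esub> c a)"
        by (rule Y.M.finsum_cong') (use hpt w fw \<xi>c I(3) in \<open>auto simp: p_def\<close>)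
      also have "\<dots> = f w" using I(4)[OF fw] by simp
      finally show ?thesis .
    qed
    ultimately show ?thesis
      using fH by (intro Hom_set_eqI[of _ A W Y]) auto
  qed
  have "bij_betw h (carrier ?T) (carrier ?H)"
    by (rule bij_betw_byWitness[where f' = g])
      (use gh hg is_hom_closed[OF h(1)] is_hom_closed[OF g] in auto)
  then show thesis using that h by blast
qed

end

text \<open>An isomorphism in the middle induces one on homology as soon as it matches cycles and
  boundaries: injectivity of \<open>hC\<close> takes care of the cycles, surjectivity of
  \<open>hA\<close> of the boundaries.\<close>

lemma homology_iso:
  assumes A: "left_module R A" and B: "left_module R B" and C: "left_module R C"
    and A': "left_module R A'" and B': "left_module R B'" and C': "left_module R C'"
    and \<alpha>: "is_hom R A B \<alpha>" and \<beta>: "is_hom R B C \<beta>" and \<beta>\<alpha>: "\<And>x. x \<in> carrier A \<Longrightarrow> \<beta> (\<alpha> x) = \<zero>\<^bsub>C\<^esub>"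
    and \<alpha>': "is_hom R A' B' \<alpha>'" and \<beta>': "is_hom R B' C' \<beta>'"
    and hA: "is_hom R A A' hA" "hA ` carrier A = carrier A'"
    and hB: "is_hom R B B' hB" "bij_betw hB (carrier B) (carrier B')"
    and hC: "is_hom R C C' hC" "inj_on hC (carrier C)"
    and comm_\<alpha>: "\<And>x. x \<in> carrier A \<Longrightarrow> hB (\<alpha> x) = \<alpha>' (hA x)"
    and comm_\<beta>: "\<And>x. x \<in> carrier B \<Longrightarrow> hC (\<beta> x) = \<beta>' (hB x)"
  shows "mod_iso R (quotient_module (B\<lparr>carrier := {x \<in> carrier B. \<beta> x = \<zero>\<^bsub>C\<^esub>}\<rparr>) (\<alpha> ` carrier A))
    (quotient_module (B'\<lparr>carrier := {x \<in> carrier B'. \<beta>' x = \<zero>\<^bsub>C'\<^esub>}\<rparr>) (\<alpha>' ` carrier A'))"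
proof -
  interpret A: left_module R A by (rule A)
  interpret B: left_module R B by (rule B)
  interpret C: left_module R C by (rule C)
  interpret B': left_module R B' by (rule B')
  have \<beta>\<alpha>': "\<beta>' (\<alpha>' y) = \<zero>\<^bsub>C'\<^esub>" if y: "y \<in> carrier A'" for y
  proof -
    obtain x where "x \<in> carrier A" "y = hA x" using y hA(2) by blast
    then show ?thesis
      using comm_\<alpha>[of x] comm_\<beta>[OF is_hom_closed[OF \<alpha>], of x] \<beta>\<alpha>[of x] is_hom_zero[OF C C' hC(1)] by simp
  qed
  have ker_iff: "\<beta>' (hB x) = \<zero>\<^bsub>C'\<^esub> \<longleftrightarrow> \<beta> x = \<zero>\<^bsub>C\<^esub>" if x: "x \<in> carrier B" for x
    using comm_\<beta>[OF x] is_hom_zero[OF C C' hC(1)] inj_on_eq_iff[OF hC(2) is_hom_closed[OF \<beta> x] C.M.zero_closed]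
    by simp
  let ?Z = "{x \<in> carrier B. \<beta> x = \<zero>\<^bsub>C\<^esub>}" and ?Z' = "{x \<in> carrier B'. \<beta>' x = \<zero>\<^bsub>C'\<^esub>}"
  note Z = submodule_kernel[OF B C \<beta>] and Z' = submodule_kernel[OF B' C' \<beta>']
  have I: "submodule (\<alpha> ` carrier A) R (B\<lparr>carrier := ?Z\<rparr>)"
    by (rule B.submodule_restrict[OF submodule_image[OF A B \<alpha> A.submodule_carrier]])
      (use is_hom_closed[OF \<alpha>] \<beta>\<alpha> in auto)
  have I': "submodule (\<alpha>' ` carrier A') R (B'\<lparr>carrier := ?Z'\<rparr>)"
    by (rule B'.submodule_restrict[OF submodule_image[OF A' B' \<alpha>' left_module.submodule_carrier[OF A']]])
      (use is_hom_closed[OF \<alpha>'] \<beta>\<alpha>' in auto)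
  define G where "G = {(x, hB x) | x. x \<in> ?Z}"
  have GI: "(x, y) \<in> G" if "x \<in> ?Z" "y = hB x" for x y using that unfolding G_def by blast
  have GE: "x \<in> carrier B \<and> \<beta> x = \<zero>\<^bsub>C\<^esub> \<and> y = hB x" if "(x, y) \<in> G" for x y using that unfolding G_def by blast
  note zadd = B.submodule_add[OF Z] and zsm = B.submodule_smult[OF Z]
  show ?thesis
  proof (rule quotient_iso_quotient_relation[OF B.left_module_restrict[OF Z] B'.left_module_restrict[OF Z'] I I', of G])
    fix x y assume "(x, y) \<in> G"
    then have x: "x \<in> carrier B" "\<beta> x = \<zero>\<^bsub>C\<^esub>" "y = hB x" using GE by auto
    then show "x \<in> carrier (B\<lparr>carrier := ?Z\<rparr>) \<and> y \<in> carrier (B'\<lparr>carrier := ?Z'\<rparr>)"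
      using ker_iff[OF x(1)] is_hom_closed[OF hB(1) x(1)] by simp
    show "x \<in> \<alpha> ` carrier A \<longleftrightarrow> y \<in> \<alpha>' ` carrier A'"
    proof
      assume "x \<in> \<alpha> ` carrier A"
      then obtain a where "a \<in> carrier A" "x = \<alpha> a" by blast
      then show "y \<in> \<alpha>' ` carrier A'" using comm_\<alpha> is_hom_closed[OF hA(1)] x(3) by simp
    next
      assume "y \<in> \<alpha>' ` carrier A'"
      then obtain a' where a': "a' \<in> carrier A'" "y = \<alpha>' a'" by blast
      from a'(1) obtain a where "a \<in> carrier A" "a' = hA a" unfolding hA(2)[symmetric] by (rule imageE)
      with a'(2) have a: "a \<in> carrier A" "y = \<alpha>' (hA a)" by simp_all
      then have "hB x = hB (\<alpha> a)" using comm_\<alpha> x(3) by simp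
      then have "x = \<alpha> a" using hB(2) x(1) is_hom_closed[OF \<alpha> a(1)] by (auto simp: bij_betw_def inj_on_def)
      then show "x \<in> \<alpha> ` carrier A" using a by blast
    qed
  next
    fix x assume "x \<in> carrier (B\<lparr>carrier := ?Z\<rparr>)"
    then show "\<exists>y. (x, y) \<in> G" using GI by auto
  next
    fix y assume y: "y \<in> carrier (B'\<lparr>carrier := ?Z'\<rparr>)"
    then obtain x where "x \<in> carrier B" "y = hB x" using hB(2) by (auto simp: bij_betw_def)
    then have "(x, y) \<in> G" using ker_iff y by (intro GI) auto
    then show "\<exists>x. (x, y) \<in> G" by blast
  next
    fix x y x' y' assume "(x, y) \<in> G" "(x', y') \<in> G"
    then have "x \<in> ?Z" "x' \<in> ?Z" "y = hB x" "y' = hB x'" using GE by auto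
    then show "(x \<oplus>\<^bsub>B\<lparr>carrier := ?Z\<rparr>\<^esub> x', y \<oplus>\<^bsub>B'\<lparr>carrier := ?Z'\<rparr>\<^esub> y') \<in> G"
      using zadd[of x x'] is_hom_add[OF hB(1)] by (intro GI) auto
  next
    fix a x y assume a: "a \<in> carrier R" and "(x, y) \<in> G"
    then have "x \<in> ?Z" "y = hB x" using GE by auto
    then show "(a \<odot>\<^bsub>B\<lparr>carrier := ?Z\<rparr>\<^esub> x, a \<odot>\<^bsub>B'\<lparr>carrier := ?Z'\<rparr>\<^esub> y) \<in> G"
      using zsm[OF a, of x] is_hom_smult[OF hB(1) a] by (intro GI) auto
  qed
qed

section \<open>Finite dimensionality\<close>

lemma fin_dim_iso:
  assumes V: "left_module K V" and V': "left_module K V'" and iso: "mod_iso K V V'" and fd: "fin_dim K V'"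
  shows "fin_dim K V"
proof -
  interpret V: left_module K V by (rule V)
  obtain f where f: "is_hom K V V' f" "bij_betw f (carrier V) (carrier V')"
    using iso by (auto simp: mod_iso_def)
  show ?thesis
  proof (rule fin_dim_injective[OF f(1) _ fd])
    fix v assume v: "v \<in> carrier V" "f v = \<zero>\<^bsub>V'\<^esub>"
    then have "f v = f \<zero>\<^bsub>V\<^esub>" using is_hom_zero[OF V V' f(1)] by simp
    then show "v = \<zero>\<^bsub>V\<^esub>" using f(2) v(1) V.M.zero_closed by (auto simp: bij_betw_def dest: inj_onD)
  qed
qed

lemma fin_dim_restrict: "\<lbrakk>H \<subseteq> carrier V; fin_dim K V\<rbrakk> \<Longrightarrow> fin_dim K (V\<lparr>carrier := H\<rparr>)"
  by (rule fin_dim_injective[OF is_hom_incl]) auto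

text \<open>\<open>fin_dim\<close> passes to subspaces directly. A quotient is made into a subspace
  by sending the class of \<open>x\<close> to \<open>x - p x\<close>, where \<open>p\<close> is a
  projection onto \<open>B\<close>.\<close>

lemma fin_dim_quotient:
  fixes K :: "'k ring" and V :: "('k, 'v) module"
  assumes K: "field K" and V: "left_module K V" and B: "submodule B K V" and fd: "fin_dim K V"
  shows "fin_dim K (quotient_module V B)"
proof -
  interpret V: left_module K V by (rule V)
  obtain p where p: "is_hom K V V p" "\<And>x. x \<in> carrier V \<Longrightarrow> p x \<in> B" "\<And>x. x \<in> B \<Longrightarrow> p x = x"
    using complement_projection[OF K V B] by blast
  have f: "is_hom K V V (\<lambda>x. x \<ominus>\<^bsub>V\<^esub> p x)" by (rule is_hom_diff_map[OF V is_hom_id p(1)])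
  have fB: "x \<ominus>\<^bsub>V\<^esub> p x = \<zero>\<^bsub>V\<^esub>" if "x \<in> B" for x
    using p(3)[OF that] V.submodule_subset[OF B] that V.diff_eq_zero_iff[of x x] by auto
  obtain h where h: "is_hom K (quotient_module V B) V h" "\<And>x. x \<in> carrier V \<Longrightarrow> h (B +>\<^bsub>V\<^esub> x) = x \<ominus>\<^bsub>V\<^esub> p x"
    using quotient_lift[OF V B f fB V] by blast
  show ?thesis
  proof (rule fin_dim_injective[OF h(1) _ fd])
    fix X assume X: "X \<in> carrier (quotient_module V B)" "h X = \<zero>\<^bsub>V\<^esub>"
    obtain x where x: "x \<in> carrier V" "X = B +>\<^bsub>V\<^esub> x" by (rule quotient_cases[OF V B X(1)])
    then have "x = p x" using h(2) X(2) V.diff_eq_zero_iff[OF x(1) is_hom_closed[OF p(1) x(1)]] by simp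
    then have "x \<in> B" using p(2)[OF x(1)] by simp
    then show "X = \<zero>\<^bsub>quotient_module V B\<^esub>" using coset_eq_zero_iff[OF V B x(1)] x(2) by simp
  qed
qed

text \<open>\<open>V'\<close> bounds the dual of \<open>V\<close>, hence \<open>V\<close> itself,
  which is then isomorphic to its own dual. This removes the dual from the comparison of Tate
  homology with Tate cohomology.\<close>

lemma mod_iso_dual_fin_dim:
  fixes K :: "'k ring" and V :: "('k, 'v) module"
  assumes K: "field K" and V: "left_module K V" and V': "left_module K V'"
    and iso: "mod_iso K V' (lin_dual K V)" and fd: "fin_dim K V'"
  shows "mod_iso K V V'"
proof -
  note D = left_module_lin_dual[OF K V]
  have "fin_dim K (lin_dual K V)" by (rule fin_dim_iso[OF D V' mod_iso_sym[OF V' iso] fd])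
  then have "mod_iso K V (lin_dual K V)"
    by (intro fin_dim_iso_dual[OF K V] fin_dim_dual_imp_fin_dim[OF K V])
  then show ?thesis by (rule mod_iso_trans[OF _ mod_iso_sym[OF V' iso]])
qed

lemma submodule_opp: "submodule H K (opp A) \<longleftrightarrow> submodule H K (A :: ('k, 'a) module)"
  by (simp add: submodule_def submodule_axioms_def opp_def)

lemma fin_gen_opp: "fin_gen K A \<Longrightarrow> fin_gen K (opp A)"
  by (simp add: fin_gen_def gen_submodule_def submodule_opp)

context
  fixes K :: "'k ring" and A :: "('k, 'a) module"
  assumes KA: "k_algebra K A"
begin

interpretation A: k_algebra K A by (rule KA)

lemma left_module_algebra: "left_module K A"
  using A.abelian_group_axioms
  by (intro left_module.intro left_module_axioms.intro)
    (auto simp: A.R.ring_axioms A.smult_l_distr A.smult_r_distr A.smult_assoc1 intro: A.A.is_abelian_group)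

text \<open>A functional on \<open>L\<close> is determined by its values at the products of the
  generators of \<open>A\<close> over \<open>K\<close> with those of \<open>L\<close> over
  \<open>A\<close>. The dual comes before \<open>L\<close> because evaluations are functionals on it
  that are at hand, whereas separating functionals on \<open>L\<close> itself would first have to be
  constructed.\<close>

lemma fin_dim_lin_dual_k_space:
  assumes fA: "fin_gen K A" and L: "left_module A L" and fL: "fin_gen A L"
  shows "fin_dim K (lin_dual K (k_space A L))"
proof -
  interpret L: left_module A L by (rule L)
  note LK = left_module_k_space[OF KA L] and KK = left_module_regular_field[OF k_algebra_field[OF KA]]
  obtain S where S: "finite S" "S \<subseteq> carrier A" "gen_submodule K A S = carrier A" using fA by (auto simp: fin_gen_def)
  obtain Z where Z: "finite Z" "Z \<subseteq> carrier L" "gen_submodule A L Z = carrier L" using fL by (auto simp: fin_gen_def)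
  let ?F = "(\<lambda>(a, l) G. G (a \<odot>\<^bsub>L\<^esub> l)) ` (S \<times> Z)"
  show ?thesis
    unfolding fin_dim_def
  proof (intro exI[of _ ?F] conjI ballI impI)
    show "finite ?F" using S(1) Z(1) by simp
    show "is_hom K (lin_dual K (k_space A L)) (regular K) e" if e: "e \<in> ?F" for e
    proof -
      obtain a l where al: "a \<in> S" "l \<in> Z" "e = (\<lambda>G. G (a \<odot>\<^bsub>L\<^esub> l))" using e by auto
      then have "a \<odot>\<^bsub>L\<^esub> l \<in> carrier L" using S(2) Z(2) by auto
      then show ?thesis
        unfolding al(3) by (intro is_homI) (use Hom_set_closed[of _ K "k_space A L" "regular K"] in auto)
    qed
    fix G assume "G \<in> carrier (lin_dual K (k_space A L))" and z: "\<forall>e\<in>?F. e G = \<zero>\<^bsub>K\<^esub>"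
    then have GH: "G \<in> Hom_set K (k_space A L) (regular K)" by simp
    note G = Hom_set_hom[OF GH]
    have z': "G (a \<odot>\<^bsub>L\<^esub> l) = \<zero>\<^bsub>K\<^esub>" if "a \<in> S" "l \<in> Z" for a l using z that by force
    have zA: "G (a \<odot>\<^bsub>L\<^esub> l) = \<zero>\<^bsub>K\<^esub>" if a: "a \<in> carrier A" and l: "l \<in> Z" for a l
    proof -
      have lc: "l \<in> carrier L" using l Z(2) by blast
      have h: "is_hom K A (regular K) (\<lambda>a. G (a \<odot>\<^bsub>L\<^esub> l))"
      proof (rule is_homI)
        show "G (a \<odot>\<^bsub>L\<^esub> l) \<in> carrier (regular K)" if "a \<in> carrier A" for a
          using is_hom_closed[OF G, of "a \<odot>\<^bsub>L\<^esub> l"] that lc by simp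
        show "G ((a \<oplus>\<^bsub>A\<^esub> b) \<odot>\<^bsub>L\<^esub> l) = G (a \<odot>\<^bsub>L\<^esub> l) \<oplus>\<^bsub>regular K\<^esub> G (b \<odot>\<^bsub>L\<^esub> l)" if "a \<in> carrier A" "b \<in> carrier A" for a b
          using is_hom_add[OF G, of "a \<odot>\<^bsub>L\<^esub> l" "b \<odot>\<^bsub>L\<^esub> l"] that lc by (simp add: L.smult_l_distr)
        show "G ((c \<odot>\<^bsub>A\<^esub> a) \<odot>\<^bsub>L\<^esub> l) = c \<odot>\<^bsub>regular K\<^esub> G (a \<odot>\<^bsub>L\<^esub> l)" if c: "c \<in> carrier K" and a: "a \<in> carrier A" for c a
        proof -
          have "(c \<odot>\<^bsub>A\<^esub> a) \<odot>\<^bsub>L\<^esub> l = k_smult A L c (a \<odot>\<^bsub>L\<^esub> l)"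
            using c a lc by (simp add: k_smult_def A.smult_mult_left flip: L.smult_assoc1)
          then show ?thesis using is_hom_smult[OF G c, of "a \<odot>\<^bsub>L\<^esub> l"] a lc by simp
        qed
      qed
      \<comment> \<open>For fixed \<open>l\<close> the zeros of \<open>a \<mapsto> G (a l)\<close>
        form a subspace of the algebra that contains its generators.\<close>
      have "gen_submodule K A S \<subseteq> {a \<in> carrier A. G (a \<odot>\<^bsub>L\<^esub> l) = \<zero>\<^bsub>regular K\<^esub>}"
        by (rule gen_submodule_least[OF submodule_kernel[OF left_module_algebra KK h]])
          (use S(2) z' l in auto)
      then show ?thesis using a S(3) by auto
    qed
    \<comment> \<open>Asking for \<open>G (a l) = 0\<close> for all \<open>a\<close> at once makes
      the set stable under the action of \<open>A\<close>; \<open>a = 1\<close> recovers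
      \<open>G l = 0\<close> at the end.\<close>
    have "submodule {l \<in> carrier L. \<forall>a\<in>carrier A. G (a \<odot>\<^bsub>L\<^esub> l) = \<zero>\<^bsub>K\<^esub>} A L"
    proof (rule L.submoduleI)
      show "\<zero>\<^bsub>L\<^esub> \<in> {l \<in> carrier L. \<forall>a\<in>carrier A. G (a \<odot>\<^bsub>L\<^esub> l) = \<zero>\<^bsub>K\<^esub>}"
        using is_hom_zero[OF LK KK G] by simp
      fix x y assume "x \<in> {l \<in> carrier L. \<forall>a\<in>carrier A. G (a \<odot>\<^bsub>L\<^esub> l) = \<zero>\<^bsub>K\<^esub>}"
        "y \<in> {l \<in> carrier L. \<forall>a\<in>carrier A. G (a \<odot>\<^bsub>L\<^esub> l) = \<zero>\<^bsub>K\<^esub>}"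
      then show "x \<oplus>\<^bsub>L\<^esub> y \<in> {l \<in> carrier L. \<forall>a\<in>carrier A. G (a \<odot>\<^bsub>L\<^esub> l) = \<zero>\<^bsub>K\<^esub>}"
        using is_hom_add[OF G, of "a \<odot>\<^bsub>L\<^esub> x" "a \<odot>\<^bsub>L\<^esub> y" for a] by (auto simp: L.smult_r_distr)
    next
      fix b x assume "b \<in> carrier A" "x \<in> {l \<in> carrier L. \<forall>a\<in>carrier A. G (a \<odot>\<^bsub>L\<^esub> l) = \<zero>\<^bsub>K\<^esub>}"
      then show "b \<odot>\<^bsub>L\<^esub> x \<in> {l \<in> carrier L. \<forall>a\<in>carrier A. G (a \<odot>\<^bsub>L\<^esub> l) = \<zero>\<^bsub>K\<^esub>}"
        by (auto simp flip: L.smult_assoc1)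
    qed auto
    then have "gen_submodule A L Z \<subseteq> {l \<in> carrier L. \<forall>a\<in>carrier A. G (a \<odot>\<^bsub>L\<^esub> l) = \<zero>\<^bsub>K\<^esub>}"
      by (rule gen_submodule_least) (use Z(2) zA in auto)
    then have "G l = \<zero>\<^bsub>K\<^esub>" if l: "l \<in> carrier L" for l
    proof -
      have "G (\<one>\<^bsub>A\<^esub> \<odot>\<^bsub>L\<^esub> l) = \<zero>\<^bsub>K\<^esub>"
        using \<open>gen_submodule A L Z \<subseteq> _\<close> l Z(3) A.A.one_closed by blast
      then show ?thesis using l by simp
    qed
    then have "restrict G (carrier L) = (\<lambda>x\<in>carrier L. \<zero>\<^bsub>K\<^esub>)" by (auto intro!: restrict_ext)
    then show "G = \<zero>\<^bsub>lin_dual K (k_space A L)\<^esub>" using Hom_set_restrict[OF GH] by simp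
  qed
qed

lemma fin_dim_k_space:
  assumes "fin_gen K A" and L: "left_module A L" and "fin_gen A L"
  shows "fin_dim K (k_space A L)"
  by (rule fin_dim_dual_imp_fin_dim[OF k_algebra_field[OF KA] left_module_k_space[OF KA L] fin_dim_lin_dual_k_space[OF assms]])

text \<open>A homomorphism is determined by its values at the generators of \<open>X\<close>, and
  these by finitely many functionals on \<open>L\<close>.\<close>

lemma fin_dim_Hom_space:
  assumes X: "left_module A X" and fX: "fin_gen A X" and L: "left_module A L" and fd: "fin_dim K (k_space A L)"
  shows "fin_dim K (Hom_space A X L)"
proof -
  interpret X: left_module A X by (rule X)
  obtain S where S: "finite S" "S \<subseteq> carrier X" "gen_submodule A X S = carrier X" using fX by (auto simp: fin_gen_def)
  obtain F where F: "finite F" "\<forall>f\<in>F. is_hom K (k_space A L) (regular K) f"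
    "\<forall>v\<in>carrier (k_space A L). (\<forall>f\<in>F. f v = \<zero>\<^bsub>K\<^esub>) \<longrightarrow> v = \<zero>\<^bsub>k_space A L\<^esub>"
    using fd by (auto simp: fin_dim_def)
  let ?F = "(\<lambda>(f, s) h. f (h s)) ` (F \<times> S)"
  show ?thesis
    unfolding fin_dim_def
  proof (intro exI[of _ ?F] conjI ballI impI)
    show "finite ?F" using S(1) F(1) by simp
    show "is_hom K (Hom_space A X L) (regular K) e" if e: "e \<in> ?F" for e
    proof -
      obtain f s where fs: "f \<in> F" "s \<in> S" "e = (\<lambda>h. f (h s))" using e by auto
      have s: "s \<in> carrier X" using fs S(2) by blast
      have f: "is_hom K (k_space A L) (regular K) f" using fs F(2) by blast
      have "is_hom K (Hom_space A X L) (k_space A L) (\<lambda>h. h s)"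
        by (rule is_homI) (use s Hom_set_closed[of _ A X L] in auto)
      from is_hom_comp[OF this f] show ?thesis by (simp add: fs(3))
    qed
    fix h assume "h \<in> carrier (Hom_space A X L)" and z: "\<forall>e\<in>?F. e h = \<zero>\<^bsub>K\<^esub>"
    then have hH: "h \<in> Hom_set A X L" by simp
    have "h s = \<zero>\<^bsub>L\<^esub>" if s: "s \<in> S" for s
    proof -
      have "f (h s) = \<zero>\<^bsub>K\<^esub>" if "f \<in> F" for f using z s that by force
      then show ?thesis using F(3) Hom_set_closed[OF hH] s S(2) by auto
    qed
    then have "gen_submodule A X S \<subseteq> {x \<in> carrier X. h x = \<zero>\<^bsub>L\<^esub>}"
      by (intro gen_submodule_least submodule_kernel[OF X L Hom_set_hom[OF hH]]) (use S(2) in auto)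
    then have "restrict h (carrier X) = (\<lambda>x\<in>carrier X. \<zero>\<^bsub>L\<^esub>)" using S(3) by (auto intro!: restrict_ext)
    then show "h = \<zero>\<^bsub>Hom_space A X L\<^esub>" using Hom_set_restrict[OF hH] by simp
  qed
qed

text \<open>With the identity as surjection the stable description applies to every
  \<open>L\<close>, and the module structure and finite dimension of Tate cohomology are obtained
  from it.\<close>

lemma tate_Ext_eq_stable_Hom_id:
  assumes T: "totally_acyclic A T" and L: "left_module A L"
  shows "tate_Ext A T L n = stable_Hom A T n L (\<lambda>x. x) L"
  by (rule tate_Ext_eq_stable_Hom[OF KA T L L is_hom_id]) simp

lemma left_module_tate_Ext:
  assumes T: "totally_acyclic A T" and L: "left_module A L"
  shows "left_module K (tate_Ext A T L n)"
  unfolding tate_Ext_eq_stable_Hom_id[OF assms] by (rule left_module_stable_Hom[OF KA T L L is_hom_id])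

lemma fin_dim_tate_Ext:
  assumes T: "totally_acyclic A T" and L: "left_module A L" and fd: "fin_dim K (k_space A L)"
  shows "fin_dim K (tate_Ext A T L n)"
  unfolding tate_Ext_eq_stable_Hom_id[OF T L] stable_Hom_def
  by (intro fin_dim_quotient[OF k_algebra_field[OF KA] left_module_stable_cocycles[OF KA T L L is_hom_id]
        submodule_stable_coboundaries'[OF KA T L L is_hom_id]] fin_dim_restrict fin_dim_Hom_space
      totally_acyclic_left_module[OF T] totally_acyclic_fin_gen[OF T] L fd)
    (auto simp: stable_cocycles_def)

end

text \<open>The scalars act on \<open>D(N)\<close> through the algebra, in the linear dual through
  the values. Linearity of the functionals makes the two actions agree, so the identity map embeds
  one space in the other.\<close>

lemma fin_dim_k_dual:
  fixes K :: "'k ring" and A :: "('k, 'a) module" and N :: "('a, 'n) module"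
  assumes KA: "k_algebra K A" and fA: "fin_gen K A" and N: "left_module (opp A) N" and fN: "fin_gen (opp A) N"
  shows "fin_dim K (k_space A (k_dual K (opp A) N))"
proof (rule fin_dim_injective[OF _ _ fin_dim_lin_dual_k_space[OF k_algebra_opp[OF KA] fin_gen_opp[OF fA] N fN], of _ "\<lambda>f. f"])
  interpret N: left_module "opp A" N by (rule N)
  show "is_hom K (k_space A (k_dual K (opp A) N)) (lin_dual K (k_space (opp A) N)) (\<lambda>f. f)"
  proof (rule is_homI)
    fix c f assume c: "c \<in> carrier K" and "f \<in> carrier (k_space A (k_dual K (opp A) N))"
    then have f: "is_hom K (k_space (opp A) N) (regular K) f" using Hom_set_hom by auto
    have "f ((c \<odot>\<^bsub>A\<^esub> \<one>\<^bsub>A\<^esub>) \<odot>\<^bsub>N\<^esub> x) = c \<otimes>\<^bsub>K\<^esub> f x" if "x \<in> carrier N" for x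
      using is_hom_smult[OF f c, of x] that by (simp add: k_smult_def)
    then show "c \<odot>\<^bsub>k_space A (k_dual K (opp A) N)\<^esub> f = c \<odot>\<^bsub>lin_dual K (k_space (opp A) N)\<^esub> f"
      by (auto simp: k_smult_def intro!: restrict_ext)
  qed auto
qed auto

section \<open>Tate homology with coefficients in a dual\<close>

text \<open>The terms of \<open>U\<close> are finitely generated projective, so
  \<open>W\<^sup>* \<otimes> U\<close> and \<open>Hom(W, U)\<close> agree in every degree; agreement
  of the differentials is tested on pure tensors.\<close>

lemma tate_Tor_ring_dual_iso:
  fixes K :: "'k ring" and A :: "('k, 'a) module" and W :: "('a, 'w) module" and U :: "('a, 'u) complx"
  assumes KA: "k_algebra K A" and W: "left_module A W" and U: "totally_acyclic A U"
  shows "mod_iso K (tate_Tor K A (ring_dual A W) U m) (cov_homology A W U m)"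
proof -
  let ?N = "ring_dual A W"
  note N = left_module_ring_dual[OF W]
  note Ul = totally_acyclic_left_module[OF U] and d = totally_acyclic_hom[OF U] and d' = totally_acyclic_hom'[OF U]
  note TT = left_module_tensor[OF KA N Ul] and H = left_module_Hom_space[OF KA W Ul]
  let ?\<alpha> = "tensor_map K A ?N (obj U (m + 1)) (obj U m) (diff U (m + 1))"
  let ?\<beta> = "tensor_map K A ?N (obj U m) (obj U (m - 1)) (diff U m)"
  let ?\<alpha>' = "\<lambda>h. \<lambda>w\<in>carrier W. diff U (m + 1) (h w)" and ?\<beta>' = "\<lambda>h. \<lambda>w\<in>carrier W. diff U m (h w)"
  note \<alpha> = tensor_map[OF KA N Ul Ul d'] and \<beta> = tensor_map[OF KA N Ul Ul d]
  \<comment> \<open>Stated as an existence claim for each \<open>i\<close>, so that one family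
    \<open>h\<close> can be chosen for all degrees.\<close>
  have "\<exists>h. is_hom K (tensor K A ?N (obj U i)) (Hom_space A W (obj U i)) h \<and>
    bij_betw h (carrier (tensor K A ?N (obj U i))) (carrier (Hom_space A W (obj U i))) \<and>
    (\<forall>\<phi>\<in>carrier ?N. \<forall>u\<in>carrier (obj U i).
      h (pure_tensor K A ?N (obj U i) \<phi> u) = (\<lambda>w\<in>carrier W. \<phi> w \<odot>\<^bsub>obj U i\<^esub> u))" for i
    by (rule dual_tensor_iso[OF KA W totally_acyclic_projective[OF U, of i] totally_acyclic_fin_gen[OF U, of i]]) blast
  then obtain h where h: "\<And>i. is_hom K (tensor K A ?N (obj U i)) (Hom_space A W (obj U i)) (h i)"
    and bij: "\<And>i. bij_betw (h i) (carrier (tensor K A ?N (obj U i))) (carrier (Hom_space A W (obj U i)))"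
    and pure: "\<And>i \<phi> u. \<lbrakk>\<phi> \<in> carrier ?N; u \<in> carrier (obj U i)\<rbrakk> \<Longrightarrow>
      h i (pure_tensor K A ?N (obj U i) \<phi> u) = (\<lambda>w\<in>carrier W. \<phi> w \<odot>\<^bsub>obj U i\<^esub> u)"
    by metis
  \<comment> \<open>Both ways around the square send \<open>\<phi> \<otimes> u\<close> to the map
    with value \<open>\<phi> w\<close> times the differential of \<open>u\<close> at
    \<open>w\<close>.\<close>
  have nat: "h (i - 1) (tensor_map K A ?N (obj U i) (obj U (i - 1)) (diff U i) t) = (\<lambda>w\<in>carrier W. diff U i (h i t w))"
    if t: "t \<in> carrier (tensor K A ?N (obj U i))" for i t
  proof (rule tensor_hom_eqI[OF KA N Ul H is_hom_comp[OF tensor_map(1)[OF KA N Ul Ul d] h]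
        is_hom_comp[OF h is_hom_Hom_post[OF KA W d]] _ t])
    fix \<phi> u assume \<phi>: "\<phi> \<in> carrier ?N" and u: "u \<in> carrier (obj U i)"
    have "\<phi> w \<in> carrier A" if "w \<in> carrier W" for w
      using \<phi> Hom_set_closed[of \<phi> A W "regular A" w] that by simp
    then show "h (i - 1) (tensor_map K A ?N (obj U i) (obj U (i - 1)) (diff U i) (pure_tensor K A ?N (obj U i) \<phi> u)) =
        (\<lambda>w\<in>carrier W. diff U i (h i (pure_tensor K A ?N (obj U i) \<phi> u) w))"
      using tensor_map(2)[OF KA N Ul Ul d \<phi> u] pure[OF \<phi> u] pure[OF \<phi> is_hom_closed[OF d u]] is_hom_smult[OF d _ u]
      by (auto intro!: restrict_ext)
  qed
  have "mod_iso K
    (quotient_module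
      ((tensor K A ?N (obj U m))\<lparr>carrier := {x \<in> carrier (tensor K A ?N (obj U m)).
        ?\<beta> x = \<zero>\<^bsub>tensor K A ?N (obj U (m - 1))\<^esub>}\<rparr>)
      (?\<alpha> ` carrier (tensor K A ?N (obj U (m + 1)))))
    (cov_homology A W U m)"
    unfolding cov_homology_def
  proof (rule homology_iso[OF TT[of "m + 1"] TT[of m] TT[of "m - 1"] H[of "m + 1"] H[of m] H[of "m - 1"]
        \<alpha>(1)[of m] \<beta>(1)[of m] tensor_diff_diff[OF KA N U] is_hom_Hom_post[OF KA W d'] is_hom_Hom_post[OF KA W d]
        h[of "m + 1"] bij_betw_imp_surj_on[OF bij] h[of m] bij[of m] h[of "m - 1"] bij_betw_imp_inj_on[OF bij]])
    show "h m (?\<alpha> x) = ?\<alpha>' (h (m + 1) x)" if "x \<in> carrier (tensor K A ?N (obj U (m + 1)))" for x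
      using nat[OF that] by simp
    show "h (m - 1) (?\<beta> x) = ?\<beta>' (h m x)" if "x \<in> carrier (tensor K A ?N (obj U m))" for x
      by (rule nat[OF that])
  qed
  then show ?thesis
    by (simp add: tate_Tor_def homology_def cycles_def boundaries_def a_kernel_eq tensor_complex_def)
qed

lemma left_module_tate_Tor:
  fixes K :: "'k ring" and A :: "('k, 'a) module" and N :: "('a, 'n) module" and U :: "('a, 'u) complx"
  assumes KA: "k_algebra K A" and N: "left_module (opp A) N" and U: "totally_acyclic A U"
  shows "left_module K (tate_Tor K A N U m)"
proof -
  note Ul = totally_acyclic_left_module[OF U] and d = totally_acyclic_hom[OF U] and d' = totally_acyclic_hom'[OF U]
  note TT = left_module_tensor[OF KA N Ul]
  note \<alpha> = tensor_map(1)[OF KA N Ul Ul d'[of m]] and \<beta> = tensor_map(1)[OF KA N Ul Ul d[of m]]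
  note Z = submodule_kernel[OF TT TT \<beta>]
  let ?Z = "{x \<in> carrier (tensor K A N (obj U m)).
    tensor_map K A N (obj U m) (obj U (m - 1)) (diff U m) x = \<zero>\<^bsub>tensor K A N (obj U (m - 1))\<^esub>}"
  let ?I = "tensor_map K A N (obj U (m + 1)) (obj U m) (diff U (m + 1)) ` carrier (tensor K A N (obj U (m + 1)))"
  have "submodule ?I K ((tensor K A N (obj U m))\<lparr>carrier := ?Z\<rparr>)"
    by (rule left_module.submodule_restrict[OF TT submodule_image[OF TT TT \<alpha> left_module.submodule_carrier[OF TT]]])
      (use is_hom_closed[OF \<alpha>] tensor_diff_diff[OF KA N U] in auto)
  from left_module_quotient[OF left_module.left_module_restrict[OF TT Z] this]
  show ?thesis
    by (simp add: tate_Tor_def homology_def cycles_def boundaries_def a_kernel_eq tensor_complex_def)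
qed

theorem theorem2p4:
  fixes K :: "'k ring" and \<Lambda> :: "('k, 'a) module" and g d :: nat
    and M :: "('a, 'm) module" and L :: "('a, 'l) module" and N :: "('a, 'n) module"
    and W :: "('a, 'w) module"
    and T :: "('a, 't) complx" and P :: "('a, 'p) complx"
    and e :: "'p \<Rightarrow> 'm" and f :: "int \<Rightarrow> 't \<Rightarrow> 'p"
    and T_DN :: "('a, 'u) complx" and P_DN :: "('a, 'q) complx"
    and e_DN :: "'q \<Rightarrow> 'n \<Rightarrow> 'k" and f_DN :: "int \<Rightarrow> 'u \<Rightarrow> 'q"
    and T_L :: "('a, 'v) complx" and P_L :: "('a, 'r) complx"
    and e_L :: "'r \<Rightarrow> 'l" and f_L :: "int \<Rightarrow> 'v \<Rightarrow> 'r"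
  assumes "field K" and "k_algebra K \<Lambda>" and "fin_gen K \<Lambda>"
    and "gorenstein_of_dim \<Lambda> g" and "g \<le> d"
    and "left_module \<Lambda> M" and "fin_gen \<Lambda> M"
    and "left_module \<Lambda> L" and "fin_gen \<Lambda> L"
    and "right_module \<Lambda> N" and "fin_gen (opp \<Lambda>) N"
    and "is_syzygy \<Lambda> d M W"
    and "complete_resolution \<Lambda> g M T P e f"
    and "complete_resolution \<Lambda> g (k_dual K (opp \<Lambda>) N) T_DN P_DN e_DN f_DN"
    and "complete_resolution \<Lambda> g L T_L P_L e_L f_L"
  shows "\<forall>n::int.
      mod_iso K (tate_Tor K \<Lambda> N T n)
        (tate_Tor K \<Lambda> (ring_dual \<Lambda> W) T_DN (- (n - int d + 1))) \<and>
      mod_iso K (tate_Ext \<Lambda> T L n)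
        (tate_Ext \<Lambda> T_L (k_dual K (opp \<Lambda>) (ring_dual \<Lambda> W)) (- (n - int d + 1)))"
proof (intro allI conjI)
  fix n :: int
  note K = assms(1) and KA = assms(2) and fA = assms(3) and gd = assms(5) and M = assms(6)
    and L = assms(8) and fL = assms(9) and N = assms(10) and fN = assms(11) and WM = assms(12)
    and T = assms(13) and U = assms(14) and V = assms(15)
  let ?D = "k_dual K (opp \<Lambda>) N" and ?W = "ring_dual \<Lambda> W" and ?m = "int d - 1 - n"
  have m: "- (n - int d + 1) = ?m" by simp
  have W: "left_module \<Lambda> W" using WM by (simp add: is_syzygy_def)
  note D = left_module_k_dual_opp[OF KA N] and W' = left_module_ring_dual[OF W]
  note T' = complete_resolution_totally_acyclic[OF T] and U' = complete_resolution_totally_acyclic[OF U]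
    and V' = complete_resolution_totally_acyclic[OF V]
  note D' = left_module_k_dual_opp[OF KA W']
  note E1 = left_module_tate_Ext[OF KA T' D, of n] fin_dim_tate_Ext[OF KA T' D fin_dim_k_dual[OF KA fA N fN], of n]
  note E2 = left_module_tate_Ext[OF KA T' L, of n] fin_dim_tate_Ext[OF KA T' L fin_dim_k_space[OF KA fA L fL], of n]
  \<comment> \<open>The duality gives the dual of Tate homology; finite dimension of the cohomology,
    from that of \<open>D(N)\<close>, removes the dual.\<close>
  have "mod_iso K (tate_Tor K \<Lambda> N T n) (tate_Ext \<Lambda> T ?D n)"
    by (rule mod_iso_dual_fin_dim[OF K left_module_tate_Tor[OF KA N T'] E1(1) tate_Ext_iso_dual_tate_Tor[OF KA N T'] E1(2)])
  moreover have "mod_iso K (tate_Ext \<Lambda> T ?D n) (cov_homology \<Lambda> W T_DN ?m)"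
    by (rule tate_Ext_iso_cov_homology[OF KA M D T U WM gd])
  moreover have "mod_iso K (cov_homology \<Lambda> W T_DN ?m) (tate_Tor K \<Lambda> ?W T_DN ?m)"
    by (rule mod_iso_sym[OF left_module_tate_Tor[OF KA W' U'] tate_Tor_ring_dual_iso[OF KA W U']])
  ultimately show "mod_iso K (tate_Tor K \<Lambda> N T n) (tate_Tor K \<Lambda> ?W T_DN (- (n - int d + 1)))"
    unfolding m by (blast intro: mod_iso_trans)
  have 1: "mod_iso K (tate_Ext \<Lambda> T L n) (cov_homology \<Lambda> W T_L ?m)"
    by (rule tate_Ext_iso_cov_homology[OF KA M L T V WM gd])
  have 2: "mod_iso K (cov_homology \<Lambda> W T_L ?m) (tate_Tor K \<Lambda> ?W T_L ?m)"
    by (rule mod_iso_sym[OF left_module_tate_Tor[OF KA W' V'] tate_Tor_ring_dual_iso[OF KA W V']])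
  note R = left_module_tate_Tor[OF KA W' V', of ?m]
  \<comment> \<open>Finite dimension is imported from the cohomology with coefficients in
    \<open>L\<close> along the isomorphisms \<open>1\<close> and \<open>2\<close>.\<close>
  have "fin_dim K (tate_Tor K \<Lambda> ?W T_L ?m)"
    by (rule fin_dim_iso[OF R E2(1) mod_iso_sym[OF E2(1) mod_iso_trans[OF 1 2]] E2(2)])
  then have "mod_iso K (tate_Tor K \<Lambda> ?W T_L ?m) (lin_dual K (tate_Tor K \<Lambda> ?W T_L ?m))"
    by (rule fin_dim_iso_dual[OF K R])
  \<comment> \<open>The duality again, now with the ring dual of \<open>W\<close> in the place of
    \<open>N\<close> and the complete resolution of \<open>L\<close> in the place of that of
    \<open>M\<close>.\<close>
  moreover have "mod_iso K (lin_dual K (tate_Tor K \<Lambda> ?W T_L ?m)) (tate_Ext \<Lambda> T_L (k_dual K (opp \<Lambda>) ?W) ?m)"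
    by (rule mod_iso_sym[OF left_module_tate_Ext[OF KA V' D'] tate_Ext_iso_dual_tate_Tor[OF KA W' V']])
  ultimately show "mod_iso K (tate_Ext \<Lambda> T L n) (tate_Ext \<Lambda> T_L (k_dual K (opp \<Lambda>) ?W) (- (n - int d + 1)))"
    unfolding m using mod_iso_trans[OF 1 2] by (blast intro: mod_iso_trans)
qed

end
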